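(* Let $M$ be a free $\mathbb{Z}$-module of finite rank $n$, let $R\subset M$ be a finite set of nonzero elements, and let $\Gamma$ be a finite group acting linearly on $M$ and mapping $R$ to itself. Let $N=\mathbb{Z}\langle S\rangle$ for some $S\subseteq R$, let $Z=\{\chi\in\mathrm{Hom}(M,\mathbb{C}^* ) : \chi(m)=1 \text{ for all } m\in S\}=\mathrm{Hom}(M/N,\mathbb{C}^* )$ be the corresponding intersection, and let $g\in\Gamma$ stabilize $Z$ (equivalently, $gN=N$). Let $m$ be the number of elements of $Q_N^T$ fixed by $g$. Then $$P(Z,t)(g)=m\cdot\sum_{i=0}^{n}\mathrm{Tr}\bigl(g,\textstyle\bigwedge^i Q_N^F\bigr)\,t^i .$$ Hence $P(Z,t)(g)$ can be computed by computing $m$, then $\mathrm{Tr}(g,Q_N^F)$ (for instance as $\mathrm{Tr}(g,M)-\mathrm{Tr}(g,N)$), and then the traces $\mathrm{Tr}(g,\bigwedge^iQ_N^F)$ (for instance via Newton's identities).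
   Context: $\Gamma$ acts on $X=\mathrm{Hom}(M,\mathbb{C}^* )$ by precomposition, $(\chi.g)(v)=\chi(g.v)$, so an element $g$ with $gN=N$ acts on $Z$. $P(Z,t)(g)=\sum_{i\ge0}\mathrm{Tr}(g,H^i(Z))\,t^i$ is the equivariant Poincaré polynomial at $g$, where $H^i$ is cohomology with complex coefficients and $g$ acts by pullback. $Q_N=M/N$, $Q_N^T$ is its torsion submodule, and $Q_N^F=Q_N/Q_N^T$ is its free part; $g$ acts on both. *)

theory Defs
  imports
    "HOL-Homology.Homology"
    "HOL-Algebra.Free_Abelian_Groups"
    "HOL-Algebra.Group_Action"
    "HOL-Computational_Algebra.Formal_Power_Series"
begin

text \<open>Abelian groups, including the underlying additive groups of vector spaces, are the
  (multiplicatively written) groups of HOL-Algebra.\<close>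

definition complex_add_group :: "complex monoid"
  where "complex_add_group = \<lparr>carrier = UNIV, monoid.mult = (+), one = 0\<rparr>"

definition complex_mult_group :: "complex monoid"
  where "complex_mult_group = \<lparr>carrier = UNIV - {0}, monoid.mult = (*), one = 1\<rparr>"


subsection \<open>Quotients and traces\<close>

text \<open>The map induced on the cosets of \<open>H\<close> in \<open>G\<close> by a map \<open>f\<close> with \<open>f ` H \<subseteq> H\<close>.  If \<open>f\<close> is a
  homomorphism, the coset of \<open>x\<close> goes to the coset of \<open>f x\<close>; multiplying by \<open>H\<close> is needed
  because \<open>f ` H\<close> may be a proper subset of \<open>H\<close>.\<close>

definition coset_map ::
    "('a, 'm) monoid_scheme \<Rightarrow> 'a set \<Rightarrow> ('b \<Rightarrow> 'a) \<Rightarrow> 'b set \<Rightarrow> 'a set"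
  where "coset_map G H f K = H <#>\<^bsub>G\<^esub> f ` K"

text \<open>\<open>b 0, \<dots>, b (d - 1)\<close> is a basis of the module with underlying abelian group \<open>G\<close> and scalar
  multiplication \<open>sc\<close>.\<close>

definition module_basis ::
    "('a, 'm) monoid_scheme \<Rightarrow> ('s::comm_ring_1 \<Rightarrow> 'a \<Rightarrow> 'a) \<Rightarrow> nat \<Rightarrow> (nat \<Rightarrow> 'a) \<Rightarrow> bool"
  where "module_basis G sc d b \<longleftrightarrow>
    b \<in> {..<d} \<rightarrow> carrier G \<and>
    (\<forall>x\<in>carrier G. \<exists>!c. c \<in> extensional {..<d} \<and> x = finprod G (\<lambda>i. sc (c i) (b i)) {..<d})"

text \<open>The trace of a linear endomorphism of a module with a finite basis: the sum of the diagonal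
  entries of its matrix.  It does not depend on the basis; it is left unspecified if
  there is no finite basis.\<close>

definition module_trace ::
    "('a, 'm) monoid_scheme \<Rightarrow> ('s::comm_ring_1 \<Rightarrow> 'a \<Rightarrow> 'a) \<Rightarrow> ('a \<Rightarrow> 'a) \<Rightarrow> 's"
  where "module_trace G sc f =
    (THE t. \<exists>d b a. module_basis G sc d b \<and>
       (\<forall>j<d. f (b j) = finprod G (\<lambda>i. sc (a i j) (b i)) {..<d}) \<and>
       t = (\<Sum>i<d. a i i))"

definition int_trace :: "('a, 'm) monoid_scheme \<Rightarrow> ('a \<Rightarrow> 'a) \<Rightarrow> int"
  where "int_trace G f = module_trace G (\<lambda>(k::int) x. x [^]\<^bsub>G\<^esub> k) f"


subsection \<open>Torsion and exterior powers of abelian groups\<close>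

definition torsion :: "('a, 'm) monoid_scheme \<Rightarrow> 'a set"
  where "torsion G = {x \<in> carrier G. \<exists>k::nat. 0 < k \<and> x [^]\<^bsub>G\<^esub> k = \<one>\<^bsub>G\<^esub>}"

definition tuple_group :: "nat \<Rightarrow> ('a, 'm) monoid_scheme \<Rightarrow> ('a list \<Rightarrow>\<^sub>0 int) monoid"
  where "tuple_group k A = free_Abelian_group {xs. length xs = k \<and> set xs \<subseteq> carrier A}"

text \<open>Additivity in each argument suffices, as it implies linearity over the integers.\<close>

definition exterior_relations :: "nat \<Rightarrow> ('a, 'm) monoid_scheme \<Rightarrow> ('a list \<Rightarrow>\<^sub>0 int) set"
  where "exterior_relations k A = generate (tuple_group k A)
    ({frag_of (xs[i := x \<otimes>\<^bsub>A\<^esub> y]) - frag_of (xs[i := x]) - frag_of (xs[i := y]) | xs i x y.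
        length xs = k \<and> set xs \<subseteq> carrier A \<and> i < k \<and> x \<in> carrier A \<and> y \<in> carrier A}
     \<union> {frag_of xs | xs i j.
        length xs = k \<and> set xs \<subseteq> carrier A \<and> i < j \<and> j < k \<and> xs ! i = xs ! j})"

definition exterior_power :: "nat \<Rightarrow> ('a, 'm) monoid_scheme \<Rightarrow> ('a list \<Rightarrow>\<^sub>0 int) set monoid"
  where "exterior_power k A = tuple_group k A Mod exterior_relations k A"

definition exterior_power_map ::
    "nat \<Rightarrow> ('a, 'm) monoid_scheme \<Rightarrow> ('a \<Rightarrow> 'a) \<Rightarrow> ('a list \<Rightarrow>\<^sub>0 int) set \<Rightarrow> ('a list \<Rightarrow>\<^sub>0 int) set"
  where "exterior_power_map k A f =
    coset_map (tuple_group k A) (exterior_relations k A) (frag_extend (\<lambda>xs. frag_of (map f xs)))"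


subsection \<open>Singular cohomology with complex coefficients\<close>

type_synonym 'a cochain = "'a chain \<Rightarrow> complex"

definition cochain_set :: "nat \<Rightarrow> 'a topology \<Rightarrow> 'a cochain set"
  where "cochain_set p X =
    hom (chain_group p X) complex_add_group \<inter> extensional (carrier (chain_group p X))"

definition cochain_group :: "nat \<Rightarrow> 'a topology \<Rightarrow> 'a cochain monoid"
  where "cochain_group p X =
    \<lparr>carrier = cochain_set p X,
     monoid.mult = (\<lambda>c d. \<lambda>x\<in>carrier (chain_group p X). c x + d x),
     one = (\<lambda>x\<in>carrier (chain_group p X). 0)\<rparr>"

definition cochain_scale :: "nat \<Rightarrow> 'a topology \<Rightarrow> complex \<Rightarrow> 'a cochain \<Rightarrow> 'a cochain"
  where "cochain_scale p X a c = (\<lambda>x\<in>carrier (chain_group p X). a * c x)"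

text \<open>The differential from degree \<open>p - 1\<close> to degree \<open>p\<close>.  Since \<open>chain_boundary 0\<close> is zero, so
  is this map for \<open>p = 0\<close>, where \<open>p - 1 = 0\<close>.\<close>

definition coboundary :: "nat \<Rightarrow> 'a topology \<Rightarrow> 'a cochain \<Rightarrow> 'a cochain"
  where "coboundary p X c = compose (carrier (chain_group p X)) c (chain_boundary p)"

definition cocycle_set :: "nat \<Rightarrow> 'a topology \<Rightarrow> 'a cochain set"
  where "cocycle_set p X =
    {c \<in> cochain_set p X. coboundary (Suc p) X c = \<one>\<^bsub>cochain_group (Suc p) X\<^esub>}"

definition coboundary_set :: "nat \<Rightarrow> 'a topology \<Rightarrow> 'a cochain set"
  where "coboundary_set p X = coboundary p X ` cochain_set (p - 1) X"

definition cocycle_group :: "nat \<Rightarrow> 'a topology \<Rightarrow> 'a cochain monoid"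
  where "cocycle_group p X = subgroup_generated (cochain_group p X) (cocycle_set p X)"

definition cohomology_group :: "nat \<Rightarrow> 'a topology \<Rightarrow> 'a cochain set monoid"
  where "cohomology_group p X = cocycle_group p X Mod coboundary_set p X"

definition cohomology_scale ::
    "nat \<Rightarrow> 'a topology \<Rightarrow> complex \<Rightarrow> 'a cochain set \<Rightarrow> 'a cochain set"
  where "cohomology_scale p X a =
    coset_map (cocycle_group p X) (coboundary_set p X) (cochain_scale p X a)"

text \<open>Pullback along a continuous map \<open>f\<close> from \<open>X\<close> to \<open>Y\<close>.\<close>

definition cochain_pullback ::
    "nat \<Rightarrow> 'a topology \<Rightarrow> ('a \<Rightarrow> 'b) \<Rightarrow> 'b cochain \<Rightarrow> 'a cochain"
  where "cochain_pullback p X f c = compose (carrier (chain_group p X)) c (chain_map p f)"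

definition cohomology_pullback ::
    "nat \<Rightarrow> 'a topology \<Rightarrow> ('a \<Rightarrow> 'b) \<Rightarrow> 'b cochain set \<Rightarrow> 'a cochain set"
  where "cohomology_pullback p X f =
    coset_map (cocycle_group p X) (coboundary_set p X) (cochain_pullback p X f)"

text \<open>As a formal power series: that it is a polynomial is not built into the definition.\<close>

definition equivariant_poincare :: "'a topology \<Rightarrow> ('a \<Rightarrow> 'a) \<Rightarrow> complex fps"
  where "equivariant_poincare X f =
    Abs_fps (\<lambda>i. module_trace (cohomology_group i X) (cohomology_scale i X)
                   (cohomology_pullback i X f))"


subsection \<open>Character tori\<close>

text \<open>\<open>Hom(M, \<complex>\<^sup>*)\<close>, with the topology of pointwise convergence.  For \<open>M\<close> free with basis
  \<open>e\<^sub>1, \<dots>, e\<^sub>n\<close> this is the usual topology of \<open>(\<complex>\<^sup>*)\<^sup>n\<close>, via \<open>\<psi> \<mapsto> (\<psi> e\<^sub>1, \<dots>, \<psi> e\<^sub>n)\<close>.\<close>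

definition character_space :: "('a, 'm) monoid_scheme \<Rightarrow> ('a \<Rightarrow> complex) topology"
  where "character_space M =
    subtopology (product_topology (\<lambda>_. euclidean) (carrier M)) (hom M complex_mult_group)"

definition toric_intersection ::
    "('a, 'm) monoid_scheme \<Rightarrow> 'a set \<Rightarrow> ('a \<Rightarrow> complex) topology"
  where "toric_intersection M S = subtopology (character_space M) {\<psi>. \<forall>m\<in>S. \<psi> m = 1}"

end

theory Submission
  imports "HOL-Analysis.Analysis" Defs "HOL-Combinatorics.Multiset_Permutations" "Jordan_Normal_Form.Determinant"
begin

text \<open>In a basis of \<open>M\<close> adapted to \<open>N\<close> the space \<open>Z\<close> becomes a product of groups of roots of unity
  and copies of \<open>\<complex>\<^sup>*\<close>.  Excision bounds the number of generators of its integral homology in degree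
  \<open>k\<close> by the number of pairs \<open>(c, J)\<close> of a component \<open>c\<close> and a \<open>k\<close>-element set \<open>J\<close> of free
  coordinates.  For each such pair there is an explicit cocycle, which on a simplex in \<open>c\<close> is the
  determinant of the differences of logarithms of the coordinates in \<open>J\<close> along the vertices, and an
  explicit cycle, the triangulated coordinate torus.  They pair to \<open>k!\<close> times the identity matrix, so
  the cocycles give a basis of cohomology.  The determinant is natural in the simplex and alternating
  in the free part of \<open>M/N\<close>, so in this basis \<open>g\<close> acts as the permutation of components tensored
  with the exterior power.  Finally, a finite abelian group and its dual have equally many fixed
  points under dual endomorphisms, by counting the values of all characters in two ways.\<close>

section \<open>Modules, bases and traces\<close>

text \<open>Cohomology is squeezed between two bounds rather than computed. As the complex numbers
  are divisible, a cocycle vanishing on all cycles is a coboundary, so a class is determined by its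
  values on generators of integral homology: few generators bound the dimension from above, and a
  nondegenerate pairing with cycles gives the same number from below. The trace requires an actual
  basis on which \<open>g\<close> acts by a known matrix. Cup products of one-dimensional classes
  are alternating only up to coboundaries. Replacing a simplex by the affine simplex on the
  logarithms of its vertices and taking its volume gives cochains that are alternating and natural
  on the nose, so that the pullback by \<open>g\<close> is an identity between functions on
  simplices. The factor \<open>k!\<close> counts the simplices of the triangulated cube: each has
  volume equal to its sign and enters the cycle with that sign. The components of \<open>Z\<close>
  form the dual of the torsion of \<open>M/N\<close>, on which \<open>g\<close> acts by the dual
  map. In general there is no equivariant identification with the torsion itself, so only the
  numbers of fixed points can be compared.\<close>

lemma hom_finprod:
  assumes "comm_group G" "comm_group H" "f \<in> hom G H" "\<And>i. i \<in> I \<Longrightarrow> g i \<in> carrier G"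
  shows "f (finprod G g I) = finprod H (\<lambda>i. f (g i)) I"
proof -
  interpret G: comm_group G by fact
  interpret H: comm_group H by fact
  interpret f: group_hom G H f
    using assms by (simp add: group_hom_def group_hom_axioms_def comm_group.axioms)
  show ?thesis
    using assms(4)
    by (induction I rule: infinite_finite_induct) (simp_all add: Pi_iff)
qed

text \<open>One interface for two kinds of modules: abelian groups with integer powers as scalars,
  and complex cohomology. Bases and traces are treated once for both.\<close>

locale scalar_module = comm_group G for G (structure) +
  fixes sc :: "'s::comm_ring_1 \<Rightarrow> 'a \<Rightarrow> 'a"
  assumes sc_closed [simp]: "x \<in> carrier G \<Longrightarrow> sc c x \<in> carrier G"
    and sc_mult: "x \<in> carrier G \<Longrightarrow> y \<in> carrier G \<Longrightarrow> sc c (x \<otimes> y) = sc c x \<otimes> sc c y"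
    and sc_add: "x \<in> carrier G \<Longrightarrow> sc (c + d) x = sc c x \<otimes> sc d x"
    and sc_sc: "x \<in> carrier G \<Longrightarrow> sc (c * d) x = sc c (sc d x)"
    and sc_1 [simp]: "x \<in> carrier G \<Longrightarrow> sc 1 x = x"
begin

definition lc :: "('i \<Rightarrow> 's) \<Rightarrow> ('i \<Rightarrow> 'a) \<Rightarrow> 'i set \<Rightarrow> 'a"
  where "lc c b I = finprod G (\<lambda>i. sc (c i) (b i)) I"

text \<open>Arbitrary finite index sets are allowed because the bases to come are indexed by
  increasing lists and by pairs of a component and such a list. Independence by vanishing
  coefficients is easier to verify than the unique extensional coefficient functions of
  \<open>module_basis\<close>.\<close>

definition basis_on :: "'i set \<Rightarrow> ('i \<Rightarrow> 'a) \<Rightarrow> bool"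
  where "basis_on I b \<longleftrightarrow> finite I \<and> b \<in> I \<rightarrow> carrier G \<and>
    (\<forall>x\<in>carrier G. \<exists>c. x = lc c b I) \<and> (\<forall>c. lc c b I = \<one> \<longrightarrow> (\<forall>i\<in>I. c i = 0))"

definition linear :: "('a \<Rightarrow> 'a) \<Rightarrow> bool"
  where "linear f \<longleftrightarrow> f \<in> hom G G \<and> (\<forall>c. \<forall>x\<in>carrier G. f (sc c x) = sc c (f x))"

lemma sc_0 [simp]: assumes "x \<in> carrier G" shows "sc 0 x = \<one>"
proof -
  have "sc 0 x = sc 0 x \<otimes> sc 0 x" using sc_add[OF assms, of 0 0] by simp
  then show ?thesis using assms l_cancel_one'[of "sc 0 x" "sc 0 x"] by simp
qed

lemma sc_one [simp]: "sc c \<one> = \<one>"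
  using sc_sc[of \<one> c 0] by simp

lemma sc_hom: "sc c \<in> hom G G"
  by (auto simp: hom_def sc_mult)

lemma lc_closed [simp]: "b \<in> I \<rightarrow> carrier G \<Longrightarrow> lc c b I \<in> carrier G"
  unfolding lc_def by (intro finprod_closed) (auto simp: Pi_iff)

lemma lc_cong: "(\<And>i. i \<in> I \<Longrightarrow> c i = d i) \<Longrightarrow> b \<in> I \<rightarrow> carrier G \<Longrightarrow> lc c b I = lc d b I"
  unfolding lc_def by (intro finprod_cong') (auto simp: Pi_iff)

lemma lc_add:
  assumes b: "b \<in> I \<rightarrow> carrier G"
  shows "lc (\<lambda>i. c i + d i) b I = lc c b I \<otimes> lc d b I"
proof -
  have "lc (\<lambda>i. c i + d i) b I = finprod G (\<lambda>i. sc (c i) (b i) \<otimes> sc (d i) (b i)) I"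
    unfolding lc_def using b by (intro finprod_cong') (auto simp: sc_add Pi_iff)
  also have "\<dots> = lc c b I \<otimes> lc d b I"
    unfolding lc_def using b by (intro finprod_multf) (auto simp: Pi_iff)
  finally show ?thesis .
qed

lemma lc_zero: "b \<in> I \<rightarrow> carrier G \<Longrightarrow> lc (\<lambda>i. 0) b I = \<one>"
  unfolding lc_def by (intro finprod_one_eqI) (auto simp: Pi_iff)

lemma sc_lc: "b \<in> I \<rightarrow> carrier G \<Longrightarrow> sc a (lc c b I) = lc (\<lambda>i. a * c i) b I"
  unfolding lc_def
  by (subst hom_finprod[OF comm_group_axioms comm_group_axioms sc_hom])
     (auto simp: sc_sc Pi_iff intro!: finprod_cong')

lemma finprod_sc_lc:
  assumes "b \<in> I \<rightarrow> carrier G"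
  shows "finprod G (\<lambda>j. sc (d j) (lc (\<lambda>i. a i j) b I)) J = lc (\<lambda>i. \<Sum>j\<in>J. a i j * d j) b I"
proof (induction J rule: infinite_finite_induct)
  case (insert j J)
  then show ?case
    using assms by (simp add: lc_add sc_lc Pi_iff mult.commute)
qed (use assms in \<open>simp_all add: lc_zero\<close>)

lemma linear_lc:
  assumes "linear f" "b \<in> I \<rightarrow> carrier G"
  shows "f (lc c b I) = finprod G (\<lambda>i. sc (c i) (f (b i))) I"
proof -
  have f: "f \<in> hom G G" using assms by (simp add: linear_def)
  show ?thesis
    unfolding lc_def using assms
    by (subst hom_finprod[OF comm_group_axioms comm_group_axioms f])
       (auto simp: linear_def Pi_iff hom_in_carrier[OF f] intro!: finprod_cong')
qed

lemma basis_on_unique: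
  assumes "basis_on I b" "lc c b I = lc d b I" "i \<in> I"
  shows "c i = d i"
proof -
  have b: "b \<in> I \<rightarrow> carrier G" using assms by (simp add: basis_on_def)
  have "lc (\<lambda>i. c i + -1 * d i) b I = lc c b I \<otimes> sc (-1) (lc d b I)"
    unfolding sc_lc[OF b] by (rule lc_add[OF b])
  also have "\<dots> = sc (1 + -1) (lc d b I)"
    using assms(2) b by (subst sc_add) simp_all
  also have "\<dots> = \<one>" using b by simp
  finally have "c i + -1 * d i = 0" using assms unfolding basis_on_def by blast
  then show ?thesis by simp
qed

lemma basis_on_expand:
  assumes "basis_on I b" "x \<in> carrier G" obtains c where "x = lc c b I"
proof -
  have "\<exists>c. x = lc c b I" using assms by (simp add: basis_on_def)
  then show ?thesis using that by blast
qed

lemma lc_single: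
  assumes "finite I" "b \<in> I \<rightarrow> carrier G" "k \<in> I"
  shows "lc (\<lambda>i. if i = k then 1 else 0) b I = b k"
proof -
  have "lc (\<lambda>i. if i = k then 1 else 0) b I = finprod G (\<lambda>i. if k = i then b i else \<one>) I"
    unfolding lc_def using assms by (intro finprod_cong') (auto simp: Pi_iff)
  also have "\<dots> = b k" using assms by (intro finprod_singleton) auto
  finally show ?thesis .
qed

text \<open>With base change matrices \<open>p\<close> and \<open>q\<close> the second matrix is
  \<open>q a p\<close>; moving \<open>q\<close> cyclically gives the trace of \<open>a p q\<close>,
  where \<open>p q = 1\<close>.\<close>

lemma trace_basis_independent:
  assumes I: "basis_on I b" and J: "basis_on J b'" and f: "linear f"
    and a: "\<And>j. j \<in> I \<Longrightarrow> f (b j) = lc (\<lambda>i. a i j) b I"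
    and a': "\<And>j. j \<in> J \<Longrightarrow> f (b' j) = lc (\<lambda>i. a' i j) b' J"
  shows "(\<Sum>i\<in>I. a i i) = (\<Sum>j\<in>J. a' j j)"
proof -
  have b: "b \<in> I \<rightarrow> carrier G" "finite I" and b': "b' \<in> J \<rightarrow> carrier G" "finite J"
    using I J by (auto simp: basis_on_def)
  have "\<exists>p. \<forall>j\<in>J. b' j = lc (\<lambda>i. p i j) b I"
  proof -
    have "\<forall>j\<in>J. \<exists>c. b' j = lc c b I" using b' I unfolding basis_on_def by blast
    then obtain c where "\<forall>j\<in>J. b' j = lc (c j) b I" by metis
    then show ?thesis by (intro exI[of _ "\<lambda>i j. c j i"])
  qed
  then obtain p where p: "\<And>j. j \<in> J \<Longrightarrow> b' j = lc (\<lambda>i. p i j) b I" by blast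
  have "\<exists>q. \<forall>i\<in>I. b i = lc (\<lambda>j. q j i) b' J"
  proof -
    have "\<forall>i\<in>I. \<exists>c. b i = lc c b' J" using b J unfolding basis_on_def by blast
    then obtain c where "\<forall>i\<in>I. b i = lc (c i) b' J" by metis
    then show ?thesis by (intro exI[of _ "\<lambda>j i. c i j"])
  qed
  then obtain q where q: "\<And>i. i \<in> I \<Longrightarrow> b i = lc (\<lambda>j. q j i) b' J" by blast
  have pq: "(\<Sum>j\<in>J. p i j * q j k) = (if i = k then 1 else 0)" if "i \<in> I" "k \<in> I" for i k
  proof -
    have "lc (\<lambda>i. \<Sum>j\<in>J. p i j * q j k) b I = finprod G (\<lambda>j. sc (q j k) (lc (\<lambda>i. p i j) b I)) J"
      by (rule finprod_sc_lc[symmetric, OF b(1)])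
    also have "\<dots> = finprod G (\<lambda>j. sc (q j k) (b' j)) J"
      using p b b' by (intro finprod_cong') auto
    also have "\<dots> = lc (\<lambda>i. if i = k then 1 else 0) b I"
      using q[OF that(2)] lc_single[OF b(2,1) that(2)] by (simp add: lc_def)
    finally show ?thesis using basis_on_unique[OF I] that(1) by fastforce
  qed
  have "a' l j = (\<Sum>k\<in>I. q l k * (\<Sum>i\<in>I. a k i * p i j))" if "l \<in> J" "j \<in> J" for l j
  proof -
    have "lc (\<lambda>i. a' i j) b' J = f (lc (\<lambda>i. p i j) b I)"
      using a'[OF that(2)] p[OF that(2)] by simp
    also have "\<dots> = finprod G (\<lambda>i. sc (p i j) (lc (\<lambda>k. a k i) b I)) I"
      unfolding linear_lc[OF f b(1)] using a b by (intro finprod_cong') auto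
    also have "\<dots> = lc (\<lambda>k. \<Sum>i\<in>I. a k i * p i j) b I"
      by (rule finprod_sc_lc[OF b(1)])
    also have "\<dots> = finprod G (\<lambda>k. sc (\<Sum>i\<in>I. a k i * p i j) (lc (\<lambda>l. q l k) b' J)) I"
      unfolding lc_def[of _ b] using q b b' by (intro finprod_cong') auto
    also have "\<dots> = lc (\<lambda>l. \<Sum>k\<in>I. q l k * (\<Sum>i\<in>I. a k i * p i j)) b' J"
      by (rule finprod_sc_lc[OF b'(1)])
    finally show ?thesis using basis_on_unique[OF J] that(1) by fastforce
  qed
  then have "(\<Sum>j\<in>J. a' j j) = (\<Sum>j\<in>J. \<Sum>k\<in>I. q j k * (\<Sum>i\<in>I. a k i * p i j))"
    by (intro sum.cong) auto
  also have "\<dots> = (\<Sum>k\<in>I. \<Sum>j\<in>J. \<Sum>i\<in>I. q j k * (a k i * p i j))"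
    by (subst sum.swap) (simp add: sum_distrib_left)
  also have "\<dots> = (\<Sum>k\<in>I. \<Sum>i\<in>I. a k i * (\<Sum>j\<in>J. p i j * q j k))"
  proof (rule sum.cong[OF refl])
    fix k assume "k \<in> I"
    show "(\<Sum>j\<in>J. \<Sum>i\<in>I. q j k * (a k i * p i j)) = (\<Sum>i\<in>I. a k i * (\<Sum>j\<in>J. p i j * q j k))"
      by (subst sum.swap) (simp add: sum_distrib_left mult_ac)
  qed
  also have "\<dots> = (\<Sum>k\<in>I. \<Sum>i\<in>I. a k i * (if i = k then 1 else 0))"
    using pq by (intro sum.cong) auto
  also have "\<dots> = (\<Sum>k\<in>I. a k k)"
    using b(2) by (intro sum.cong) (auto simp: if_distrib sum.delta cong: if_cong)
  finally show ?thesis by simp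
qed

lemma basis_on_module_basis: "basis_on {..<d} b \<longleftrightarrow> module_basis G sc d b"
proof
  assume B: "basis_on {..<d} b"
  then have b: "b \<in> {..<d} \<rightarrow> carrier G" by (simp add: basis_on_def)
  have "\<exists>!c. c \<in> extensional {..<d} \<and> x = lc c b {..<d}" if x: "x \<in> carrier G" for x
  proof -
    obtain c where c: "x = lc c b {..<d}" using basis_on_expand[OF B x] .
    show ?thesis
    proof (rule ex1I[of _ "restrict c {..<d}"])
      show "restrict c {..<d} \<in> extensional {..<d} \<and> x = lc (restrict c {..<d}) b {..<d}"
        using c lc_cong[OF _ b, of "restrict c {..<d}" c] by simp
    next
      fix c' assume c': "c' \<in> extensional {..<d} \<and> x = lc c' b {..<d}"
      then have "c' i = c i" if "i \<in> {..<d}" for i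
        using basis_on_unique[OF B _ that, of c' c] c by simp
      then show "c' = restrict c {..<d}"
        using c' by (auto simp: fun_eq_iff extensional_def)
    qed
  qed
  then show "module_basis G sc d b"
    using b unfolding module_basis_def lc_def by blast
next
  assume B: "module_basis G sc d b"
  then have b: "b \<in> {..<d} \<rightarrow> carrier G"
    and u: "\<And>x. x \<in> carrier G \<Longrightarrow> \<exists>!c. c \<in> extensional {..<d} \<and> x = lc c b {..<d}"
    by (auto simp: module_basis_def lc_def)
  have "c i = 0" if c: "lc c b {..<d} = \<one>" and i: "i \<in> {..<d}" for c i
  proof -
    have "\<one> = lc (restrict c {..<d}) b {..<d}" "\<one> = lc (restrict (\<lambda>i. 0) {..<d}) b {..<d}"
      using c lc_cong[OF _ b, of "restrict c {..<d}" c] lc_zero[OF b]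
        lc_cong[OF _ b, of "restrict (\<lambda>i. 0) {..<d}" "\<lambda>i. 0"] by simp_all
    then have "restrict c {..<d} = restrict (\<lambda>i. 0) {..<d}"
      using u[OF one_closed] restrict_extensional[of _ "{..<d}"] by blast
    from fun_cong[OF this, of i] show ?thesis using i by simp
  qed
  moreover have "\<exists>c. x = lc c b {..<d}" if "x \<in> carrier G" for x using u[OF that] by auto
  ultimately show "basis_on {..<d} b"
    using b unfolding basis_on_def by auto
qed

lemma basis_on_reindex:
  assumes h: "bij_betw h J I" and B: "basis_on I b"
  shows "basis_on J (b \<circ> h)"
proof -
  have b: "b \<in> I \<rightarrow> carrier G" "finite I" using B by (auto simp: basis_on_def)
  have inj: "inj_on h J" and im: "h ` J = I" using h by (auto simp: bij_betw_def)
  have lc: "lc (c \<circ> h) (b \<circ> h) J = lc c b I" for c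
    unfolding lc_def using finprod_reindex[OF _ inj, of "\<lambda>i. sc (c i) (b i)"] b im by (auto simp: comp_def Pi_iff)
  have fin: "finite J" using b(2) h bij_betw_finite by blast
  have bh: "b \<circ> h \<in> J \<rightarrow> carrier G" using b im by auto
  have "\<exists>c. x = lc c (b \<circ> h) J" if x: "x \<in> carrier G" for x
  proof -
    obtain c where "x = lc c b I" using basis_on_expand[OF B x] .
    then show ?thesis using lc[of c] by metis
  qed
  moreover have "c j = 0" if c: "lc c (b \<circ> h) J = \<one>" and j: "j \<in> J" for c j
  proof -
    let ?c = "c \<circ> inv_into J h"
    have "lc (?c \<circ> h) (b \<circ> h) J = lc c (b \<circ> h) J"
      using inj bh by (intro lc_cong) auto
    then have "lc ?c b I = \<one>" using c lc[of ?c] by simp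
    then have "?c (h j) = 0" using B j im unfolding basis_on_def by blast
    then show ?thesis using inj j by simp
  qed
  ultimately show ?thesis using fin bh unfolding basis_on_def by auto
qed

text \<open>Turns the definite description in \<open>module_trace\<close> into a computation:
  existence comes from the given basis, uniqueness from
  \<open>trace_basis_independent\<close>.\<close>

lemma module_trace_eqI:
  assumes B: "basis_on I b" and f: "linear f"
    and a: "\<And>j. j \<in> I \<Longrightarrow> f (b j) = lc (\<lambda>i. a i j) b I"
  shows "module_trace G sc f = (\<Sum>i\<in>I. a i i)"
  unfolding module_trace_def
proof (rule the_equality)
  have b: "b \<in> I \<rightarrow> carrier G" "finite I" using B by (auto simp: basis_on_def)
  \<comment> \<open>\<open>module_trace\<close> ranges over bases indexed by initial segments of the
    naturals, so the index set is enumerated.\<close>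
  obtain h where h: "bij_betw h {..<card I} I"
    using bij_betw_from_nat_into_finite[OF b(2)] by blast
  have inj: "inj_on h {..<card I}" and im: "h ` {..<card I} = I" using h by (auto simp: bij_betw_def)
  have lc: "lc (c \<circ> h) (b \<circ> h) {..<card I} = lc c b I" for c
    unfolding lc_def using finprod_reindex[OF _ inj, of "\<lambda>i. sc (c i) (b i)"] b im by (auto simp: comp_def Pi_iff)
  have "f ((b \<circ> h) j) = lc (\<lambda>i. a (h i) (h j)) (b \<circ> h) {..<card I}" if "j < card I" for j
    using a[of "h j"] im lc[of "\<lambda>i. a i (h j)"] that by (auto simp: comp_def)
  moreover have "(\<Sum>i\<in>I. a i i) = (\<Sum>i<card I. a (h i) (h i))"
    using sum.reindex[OF inj, of "\<lambda>i. a i i"] im by (simp add: comp_def)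
  moreover have "module_basis G sc (card I) (b \<circ> h)"
    using basis_on_reindex[OF h B] basis_on_module_basis by blast
  ultimately show "\<exists>d b' a'. module_basis G sc d b' \<and>
       (\<forall>j<d. f (b' j) = finprod G (\<lambda>i. sc (a' i j) (b' i)) {..<d}) \<and>
       (\<Sum>i\<in>I. a i i) = (\<Sum>i<d. a' i i)"
    by (intro exI[of _ "card I"] exI[of _ "b \<circ> h"] exI[of _ "\<lambda>i j. a (h i) (h j)"]) (simp add: lc_def)
next
  fix t assume "\<exists>d b a. module_basis G sc d b \<and>
       (\<forall>j<d. f (b j) = finprod G (\<lambda>i. sc (a i j) (b i)) {..<d}) \<and> t = (\<Sum>i<d. a i i)"
  then obtain d :: nat and b' a' where t: "basis_on {..<d} b'"
       "\<And>j. j < d \<Longrightarrow> f (b' j) = lc (\<lambda>i. a' i j) b' {..<d}" "t = (\<Sum>i<d. a' i i)"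
    unfolding basis_on_module_basis lc_def by blast
  show "t = (\<Sum>i\<in>I. a i i)"
    unfolding t(3) using trace_basis_independent[OF B t(1) f a] t(2) by simp
qed

end

lemma scalar_module_int:
  assumes "comm_group G" shows "scalar_module G (\<lambda>(k::int) x. x [^]\<^bsub>G\<^esub> k)"
proof -
  interpret comm_group G by fact
  show ?thesis
    by unfold_locales (simp_all add: int_pow_distrib int_pow_mult int_pow_pow mult.commute)
qed

subsection \<open>Quotients\<close>

lemma coset_map_coset:
  assumes "comm_group G" "subgroup H G" "f \<in> hom G G" "f ` H \<subseteq> H" "x \<in> carrier G"
  shows "coset_map G H f (H #>\<^bsub>G\<^esub> x) = H #>\<^bsub>G\<^esub> f x"
proof -
  interpret G: comm_group G by fact
  interpret H: subgroup H G by fact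
  have f: "f y \<in> carrier G" if "y \<in> carrier G" for y using assms(3) that by (auto simp: hom_def)
  have fm: "f (y \<otimes>\<^bsub>G\<^esub> z) = f y \<otimes>\<^bsub>G\<^esub> f z" if "y \<in> carrier G" "z \<in> carrier G" for y z
    using assms(3) that by (auto simp: hom_def)
  show ?thesis
  proof
    show "coset_map G H f (H #>\<^bsub>G\<^esub> x) \<subseteq> H #>\<^bsub>G\<^esub> f x"
    proof
      fix y assume "y \<in> coset_map G H f (H #>\<^bsub>G\<^esub> x)"
      then obtain h k where hk: "h \<in> H" "k \<in> H" "y = h \<otimes>\<^bsub>G\<^esub> f (k \<otimes>\<^bsub>G\<^esub> x)"
        unfolding coset_map_def set_mult_def r_coset_def by auto
      then have "y = (h \<otimes>\<^bsub>G\<^esub> f k) \<otimes>\<^bsub>G\<^esub> f x"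
        using assms(5) f by (simp add: fm G.m_assoc)
      moreover have "h \<otimes>\<^bsub>G\<^esub> f k \<in> H" using hk assms(4) by auto
      ultimately show "y \<in> H #>\<^bsub>G\<^esub> f x" unfolding r_coset_def by auto
    qed
    show "H #>\<^bsub>G\<^esub> f x \<subseteq> coset_map G H f (H #>\<^bsub>G\<^esub> x)"
    proof
      fix y assume "y \<in> H #>\<^bsub>G\<^esub> f x"
      then obtain h where h: "h \<in> H" "y = h \<otimes>\<^bsub>G\<^esub> f x" unfolding r_coset_def by auto
      moreover have "x \<in> H #>\<^bsub>G\<^esub> x" using G.rcos_self[OF assms(5,2)] .
      ultimately show "y \<in> coset_map G H f (H #>\<^bsub>G\<^esub> x)"
        unfolding coset_map_def set_mult_def by blast
    qed
  qed
qed

lemma comm_group_Mod: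
  assumes "comm_group G" "subgroup H G"
  shows "comm_group (G Mod H)" "(\<lambda>x. H #>\<^bsub>G\<^esub> x) \<in> hom G (G Mod H)"
    "(\<lambda>x. H #>\<^bsub>G\<^esub> x) ` carrier G = carrier (G Mod H)"
proof -
  interpret comm_group G by fact
  have n: "H \<lhd> G" using assms(2) normal_iff_subgroup by blast
  show "comm_group (G Mod H)" using assms abelian_FactGroup by blast
  show "(\<lambda>x. H #>\<^bsub>G\<^esub> x) \<in> hom G (G Mod H)" using normal.r_coset_hom_Mod[OF n] .
  show "(\<lambda>x. H #>\<^bsub>G\<^esub> x) ` carrier G = carrier (G Mod H)" by (auto simp: FactGroup_def RCOSETS_def)
qed

lemma coset_eq_iff:
  assumes "comm_group G" "subgroup H G" "x \<in> carrier G" "y \<in> carrier G"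
  shows "H #>\<^bsub>G\<^esub> x = H #>\<^bsub>G\<^esub> y \<longleftrightarrow> x \<otimes>\<^bsub>G\<^esub> inv\<^bsub>G\<^esub> y \<in> H"
proof -
  interpret comm_group G by fact
  show ?thesis
  proof
    assume "H #>\<^bsub>G\<^esub> x = H #>\<^bsub>G\<^esub> y"
    then have "x \<in> H #>\<^bsub>G\<^esub> y" using assms rcos_self by blast
    then obtain h where "h \<in> H" "x = h \<otimes>\<^bsub>G\<^esub> y" unfolding r_coset_def by auto
    then show "x \<otimes>\<^bsub>G\<^esub> inv\<^bsub>G\<^esub> y \<in> H"
      using assms subgroup.mem_carrier[OF assms(2)] by (simp add: m_assoc)
  next
    assume "x \<otimes>\<^bsub>G\<^esub> inv\<^bsub>G\<^esub> y \<in> H"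
    moreover have "x = (x \<otimes>\<^bsub>G\<^esub> inv\<^bsub>G\<^esub> y) \<otimes>\<^bsub>G\<^esub> y" using assms by (simp add: m_assoc)
    ultimately have "x \<in> H #>\<^bsub>G\<^esub> y" unfolding r_coset_def by auto
    then show "H #>\<^bsub>G\<^esub> x = H #>\<^bsub>G\<^esub> y"
      using assms repr_independence by metis
  qed
qed

lemma coset_eq_self_iff:
  assumes "comm_group G" "subgroup H G" "x \<in> carrier G"
  shows "H #>\<^bsub>G\<^esub> x = H \<longleftrightarrow> x \<in> H"
proof -
  interpret comm_group G by fact
  show ?thesis using assms coset_join1[of H x] coset_join2[of x H] subgroup.subset[of H G] by blast
qed

lemma coset_map_hom:
  assumes G: "comm_group G" and H: "subgroup H G" and f: "f \<in> hom G G" "f ` H \<subseteq> H"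
  shows "coset_map G H f \<in> hom (G Mod H) (G Mod H)"
proof (rule homI)
  note c = coset_map_coset[OF G H f]
  have p: "H #>\<^bsub>G\<^esub> (x \<otimes>\<^bsub>G\<^esub> y) = (H #>\<^bsub>G\<^esub> x) \<otimes>\<^bsub>G Mod H\<^esub> (H #>\<^bsub>G\<^esub> y)" if "x \<in> carrier G" "y \<in> carrier G" for x y
    using comm_group_Mod(2)[OF G H] that by (simp add: hom_def)
  interpret G: comm_group G by fact
  show "coset_map G H f X \<in> carrier (G Mod H)" if X: "X \<in> carrier (G Mod H)" for X
  proof -
    obtain x where x: "x \<in> carrier G" "X = H #>\<^bsub>G\<^esub> x"
      using X comm_group_Mod(3)[OF G H] by auto
    have "H #>\<^bsub>G\<^esub> f x \<in> carrier (G Mod H)"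
      using hom_in_carrier[OF comm_group_Mod(2)[OF G H] hom_in_carrier[OF f(1) x(1)]] .
    then show ?thesis using c[OF x(1)] x(2) by simp
  qed
  show "coset_map G H f (X \<otimes>\<^bsub>G Mod H\<^esub> Y) = coset_map G H f X \<otimes>\<^bsub>G Mod H\<^esub> coset_map G H f Y"
    if X: "X \<in> carrier (G Mod H)" and Y: "Y \<in> carrier (G Mod H)" for X Y
  proof -
    obtain x where x: "x \<in> carrier G" "X = H #>\<^bsub>G\<^esub> x"
      using X comm_group_Mod(3)[OF G H] by auto
    obtain y where y: "y \<in> carrier G" "Y = H #>\<^bsub>G\<^esub> y"
      using Y comm_group_Mod(3)[OF G H] by auto
    have fx: "f x \<in> carrier G" "f y \<in> carrier G" "f (x \<otimes>\<^bsub>G\<^esub> y) = f x \<otimes>\<^bsub>G\<^esub> f y"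
      using x y f(1) by (auto simp: hom_def)
    show ?thesis
      unfolding x(2) y(2) p[OF x(1) y(1), symmetric] c[OF x(1)] c[OF y(1)]
        c[OF G.m_closed[OF x(1) y(1)]] fx(3)
      by (rule p[OF fx(1,2)])
  qed
qed

lemma scalar_module_Mod:
  assumes "scalar_module G sc" and H: "subgroup H G" and sc: "\<And>c. sc c ` H \<subseteq> H"
  shows "scalar_module (G Mod H) (\<lambda>c. coset_map G H (sc c))"
proof -
  interpret G: scalar_module G sc by fact
  note cg = G.comm_group_axioms
  have c: "coset_map G H (sc c) (H #>\<^bsub>G\<^esub> x) = H #>\<^bsub>G\<^esub> sc c x" if "x \<in> carrier G" for c x
    by (rule coset_map_coset[OF cg H G.sc_hom sc that])
  have p: "H #>\<^bsub>G\<^esub> (x \<otimes>\<^bsub>G\<^esub> y) = (H #>\<^bsub>G\<^esub> x) \<otimes>\<^bsub>G Mod H\<^esub> (H #>\<^bsub>G\<^esub> y)" if "x \<in> carrier G" "y \<in> carrier G" for x y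
    using comm_group_Mod(2)[OF cg H] that by (simp add: hom_def)
  have h: "coset_map G H (sc c) \<in> hom (G Mod H) (G Mod H)" for c
    by (rule coset_map_hom[OF cg H G.sc_hom sc])
  have ex: "\<exists>x\<in>carrier G. X = H #>\<^bsub>G\<^esub> x" if "X \<in> carrier (G Mod H)" for X
    using that comm_group_Mod(3)[OF cg H] by auto
  interpret Q: comm_group "G Mod H" by (rule comm_group_Mod[OF cg H])
  show ?thesis
  proof unfold_locales
    fix c d and X assume "X \<in> carrier (G Mod H)"
    with ex obtain x where x: "x \<in> carrier G" "X = H #>\<^bsub>G\<^esub> x" by blast
    show "coset_map G H (sc (c + d)) X = coset_map G H (sc c) X \<otimes>\<^bsub>G Mod H\<^esub> coset_map G H (sc d) X"
      unfolding x(2) c[OF x(1)] G.sc_add[OF x(1)] by (rule p) (simp_all add: x)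
    show "coset_map G H (sc (c * d)) X = coset_map G H (sc c) (coset_map G H (sc d) X)"
      unfolding x(2) c[OF x(1)] c[OF G.sc_closed[OF x(1)]] G.sc_sc[OF x(1)] by (rule refl)
    show "coset_map G H (sc 1) X = X"
      unfolding x(2) c[OF x(1)] by (simp add: x)
    show "coset_map G H (sc c) X \<in> carrier (G Mod H)"
      using hom_in_carrier[OF h] \<open>X \<in> _\<close> .
    fix Y assume "Y \<in> carrier (G Mod H)"
    then show "coset_map G H (sc c) (X \<otimes>\<^bsub>G Mod H\<^esub> Y) = coset_map G H (sc c) X \<otimes>\<^bsub>G Mod H\<^esub> coset_map G H (sc c) Y"
      using h[of c] \<open>X \<in> _\<close> by (simp add: hom_def)
  qed
qed

text \<open>\<open>sc'\<close> is kept abstract because the two uses differ: powers in the quotient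
  group for exterior powers, the induced coset map for cohomology. Spanning and independence are
  both tested modulo \<open>H\<close> on representatives in \<open>G\<close>.\<close>

lemma
  assumes "scalar_module G sc" and H: "subgroup H G" and "scalar_module (G Mod H) sc'"
    and sc': "\<And>c x. x \<in> carrier G \<Longrightarrow> sc' c (H #>\<^bsub>G\<^esub> x) = H #>\<^bsub>G\<^esub> sc c x"
    and w: "w \<in> I \<rightarrow> carrier G"
  shows lc_Mod: "scalar_module.lc (G Mod H) sc' c (\<lambda>i. H #>\<^bsub>G\<^esub> w i) I = H #>\<^bsub>G\<^esub> scalar_module.lc G sc c w I"
    and basis_on_Mod: "\<lbrakk>finite I; \<And>x. x \<in> carrier G \<Longrightarrow> \<exists>c. x \<otimes>\<^bsub>G\<^esub> inv\<^bsub>G\<^esub> scalar_module.lc G sc c w I \<in> H;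
      \<And>c i. scalar_module.lc G sc c w I \<in> H \<Longrightarrow> i \<in> I \<Longrightarrow> c i = 0\<rbrakk> \<Longrightarrow>
      scalar_module.basis_on (G Mod H) sc' I (\<lambda>i. H #>\<^bsub>G\<^esub> w i)"
proof -
  interpret G: scalar_module G sc by fact
  interpret Q: scalar_module "G Mod H" sc' by fact
  note cg = G.comm_group_axioms
  have wi: "w i \<in> carrier G" if "i \<in> I" for i using w that by auto
  have lc: "Q.lc c (\<lambda>i. H #>\<^bsub>G\<^esub> w i) I = H #>\<^bsub>G\<^esub> G.lc c w I" for c
  proof -
    have "H #>\<^bsub>G\<^esub> G.lc c w I = finprod (G Mod H) (\<lambda>i. H #>\<^bsub>G\<^esub> sc (c i) (w i)) I"
      unfolding G.lc_def
      by (rule hom_finprod[OF cg Q.comm_group_axioms comm_group_Mod(2)[OF cg H]]) (simp add: wi)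
    also have "\<dots> = Q.lc c (\<lambda>i. H #>\<^bsub>G\<^esub> w i) I"
      unfolding Q.lc_def
      by (rule Q.finprod_cong') (auto simp: wi sc' intro!: hom_in_carrier[OF comm_group_Mod(2)[OF cg H]] Q.sc_closed)
    finally show ?thesis by simp
  qed
  show "Q.lc c (\<lambda>i. H #>\<^bsub>G\<^esub> w i) I = H #>\<^bsub>G\<^esub> G.lc c w I" by (rule lc)
  assume fin: "finite I"
    and sp: "\<And>x. x \<in> carrier G \<Longrightarrow> \<exists>c. x \<otimes>\<^bsub>G\<^esub> inv\<^bsub>G\<^esub> G.lc c w I \<in> H"
    and ind: "\<And>c i. G.lc c w I \<in> H \<Longrightarrow> i \<in> I \<Longrightarrow> c i = 0"
  have one: "\<one>\<^bsub>G Mod H\<^esub> = H" by (simp add: FactGroup_def)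
  show "Q.basis_on I (\<lambda>i. H #>\<^bsub>G\<^esub> w i)"
    unfolding Q.basis_on_def
  proof (intro conjI ballI allI impI)
    show "(\<lambda>i. H #>\<^bsub>G\<^esub> w i) \<in> I \<rightarrow> carrier (G Mod H)"
      using hom_in_carrier[OF comm_group_Mod(2)[OF cg H]] wi by blast
  next
    fix X assume "X \<in> carrier (G Mod H)"
    then obtain x where x: "x \<in> carrier G" "X = H #>\<^bsub>G\<^esub> x"
      using comm_group_Mod(3)[OF cg H] by auto
    obtain c where c: "x \<otimes>\<^bsub>G\<^esub> inv\<^bsub>G\<^esub> G.lc c w I \<in> H" using sp[OF x(1)] by blast
    have "X = Q.lc c (\<lambda>i. H #>\<^bsub>G\<^esub> w i) I"
      unfolding lc x(2) using c coset_eq_iff[OF cg H x(1) G.lc_closed[OF w]] by blast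
    then show "\<exists>c. X = Q.lc c (\<lambda>i. H #>\<^bsub>G\<^esub> w i) I" by blast
  next
    fix c i assume "Q.lc c (\<lambda>i. H #>\<^bsub>G\<^esub> w i) I = \<one>\<^bsub>G Mod H\<^esub>" "i \<in> I"
    then show "c i = 0"
      unfolding lc one using ind coset_eq_self_iff[OF cg H G.lc_closed[OF w]] by blast
  qed (rule fin)
qed

lemma int_pow_coset:
  assumes "comm_group G" "subgroup H G" "x \<in> carrier G"
  shows "(H #>\<^bsub>G\<^esub> x) [^]\<^bsub>G Mod H\<^esub> (k::int) = H #>\<^bsub>G\<^esub> (x [^]\<^bsub>G\<^esub> k)"
proof -
  interpret group_hom G "G Mod H" "\<lambda>x. H #>\<^bsub>G\<^esub> x"
    using assms comm_group_Mod[OF assms(1,2)]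
    by (simp add: group_hom_def group_hom_axioms_def comm_group.axioms)
  show ?thesis using assms(3) hom_int_pow by (simp add: int_pow_mult)
qed

section \<open>Determinants of arrays\<close>

text \<open>Determinants of plain functions: only the values below \<open>k\<close> matter
  (\<open>dt_cong\<close>), so inserting, deleting or permuting rows is ordinary composition of
  functions.\<close>

definition dt :: "nat \<Rightarrow> (nat \<Rightarrow> nat \<Rightarrow> 'r) \<Rightarrow> 'r::comm_ring_1"
  where "dt k f = det (mat k k (\<lambda>(i, j). f i j))"

lemma dt_cong: "(\<And>i j. i < k \<Longrightarrow> j < k \<Longrightarrow> f i j = g i j) \<Longrightarrow> dt k f = dt k g"
  unfolding dt_def by (rule arg_cong[of _ _ det]) (auto intro!: eq_matI)

lemma dt_0 [simp]: "dt 0 f = 1"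
  by (simp add: dt_def)

lemma dt_transpose: "dt k (\<lambda>i j. f j i) = dt k f"
proof -
  have "transpose_mat (mat k k (\<lambda>(i, j). f i j)) = mat k k (\<lambda>(i, j). f j i)" by (auto intro!: eq_matI)
  then show ?thesis unfolding dt_def by (metis det_transpose mat_carrier)
qed

lemma dt_laplace_row:
  assumes "i \<le> k"
  shows "dt (Suc k) f = (\<Sum>j\<le>k. (-1) ^ (i + j) * f i j *
           dt k (\<lambda>a b. f (if a < i then a else Suc a) (if b < j then b else Suc b)))"
proof -
  let ?A = "mat (Suc k) (Suc k) (\<lambda>(i, j). f i j)"
  have "dt (Suc k) f = (\<Sum>j<Suc k. ?A $$ (i, j) * cofactor ?A i j)"
    unfolding dt_def using assms by (intro laplace_expansion_row) auto
  also have "\<dots> = (\<Sum>j\<le>k. (-1) ^ (i + j) * f i j *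
           dt k (\<lambda>a b. f (if a < i then a else Suc a) (if b < j then b else Suc b)))"
    unfolding lessThan_Suc_atMost
  proof (rule sum.cong[OF refl])
    fix j assume j: "j \<in> {..k}"
    have "mat_delete ?A i j = mat k k (\<lambda>(a, b). f (if a < i then a else Suc a) (if b < j then b else Suc b))"
      unfolding mat_delete_def using j assms by (auto intro!: eq_matI)
    then show "?A $$ (i, j) * cofactor ?A i j = (-1) ^ (i + j) * f i j *
           dt k (\<lambda>a b. f (if a < i then a else Suc a) (if b < j then b else Suc b))"
      using j assms by (simp add: cofactor_def dt_def mult_ac)
  qed
  finally show ?thesis .
qed

lemma dt_laplace_column:
  assumes "j \<le> k"
  shows "dt (Suc k) f = (\<Sum>i\<le>k. (-1) ^ (i + j) * f i j *
           dt k (\<lambda>a b. f (if a < i then a else Suc a) (if b < j then b else Suc b)))"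
proof -
  have "dt (Suc k) f = dt (Suc k) (\<lambda>i j. f j i)" by (rule dt_transpose[symmetric])
  also have "\<dots> = (\<Sum>i\<le>k. (-1) ^ (j + i) * f i j *
           dt k (\<lambda>a b. f (if b < i then b else Suc b) (if a < j then a else Suc a)))"
    by (rule dt_laplace_row[OF assms])
  also have "\<dots> = (\<Sum>i\<le>k. (-1) ^ (i + j) * f i j *
           dt k (\<lambda>a b. f (if a < i then a else Suc a) (if b < j then b else Suc b)))"
    by (intro sum.cong refl arg_cong2[of _ _ _ _ "(*)"] dt_transpose[symmetric, THEN trans])
       (auto simp: add.commute dt_transpose)
  finally show ?thesis .
qed

text \<open>In the expansion along row \<open>m\<close> the complementary minors do not involve that
  row.\<close>

lemma dt_row_add:
  assumes "m < k"
  shows "dt k (\<lambda>i j. if i = m then a j + b j else f i j) =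
    dt k (\<lambda>i j. if i = m then a j else f i j) + dt k (\<lambda>i j. if i = m then b j else f i j)"
proof -
  obtain l where l: "k = Suc l" "m \<le> l" using assms by (cases k) auto
  have *: "dt l (\<lambda>a b. if (if a < m then a else Suc a) = m then c (if b < j then b else Suc b)
       else f (if a < m then a else Suc a) (if b < j then b else Suc b)) =
    dt l (\<lambda>a b. f (if a < m then a else Suc a) (if b < j then b else Suc b))" for c j
    by (rule dt_cong) auto
  show ?thesis
    unfolding l(1) dt_laplace_row[OF l(2)] *[of a] *[of b] *[of "\<lambda>j. a j + b j"]
    by (simp add: sum.distrib[symmetric] algebra_simps)
qed

lemma dt_row_zero:
  assumes "m < k" "\<And>j. j < k \<Longrightarrow> f m j = 0"
  shows "dt k f = 0"
proof -
  obtain l where l: "k = Suc l" "m \<le> l" using assms by (cases k) auto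
  show ?thesis unfolding l(1) dt_laplace_row[OF l(2)] using assms l by simp
qed

lemma dt_equal_rows:
  assumes "i < k" "j < k" "i \<noteq> j" "\<And>c. c < k \<Longrightarrow> f i c = f j c"
  shows "dt k f = 0"
  unfolding dt_def
  by (rule det_identical_rows[of _ k i j]) (use assms in \<open>auto simp: row_def intro!: eq_vecI\<close>)

lemma dt_permute_rows:
  assumes "p permutes {..<k}" shows "dt k (\<lambda>i. f (p i)) = of_int (sign p) * dt k f"
proof -
  have p: "p permutes {0..<k}" using assms by (simp add: atLeast0LessThan)
  have "p i < k" if "i < k" for i using permutes_in_image[OF p, of i] that by simp
  then have "mat k k (\<lambda>(i, j). mat k k (\<lambda>(i, j). f i j) $$ (p i, j)) = mat k k (\<lambda>(i, j). f (p i) j)"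
    by (intro eq_matI) simp_all
  then show ?thesis
    using det_permute_rows[OF mat_carrier p, of "\<lambda>(i, j). f i j"] by (simp add: dt_def)
qed

lemma dt_permute_columns:
  assumes "p permutes {..<k}" shows "dt k (\<lambda>i j. f i (p j)) = of_int (sign p) * dt k f"
  using dt_permute_rows[OF assms, of "\<lambda>i j. f j i"] dt_transpose[of k "\<lambda>i j. f i (p j)"]
    dt_transpose[of k f] by simp

lemma dt_upper_triangular:
  assumes "\<And>i j. j < i \<Longrightarrow> i < k \<Longrightarrow> f i j = 0"
  shows "dt k f = (\<Prod>i<k. f i i)"
proof -
  have "upper_triangular (mat k k (\<lambda>(i, j). f i j))" using assms by auto
  then have "dt k f = prod_list (diag_mat (mat k k (\<lambda>(i, j). f i j)))"
    unfolding dt_def by (rule det_upper_triangular[OF _ mat_carrier])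
  also have "\<dots> = (\<Prod>i<k. f i i)"
    unfolding diag_mat_def by (simp add: prod.distinct_set_conv_list[symmetric] atLeast0LessThan)
  finally show ?thesis .
qed

lemma dt_mult: "dt k f * dt k g = dt k (\<lambda>i j. \<Sum>l<k. f i l * g l j)"
proof -
  have "mat k k (\<lambda>(i, j). f i j) * mat k k (\<lambda>(i, j). g i j) = mat k k (\<lambda>(i, j). \<Sum>l<k. f i l * g l j)"
    by (auto intro!: eq_matI simp: scalar_prod_def atLeast0LessThan)
  then show ?thesis unfolding dt_def by (metis det_mult mat_carrier)
qed

section \<open>Exterior powers of free abelian groups\<close>

text \<open>Values in a general ring serve two purposes: integer minors on formal sums of tuples,
  and complex cochains on singular chains.\<close>

definition frag_lin :: "('a \<Rightarrow> 'c) \<Rightarrow> ('a \<Rightarrow>\<^sub>0 int) \<Rightarrow> 'c::comm_ring_1"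
  where "frag_lin h u = (\<Sum>x\<in>Poly_Mapping.keys u. of_int (Poly_Mapping.lookup u x) * h x)"

lemma frag_lin_superset:
  assumes "finite S" "Poly_Mapping.keys u \<subseteq> S"
  shows "frag_lin h u = (\<Sum>x\<in>S. of_int (Poly_Mapping.lookup u x) * h x)"
  unfolding frag_lin_def using assms
  by (intro sum.mono_neutral_left) (auto simp: in_keys_iff)

lemma frag_lin_0 [simp]: "frag_lin h 0 = 0"
  by (simp add: frag_lin_def)

lemma frag_lin_of [simp]: "frag_lin h (frag_of x) = h x"
  by (simp add: frag_lin_def)

lemma frag_lin_add: "frag_lin h (u + v) = frag_lin h u + frag_lin h v"
proof -
  let ?S = "Poly_Mapping.keys u \<union> Poly_Mapping.keys v"
  have "Poly_Mapping.keys (u + v) \<subseteq> ?S" by (rule keys_add)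
  then show ?thesis
    by (simp add: frag_lin_superset[of ?S] sum.distrib[symmetric] lookup_add algebra_simps)
qed

lemma frag_lin_cmul: "frag_lin h (frag_cmul c u) = of_int c * frag_lin h u"
proof -
  have "Poly_Mapping.keys (frag_cmul c u) \<subseteq> Poly_Mapping.keys u" by (rule keys_cmul)
  then have "frag_lin h (frag_cmul c u) = (\<Sum>x\<in>Poly_Mapping.keys u. of_int (c * Poly_Mapping.lookup u x) * h x)"
    by (subst frag_lin_superset[of "Poly_Mapping.keys u"]) auto
  then show ?thesis by (simp add: frag_lin_def sum_distrib_left mult.assoc)
qed

lemma frag_lin_minus: "frag_lin h (- u) = - frag_lin h u"
  using frag_lin_cmul[of h "-1" u] by simp

lemma frag_lin_diff: "frag_lin h (u - v) = frag_lin h u - frag_lin h v"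
  using frag_lin_add[of h u "- v"] by (simp add: frag_lin_minus)

lemma frag_lin_sum: "frag_lin h (sum g I) = (\<Sum>i\<in>I. frag_lin h (g i))"
  by (induction I rule: infinite_finite_induct) (simp_all add: frag_lin_add)

lemma frag_lin_extend: "frag_lin h (frag_extend g u) = frag_lin (\<lambda>x. frag_lin h (g x)) u"
  by (simp add: frag_extend_def frag_lin_sum frag_lin_cmul frag_lin_def[of _ u])

definition tuples :: "nat \<Rightarrow> ('a, 'm) monoid_scheme \<Rightarrow> 'a list set"
  where "tuples k A = {xs. length xs = k \<and> set xs \<subseteq> carrier A}"

definition alternating :: "nat \<Rightarrow> ('a, 'm) monoid_scheme \<Rightarrow> ('a list \<Rightarrow> 'c::ab_group_add) \<Rightarrow> bool"
  where "alternating k A h \<longleftrightarrow>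
    (\<forall>xs\<in>tuples k A. \<forall>i<k. \<forall>x\<in>carrier A. \<forall>y\<in>carrier A.
       h (xs[i := x \<otimes>\<^bsub>A\<^esub> y]) = h (xs[i := x]) + h (xs[i := y])) \<and>
    (\<forall>xs\<in>tuples k A. \<forall>j<k. \<forall>i<j. xs ! i = xs ! j \<longrightarrow> h xs = 0)"

lemma tuple_group_eq: "tuple_group k A = free_Abelian_group (tuples k A)"
  by (simp add: tuple_group_def tuples_def)

lemma tuples_update: "xs \<in> tuples k A \<Longrightarrow> x \<in> carrier A \<Longrightarrow> xs[i := x] \<in> tuples k A"
  unfolding tuples_def using set_update_subset_insert[of xs i x] by auto

locale comm_group_exterior = comm_group A for A (structure) + fixes k :: nat
begin

abbreviation "R \<equiv> exterior_relations k A"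

lemma subgroup_R: "subgroup R (tuple_group k A)"
  unfolding exterior_relations_def
proof (rule group.generate_is_subgroup)
  show "group (tuple_group k A)" by (simp add: tuple_group_eq)
  have "frag_of (xs[i := x \<otimes> y]) - frag_of (xs[i := x]) - frag_of (xs[i := y]) \<in> carrier (tuple_group k A)"
    if "xs \<in> tuples k A" "x \<in> carrier A" "y \<in> carrier A" for xs i x y
    unfolding tuple_group_eq carrier_free_Abelian_group_iff
    by (intro order_trans[OF keys_diff] Un_least)
       (use that in \<open>auto intro: tuples_update\<close>)
  then show "{frag_of (xs[i := x \<otimes> y]) - frag_of (xs[i := x]) - frag_of (xs[i := y]) |xs i x y.
       length xs = k \<and> set xs \<subseteq> carrier A \<and> i < k \<and> x \<in> carrier A \<and> y \<in> carrier A} \<union>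
      {frag_of xs |xs i j. length xs = k \<and> set xs \<subseteq> carrier A \<and> i < j \<and> j < k \<and> xs ! i = xs ! j}
      \<subseteq> carrier (tuple_group k A)"
    unfolding tuples_def by (auto simp: tuple_group_def)
qed

lemma R_carrier: "u \<in> R \<Longrightarrow> Poly_Mapping.keys u \<subseteq> tuples k A"
  using subgroup.mem_carrier[OF subgroup_R, of u] by (simp add: tuple_group_eq)

lemma R_0 [simp]: "0 \<in> R"
  using subgroup.one_closed[OF subgroup_R] by (simp add: tuple_group_eq)

lemma R_add: "u \<in> R \<Longrightarrow> v \<in> R \<Longrightarrow> u + v \<in> R"
  using subgroup.m_closed[OF subgroup_R, of u v] by (simp add: tuple_group_eq)

lemma R_minus: "u \<in> R \<Longrightarrow> - u \<in> R"
  using subgroup.m_inv_closed[OF subgroup_R, of u] R_carrier[of u] by (simp add: tuple_group_eq)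

lemma R_diff: "u \<in> R \<Longrightarrow> v \<in> R \<Longrightarrow> u - v \<in> R"
  using R_add[of u "- v"] R_minus[of v] by simp

lemma R_additive:
  "\<lbrakk>xs \<in> tuples k A; i < k; x \<in> carrier A; y \<in> carrier A\<rbrakk> \<Longrightarrow>
   frag_of (xs[i := x \<otimes> y]) - frag_of (xs[i := x]) - frag_of (xs[i := y]) \<in> R"
  unfolding exterior_relations_def tuples_def by (intro generate.incl) blast

lemma R_repeat: "\<lbrakk>xs \<in> tuples k A; i < j; j < k; xs ! i = xs ! j\<rbrakk> \<Longrightarrow> frag_of xs \<in> R"
  unfolding exterior_relations_def tuples_def by (intro generate.incl) blast

text \<open>The universal property of the exterior power, in the form in which functionals on it are
  produced: an alternating map kills the generators of \<open>R\<close>, hence all of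
  \<open>R\<close>.\<close>

lemma alternating_vanishes_R:
  fixes h :: "'a list \<Rightarrow> 'c::comm_ring_1"
  assumes h: "alternating k A h" and u: "u \<in> R"
  shows "frag_lin h u = 0"
proof -
  let ?S = "{frag_of (xs[i := x \<otimes> y]) - frag_of (xs[i := x]) - frag_of (xs[i := y]) |xs i x y.
       length xs = k \<and> set xs \<subseteq> carrier A \<and> i < k \<and> x \<in> carrier A \<and> y \<in> carrier A} \<union>
      {frag_of xs |xs i j. length xs = k \<and> set xs \<subseteq> carrier A \<and> i < j \<and> j < k \<and> xs ! i = xs ! j}"
  have S: "frag_lin h v = 0" if "v \<in> ?S" for v
    using that h unfolding alternating_def tuples_def by (auto simp: frag_lin_diff)
  have SR: "?S \<subseteq> R" unfolding exterior_relations_def by (auto intro!: generate.incl)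
  show ?thesis
    using u unfolding exterior_relations_def
  proof (induction rule: generate.induct)
    case one
    then show ?case by (simp add: tuple_group_eq)
  next
    case (incl v)
    then show ?case by (rule S)
  next
    case (inv v)
    then have "Poly_Mapping.keys v \<subseteq> tuples k A" using SR R_carrier by blast
    then show ?case using S[OF inv] by (simp add: tuple_group_eq frag_lin_minus)
  next
    case (eng u v)
    then show ?case by (simp add: tuple_group_eq frag_lin_add)
  qed
qed

text \<open>Polarization: the tuple with the product of both entries in both places is a relation,
  and expanding it in both places leaves the two mixed terms modulo tuples with a repeated
  entry.\<close>

lemma R_swap:
  assumes xs: "xs \<in> tuples k A" and ij: "i < k" "j < k" "i \<noteq> j"
  shows "frag_of xs + frag_of (xs[i := xs ! j, j := xs ! i]) \<in> R"
proof -
  let ?f = "\<lambda>x y. frag_of (xs[i := x, j := y])"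
  let ?x = "xs ! i" and ?y = "xs ! j"
  have len: "length xs = k" using xs by (simp add: tuples_def)
  have c: "?x \<in> carrier A" "?y \<in> carrier A" using xs ij nth_mem by (auto simp: tuples_def)
  have rep: "?f x x \<in> R" if "x \<in> carrier A" for x
  proof (cases "i < j")
    case True
    then show ?thesis using xs ij that len by (intro R_repeat[of _ i j]) (auto intro!: tuples_update)
  next
    case False
    then show ?thesis using xs ij that len by (intro R_repeat[of _ j i]) (auto intro!: tuples_update)
  qed
  have a1: "?f (x \<otimes> y) z - ?f x z - ?f y z \<in> R" if "x \<in> carrier A" "y \<in> carrier A" "z \<in> carrier A" for x y z
    using R_additive[of "xs[j := z]" i x y] xs ij that tuples_update[OF xs, of z j]
    by (simp add: list_update_swap[OF ij(3)])
  have a2: "?f z (x \<otimes> y) - ?f z x - ?f z y \<in> R" if "x \<in> carrier A" "y \<in> carrier A" "z \<in> carrier A" for x y z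
    using R_additive[of "xs[i := z]" j x y] xs ij that tuples_update[OF xs, of z i] by simp
  have "?f (?x \<otimes> ?y) (?x \<otimes> ?y) - (?f (?x \<otimes> ?y) (?x \<otimes> ?y) - ?f ?x (?x \<otimes> ?y) - ?f ?y (?x \<otimes> ?y))
    - (?f ?x (?x \<otimes> ?y) - ?f ?x ?x - ?f ?x ?y) - (?f ?y (?x \<otimes> ?y) - ?f ?y ?x - ?f ?y ?y)
    - ?f ?x ?x - ?f ?y ?y \<in> R"
    using c by (intro R_diff rep a1 a2 m_closed)
  then have "?f ?x ?y + ?f ?y ?x \<in> R" by (simp add: algebra_simps)
  then show ?thesis by (simp add: list_update_id)
qed

end

text \<open>Sorted lists stand for the \<open>k\<close>-element subsets of \<open>{..<s}\<close>;
  the list fixes the order in which rows and columns of a minor are taken.\<close>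

definition increasing_lists :: "nat \<Rightarrow> nat \<Rightarrow> nat list set"
  where "increasing_lists s k = {is. sorted_wrt (<) is \<and> length is = k \<and> set is \<subseteq> {..<s}}"

lemma bij_betw_increasing_lists:
  "bij_betw set (increasing_lists s k) {I. I \<subseteq> {..<s} \<and> card I = k}"
proof (rule bij_betw_byWitness[of _ sorted_list_of_set])
  show "\<forall>is\<in>increasing_lists s k. sorted_list_of_set (set is) = is"
    by (auto simp: increasing_lists_def strict_sorted_iff sorted_list_of_set.idem_if_sorted_distinct)
  show "\<forall>I\<in>{I. I \<subseteq> {..<s} \<and> card I = k}. set (sorted_list_of_set I) = I"
    by (auto simp: finite_subset[of _ "{..<s}"])
  show "set ` increasing_lists s k \<subseteq> {I. I \<subseteq> {..<s} \<and> card I = k}"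
    by (auto simp: increasing_lists_def strict_sorted_iff distinct_card)
  show "sorted_list_of_set ` {I. I \<subseteq> {..<s} \<and> card I = k} \<subseteq> increasing_lists s k"
    by (auto simp: increasing_lists_def finite_subset[of _ "{..<s}"])
qed

lemma finite_increasing_lists [simp]: "finite (increasing_lists s k)"
  using bij_betw_finite[OF bij_betw_increasing_lists[of s k]] finite_subset[of _ "Pow {..<s}"] by auto

lemma card_increasing_lists: "card (increasing_lists s k) = s choose k"
  using bij_betw_same_card[OF bij_betw_increasing_lists[of s k]] n_subsets[of "{..<s}" k] by simp

locale exterior_basis = comm_group_exterior A k for A (structure) and k +
  fixes s :: nat and b :: "nat \<Rightarrow> 'a"
  assumes basis: "scalar_module.basis_on A (\<lambda>(n::int) x. x [^]\<^bsub>A\<^esub> n) {..<s} b"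
begin

sublocale Z: scalar_module A "\<lambda>(n::int) x. x [^] n"
  by (rule scalar_module_int[OF comm_group_axioms])

lemma b_carrier [simp]: "i < s \<Longrightarrow> b i \<in> carrier A"
  using basis by (auto simp: Z.basis_on_def)

lemma b_Pi: "b \<in> {..<s} \<rightarrow> carrier A" by auto

text \<open>Only the values at \<open>i < s\<close> are determined; facts about single coordinates
  therefore carry that bound.\<close>

definition coord :: "'a \<Rightarrow> nat \<Rightarrow> int"
  where "coord x = (SOME c. x = Z.lc c b {..<s})"

lemma coord: "x \<in> carrier A \<Longrightarrow> x = Z.lc (coord x) b {..<s}"
  unfolding coord_def using Z.basis_on_expand[OF basis, of x] by (metis (mono_tags, lifting) someI)

lemma coord_eqI: "x = Z.lc c b {..<s} \<Longrightarrow> i < s \<Longrightarrow> coord x i = c i"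
  using Z.basis_on_unique[OF basis, of "coord x" c i] coord[of x] Z.lc_closed[OF b_Pi, of c] by simp

lemma coord_mult:
  "\<lbrakk>x \<in> carrier A; y \<in> carrier A; i < s\<rbrakk> \<Longrightarrow> coord (x \<otimes> y) i = coord x i + coord y i"
  by (rule coord_eqI) (simp_all add: Z.lc_add[OF b_Pi] coord[symmetric])

lemma coord_b: "i < s \<Longrightarrow> j < s \<Longrightarrow> coord (b j) i = (if i = j then 1 else 0)"
  by (rule coord_eqI) (simp_all add: Z.lc_single[OF _ b_Pi])

definition spanned :: "('a list \<Rightarrow>\<^sub>0 int) \<Rightarrow> bool"
  where "spanned u \<longleftrightarrow> (\<exists>c. u - (\<Sum>I\<in>increasing_lists s k. frag_cmul (c I) (frag_of (map b I))) \<in> R)"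

lemma spanned_R: "u \<in> R \<Longrightarrow> spanned u"
  unfolding spanned_def by (rule exI[of _ "\<lambda>_. 0"]) simp

lemma spanned_diff:
  assumes "spanned u" "spanned v" shows "spanned (u - v)"
proof -
  let ?S = "\<lambda>c. \<Sum>I\<in>increasing_lists s k. frag_cmul (c I) (frag_of (map b I))"
  obtain c d where c: "u - ?S c \<in> R" and d: "v - ?S d \<in> R" using assms unfolding spanned_def by blast
  have "?S (\<lambda>I. c I - d I) = ?S c - ?S d"
    by (simp add: sum_subtractf[symmetric] frag_cmul_diff_distrib)
  then have "(u - v) - ?S (\<lambda>I. c I - d I) = (u - ?S c) - (v - ?S d)" by simp
  then show ?thesis unfolding spanned_def using R_diff[OF c d] by metis
qed

lemma spanned_add: "spanned u \<Longrightarrow> spanned v \<Longrightarrow> spanned (u + v)"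
  using spanned_diff[of u "0 - v"] spanned_diff[of 0 v] spanned_R[OF R_0] by simp

lemma spanned_basis: "I \<in> increasing_lists s k \<Longrightarrow> spanned (frag_of (map b I))"
  unfolding spanned_def
  by (rule exI[of _ "\<lambda>J. if J = I then 1 else 0"])
     (simp add: if_distrib[of "\<lambda>n. frag_cmul n _"] sum.delta cong: if_cong)

lemma map_b_tuples: "length is = k \<Longrightarrow> set is \<subseteq> {..<s} \<Longrightarrow> map b is \<in> tuples k A"
  by (auto simp: tuples_def)

lemma spanned_swap:
  assumes xs: "xs \<in> tuples k A" and ij: "i < k" "j < k"
  shows "spanned (frag_of (xs[i := xs ! j, j := xs ! i])) \<longleftrightarrow> spanned (frag_of xs)"
proof (cases "i = j")
  case True
  then show ?thesis by (simp add: list_update_id)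
next
  case False
  let ?u = "frag_of xs" and ?v = "frag_of (xs[i := xs ! j, j := xs ! i])"
  have s: "spanned (?u + ?v)" by (rule spanned_R[OF R_swap[OF xs ij False]])
  show ?thesis using spanned_diff[OF s, of ?u] spanned_diff[OF s, of ?v] by auto
qed

lemma permute_list_transpose:
  assumes "i < length xs" "j < length xs"
  shows "permute_list (Transposition.transpose i j) xs = xs[i := xs ! j, j := xs ! i]"
  proof (rule nth_equalityI)
  show "length (permute_list (Transposition.transpose i j) xs) = length (xs[i := xs ! j, j := xs ! i])" by simp
next
  fix l assume "l < length (permute_list (Transposition.transpose i j) xs)"
  then have "l < length xs" by simp
  then show "permute_list (Transposition.transpose i j) xs ! l = xs[i := xs ! j, j := xs ! i] ! l"
    using assms by (simp add: permute_list_def nth_list_update Transposition.transpose_def)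
qed

lemma spanned_permute:
  assumes "p permutes {..<k}" "xs \<in> tuples k A"
  shows "spanned (frag_of (permute_list p xs)) \<longleftrightarrow> spanned (frag_of xs)"
proof -
  have "\<forall>xs\<in>tuples k A. spanned (frag_of (permute_list p xs)) \<longleftrightarrow> spanned (frag_of xs)"
    using assms(1) finite_lessThan[of k]
  proof (induction rule: permutes_induct)
    case id
    show ?case by (auto simp: tuples_def)
  next
    case (swap i j p)
    show ?case
    proof
      fix xs assume xs: "xs \<in> tuples k A"
      then have len: "length xs = k" by (simp add: tuples_def)
      let ?ys = "xs[i := xs ! j, j := xs ! i]"
      have ys: "?ys = permute_list (Transposition.transpose i j) xs"
        using permute_list_transpose[of i xs j] swap(1,2) len by simp
      have "permute_list (Transposition.transpose i j \<circ> p) xs = permute_list p ?ys"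
        unfolding ys using swap len by (intro permute_list_compose) auto
      moreover have "?ys \<in> tuples k A"
        using xs swap len nth_mem[of i xs] nth_mem[of j xs]
        by (intro tuples_update xs) (auto simp: tuples_def)
      ultimately show "spanned (frag_of (permute_list (Transposition.transpose i j \<circ> p) xs)) \<longleftrightarrow> spanned (frag_of xs)"
        using swap.IH spanned_swap[OF xs] swap by auto
    qed
  qed
  with assms(2) show ?thesis by simp
qed

lemma spanned_basis_tuple:
  assumes "length is = k" "set is \<subseteq> {..<s}"
  shows "spanned (frag_of (map b is))"
proof (cases "distinct is")
  case False
  then obtain i j where ij: "i < k" "j < k" "i \<noteq> j" "is ! i = is ! j"
    using assms by (auto simp: distinct_conv_nth)
  have "map b is ! min i j = map b is ! max i j"
    using ij assms by (simp add: min_def max_def)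
  then show ?thesis
    using ij assms by (intro spanned_R R_repeat[of _ "min i j" "max i j"] map_b_tuples) auto
next
  case True
  let ?I = "sort is"
  have I: "?I \<in> increasing_lists s k"
    using True assms by (auto simp: increasing_lists_def strict_sorted_iff)
  obtain p where p: "p permutes {..<length ?I}" "permute_list p ?I = is"
    using mset_eq_permutation[of "is" ?I] by auto
  have "permute_list p (map b ?I) = map b is"
    using p permute_list_map[of p ?I b] by simp
  moreover have "map b ?I \<in> tuples k A" using I by (intro map_b_tuples) (auto simp: increasing_lists_def)
  ultimately show ?thesis
    using spanned_permute[of p "map b ?I"] p(1) assms(1) spanned_basis[OF I] by simp
qed

text \<open>For fixed other entries, the \<open>x\<close> whose tuple is spanned form a subgroup by
  additivity, and a subgroup that contains the basis is everything.\<close>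

lemma spanned_update:
  assumes xs: "xs \<in> tuples k A" "m < k" and bs: "\<And>i. i < s \<Longrightarrow> spanned (frag_of (xs[m := b i]))"
    and x: "x \<in> carrier A"
  shows "spanned (frag_of (xs[m := x]))"
proof -
  let ?P = "\<lambda>x. spanned (frag_of (xs[m := x]))"
  have add: "spanned (frag_of (xs[m := y \<otimes> z]) - frag_of (xs[m := y]) - frag_of (xs[m := z]))"
    if "y \<in> carrier A" "z \<in> carrier A" for y z
    by (intro spanned_R R_additive xs that)
  have one: "?P \<one>"
  proof -
    \<comment> \<open>Additivity at \<open>\<one> \<otimes> \<one> = \<one>\<close> leaves minus the
      tuple itself as a relation.\<close>
    have "spanned (- frag_of (xs[m := \<one>]))" using add[of \<one> \<one>] by simp
    then show ?thesis using spanned_diff[OF spanned_R[OF R_0]] by fastforce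
  qed
  have mult: "?P (y \<otimes> z)" if "y \<in> carrier A" "z \<in> carrier A" "?P y" "?P z" for y z
    using spanned_add[OF add[OF that(1,2)] spanned_add[OF that(3,4)]] by (simp add: algebra_simps)
  have inv: "?P (inv y)" if "y \<in> carrier A" "?P y" for y
    using spanned_diff[OF one spanned_add[OF add[of y "inv y"] that(2)]] that(1) by (simp add: algebra_simps)
  have W: "subgroup {x \<in> carrier A. ?P x} A"
    by unfold_locales (auto simp: one mult inv)
  have bi: "b i \<in> {x \<in> carrier A. ?P x}" if "i < s" for i
    using bs[OF that] b_carrier[OF that] by blast
  have pw: "b i [^] (n::int) \<in> {x \<in> carrier A. ?P x}" if "i < s" for i n
    by (rule subgroup_int_pow_closed[OF W bi[OF that]])
  have "finprod A (\<lambda>i. b i [^] coord x i) I \<in> {x \<in> carrier A. ?P x}" if "finite I" "I \<subseteq> {..<s}" for I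
    using that
  proof (induction I rule: finite_induct)
    case empty
    show ?case using one by simp
  next
    case (insert i I)
    have i: "i < s" "I \<subseteq> {..<s}" using insert.prems by auto
    have eq: "finprod A (\<lambda>i. b i [^] coord x i) (insert i I) = b i [^] coord x i \<otimes> finprod A (\<lambda>i. b i [^] coord x i) I"
      using insert.hyps i by (intro finprod_insert) auto
    show ?case unfolding eq by (rule subgroup.m_closed[OF W pw[OF i(1)] insert.IH[OF i(2)]])
  qed
  from this[of "{..<s}"] have "Z.lc (coord x) b {..<s} \<in> {x \<in> carrier A. ?P x}"
    unfolding Z.lc_def by simp
  then show ?thesis using coord[OF x] by simp
qed

lemma spanned_tuple:
  assumes "xs \<in> tuples k A" shows "spanned (frag_of xs)"
proof -
  \<comment> \<open>The positions from \<open>m\<close> on already hold basis elements; the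
    induction releases one more leading position at a time.\<close>
  have "spanned (frag_of xs)" if "xs \<in> tuples k A" "m \<le> k" "\<forall>i<k. m \<le> i \<longrightarrow> xs ! i \<in> b ` {..<s}" for m xs
    using that
  proof (induction m arbitrary: xs)
    case 0
    then have len: "length xs = k" by (simp add: tuples_def)
    have "\<exists>j. \<forall>i. i < k \<longrightarrow> xs ! i = b (j i) \<and> j i < s"
      by (rule choice) (use 0 in auto)
    then obtain j where j: "\<And>i. i < k \<Longrightarrow> xs ! i = b (j i)" "\<And>i. i < k \<Longrightarrow> j i < s" by blast
    have xs: "xs = map b (map j [0..<k])" by (rule nth_equalityI) (simp_all add: len j)
    show ?case unfolding xs by (rule spanned_basis_tuple) (use j(2) in auto)
  next
    case (Suc m)
    then have len: "length xs = k" and m: "m < k" by (auto simp: tuples_def)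
    have "spanned (frag_of (xs[m := xs ! m]))"
    proof (rule spanned_update[OF Suc.prems(1) m])
      show "spanned (frag_of (xs[m := b i]))" if "i < s" for i
        using Suc.prems that len m by (intro Suc.IH tuples_update) (auto simp: nth_list_update)
      show "xs ! m \<in> carrier A" using Suc.prems(1) m nth_mem by (auto simp: tuples_def)
    qed
    then show ?case by simp
  qed
  from this[OF assms order_refl] show ?thesis by simp
qed

lemma increasing_lists_nth: "J \<in> increasing_lists s k \<Longrightarrow> j < k \<Longrightarrow> J ! j < s"
  unfolding increasing_lists_def using nth_mem[of j J] by blast

definition minor :: "nat list \<Rightarrow> 'a list \<Rightarrow> int"
  where "minor J xs = dt k (\<lambda>i j. coord (xs ! i) (J ! j))"

lemma alternating_minor:
  assumes J: "J \<in> increasing_lists s k"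
  shows "alternating k A (minor J)"
  unfolding alternating_def
proof (intro conjI ballI allI impI)
  have Js: "J ! j < s" if "j < k" for j
    by (rule increasing_lists_nth[OF J that])
  fix xs i x y assume xs: "xs \<in> tuples k A" "i < k" "x \<in> carrier A" "y \<in> carrier A"
  have "minor J (xs[i := z]) = dt k (\<lambda>l j. if l = i then coord z (J ! j) else coord (xs ! l) (J ! j))" for z
    unfolding minor_def using xs by (intro dt_cong) (auto simp: tuples_def)
  moreover have "dt k (\<lambda>l j. if l = i then coord (x \<otimes> y) (J ! j) else coord (xs ! l) (J ! j)) =
    dt k (\<lambda>l j. if l = i then coord x (J ! j) + coord y (J ! j) else coord (xs ! l) (J ! j))"
    using xs Js by (intro dt_cong) (auto simp: coord_mult)
  ultimately show "minor J (xs[i := x \<otimes> y]) = minor J (xs[i := x]) + minor J (xs[i := y])"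
    by (simp add: dt_row_add[OF xs(2)])
next
  fix xs i j assume "xs \<in> tuples k A" "j < k" "i < j" "xs ! i = xs ! j"
  then show "minor J xs = 0"
    unfolding minor_def by (intro dt_equal_rows[of i k j]) auto
qed

lemma minor_basis:
  assumes I: "I \<in> increasing_lists s k" and J: "J \<in> increasing_lists s k"
  shows "minor J (map b I) = (if I = J then 1 else 0)"
proof -
  have len: "length I = k" "length J = k" and s: "\<And>i. i < k \<Longrightarrow> I ! i < s" "\<And>i. i < k \<Longrightarrow> J ! i < s"
    using I J increasing_lists_nth by (auto simp: increasing_lists_def)
  have m: "minor J (map b I) = dt k (\<lambda>i j. if J ! j = I ! i then 1 else 0)"
    unfolding minor_def using len s by (intro dt_cong) (simp add: coord_b)
  show ?thesis
  proof (cases "I = J")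
    case True
    have "distinct I" using I by (auto simp: increasing_lists_def strict_sorted_iff)
    then have "dt k (\<lambda>i j. if J ! j = I ! i then 1 else 0 :: int) = (\<Prod>i<k. if J ! i = I ! i then 1 else 0)"
      using True len by (intro dt_upper_triangular) (auto simp: nth_eq_iff_index_eq)
    then show ?thesis using m True by simp
  next
    case False
    have "set I \<noteq> set J"
      using False bij_betw_imp_inj_on[OF bij_betw_increasing_lists[of s k]] I J by (auto dest: inj_onD)
    moreover have "card (set I) = card (set J)"
      using I J by (auto simp: increasing_lists_def strict_sorted_iff distinct_card)
    ultimately have "\<not> set I \<subseteq> set J" using card_subset_eq[of "set J" "set I"] by auto
    then obtain x where x: "x \<in> set I" "x \<notin> set J" by blast
    then obtain i where i: "i < k" "I ! i = x" using len by (auto simp: in_set_conv_nth)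
    have "dt k (\<lambda>i j. if J ! j = I ! i then 1 else 0 :: int) = 0"
    proof (rule dt_row_zero[OF i(1)])
      fix j assume "j < k"
      then have "J ! j \<in> set J" using len by simp
      then show "(if J ! j = I ! i then 1 else 0 :: int) = 0" using x i by auto
    qed
    then show ?thesis using m False by simp
  qed
qed

text \<open>Some expansion exists by \<open>spanned_tuple\<close>. Its coefficients are forced:
  \<open>minor J\<close> vanishes on \<open>R\<close> and is dual to the basis tuples, so applying
  it to the expansion isolates the coefficient at \<open>J\<close>.\<close>

lemma tuple_expansion:
  assumes xs: "xs \<in> tuples k A"
  shows "frag_of xs - (\<Sum>J\<in>increasing_lists s k. frag_cmul (minor J xs) (frag_of (map b J))) \<in> R"
proof -
  obtain c where c: "frag_of xs - (\<Sum>J\<in>increasing_lists s k. frag_cmul (c J) (frag_of (map b J))) \<in> R"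
    using spanned_tuple[OF xs] unfolding spanned_def by blast
  have "minor J xs = c J" if J: "J \<in> increasing_lists s k" for J
  proof -
    have "minor J xs - (\<Sum>I\<in>increasing_lists s k. c I * minor J (map b I)) = 0"
      using alternating_vanishes_R[OF alternating_minor[OF J] c]
      by (simp add: frag_lin_diff frag_lin_sum frag_lin_cmul)
    moreover have "(\<Sum>I\<in>increasing_lists s k. c I * minor J (map b I)) = (\<Sum>I\<in>increasing_lists s k. if I = J then c I else 0)"
      using J by (intro sum.cong) (auto simp: minor_basis)
    ultimately show ?thesis using J by (simp add: sum.delta)
  qed
  then have "(\<Sum>J\<in>increasing_lists s k. frag_cmul (minor J xs) (frag_of (map b J))) =
     (\<Sum>J\<in>increasing_lists s k. frag_cmul (c J) (frag_of (map b J)))" by (intro sum.cong) auto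
  then show ?thesis using c by simp
qed

end

section \<open>Induced maps, bases and traces of exterior powers\<close>

lemma linear_int_hom:
  assumes "comm_group G" "f \<in> hom G G"
  shows "scalar_module.linear G (\<lambda>(n::int) x. x [^]\<^bsub>G\<^esub> n) f"
proof -
  interpret scalar_module G "\<lambda>(n::int) x. x [^]\<^bsub>G\<^esub> n" by (rule scalar_module_int[OF assms(1)])
  interpret f: group_hom G G f
    using assms by (simp add: group_hom_def group_hom_axioms_def comm_group.axioms)
  show ?thesis unfolding linear_def using assms(2) f.hom_int_pow by auto
qed

lemma finprod_free_Abelian_group:
  assumes "\<And>i. i \<in> I \<Longrightarrow> Poly_Mapping.keys (f i) \<subseteq> S"
  shows "finprod (free_Abelian_group S) f I = sum f I"
proof -
  interpret comm_group "free_Abelian_group S" by (rule abelian_free_Abelian_group)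
  show ?thesis
    using assms by (induction I rule: infinite_finite_induct) (simp_all add: Pi_iff)
qed

lemma lc_free_Abelian_group:
  assumes "\<And>i. i \<in> I \<Longrightarrow> Poly_Mapping.keys (w i) \<subseteq> S"
  shows "scalar_module.lc (free_Abelian_group S) (\<lambda>(n::int) x. x [^]\<^bsub>free_Abelian_group S\<^esub> n) c w I =
    (\<Sum>i\<in>I. frag_cmul (c i) (w i))"
proof -
  let ?G = "free_Abelian_group S"
  interpret scalar_module ?G "\<lambda>(n::int) x. x [^]\<^bsub>?G\<^esub> n"
    by (rule scalar_module_int[OF abelian_free_Abelian_group])
  have k: "Poly_Mapping.keys (frag_cmul (c i) (w i)) \<subseteq> S" if "i \<in> I" for i
    by (rule order_trans[OF keys_cmul assms[OF that]])
  have "lc c w I = finprod ?G (\<lambda>i. frag_cmul (c i) (w i)) I"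
    unfolding lc_def
  proof (rule finprod_cong'[OF refl])
    show "(\<lambda>i. frag_cmul (c i) (w i)) \<in> I \<rightarrow> carrier ?G"
      unfolding Pi_iff carrier_free_Abelian_group_iff using k by blast
  qed (use assms in simp)
  also have "\<dots> = (\<Sum>i\<in>I. frag_cmul (c i) (w i))"
    by (rule finprod_free_Abelian_group[OF k])
  finally show ?thesis .
qed

context comm_group_exterior
begin

lemma comm_group_tuple_group: "comm_group (tuple_group k A)"
  unfolding tuple_group_eq by (rule abelian_free_Abelian_group)

lemma comm_group_exterior_power: "comm_group (exterior_power k A)"
  unfolding exterior_power_def by (rule comm_group_Mod[OF comm_group_tuple_group subgroup_R])

context
  fixes f assumes f: "f \<in> hom A A"
begin

lemma map_tuples: "xs \<in> tuples k A \<Longrightarrow> map f xs \<in> tuples k A"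
  using hom_in_carrier[OF f] by (auto simp: tuples_def)

lemma frag_map_hom: "frag_extend (\<lambda>xs. frag_of (map f xs)) \<in> hom (tuple_group k A) (tuple_group k A)"
proof (rule homI)
  fix u assume "u \<in> carrier (tuple_group k A)"
  then have u: "Poly_Mapping.keys u \<subseteq> tuples k A" by (simp add: tuple_group_eq)
  have "Poly_Mapping.keys (frag_extend (\<lambda>xs. frag_of (map f xs)) u)
      \<subseteq> (\<Union>xs\<in>Poly_Mapping.keys u. Poly_Mapping.keys (frag_of (map f xs)))"
    by (rule keys_frag_extend)
  also have "\<dots> \<subseteq> tuples k A" using u map_tuples by auto
  finally show "frag_extend (\<lambda>xs. frag_of (map f xs)) u \<in> carrier (tuple_group k A)"
    by (simp add: tuple_group_eq)
qed (simp add: tuple_group_eq frag_extend_add)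

lemma frag_map_R: "frag_extend (\<lambda>xs. frag_of (map f xs)) ` R \<subseteq> R"
proof clarify
  let ?F = "frag_extend (\<lambda>xs. frag_of (map f xs))"
  let ?S = "{frag_of (xs[i := x \<otimes> y]) - frag_of (xs[i := x]) - frag_of (xs[i := y]) |xs i x y.
       length xs = k \<and> set xs \<subseteq> carrier A \<and> i < k \<and> x \<in> carrier A \<and> y \<in> carrier A} \<union>
      {frag_of xs |xs i j. length xs = k \<and> set xs \<subseteq> carrier A \<and> i < j \<and> j < k \<and> xs ! i = xs ! j}"
  have S: "?F v \<in> R" if "v \<in> ?S" for v
    using that
  proof
    assume "v \<in> {frag_of (xs[i := x \<otimes> y]) - frag_of (xs[i := x]) - frag_of (xs[i := y]) |xs i x y.
       length xs = k \<and> set xs \<subseteq> carrier A \<and> i < k \<and> x \<in> carrier A \<and> y \<in> carrier A}"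
    then obtain xs i x y where v: "v = frag_of (xs[i := x \<otimes> y]) - frag_of (xs[i := x]) - frag_of (xs[i := y])"
      "xs \<in> tuples k A" "i < k" "x \<in> carrier A" "y \<in> carrier A" unfolding tuples_def by blast
    have "f (x \<otimes> y) = f x \<otimes> f y" using f v by (simp add: hom_def)
    then show "?F v \<in> R"
      unfolding v(1) using R_additive[OF map_tuples[OF v(2)] v(3) hom_in_carrier[OF f v(4)] hom_in_carrier[OF f v(5)]]
      by (simp add: frag_extend_diff map_update)
  next
    assume "v \<in> {frag_of xs |xs i j. length xs = k \<and> set xs \<subseteq> carrier A \<and> i < j \<and> j < k \<and> xs ! i = xs ! j}"
    then obtain xs i j where v: "v = frag_of xs" "xs \<in> tuples k A" "i < j" "j < k" "xs ! i = xs ! j"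
      unfolding tuples_def by blast
    then show "?F v \<in> R" using R_repeat[OF map_tuples[OF v(2)] v(3,4)] by (auto simp: tuples_def)
  qed
  have SR: "?S \<subseteq> R" unfolding exterior_relations_def by (auto intro!: generate.incl)
  have "?F u \<in> R" if "u \<in> generate (tuple_group k A) ?S" for u
    using that
  proof (induction rule: generate.induct)
    case one
    then show ?case using R_0 by (simp add: tuple_group_eq)
  next
    case (incl v)
    then show ?case by (rule S)
  next
    case (inv v)
    have "Poly_Mapping.keys v \<subseteq> tuples k A" by (rule R_carrier[OF subsetD[OF SR inv]])
    then have "inv\<^bsub>tuple_group k A\<^esub> v = - v" by (simp add: tuple_group_eq)
    then show ?case using R_minus[OF S[OF inv]] by (simp add: frag_extend_minus)
  next
    case (eng u v)
    have "?F (u \<otimes>\<^bsub>tuple_group k A\<^esub> v) = ?F u + ?F v" by (simp add: tuple_group_eq frag_extend_add)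
    then show ?case using R_add[OF eng.IH] by simp
  qed
  moreover have "R = generate (tuple_group k A) ?S" by (simp only: exterior_relations_def)
  ultimately show "?F u \<in> R" if "u \<in> R" for u using that by metis
qed

lemma exterior_power_map_hom:
  "exterior_power_map k A f \<in> hom (exterior_power k A) (exterior_power k A)"
  unfolding exterior_power_map_def exterior_power_def
  by (rule coset_map_hom[OF comm_group_tuple_group subgroup_R frag_map_hom frag_map_R])

lemma exterior_power_map_of:
  assumes "xs \<in> tuples k A"
  shows "exterior_power_map k A f (R #>\<^bsub>tuple_group k A\<^esub> frag_of xs) = R #>\<^bsub>tuple_group k A\<^esub> frag_of (map f xs)"
  unfolding exterior_power_map_def
  using coset_map_coset[OF comm_group_tuple_group subgroup_R frag_map_hom frag_map_R, of "frag_of xs"] assms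
  by (simp add: tuple_group_eq)

end

end

context exterior_basis
begin

sublocale E: scalar_module "exterior_power k A" "\<lambda>(n::int) x. x [^]\<^bsub>exterior_power k A\<^esub> n"
  by (rule scalar_module_int[OF comm_group_exterior_power])

abbreviation bases :: "nat list set" where "bases \<equiv> increasing_lists s k"

lemma map_b_bases: "I \<in> bases \<Longrightarrow> map b I \<in> tuples k A"
  by (rule map_b_tuples) (auto simp: increasing_lists_def)

lemma lc_tuple_group:
  "scalar_module.lc (tuple_group k A) (\<lambda>(n::int) x. x [^]\<^bsub>tuple_group k A\<^esub> n) c (\<lambda>I. frag_of (map b I)) bases
   = (\<Sum>I\<in>bases. frag_cmul (c I) (frag_of (map b I)))"
  unfolding tuple_group_eq by (rule lc_free_Abelian_group) (simp add: map_b_bases)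

lemma lc_exterior_power:
  "E.lc c (\<lambda>I. R #>\<^bsub>tuple_group k A\<^esub> frag_of (map b I)) bases =
   R #>\<^bsub>tuple_group k A\<^esub> (\<Sum>I\<in>bases. frag_cmul (c I) (frag_of (map b I)))"
  unfolding exterior_power_def lc_tuple_group[symmetric]
proof (rule lc_Mod[OF scalar_module_int[OF comm_group_tuple_group] subgroup_R])
  show "scalar_module (tuple_group k A Mod R) (\<lambda>(n::int) x. x [^]\<^bsub>tuple_group k A Mod R\<^esub> n)"
    using E.scalar_module_axioms unfolding exterior_power_def .
  show "(R #>\<^bsub>tuple_group k A\<^esub> x) [^]\<^bsub>tuple_group k A Mod R\<^esub> (c::int) = R #>\<^bsub>tuple_group k A\<^esub> (x [^]\<^bsub>tuple_group k A\<^esub> c)"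
    if "x \<in> carrier (tuple_group k A)" for c x
    by (rule int_pow_coset[OF comm_group_tuple_group subgroup_R that])
  show "(\<lambda>I. frag_of (map b I)) \<in> bases \<rightarrow> carrier (tuple_group k A)"
    using map_b_bases by (auto simp: tuple_group_eq)
qed

lemma tuple_coset_expansion:
  assumes xs: "xs \<in> tuples k A"
  shows "R #>\<^bsub>tuple_group k A\<^esub> frag_of xs =
    E.lc (\<lambda>J. minor J xs) (\<lambda>I. R #>\<^bsub>tuple_group k A\<^esub> frag_of (map b I)) bases"
proof -
  let ?S = "\<Sum>J\<in>bases. frag_cmul (minor J xs) (frag_of (map b J))"
  have "Poly_Mapping.keys ?S \<subseteq> (\<Union>J\<in>bases. Poly_Mapping.keys (frag_cmul (minor J xs) (frag_of (map b J))))"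
    by (rule keys_sum)
  also have "\<dots> \<subseteq> tuples k A"
  proof (rule UN_least)
    fix J assume "J \<in> bases"
    then show "Poly_Mapping.keys (frag_cmul (minor J xs) (frag_of (map b J))) \<subseteq> tuples k A"
      using keys_cmul[of "minor J xs" "frag_of (map b J)"] map_b_bases[of J] by auto
  qed
  finally have S: "Poly_Mapping.keys ?S \<subseteq> tuples k A" .
  show ?thesis
    unfolding lc_exterior_power
    using coset_eq_iff[OF comm_group_tuple_group subgroup_R, of "frag_of xs" ?S] S xs tuple_expansion[OF xs]
    by (simp add: tuple_group_eq)
qed

text \<open>Spanning passes from tuples to all formal sums because spanned elements are closed under
  differences; independence is read off by applying the minors.\<close>

lemma exterior_power_basis:
  "E.basis_on bases (\<lambda>I. R #>\<^bsub>tuple_group k A\<^esub> frag_of (map b I))"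
  unfolding exterior_power_def
proof (rule basis_on_Mod[OF scalar_module_int[OF comm_group_tuple_group] subgroup_R])
  show "scalar_module (tuple_group k A Mod R) (\<lambda>(n::int) x. x [^]\<^bsub>tuple_group k A Mod R\<^esub> n)"
    using E.scalar_module_axioms unfolding exterior_power_def .
  show "(R #>\<^bsub>tuple_group k A\<^esub> x) [^]\<^bsub>tuple_group k A Mod R\<^esub> (c::int) = R #>\<^bsub>tuple_group k A\<^esub> (x [^]\<^bsub>tuple_group k A\<^esub> c)"
    if "x \<in> carrier (tuple_group k A)" for c x
    by (rule int_pow_coset[OF comm_group_tuple_group subgroup_R that])
  show "(\<lambda>I. frag_of (map b I)) \<in> bases \<rightarrow> carrier (tuple_group k A)"
    using map_b_bases by (auto simp: tuple_group_eq)
  show "finite bases" by simp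
next
  fix u assume "u \<in> carrier (tuple_group k A)"
  then have u: "Poly_Mapping.keys u \<subseteq> tuples k A" by (simp add: tuple_group_eq)
  have "spanned u"
    by (rule free_Abelian_group_induct[OF u]) (use spanned_R[OF R_0] spanned_diff spanned_tuple in auto)
  then obtain c where c: "u - (\<Sum>I\<in>bases. frag_cmul (c I) (frag_of (map b I))) \<in> R"
    unfolding spanned_def by blast
  let ?S = "\<Sum>I\<in>bases. frag_cmul (c I) (frag_of (map b I))"
  have "Poly_Mapping.keys (u - (u - ?S)) \<subseteq> tuples k A"
    using keys_diff[of u "u - ?S"] u R_carrier[OF c] by blast
  then have S: "Poly_Mapping.keys ?S \<subseteq> tuples k A" by simp
  show "\<exists>c. u \<otimes>\<^bsub>tuple_group k A\<^esub> inv\<^bsub>tuple_group k A\<^esub> scalar_module.lc (tuple_group k A)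
      (\<lambda>(n::int) x. x [^]\<^bsub>tuple_group k A\<^esub> n) c (\<lambda>I. frag_of (map b I)) bases \<in> R"
    unfolding lc_tuple_group using c S by (intro exI[of _ c]) (simp add: tuple_group_eq)
next
  fix c J assume c: "scalar_module.lc (tuple_group k A)
      (\<lambda>(n::int) x. x [^]\<^bsub>tuple_group k A\<^esub> n) c (\<lambda>I. frag_of (map b I)) bases \<in> R" and J: "J \<in> bases"
  have "(\<Sum>I\<in>bases. c I * minor J (map b I)) = 0"
    using alternating_vanishes_R[OF alternating_minor[OF J] c[unfolded lc_tuple_group]]
    by (simp add: frag_lin_sum frag_lin_cmul)
  moreover have "(\<Sum>I\<in>bases. c I * minor J (map b I)) = (\<Sum>I\<in>bases. if I = J then c I else 0)"
    using J by (intro sum.cong) (auto simp: minor_basis)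
  ultimately show "c J = 0" using J by (simp add: sum.delta)
qed

lemma int_trace_exterior_power:
  assumes f: "f \<in> hom A A"
  shows "int_trace (exterior_power k A) (exterior_power_map k A f) = (\<Sum>I\<in>bases. minor I (map f (map b I)))"
  unfolding int_trace_def
proof (rule E.module_trace_eqI[where a = "\<lambda>I J. minor I (map f (map b J))", OF exterior_power_basis linear_int_hom[OF comm_group_exterior_power exterior_power_map_hom[OF f]]])
  fix J assume J: "J \<in> bases"
  show "exterior_power_map k A f (R #>\<^bsub>tuple_group k A\<^esub> frag_of (map b J)) =
     E.lc (\<lambda>I. minor I (map f (map b J))) (\<lambda>I. R #>\<^bsub>tuple_group k A\<^esub> frag_of (map b I)) bases"
    unfolding exterior_power_map_of[OF f map_b_bases[OF J]]
    by (rule tuple_coset_expansion[OF map_tuples[OF f map_b_bases[OF J]]])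
qed

end

section \<open>Newton's identities for sums of principal minors\<close>

text \<open>Up to sign a coefficient of the characteristic polynomial, that is, the elementary
  symmetric function of degree \<open>k\<close> in the eigenvalues.\<close>

definition minor_sum :: "nat \<Rightarrow> (nat \<Rightarrow> nat \<Rightarrow> int) \<Rightarrow> nat \<Rightarrow> int"
  where "minor_sum s A k = (\<Sum>I\<in>increasing_lists s k. dt k (\<lambda>i j. A (I ! i) (I ! j)))"

fun mat_power :: "nat \<Rightarrow> (nat \<Rightarrow> nat \<Rightarrow> int) \<Rightarrow> nat \<Rightarrow> nat \<Rightarrow> nat \<Rightarrow> int"
  where "mat_power s A 0 = (\<lambda>i j. if i = j then 1 else 0)"
  | "mat_power s A (Suc n) = (\<lambda>i j. \<Sum>l<s. mat_power s A n i l * A l j)"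

text \<open>Lists in any order and with repetitions: summing over them only multiplies a sum of
  minors by \<open>k!\<close>, and a new index can be inserted at any position without
  sorting.\<close>

definition lists_below :: "nat \<Rightarrow> nat \<Rightarrow> nat list set"
  where "lists_below s k = {is. length is = k \<and> set is \<subseteq> {..<s}}"

lemma finite_lists_below [simp]: "finite (lists_below s k)"
  unfolding lists_below_def using finite_lists_length_eq[of "{..<s}" k] by (simp add: conj_commute)

text \<open>Removing the entry at position \<open>l\<close> is a bijection onto pairs of an index
  and a shorter list.\<close>

lemma sum_lists_below_insert:
  assumes "l \<le> k"
  shows "(\<Sum>is\<in>lists_below s (Suc k). f is) =
    (\<Sum>w<s. \<Sum>js\<in>lists_below s k. f (take l js @ w # drop l js))"
proof -
  let ?h = "\<lambda>(w, js). take l js @ w # drop l js"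
  have "bij_betw ?h ({..<s} \<times> lists_below s k) (lists_below s (Suc k))"
  proof (rule bij_betw_byWitness[of _ "\<lambda>is. (is ! l, take l is @ drop (Suc l) is)"])
    show "\<forall>x\<in>{..<s} \<times> lists_below s k. (\<lambda>is. (is ! l, take l is @ drop (Suc l) is)) (?h x) = x"
      using assms by (auto simp: lists_below_def nth_append)
    show "\<forall>is\<in>lists_below s (Suc k). ?h (is ! l, take l is @ drop (Suc l) is) = is"
      using assms by (auto simp: lists_below_def id_take_nth_drop[symmetric])
    have sub: "set (take l js) \<subseteq> {..<s}" "set (drop m js) \<subseteq> {..<s}" if "js \<in> lists_below s n" for m n js
      using that set_take_subset[of l js] set_drop_subset[of m js] unfolding lists_below_def by blast+
    have "take l js @ w # drop l js \<in> lists_below s (Suc k)" if "w < s" "js \<in> lists_below s k" for w js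
      using sub[OF that(2)] that assms by (auto simp: lists_below_def)
    then show "?h ` ({..<s} \<times> lists_below s k) \<subseteq> lists_below s (Suc k)" by auto
    have "js ! l < s \<and> take l js @ drop (Suc l) js \<in> lists_below s k" if js: "js \<in> lists_below s (Suc k)" for js
    proof -
      have "js ! l \<in> set js" "set js \<subseteq> {..<s}" using js assms by (auto simp: lists_below_def)
      then have "js ! l < s" by blast
      then show ?thesis using sub[OF js] js assms by (auto simp: lists_below_def)
    qed
    then show "(\<lambda>is. (is ! l, take l is @ drop (Suc l) is)) ` lists_below s (Suc k) \<subseteq> {..<s} \<times> lists_below s k"
      by auto
  qed
  from sum.reindex_bij_betw[OF this, of f, symmetric]
  show ?thesis by (simp add: sum.cartesian_product case_prod_unfold)
qed

text \<open>On its way to the front \<open>w\<close> passes \<open>l\<close> columns, one adjacent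
  transposition each.\<close>

lemma dt_move_column:
  assumes "length js = k" "l \<le> k"
  shows "dt (Suc k) (\<lambda>a b. g a ((take l js @ w # drop l js) ! b)) = (-1) ^ l * dt (Suc k) (\<lambda>a b. g a ((w # js) ! b))"
  using assms(2)
proof (induction l)
  case 0
  then show ?case by simp
next
  case (Suc l)
  let ?t = "Transposition.transpose l (Suc l)"
  let ?is = "\<lambda>l. take l js @ w # drop l js"
  have nth: "?is (Suc l) ! b = ?is l ! ?t b" if "b < Suc k" for b
  proof (cases "Suc l < b")
    case True
    then obtain c where "b = Suc (Suc c)" "l \<le> c" by (cases b; cases "b - 1") auto
    then show ?thesis using that Suc.prems assms(1)
      by (simp add: Transposition.transpose_def nth_append)
  next
    case False
    then show ?thesis using that Suc.prems assms(1)
      by (auto simp: Transposition.transpose_def nth_append nth_Cons' not_less le_Suc_eq)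
  qed
  have "dt (Suc k) (\<lambda>a b. g a (?is (Suc l) ! b)) = dt (Suc k) (\<lambda>a b. g a (?is l ! ?t b))"
    using nth by (intro dt_cong) simp
  also have "\<dots> = of_int (sign ?t) * dt (Suc k) (\<lambda>a b. g a (?is l ! b))"
    using Suc.prems by (intro dt_permute_columns permutes_swap_id) auto
  also have "sign ?t = -1" by (simp add: sign_swap_id)
  finally show ?case using Suc by simp
qed

lemma dt_permute_both:
  assumes "p permutes {..<k}"
  shows "dt k (\<lambda>i j. f (p i) (p j)) = dt k f"
proof -
  have "dt k (\<lambda>i j. f (p i) (p j)) = of_int (sign p) * (of_int (sign p) * dt k f)"
    using dt_permute_rows[OF assms, of "\<lambda>i j. f i (p j)"] dt_permute_columns[OF assms, of f] by simp
  also have "\<dots> = of_int (sign p * sign p) * dt k f" by (simp only: of_int_mult mult.assoc)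
  finally show ?thesis by simp
qed

text \<open>A repeated entry gives two equal rows. Each increasing list has \<open>k!\<close>
  rearrangements, and permuting rows and columns together leaves the determinant unchanged.\<close>

lemma sum_lists_below_minors:
  "(\<Sum>is\<in>lists_below s k. dt k (\<lambda>i j. A (is ! i) (is ! j))) = fact k * minor_sum s A k"
proof -
  let ?D = "{is \<in> lists_below s k. distinct is}"
  let ?d = "\<lambda>is. dt k (\<lambda>i j. A (is ! i) (is ! j))"
  have "(\<Sum>is\<in>lists_below s k. ?d is) = (\<Sum>is\<in>?D. ?d is)"
  proof (rule sum.mono_neutral_right)
    show "\<forall>is\<in>lists_below s k - ?D. ?d is = 0"
    proof
      fix js assume "js \<in> lists_below s k - ?D"
      then obtain i j where "i < k" "j < k" "i \<noteq> j" "js ! i = js ! j"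
        by (auto simp: distinct_conv_nth lists_below_def)
      then show "?d js = 0" by (intro dt_equal_rows[of i k j]) auto
    qed
  qed auto
  also have "\<dots> = (\<Sum>I\<in>increasing_lists s k. \<Sum>is\<in>{is \<in> ?D. sort is = I}. ?d is)"
  proof (rule sum.group[symmetric])
    show "sort ` ?D \<subseteq> increasing_lists s k"
      by (auto simp: lists_below_def increasing_lists_def strict_sorted_iff)
  qed auto
  also have "\<dots> = (\<Sum>I\<in>increasing_lists s k. fact k * ?d I)"
  proof (rule sum.cong[OF refl])
    fix I assume I: "I \<in> increasing_lists s k"
    have "{is \<in> ?D. sort is = I} = permutations_of_set (set I)"
    proof (intro equalityI subsetI)
      fix js assume "js \<in> {is \<in> ?D. sort is = I}"
      then show "js \<in> permutations_of_set (set I)" by (auto simp: permutations_of_set_def)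
    next
      fix js assume js: "js \<in> permutations_of_set (set I)"
      have "sorted I" "distinct I" "length I = k" "set I \<subseteq> {..<s}"
        using I by (auto simp: increasing_lists_def strict_sorted_iff)
      moreover from js have "set js = set I" "distinct js" by (auto simp: permutations_of_set_def)
      moreover from calculation have "sort js = I"
        by (intro sorted_distinct_set_unique) auto
      moreover have "length js = k" using calculation distinct_card[of js] distinct_card[of I] by simp
      ultimately show "js \<in> {is \<in> ?D. sort is = I}" by (auto simp: lists_below_def)
    qed
    moreover have "card (set I) = k"
      using I by (auto simp: increasing_lists_def strict_sorted_iff distinct_card)
    ultimately have c: "card {is \<in> ?D. sort is = I} = fact k" by simp
    have "?d js = ?d I" if "js \<in> {is \<in> ?D. sort is = I}" for js
    proof -
      have js: "mset js = mset I" "length I = k" using that by (auto simp: lists_below_def)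
      obtain p where p: "p permutes {..<length I}" "permute_list p I = js"
        using mset_eq_permutation[OF js(1)] by blast
      have "?d js = dt k (\<lambda>i j. A (I ! p i) (I ! p j))"
        using p js(2) by (intro dt_cong) (auto simp: permute_list_nth)
      then show ?thesis using dt_permute_both[of p k "\<lambda>i j. A (I ! i) (I ! j)"] p js(2) by simp
    qed
    then have "(\<Sum>is\<in>{is \<in> ?D. sort is = I}. ?d is) = (\<Sum>is\<in>{is \<in> ?D. sort is = I}. ?d I)"
      by (rule sum.cong[OF refl])
    also have "\<dots> = fact k * ?d I" using c by simp
    finally show "(\<Sum>is\<in>{is \<in> ?D. sort is = I}. ?d is) = fact k * ?d I" .
  qed
  finally show ?thesis by (simp add: minor_sum_def sum_distrib_left)
qed

text \<open>Minors bordered by one extra row \<open>u\<close> and column \<open>v\<close>: expanding along that column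
  relates them to the minors of the next smaller size.\<close>

definition bordered :: "nat \<Rightarrow> (nat \<Rightarrow> nat \<Rightarrow> int) \<Rightarrow> nat \<Rightarrow> nat \<Rightarrow> nat \<Rightarrow> int"
  where "bordered s A k u v =
    (\<Sum>is\<in>lists_below s k. dt (Suc k) (\<lambda>i j. A ((u # is) ! i) ((v # is) ! j)))"

text \<open>In the expansion along the column \<open>v\<close> the entry in row \<open>u\<close>
  leaves an ordinary minor. The entry in the row of the index \<open>w\<close> at position
  \<open>l\<close> leaves a minor that lacks row \<open>w\<close> but keeps column \<open>w\<close>;
  moving this column to the front costs \<open>(-1) ^ l\<close>, which cancels the dependence of the
  cofactor sign on \<open>l\<close>. So all \<open>k + 1\<close> positions contribute
  equally.\<close>

lemma bordered_Suc:
  "bordered s A (Suc k) u v = A u v * (fact (Suc k) * minor_sum s A (Suc k))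
     - int (Suc k) * (\<Sum>w<s. bordered s A k u w * A w v)"
proof -
  let ?L = "lists_below s (Suc k)"
  let ?t = "\<lambda>l is. (-1) ^ Suc l * A (is ! l) v *
     dt (Suc k) (\<lambda>a b. A ((u # is) ! (if a < Suc l then a else Suc a)) (is ! b))"
  have expand: "dt (Suc (Suc k)) (\<lambda>i j. A ((u # is) ! i) ((v # is) ! j)) =
     A u v * dt (Suc k) (\<lambda>a b. A (is ! a) (is ! b)) + (\<Sum>l\<le>k. ?t l is)" for "is"
    unfolding dt_laplace_column[OF le0] sum.atMost_Suc_shift by simp
  have summand: "(\<Sum>is\<in>?L. ?t l is) = - (\<Sum>w<s. bordered s A k u w * A w v)" if l: "l \<le> k" for l
  proof -
    have "?t l (take l js @ w # drop l js) = - (A w v * dt (Suc k) (\<lambda>i j. A ((u # js) ! i) ((w # js) ! j)))"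
      if js: "js \<in> lists_below s k" for w js
    proof -
      have len: "length js = k" using js by (simp add: lists_below_def)
      have row: "(u # take l js @ w # drop l js) ! (if a < Suc l then a else Suc a) = (u # js) ! a" if "a < Suc k" for a
        using l len that by (auto simp: nth_append nth_Cons' min_def)
      have "dt (Suc k) (\<lambda>a b. A ((u # take l js @ w # drop l js) ! (if a < Suc l then a else Suc a))
              ((take l js @ w # drop l js) ! b)) =
         dt (Suc k) (\<lambda>a b. A ((u # js) ! a) ((take l js @ w # drop l js) ! b))"
        using row by (intro dt_cong) simp
      also have "\<dots> = (-1) ^ l * dt (Suc k) (\<lambda>a b. A ((u # js) ! a) ((w # js) ! b))"
        by (rule dt_move_column[OF len l])
      finally have eq: "dt (Suc k) (\<lambda>a b. A ((u # take l js @ w # drop l js) ! (if a < Suc l then a else Suc a))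
              ((take l js @ w # drop l js) ! b)) = (-1) ^ l * dt (Suc k) (\<lambda>a b. A ((u # js) ! a) ((w # js) ! b))" .
      have nthl: "(take l js @ w # drop l js) ! l = w" using l len by (simp add: nth_append)
      have "(-1) ^ Suc l * A w v * ((-1) ^ l * dt (Suc k) (\<lambda>a b. A ((u # js) ! a) ((w # js) ! b)))
        = ((-1) ^ Suc l * (-1) ^ l) * (A w v * dt (Suc k) (\<lambda>a b. A ((u # js) ! a) ((w # js) ! b)))"
        by (simp only: mult_ac)
      moreover have "((-1) ^ Suc l * (-1) ^ l :: int) = -1"
        by (simp add: power_add[symmetric] flip: mult_2)
      ultimately show ?thesis unfolding nthl eq by simp
    qed
    then have "(\<Sum>is\<in>?L. ?t l is) =
        (\<Sum>w<s. \<Sum>js\<in>lists_below s k. - (A w v * dt (Suc k) (\<lambda>i j. A ((u # js) ! i) ((w # js) ! j))))"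
      unfolding sum_lists_below_insert[OF l] by (intro sum.cong refl) blast
    also have "\<dots> = - (\<Sum>w<s. bordered s A k u w * A w v)"
      by (simp add: bordered_def sum_negf sum_distrib_left mult.commute)
    finally show ?thesis .
  qed
  have "bordered s A (Suc k) u v =
      A u v * (\<Sum>is\<in>?L. dt (Suc k) (\<lambda>a b. A (is ! a) (is ! b))) + (\<Sum>l\<le>k. \<Sum>is\<in>?L. ?t l is)"
    unfolding bordered_def expand sum.distrib sum_distrib_left[symmetric] by (simp only: sum.swap[of _ ?L])
  also have "(\<Sum>l\<le>k. \<Sum>is\<in>?L. ?t l is) = (\<Sum>l\<le>k. - (\<Sum>w<s. bordered s A k u w * A w v))"
    by (intro sum.cong refl summand) simp
  finally show ?thesis by (simp add: sum_lists_below_minors)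
qed

text \<open>Iterating \<open>bordered_Suc\<close> produces, up to sign, the matrices of the
  Faddeev-LeVerrier recursion: alternating sums of powers of \<open>A\<close> with the lower minor
  sums as coefficients.\<close>

lemma bordered_eq:
  "bordered s A k u v = fact k * (\<Sum>j\<le>k. (-1) ^ j * minor_sum s A (k - j) * mat_power s A (Suc j) u v)"
  if "u < s" "v < s"
  using that
proof (induction k arbitrary: v)
  case 0
  have "lists_below s 0 = {[]}" by (auto simp: lists_below_def)
  moreover have "increasing_lists s 0 = {[]}" by (auto simp: increasing_lists_def)
  moreover have "dt (Suc 0) f = f 0 0" for f :: "nat \<Rightarrow> nat \<Rightarrow> int" by (simp add: dt_laplace_row[of 0])
  moreover have "mat_power s A (Suc 0) u v = A u v"
    using 0 by (simp add: if_distrib[of "\<lambda>x. x * _"] sum.delta cong: if_cong)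
  ultimately show ?case by (simp add: bordered_def minor_sum_def)
next
  case (Suc k)
  let ?e = "minor_sum s A"
  have "(\<Sum>w<s. bordered s A k u w * A w v) =
     (\<Sum>w<s. fact k * (\<Sum>j\<le>k. (-1) ^ j * ?e (k - j) * mat_power s A (Suc j) u w) * A w v)"
    using Suc by (intro sum.cong) auto
  also have "\<dots> = fact k * (\<Sum>j\<le>k. (-1) ^ j * ?e (k - j) * mat_power s A (Suc (Suc j)) u v)"
    by (simp add: sum_distrib_left sum_distrib_right mult_ac sum.swap[of _ "{..<s}" "{..k}"])
  finally have *: "bordered s A (Suc k) u v = fact (Suc k) * (A u v * ?e (Suc k)
      - (\<Sum>j\<le>k. (-1) ^ j * ?e (k - j) * mat_power s A (Suc (Suc j)) u v))"
    unfolding bordered_Suc by (simp add: algebra_simps)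
  have "mat_power s A (Suc 0) u v = A u v"
    using Suc.prems by (simp add: if_distrib[of "\<lambda>x. x * _"] sum.delta cong: if_cong)
  then show ?case
    unfolding * sum.atMost_Suc_shift by (simp add: sum_negf del: mat_power.simps)
qed

theorem newton_minor_sum:
  assumes "k \<ge> 1"
  shows "int k * minor_sum s A k =
    (\<Sum>j=1..k. (-1) ^ (j - 1) * minor_sum s A (k - j) * (\<Sum>u<s. mat_power s A j u u))"
proof -
  obtain l where l: "k = Suc l" using assms by (cases k) auto
  let ?e = "minor_sum s A"
  \<comment> \<open>For \<open>v = u\<close> and summed over \<open>u\<close>, the bordered list
    \<open>u # is\<close> runs through all lists of length \<open>l + 1\<close>.\<close>
  have "fact (Suc l) * ?e (Suc l) = (\<Sum>u<s. bordered s A l u u)"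
    unfolding sum_lists_below_minors[symmetric] bordered_def sum_lists_below_insert[OF le0] by simp
  also have "\<dots> = (\<Sum>u<s. fact l * (\<Sum>j\<le>l. (-1) ^ j * ?e (l - j) * mat_power s A (Suc j) u u))"
    by (intro sum.cong refl bordered_eq) auto
  also have "\<dots> = fact l * (\<Sum>j\<le>l. (-1) ^ j * ?e (l - j) * (\<Sum>u<s. mat_power s A (Suc j) u u))"
    unfolding sum_distrib_left by (rule sum.swap)
  finally have "fact l * (int (Suc l) * ?e (Suc l)) =
      fact l * (\<Sum>j\<le>l. (-1) ^ j * ?e (l - j) * (\<Sum>u<s. mat_power s A (Suc j) u u))"
    by (simp add: algebra_simps del: mat_power.simps)
  then have "int (Suc l) * ?e (Suc l) = (\<Sum>j\<le>l. (-1) ^ j * ?e (l - j) * (\<Sum>u<s. mat_power s A (Suc j) u u))"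
    by simp
  also have "\<dots> = (\<Sum>j=1..Suc l. (-1) ^ (j - 1) * ?e (Suc l - j) * (\<Sum>u<s. mat_power s A j u u))"
    unfolding One_nat_def sum.shift_bounds_cl_Suc_ivl atLeast0AtMost by simp
  finally show ?thesis by (simp only: l)
qed

section \<open>Extension of additive maps to the complex numbers\<close>

text \<open>A partial additive map is kept as its graph, so that unions of chains are immediate in
  Zorn's lemma. Closure under differences reduces single-valuedness to the fibre over
  \<open>0\<close>.\<close>

definition additive_graph :: "(('a \<Rightarrow>\<^sub>0 int) \<times> complex) set \<Rightarrow> bool"
  where "additive_graph R \<longleftrightarrow> (0, 0) \<in> R \<and>
    (\<forall>u a v b. (u, a) \<in> R \<longrightarrow> (v, b) \<in> R \<longrightarrow> (u - v, a - b) \<in> R) \<and>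
    (\<forall>c. (0, c) \<in> R \<longrightarrow> c = 0)"

lemma
  assumes "additive_graph R"
  shows additive_graph_diff: "(u, a) \<in> R \<Longrightarrow> (v, b) \<in> R \<Longrightarrow> (u - v, a - b) \<in> R"
    and additive_graph_add: "(u, a) \<in> R \<Longrightarrow> (v, b) \<in> R \<Longrightarrow> (u + v, a + b) \<in> R"
    and additive_graph_cmul: "(u, a) \<in> R \<Longrightarrow> (frag_cmul n u, of_int n * a) \<in> R"
    and additive_graph_unique: "(u, a) \<in> R \<Longrightarrow> (u, b) \<in> R \<Longrightarrow> a = b"
proof -
  have z: "(0, 0) \<in> R" using assms by (simp add: additive_graph_def)
  show d: "(u - v, a - b) \<in> R" if "(u, a) \<in> R" "(v, b) \<in> R" for u a v b
    using assms that unfolding additive_graph_def by blast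
  have m: "(- v, - b) \<in> R" if "(v, b) \<in> R" for v b using d[OF z that] by simp
  show s: "(u + v, a + b) \<in> R" if "(u, a) \<in> R" "(v, b) \<in> R" for u a v b
    using d[OF that(1) m[OF that(2)]] by simp
  have nat: "(frag_cmul (int n) u, of_nat n * a) \<in> R" if "(u, a) \<in> R" for u a n
  proof (induction n)
    case (Suc n)
    then show ?case using s[OF that Suc] by (simp add: frag_cmul_distrib algebra_simps)
  qed (use z in simp)
  show "(frag_cmul n u, of_int n * a) \<in> R" if "(u, a) \<in> R" for u a n
  proof (cases "n \<ge> 0")
    case True
    then show ?thesis using nat[OF that, of "nat n"] by simp
  next
    case False
    then show ?thesis using m[OF nat[OF that, of "nat (- n)"]] by simp
  qed
  show "a = b" if "(u, a) \<in> R" "(u, b) \<in> R"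
  proof -
    have "(0, a - b) \<in> R" using d[OF that] by simp
    then have "a - b = 0" using assms unfolding additive_graph_def by blast
    then show ?thesis by simp
  qed
qed

text \<open>Divisibility of \<open>\<complex>\<close> provides a compatible value \<open>y\<close> at any new element \<open>x\<close>.\<close>

lemma additive_graph_extend:
  assumes R: "additive_graph R" shows "\<exists>R' y. additive_graph R' \<and> R \<subseteq> R' \<and> (x, y) \<in> R'"
proof -
  have "\<exists>y. \<forall>n c. (frag_cmul n x, c) \<in> R \<longrightarrow> c = of_int n * y"
  proof (cases "\<exists>n>0. \<exists>c. (frag_cmul (int n) x, c) \<in> R")
    case False
    \<comment> \<open>No nonzero multiple of \<open>x\<close> lies in the domain, so the value at
      \<open>x\<close> is free; it is chosen to be \<open>0\<close>.\<close>
    have "c = of_int n * 0" if nc: "(frag_cmul n x, c) \<in> R" for n c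
    proof -
      have "n = 0"
      proof (rule ccontr)
        assume "n \<noteq> 0"
        have e: "int (nat \<bar>n\<bar>) = sgn n * n" by (simp add: sgn_if)
        have "(frag_cmul (int (nat \<bar>n\<bar>)) x, of_int (sgn n) * c) \<in> R"
          unfolding e using additive_graph_cmul[OF R nc, of "sgn n"] by simp
        moreover have "nat \<bar>n\<bar> > 0" using \<open>n \<noteq> 0\<close> by simp
        ultimately show False using False by blast
      qed
      then show ?thesis using nc R by (simp add: additive_graph_def)
    qed
    then show ?thesis by blast
  next
    case True
    \<comment> \<open>The integers \<open>n\<close> for which \<open>n x\<close> lies in the domain
      form an ideal with generator \<open>n0\<close>, so the value at \<open>n0 x\<close>, divided
      by \<open>n0\<close>, fits all of them.\<close>
    define n0 where "n0 = (LEAST n. n > 0 \<and> (\<exists>c. (frag_cmul (int n) x, c) \<in> R))"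
    have "\<exists>n. n > 0 \<and> (\<exists>c. (frag_cmul (int n) x, c) \<in> R)" using True by blast
    from LeastI_ex[OF this] have n0: "n0 > 0" "\<exists>c. (frag_cmul (int n0) x, c) \<in> R"
      unfolding n0_def[symmetric] by simp_all
    then obtain c0 where c0: "(frag_cmul (int n0) x, c0) \<in> R" by blast
    have "c = of_int n * (c0 / of_nat n0)" if nc: "(frag_cmul n x, c) \<in> R" for n c
    proof -
      have q: "(frag_cmul (n div int n0 * int n0) x, of_int (n div int n0) * c0) \<in> R"
        using additive_graph_cmul[OF R c0, of "n div int n0"] by simp
      have "(frag_cmul (n mod int n0) x, c - of_int (n div int n0) * c0) \<in> R"
        using additive_graph_diff[OF R nc q]
        by (simp add: frag_cmul_diff_distrib[symmetric] minus_div_mult_eq_mod)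
      then have "(frag_cmul (int (nat (n mod int n0))) x, c - of_int (n div int n0) * c0) \<in> R"
        using n0 by simp
      moreover have "nat (n mod int n0) < n0" using n0 by (simp add: nat_less_iff)
      ultimately have "\<not> 0 < nat (n mod int n0)"
        using not_less_Least[of "nat (n mod int n0)" "\<lambda>n. n > 0 \<and> (\<exists>c. (frag_cmul (int n) x, c) \<in> R)"]
        unfolding n0_def[symmetric] by auto
      then have "n mod int n0 = 0" using n0 pos_mod_sign[of "int n0" n] by linarith
      then have n: "n = n div int n0 * int n0" by auto
      then have "c = of_int (n div int n0) * c0"
        using additive_graph_unique[OF R nc] q by metis
      also have "\<dots> = of_int (n div int n0 * int n0) * (c0 / of_nat n0)" using n0 by simp
      finally show ?thesis using n by simp
    qed
    then show ?thesis by blast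
  qed
  then obtain y where y: "\<And>n c. (frag_cmul n x, c) \<in> R \<Longrightarrow> c = of_int n * y" by blast
  define R' where "R' = {(v + frag_cmul k x, c + of_int k * y) | v c k. (v, c) \<in> R}"
  have R'I: "(v + frag_cmul k x, c + of_int k * y) \<in> R'" if "(v, c) \<in> R" for v c k
    unfolding R'_def by (rule CollectI, intro exI conjI, rule refl, rule that)
  have R'E: "\<exists>v c k. (v, c) \<in> R \<and> u = v + frag_cmul k x \<and> a = c + of_int k * y" if "(u, a) \<in> R'" for u a
    using that unfolding R'_def by simp metis
  have z: "(0, 0) \<in> R" using R by (simp add: additive_graph_def)
  have "additive_graph R'"
    unfolding additive_graph_def
  proof (intro conjI allI impI)
    show "(0, 0) \<in> R'" using R'I[OF z, of 0] by simp
  next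
    fix u a v b assume "(u, a) \<in> R'" "(v, b) \<in> R'"
    then obtain u' a' k v' b' l where *: "(u', a') \<in> R" "u = u' + frag_cmul k x" "a = a' + of_int k * y"
      "(v', b') \<in> R" "v = v' + frag_cmul l x" "b = b' + of_int l * y" using R'E by metis
    have "u - v = (u' - v') + frag_cmul (k - l) x" "a - b = (a' - b') + of_int (k - l) * y"
      unfolding * by (simp_all add: frag_cmul_diff_distrib algebra_simps)
    then show "(u - v, a - b) \<in> R'" using R'I[OF additive_graph_diff[OF R *(1,4)], of "k - l"] by simp
  next
    fix c assume "(0, c) \<in> R'"
    then obtain v c' k where *: "(v, c') \<in> R" "0 = v + frag_cmul k x" "c = c' + of_int k * y"
      using R'E by metis
    have "frag_cmul (- k) x + frag_cmul k x = 0" by (simp add: frag_cmul_distrib[symmetric])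
    then have "v = frag_cmul (- k) x" using *(2) by (metis add_right_cancel)
    then show "c = 0" using y[of "- k" c'] * by simp
  qed
  moreover have "R \<subseteq> R'" using R'I[of _ _ 0] by auto
  moreover have "(x, y) \<in> R'" using R'I[OF z, of 1] by simp
  ultimately show ?thesis by blast
qed

text \<open>Injectivity of the additive group of complex numbers, by Zorn's lemma on graphs
  containing that of \<open>f\<close>. It serves to extend a functional from boundaries to all
  chains.\<close>

lemma additive_extension:
  fixes f :: "('a \<Rightarrow>\<^sub>0 int) \<Rightarrow> complex"
  assumes B: "0 \<in> B" "\<And>u v. u \<in> B \<Longrightarrow> v \<in> B \<Longrightarrow> u - v \<in> B"
    and f: "\<And>u v. u \<in> B \<Longrightarrow> v \<in> B \<Longrightarrow> f (u - v) = f u - f v"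
  obtains F where "\<And>u v. F (u + v) = F u + F v" "\<And>u. u \<in> B \<Longrightarrow> F u = f u"
proof -
  let ?G = "(\<lambda>u. (u, f u)) ` B"
  have f0: "f 0 = 0" using f[OF B(1) B(1)] by simp
  have G: "additive_graph ?G"
    unfolding additive_graph_def using B f f0 by (auto simp: image_iff)
  let ?A = "{R. additive_graph R \<and> ?G \<subseteq> R}"
  have "\<exists>M\<in>?A. \<forall>X\<in>?A. M \<subseteq> X \<longrightarrow> X = M"
  proof (rule subset_Zorn_nonempty)
    show "?A \<noteq> {}" using G by blast
    fix C assume C: "C \<noteq> {}" "subset.chain ?A C"
    have CA: "additive_graph R" "?G \<subseteq> R" if "R \<in> C" for R
      using C(2) that unfolding subset_chain_def by auto
    have tot: "R \<subseteq> R' \<or> R' \<subseteq> R" if "R \<in> C" "R' \<in> C" for R R'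
      using C(2) that unfolding subset_chain_def by blast
    have "additive_graph (\<Union>C)"
      unfolding additive_graph_def
    proof (intro conjI allI impI)
      show "(0, 0) \<in> \<Union>C" using C(1) CA(1) unfolding additive_graph_def by blast
    next
      fix u a v b assume "(u, a) \<in> \<Union>C" "(v, b) \<in> \<Union>C"
      then obtain R R' where R: "R \<in> C" "(u, a) \<in> R" "R' \<in> C" "(v, b) \<in> R'" by blast
      then obtain R'' where R'': "R'' \<in> C" "(u, a) \<in> R''" "(v, b) \<in> R''" using tot[OF R(1,3)] by blast
      then show "(u - v, a - b) \<in> \<Union>C" using additive_graph_diff[OF CA(1)[OF R''(1)] R''(2,3)] by blast
    next
      fix c assume "(0, c) \<in> \<Union>C"
      then obtain R where "R \<in> C" "(0, c) \<in> R" by blast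
      then show "c = 0" using CA(1)[of R] unfolding additive_graph_def by simp
    qed
    then show "\<Union>C \<in> ?A" using C(1) CA(2) by blast
  qed
  then obtain M where MA: "M \<in> ?A" and Mmax: "\<forall>X\<in>?A. M \<subseteq> X \<longrightarrow> X = M" by (rule bexE)
  have M: "additive_graph M" "?G \<subseteq> M" using MA by simp_all
  have max: "X = M" if "additive_graph X" "M \<subseteq> X" for X
    using bspec[OF Mmax, of X] that M(2) by simp
  have "\<exists>c. (x, c) \<in> M" for x
  proof -
    obtain X y where X: "additive_graph X" "M \<subseteq> X" "(x, y) \<in> X"
      using additive_graph_extend[OF M(1), of x] by blast
    then show ?thesis using max[OF X(1,2)] by blast
  qed
  then obtain F where F: "\<And>x. (x, F x) \<in> M" by metis
  show ?thesis
  proof (rule that[of F])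
    show "F (u + v) = F u + F v" for u v
      by (rule additive_graph_unique[OF M(1) F additive_graph_add[OF M(1) F F]])
    show "F u = f u" if "u \<in> B" for u
      by (rule additive_graph_unique[OF M(1) F]) (use M(2) that in blast)
  qed
qed

section \<open>Sublattices in diagonal position\<close>

definition Zn :: "nat \<Rightarrow> (nat \<Rightarrow> int) set"
  where "Zn n = {x. \<forall>i\<ge>n. x i = 0}"

definition sublattice :: "nat \<Rightarrow> (nat \<Rightarrow> int) set \<Rightarrow> bool"
  where "sublattice n L \<longleftrightarrow> L \<subseteq> Zn n \<and> (\<lambda>i. 0) \<in> L \<and> (\<forall>x\<in>L. \<forall>y\<in>L. (\<lambda>i. x i - y i) \<in> L)"

definition lattice_aut :: "nat \<Rightarrow> ((nat \<Rightarrow> int) \<Rightarrow> nat \<Rightarrow> int) \<Rightarrow> bool"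
  where "lattice_aut n T \<longleftrightarrow> bij_betw T (Zn n) (Zn n) \<and>
    (\<forall>x\<in>Zn n. \<forall>y\<in>Zn n. T (\<lambda>i. x i - y i) = (\<lambda>i. T x i - T y i))"

lemma lattice_aut_compose: "lattice_aut n T \<Longrightarrow> lattice_aut n U \<Longrightarrow> lattice_aut n (U \<circ> T)"
  unfolding lattice_aut_def using bij_betwE[of T "Zn n" "Zn n"] by (auto intro: bij_betw_trans)

lemma lattice_autI:
  assumes "\<And>x. x \<in> Zn n \<Longrightarrow> T x \<in> Zn n \<and> U x \<in> Zn n \<and> U (T x) = x \<and> T (U x) = x"
    and "\<And>x y. T (\<lambda>i. x i - y i) = (\<lambda>i. T x i - T y i)"
  shows "lattice_aut n T"
  unfolding lattice_aut_def using assms by (auto intro!: bij_betw_byWitness[of _ U])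

lemma sublattice_diff: "sublattice n L \<Longrightarrow> x \<in> L \<Longrightarrow> y \<in> L \<Longrightarrow> (\<lambda>i. x i - y i) \<in> L"
  by (simp add: sublattice_def)

lemma sublattice_mult:
  assumes L: "sublattice n L" "x \<in> L" shows "(\<lambda>i. k * x i) \<in> L"
proof -
  have z: "(\<lambda>i. 0) \<in> L" and d: "\<And>x y. x \<in> L \<Longrightarrow> y \<in> L \<Longrightarrow> (\<lambda>i. x i - y i) \<in> L"
    using L by (auto simp: sublattice_def)
  have m: "(\<lambda>i. - x i) \<in> L" if "x \<in> L" for x using d[OF z that] by simp
  have nat: "(\<lambda>i. int n * x i) \<in> L" for n
  proof (induction n)
    case (Suc n)
    then show ?case using d[OF Suc m[OF L(2)]] by (simp add: algebra_simps)
  qed (use z in simp)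
  show ?thesis
  proof (cases "k \<ge> 0")
    case True
    then show ?thesis using nat[of "nat k"] by simp
  next
    case False
    then show ?thesis using m[OF nat[of "nat (- k)"]] by simp
  qed
qed

lemma sublattice_image:
  assumes L: "sublattice n L" and T: "lattice_aut n T" shows "sublattice n (T ` L)"
proof -
  have LZ: "L \<subseteq> Zn n" and z: "(\<lambda>i. 0) \<in> L" using L by (auto simp: sublattice_def)
  have Td: "T (\<lambda>i. x i - y i) = (\<lambda>i. T x i - T y i)" if "x \<in> L" "y \<in> L" for x y
    using T LZ that unfolding lattice_aut_def by blast
  have "T (\<lambda>i. 0) = (\<lambda>i. 0)" using Td[OF z z] by simp
  then have "(\<lambda>i. 0) \<in> T ` L" using z by (metis image_eqI)
  moreover have "T ` L \<subseteq> Zn n" using T LZ unfolding lattice_aut_def bij_betw_def by blast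
  moreover have "(\<lambda>i. x i - y i) \<in> T ` L" if x: "x \<in> T ` L" and y: "y \<in> T ` L" for x y
  proof -
    obtain x' y' where xy: "x' \<in> L" "x = T x'" "y' \<in> L" "y = T y'" using x y by blast
    have xy': "(\<lambda>i. x' i - y' i) \<in> L" using L xy by (simp add: sublattice_def)
    have e: "(\<lambda>i. x i - y i) = T (\<lambda>i. x' i - y' i)" using Td[OF xy(1,3)] xy by simp
    show ?thesis by (subst e) (rule imageI[OF xy'])
  qed
  ultimately show ?thesis by (simp add: sublattice_def)
qed

lemma lattice_aut_transpose:
  assumes "i < n" "j < n" shows "lattice_aut n (\<lambda>x. x \<circ> Transposition.transpose i j)"
  by (rule lattice_autI[of _ _ "\<lambda>x. x \<circ> Transposition.transpose i j"])
     (use assms in \<open>auto simp: Zn_def Transposition.transpose_def comp_assoc\<close>)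

lemma not_singleton_obtain: "L \<noteq> {z} \<Longrightarrow> z \<in> L \<Longrightarrow> \<exists>x\<in>L. x \<noteq> z"
  by blast

text \<open>Smith normal form without divisibility of successive entries.  The last coordinate is split
  off, having been made as small as possible by the choice of the automorphism; \<open>D i = 0\<close>
  encodes a coordinate in which the lattice vanishes.\<close>

lemma sublattice_diagonal:
  "sublattice n L \<Longrightarrow> \<exists>T D. lattice_aut n T \<and> T ` L = {x \<in> Zn n. \<forall>i<n. (D i :: int) dvd x i}"
proof (induction n arbitrary: L)
  case 0
  have "Zn 0 = {\<lambda>i. 0}" by (auto simp: Zn_def)
  then have "L = {\<lambda>i. 0}" "lattice_aut 0 (\<lambda>x. x)" using 0 by (auto simp: sublattice_def lattice_aut_def bij_betw_def)
  then show ?case using \<open>Zn 0 = _\<close> by (intro exI[of _ "\<lambda>x. x"]) auto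
next
  case (Suc n)
  show ?case
  proof (cases "L = {\<lambda>i. 0}")
    case True
    have "lattice_aut (Suc n) (\<lambda>x. x)" by (auto simp: lattice_aut_def bij_betw_def)
    moreover have "x i = 0" if "x \<in> Zn (Suc n)" "\<forall>i<Suc n. x i = 0" for x i
      using that by (cases "i < Suc n") (auto simp: Zn_def)
    then have "L = {x \<in> Zn (Suc n). \<forall>i<Suc n. 0 dvd x i}"
      unfolding True by (auto simp: fun_eq_iff) (simp add: Zn_def)
    ultimately show ?thesis by (intro exI[of _ "\<lambda>x. x"] exI[of _ "\<lambda>_. 0"]) simp
  next
    case False
    \<comment> \<open>The positive absolute values that occur as last coordinates of lattice vectors
      after some automorphism. The least of them becomes the diagonal entry split off.\<close>
    define P where "P d \<longleftrightarrow> d > 0 \<and> (\<exists>T x. lattice_aut (Suc n) T \<and> x \<in> T ` L \<and> nat \<bar>x n\<bar> = d)" for d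
    \<comment> \<open>A transposition makes any nonzero coordinate the last one, so minimality of
      \<open>d\<close> bounds all coordinates from below and not only the last.\<close>
    have Psmall: "\<exists>d. P d \<and> int d = \<bar>x i\<bar>" if T: "lattice_aut (Suc n) T" and x: "x \<in> T ` L" and i: "i < Suc n" "x i \<noteq> 0" for T x i
    proof -
      let ?s = "\<lambda>x. x \<circ> Transposition.transpose i n"
      have "lattice_aut (Suc n) (?s \<circ> T)" using lattice_aut_compose[OF T lattice_aut_transpose] i by simp
      moreover have "?s x \<in> (?s \<circ> T) ` L" using x by auto
      moreover have "?s x n = x i" by simp
      ultimately have "P (nat \<bar>x i\<bar>)" unfolding P_def using i(2) by fastforce
      then show ?thesis by (intro exI[of _ "nat \<bar>x i\<bar>"]) simp
    qed
    have "\<exists>d. P d"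
    proof -
      have "(\<lambda>i. 0) \<in> L" using Suc.prems by (simp add: sublattice_def)
      have "\<exists>x\<in>L. x \<noteq> (\<lambda>i. 0)"
        by (rule not_singleton_obtain[OF False \<open>(\<lambda>i. 0) \<in> L\<close>])
      then obtain x where xL: "x \<in> L" "x \<noteq> (\<lambda>i. 0)" by (rule bexE)
      from xL(2) obtain i where "x i \<noteq> 0" by (auto simp: fun_eq_iff)
      with xL(1) have x: "x \<in> L" "x i \<noteq> 0" .
      then have "i < Suc n" using Suc.prems by (auto simp: sublattice_def Zn_def not_less[symmetric])
      then show ?thesis using Psmall[of "\<lambda>x. x" x i] x by (auto simp: lattice_aut_def bij_betw_def)
    qed
    define d where "d = (LEAST d. P d)"
    have Pd: "P d" and dmin: "\<And>d'. P d' \<Longrightarrow> d \<le> d'"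
      using \<open>\<exists>d. P d\<close> unfolding d_def by (auto intro: LeastI_ex Least_le)
    obtain T y where T: "lattice_aut (Suc n) T" and y: "y \<in> T ` L" "nat \<bar>y n\<bar> = d" and d0: "d > 0"
      using Pd unfolding P_def by blast
    have yn: "y n \<noteq> 0" "\<bar>y n\<bar> = int d" using y d0 by auto
    \<comment> \<open>Subtracts multiples of the last coordinate so that every other coordinate of
      \<open>y\<close> becomes its remainder modulo \<open>y n\<close>; by minimality these
      remainders vanish.\<close>
    define U where "U = (\<lambda>x j. if j < n then x j - (y j div y n) * x n else x j)"
    have U: "lattice_aut (Suc n) U"
      by (rule lattice_autI[of _ _ "\<lambda>x j. if j < n then x j + (y j div y n) * x n else x j"])
         (auto simp: U_def Zn_def fun_eq_iff algebra_simps)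
    have UT: "lattice_aut (Suc n) (U \<circ> T)" by (rule lattice_aut_compose[OF T U])
    let ?L = "(U \<circ> T) ` L"
    have L2: "sublattice (Suc n) ?L" by (rule sublattice_image[OF Suc.prems UT])
    have Uy: "U y \<in> ?L" using y by auto
    have Uy0: "U y j = 0" if j: "j < n" for j
    proof (rule ccontr)
      assume ne: "U y j \<noteq> 0"
      have "U y j = y j mod y n" using j by (simp add: U_def minus_div_mult_eq_mod)
      then have "\<bar>U y j\<bar> < int d" using abs_mod_less[OF yn(1), of "y j"] yn by simp
      moreover obtain d' where "P d'" "int d' = \<bar>U y j\<bar>" using Psmall[OF UT Uy _ ne] j by auto
      ultimately show False using dmin by fastforce
    qed
    have Uyn: "U y n = y n" by (simp add: U_def)
    \<comment> \<open>The remainder of \<open>z n\<close> modulo \<open>y n\<close> is again the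
      last coordinate of a lattice vector, so minimality makes it zero.\<close>
    have dvd: "y n dvd z n" if z: "z \<in> ?L" for z
    proof (rule ccontr)
      assume "\<not> y n dvd z n"
      then have ne: "z n mod y n \<noteq> 0" by auto
      let ?w = "\<lambda>i. z i - (z n div y n) * U y i"
      have w: "?w \<in> ?L" by (rule sublattice_diff[OF L2 z sublattice_mult[OF L2 Uy]])
      have wn: "?w n = z n mod y n" by (simp add: Uyn minus_div_mult_eq_mod)
      then obtain d' where "P d'" "int d' = \<bar>z n mod y n\<bar>" using Psmall[OF UT w, of n] ne by auto
      moreover have "\<bar>z n mod y n\<bar> < int d" using abs_mod_less[OF yn(1), of "z n"] yn by simp
      ultimately show False using dmin by fastforce
    qed
    \<comment> \<open>\<open>U y\<close> is \<open>y n\<close> times the last unit vector, so the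
      lattice splits into the slice \<open>L'\<close> with last coordinate zero and the multiples of
      \<open>U y\<close>.\<close>
    define L' where "L' = ?L \<inter> Zn n"
    have "sublattice n L'" using L2 by (auto simp: sublattice_def L'_def Zn_def)
    from Suc.IH[OF this] obtain V D where V: "lattice_aut n V" and VL: "V ` L' = {x \<in> Zn n. \<forall>i<n. D i dvd x i}" by blast
    have cut: "x(n := 0) \<in> Zn n" if "x \<in> Zn (Suc n)" for x using that by (auto simp: Zn_def)
    have Vbij: "bij_betw V (Zn n) (Zn n)" using V by (simp add: lattice_aut_def)
    have VZ: "V x \<in> Zn n" if "x \<in> Zn n" for x using bij_betwE[OF Vbij] that by simp
    define W where "W = (\<lambda>x. (V (x(n := 0)))(n := x n))"
    define W' where "W' = (\<lambda>x. (inv_into (Zn n) V (x(n := 0)))(n := x n))"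
    have V'Z: "inv_into (Zn n) V x \<in> Zn n" "V (inv_into (Zn n) V x) = x" if "x \<in> Zn n" for x
      using that Vbij by (auto simp: bij_betw_def inv_into_into f_inv_into_f)
    have V'V: "inv_into (Zn n) V (V x) = x" if "x \<in> Zn n" for x
      using that Vbij by (simp add: bij_betw_def)
    have up: "x(n := a) \<in> Zn (Suc n)" "(x(n := a))(n := 0) = x" if "x \<in> Zn n" for x a
      using that by (auto simp: Zn_def fun_eq_iff)
    have up0: "x(n := 0) = x" if "x \<in> Zn n" for x using that by (auto simp: Zn_def fun_eq_iff)
    have W: "lattice_aut (Suc n) W"
      unfolding lattice_aut_def
    proof (intro conjI ballI)
      show "bij_betw W (Zn (Suc n)) (Zn (Suc n))"
        by (rule bij_betw_byWitness[of _ W'])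
           (auto simp: W_def W'_def up VZ V'Z V'V cut up0)
      fix x y assume xy: "x \<in> Zn (Suc n)" "y \<in> Zn (Suc n)"
      have "V (\<lambda>i. (x(n := 0)) i - (y(n := 0)) i) = (\<lambda>i. V (x(n := 0)) i - V (y(n := 0)) i)"
        using V[unfolded lattice_aut_def, THEN conjunct2, THEN bspec, OF cut[OF xy(1)], THEN bspec, OF cut[OF xy(2)]] .
      moreover have "(\<lambda>i. (x(n := 0)) i - (y(n := 0)) i) = (\<lambda>i. x i - y i)(n := 0)" by auto
      ultimately show "W (\<lambda>i. x i - y i) = (\<lambda>i. W x i - W y i)" by (auto simp: W_def)
    qed
    have L2iff: "x \<in> ?L \<longleftrightarrow> x(n := 0) \<in> L' \<and> y n dvd x n" if x: "x \<in> Zn (Suc n)" for x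
    proof -
      have Uyx: "(\<lambda>i. x i - (x n div y n) * U y i) = x(n := 0)" if "y n dvd x n"
      proof
        fix i
        consider "i < n" | "i = n" | "i > n" by linarith
        then show "x i - (x n div y n) * U y i = (x(n := 0)) i"
        proof cases
          case 3
          have "U y \<in> Zn (Suc n)" using L2 Uy by (auto simp: sublattice_def)
          then have "U y i = 0" using 3 by (simp add: Zn_def)
          then show ?thesis using 3 by simp
        qed (use that in \<open>simp_all add: Uy0 Uyn\<close>)
      qed
      have Uyx': "(\<lambda>i. (x(n := 0)) i - (- (x n div y n)) * U y i) = x" if d: "y n dvd x n"
      proof
        fix i
        show "(x(n := 0)) i - (- (x n div y n)) * U y i = x i"
          using fun_cong[OF Uyx[OF d], of i] by (simp add: algebra_simps)
      qed
      show ?thesis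
      proof
        assume X: "x \<in> ?L"
        have "x(n := 0) \<in> ?L"
          using sublattice_diff[OF L2 X sublattice_mult[OF L2 Uy, of "x n div y n"]] unfolding Uyx[OF dvd[OF X]] .
        then show "x(n := 0) \<in> L' \<and> y n dvd x n" using dvd[OF X] cut[OF x] by (simp add: L'_def)
      next
        assume X: "x(n := 0) \<in> L' \<and> y n dvd x n"
        then have 0: "x(n := 0) \<in> ?L" and d: "y n dvd x n" by (simp_all add: L'_def)
        show "x \<in> ?L"
          using sublattice_diff[OF L2 0 sublattice_mult[OF L2 Uy, of "- (x n div y n)"]] unfolding Uyx'[OF d] .
      qed
    qed
    have WL: "W ` ?L = {x \<in> Zn (Suc n). \<forall>i<Suc n. (D(n := y n)) i dvd x i}"
    proof (intro equalityI subsetI)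
      fix x assume "x \<in> W ` ?L"
      then obtain z where z: "z \<in> ?L" "x = W z" by blast
      have zZ: "z \<in> Zn (Suc n)" using L2 z by (auto simp: sublattice_def)
      have "V (z(n := 0)) \<in> V ` L'" "y n dvd z n" using L2iff[OF zZ] z by auto
      then have "V (z(n := 0)) \<in> Zn n" "\<forall>i<n. D i dvd V (z(n := 0)) i" unfolding VL by auto
      then show "x \<in> {x \<in> Zn (Suc n). \<forall>i<Suc n. (D(n := y n)) i dvd x i}"
        using \<open>y n dvd z n\<close> up(1) by (auto simp: z(2) W_def less_Suc_eq)
    next
      fix x assume x: "x \<in> {x \<in> Zn (Suc n). \<forall>i<Suc n. (D(n := y n)) i dvd x i}"
      then have "x(n := 0) \<in> V ` L'" unfolding VL using cut by (auto simp: less_Suc_eq)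
      then obtain z where z: "z \<in> L'" "x(n := 0) = V z" by blast
      have zZ: "z \<in> Zn n" using z by (simp add: L'_def)
      have zL: "z(n := x n) \<in> ?L" using L2iff[OF up(1)[OF zZ]] up(2)[OF zZ] z x by auto
      have Wz: "x = W (z(n := x n))" using up(2)[OF zZ] z(2)[symmetric] by (simp add: W_def)
      show "x \<in> W ` ?L" by (subst Wz) (rule imageI[OF zL])
    qed
    show ?thesis
      using lattice_aut_compose[OF UT W] WL unfolding image_comp by blast
  qed
qed

section \<open>Fixed points on a finite abelian group and on its dual\<close>

text \<open>Multiplication by the primitive root \<open>w\<close> permutes the roots and multiplies
  the sum by \<open>w powi y\<close>, which differs from 1 unless \<open>d\<close> divides
  \<open>y\<close>.\<close>

lemma sum_roots_of_unity_power:
  assumes d: "d > 0"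
  shows "(\<Sum>z\<in>{z::complex. z ^ d = 1}. z powi y) = (if int d dvd y then of_nat d else 0)"
proof (cases "int d dvd y")
  case True
  then obtain m where m: "y = int d * m" by blast
  have "z powi y = 1" if "z ^ d = 1" for z :: complex
    unfolding m power_int_mult by (simp add: that)
  then show ?thesis using True d by (simp add: card_roots_unity_eq)
next
  case False
  define w where "w = cis (2 * pi / of_nat d)"
  let ?S = "\<Sum>z\<in>{z::complex. z ^ d = 1}. z powi y"
  have "w ^ d = cis (real d * (2 * pi / of_nat d))" unfolding w_def Complex.DeMoivre ..
  also have "real d * (2 * pi / of_nat d) = 2 * pi" using d by simp
  finally have wd: "w ^ d = 1" by simp
  have w0: "w \<noteq> 0" by (simp add: w_def)
  have bij: "bij_betw (\<lambda>z. w * z) {z. z ^ d = 1} {z. z ^ d = 1}"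
    by (rule bij_betw_byWitness[of _ "\<lambda>z. z / w"])
       (use wd w0 in \<open>auto simp: power_mult_distrib power_divide\<close>)
  have S1: "(\<Sum>z\<in>{z. z ^ d = 1}. (w * z) powi y) = ?S"
    by (rule sum.reindex_bij_betw[OF bij])
  have S2: "(\<Sum>z\<in>{z. z ^ d = 1}. (w * z) powi y) = w powi y * ?S"
    by (simp add: power_int_mult_distrib sum_distrib_left)
  have "(1 - w powi y) * ?S = ?S - w powi y * ?S" by (simp add: algebra_simps)
  also have "\<dots> = 0" unfolding S2[symmetric] S1 by (rule diff_self)
  finally have "(1 - w powi y) * ?S = 0" .
  moreover have "w powi y \<noteq> 1"
  proof
    assume "w powi y = 1"
    then have "cis (of_int y * (2 * pi / of_nat d)) = 1" by (simp add: cis_power_int w_def)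
    then have "cos (of_int y * (2 * pi / of_nat d)) = 1" by (simp add: complex_eq_iff)
    then obtain k :: int where "of_int y * (2 * pi / of_nat d) = of_int k * 2 * pi"
      using cos_one_2pi_int by blast
    then have "real_of_int y = of_int (k * int d)" using d by (simp add: field_simps)
    then have "y = k * int d" by linarith
    then show False using False by simp
  qed
  ultimately show ?thesis using False by simp
qed

lemma sum_powers_root_of_unity:
  assumes "z ^ d = 1"
  shows "(\<Sum>x\<in>{0..<int d}. z powi x) = (if z = (1::complex) then of_nat d else 0)"
proof -
  have "(\<Sum>x\<in>{0..<int d}. z powi x) = (\<Sum>x\<in>int ` {0..<d}. z powi x)"
    by (simp add: image_int_atLeastLessThan)
  also have "\<dots> = (\<Sum>x<d. z ^ x)" by (simp add: sum.reindex atLeast0LessThan)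
  finally show ?thesis using assms by (simp add: sum_gp_strict)
qed

lemma power_int_sum: "(c::complex) \<noteq> 0 \<Longrightarrow> c powi (sum f I) = (\<Prod>i\<in>I. c powi f i)"
  by (induction I rule: infinite_finite_induct) (auto simp: power_int_add)

lemma prod_power_int: "(\<Prod>i\<in>I. f i :: complex) powi n = (\<Prod>i\<in>I. f i powi n)"
  by (induction I rule: infinite_finite_induct) (auto simp: power_int_mult_distrib)

lemma finite_roots_of_unity: "d > 0 \<Longrightarrow> finite {z::complex. z ^ d = 1}"
  using finite_roots_unity[of d] by simp

context
  fixes r :: nat and d :: "nat \<Rightarrow> nat" and A :: "nat \<Rightarrow> nat \<Rightarrow> int"
begin

text \<open>Characters of the product of cyclic groups of orders \<open>d i\<close>, recorded by
  their values on the generators; the elements of the group itself appear as residues in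
  \<open>box\<close>.\<close>

definition dual_group :: "(nat \<Rightarrow> complex) set"
  where "dual_group = (\<Pi>\<^sub>E i\<in>{..<r}. {z. z ^ d i = 1})"

text \<open>Composition of a character with the endomorphism of matrix \<open>A\<close>: the
  transpose of \<open>A\<close> acting in the exponents.\<close>

definition dual_map :: "(nat \<Rightarrow> complex) \<Rightarrow> nat \<Rightarrow> complex"
  where "dual_map c = (\<lambda>i\<in>{..<r}. \<Prod>j<r. c j powi A j i)"

abbreviation (input) pairing :: "(nat \<Rightarrow> complex) \<Rightarrow> (nat \<Rightarrow> int) \<Rightarrow> complex"
  where "pairing c x \<equiv> (\<Prod>i<r. c i powi x i)"

abbreviation (input) box :: "(nat \<Rightarrow> int) set"
  where "box \<equiv> (\<Pi>\<^sub>E i\<in>{..<r}. {0..<int (d i)})"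

context
  assumes d: "\<And>i. i < r \<Longrightarrow> d i > 0"
begin

lemma finite_dual_group: "finite dual_group"
  unfolding dual_group_def using d by (intro finite_PiE finite_roots_of_unity) auto

lemma card_dual_group: "card dual_group = (\<Prod>i<r. d i)"
  unfolding dual_group_def using d by (simp add: card_PiE card_roots_unity_eq)

text \<open>The divisibility says that \<open>A\<close> maps the lattice of all \<open>x\<close>
  with \<open>d i\<close> dividing \<open>x i\<close> into itself, so that it induces an
  endomorphism of the product of cyclic groups.\<close>

context
  assumes A: "\<And>i j. i < r \<Longrightarrow> j < r \<Longrightarrow> int (d i) dvd A i j * int (d j)"
begin

lemma dual_map_in: "c \<in> dual_group \<Longrightarrow> dual_map c \<in> dual_group"
proof -
  assume c: "c \<in> dual_group"
  have "(c j powi A j i) ^ d i = 1" if i: "i < r" and j: "j < r" for i j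
  proof -
    have cj: "c j ^ d j = 1" using c i j by (auto simp: dual_group_def)
    obtain m where m: "A j i * int (d i) = int (d j) * m" using A[OF j i] by blast
    have "(c j powi A j i) ^ d i = c j powi (A j i * int (d i))" by (simp add: power_int_mult)
    also have "\<dots> = 1" unfolding m power_int_mult by (simp add: cj)
    finally show ?thesis .
  qed
  then show "dual_map c \<in> dual_group"
    by (auto simp: dual_group_def dual_map_def prod_power_distrib intro!: prod.neutral)
qed

text \<open>The value of a character \<open>c\<close> at \<open>A x - x\<close> is the value of
  \<open>dual_map c / c\<close> at \<open>x\<close>. Summed over all \<open>c\<close> and
  \<open>x\<close>, orthogonality over \<open>c\<close> counts fixed elements and orthogonality over
  \<open>x\<close> counts fixed characters, with the group order as common factor.\<close>

lemma card_fixed_dual: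
  "card {c \<in> dual_group. dual_map c = c} =
   card {x \<in> box. \<forall>i<r. int (d i) dvd (\<Sum>j<r. A i j * x j) - x i}"
proof -
  let ?D = dual_group and ?N = "\<Prod>i<r. d i"
  let ?y = "\<lambda>x i. (\<Sum>j<r. A i j * x j) - x i"
  have nz: "c i \<noteq> 0" if "c \<in> ?D" "i < r" for c i
  proof
    assume "c i = 0"
    moreover have "c i ^ d i = 1" using that by (auto simp: dual_group_def PiE_iff)
    ultimately show False using d[OF that(2)] by (simp add: zero_power)
  qed
  have finB: "finite box" by (intro finite_PiE) auto
  have pair: "pairing c (?y x) = pairing (\<lambda>i. dual_map c i / c i) x" if c: "c \<in> ?D" for c x
  proof -
    have "(\<Prod>i<r. c i powi (\<Sum>j<r. A i j * x j)) = (\<Prod>i<r. \<Prod>j<r. c i powi (A i j * x j))"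
      using nz[OF c] by (intro prod.cong refl) (simp add: power_int_sum)
    also have "\<dots> = (\<Prod>j<r. \<Prod>i<r. c i powi (A i j * x j))" by (rule prod.swap)
    also have "\<dots> = (\<Prod>j<r. dual_map c j powi x j)"
      by (intro prod.cong refl) (simp add: dual_map_def power_int_mult prod_power_int)
    finally show ?thesis
      using nz[OF c] by (simp add: power_int_diff prod_dividef power_int_divide_distrib)
  qed
  have sumD: "(\<Sum>c\<in>?D. pairing c y) = (if \<forall>i<r. int (d i) dvd y i then of_nat ?N else 0)" for y
  proof -
    have "(\<Sum>c\<in>?D. pairing c y) = (\<Prod>i<r. \<Sum>z\<in>{z. z ^ d i = 1}. z powi y i)"
      unfolding dual_group_def using d by (intro prod_sum_PiE[symmetric] finite_roots_of_unity) auto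
    also have "\<dots> = (\<Prod>i<r. if int (d i) dvd y i then of_nat (d i) else 0)"
      using d by (intro prod.cong refl sum_roots_of_unity_power) auto
    also have "\<dots> = (if \<forall>i<r. int (d i) dvd y i then of_nat ?N else 0)"
      by (auto simp: prod_zero_iff)
    finally show ?thesis .
  qed
  have sumB: "(\<Sum>x\<in>box. pairing (\<lambda>i. dual_map c i / c i) x) = (if dual_map c = c then of_nat ?N else 0)"
    if c: "c \<in> ?D" for c
  proof -
    have "(dual_map c i / c i) ^ d i = 1" if "i < r" for i
      using c dual_map_in[OF c] that by (auto simp: dual_group_def power_divide PiE_iff)
    then have "(\<Sum>x\<in>box. pairing (\<lambda>i. dual_map c i / c i) x) = (\<Prod>i<r. if dual_map c i / c i = 1 then of_nat (d i) else 0)"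
      by (subst prod_sum_PiE[symmetric]) (auto intro!: prod.cong simp: sum_powers_root_of_unity)
    also have "\<dots> = (if \<forall>i<r. dual_map c i = c i then of_nat ?N else 0)"
      using nz[OF c] by (auto simp: prod_zero_iff)
    also have "(\<forall>i<r. dual_map c i = c i) \<longleftrightarrow> dual_map c = c"
      using PiE_ext[of "dual_map c" "{..<r}" _ c] c dual_map_in[OF c] unfolding dual_group_def by fastforce
    finally show ?thesis .
  qed
  have "of_nat ?N * of_nat (card {c \<in> ?D. dual_map c = c}) = (\<Sum>c\<in>?D. if dual_map c = c then of_nat ?N else (0::complex))"
    using finite_dual_group by (simp add: sum.If_cases Int_def)
  also have "\<dots> = (\<Sum>c\<in>?D. \<Sum>x\<in>box. pairing c (?y x))"
    by (intro sum.cong refl) (simp add: sumB pair)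
  also have "\<dots> = (\<Sum>x\<in>box. \<Sum>c\<in>?D. pairing c (?y x))" by (rule sum.swap)
  also have "\<dots> = (\<Sum>x\<in>box. if \<forall>i<r. int (d i) dvd ?y x i then of_nat ?N else 0)"
    by (intro sum.cong refl) (rule sumD)
  also have "\<dots> = of_nat ?N * of_nat (card {x \<in> box. \<forall>i<r. int (d i) dvd ?y x i})"
    using finB by (simp add: sum.If_cases Int_def)
  finally have eq: "(of_nat ?N :: complex) * of_nat (card {c \<in> ?D. dual_map c = c}) =
     of_nat ?N * of_nat (card {x \<in> box. \<forall>i<r. int (d i) dvd ?y x i})" .
  have "?N \<noteq> 0" using d by (simp add: prod_zero_iff)
  then have N: "(of_nat ?N :: complex) \<noteq> 0" by (simp only: of_nat_eq_0_iff not_False_eq_True)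
  show ?thesis using eq unfolding mult_left_cancel[OF N] of_nat_eq_iff .
qed

end

end

end


section \<open>Generators of homology groups\<close>

text \<open>Upper bounds pass to images and add up along extensions; the matching lower bound comes
  later from the pairing of cocycles with cycles.\<close>

definition generated_by_at_most :: "nat \<Rightarrow> ('a, 'm) monoid_scheme \<Rightarrow> bool" where
  "generated_by_at_most b G \<longleftrightarrow>
    (\<exists>B. finite B \<and> card B \<le> b \<and> B \<subseteq> carrier G \<and> generate G B = carrier G)"

lemma generated_by_at_most_trivial:
  assumes "trivial_group G" shows "generated_by_at_most b G"
proof -
  interpret group G using assms by (simp add: trivial_group_def)
  show ?thesis
    unfolding generated_by_at_most_def
    by (rule exI[of _ "{}"])
       (use assms in \<open>auto simp: trivial_group_def generate_empty\<close>)
qed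

text \<open>The generators of \<open>A\<close> are moved along the correspondence \<open>g y = f x\<close>, where
  \<open>g\<close> is injective, to generators of \<open>B\<close>.\<close>

lemma generated_by_at_most_transfer:
  assumes A: "group A" "generated_by_at_most b A" and B: "group B" and C: "group C"
    and f: "f \<in> hom A C" and g: "g \<in> hom B C" and inj: "inj_on g (carrier B)"
    and im: "f ` carrier A = g ` carrier B"
  shows "generated_by_at_most b B"
proof -
  interpret f: group_hom A C f using A C f by (simp add: group_hom_def group_hom_axioms_def)
  interpret g: group_hom B C g using B C g by (simp add: group_hom_def group_hom_axioms_def)
  obtain S where S: "finite S" "card S \<le> b" "S \<subseteq> carrier A" "generate A S = carrier A"
    using A unfolding generated_by_at_most_def by auto
  let ?k = "\<lambda>x. inv_into (carrier B) g (f x)"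
  have k: "?k x \<in> carrier B" "g (?k x) = f x" if "x \<in> carrier A" for x
    using that im inv_into_into[of "f x" g "carrier B"] f_inv_into_f[of "f x" g "carrier B"] by auto
  have sub: "?k ` S \<subseteq> carrier B" using k S by auto
  have "g ` generate B (?k ` S) = generate C (g ` ?k ` S)"
    using g.generate_img[OF sub] by simp
  also have "g ` ?k ` S = f ` S"
    unfolding image_image using k(2) S(3) by (intro image_cong) auto
  also have "generate C (f ` S) = g ` carrier B" using f.generate_img S im by metis
  finally have "generate B (?k ` S) = carrier B"
    using inj g.G.generate_incl[OF sub] by (simp add: inj_on_image_eq_iff)
  then show ?thesis
    unfolding generated_by_at_most_def using S sub
    by (intro exI[of _ "?k ` S"]) (auto intro: card_image_le le_trans)
qed

lemma generated_by_at_most_image: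
  assumes A: "group A" "generated_by_at_most b A" and B: "group B"
    and f: "f \<in> hom A B" and im: "f ` carrier A = carrier B"
  shows "generated_by_at_most b B"
  by (rule generated_by_at_most_transfer[OF A B B f, of id])
     (use im in \<open>auto simp: hom_def\<close>)

lemma generated_by_at_most_iso:
  assumes A: "group A" "generated_by_at_most b A" and B: "group B" and "A \<cong> B"
  shows "generated_by_at_most b B"
proof -
  obtain f where "f \<in> iso A B" using assms by (auto simp: is_iso_def)
  then show ?thesis
    by (intro generated_by_at_most_image[OF A B, of f]) (auto simp: iso_def bij_betw_def)
qed

text \<open>Images of generators of \<open>A\<close> together with lifts of generators of
  \<open>C\<close> generate \<open>B\<close>.\<close>

lemma generated_by_at_most_extension:
  assumes A: "group A" "generated_by_at_most a A" and C: "group C" "generated_by_at_most c C"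
    and B: "group B"
    and f: "f \<in> hom A B" and g: "g \<in> hom B C"
    and onto: "g ` carrier B = carrier C" and ker: "kernel B C g \<subseteq> f ` carrier A"
  shows "generated_by_at_most (a + c) B"
proof -
  interpret f: group_hom A B f using A B f by (simp add: group_hom_def group_hom_axioms_def)
  interpret g: group_hom B C g using B C g by (simp add: group_hom_def group_hom_axioms_def)
  obtain S where S: "finite S" "card S \<le> a" "S \<subseteq> carrier A" "generate A S = carrier A"
    using A unfolding generated_by_at_most_def by auto
  obtain T where T: "finite T" "card T \<le> c" "T \<subseteq> carrier C" "generate C T = carrier C"
    using C unfolding generated_by_at_most_def by auto
  let ?k = "inv_into (carrier B) g"
  let ?G = "f ` S \<union> ?k ` T"
  have k: "?k x \<in> carrier B" "g (?k x) = x" if "x \<in> carrier C" for x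
    using that onto inv_into_into[of x g "carrier B"] f_inv_into_f[of x g "carrier B"] by auto
  have sub: "?G \<subseteq> carrier B" using k T S by auto
  have subk: "?k ` T \<subseteq> carrier B" using sub by auto
  have "g ` ?k ` T = id ` T"
    unfolding image_image using k(2) T(3) by (intro image_cong) auto
  then have gk: "g ` ?k ` T = T" by simp
  have "y \<in> generate B ?G" if y: "y \<in> carrier B" for y
  proof -
    have "g y \<in> generate C (g ` ?k ` T)" using y T gk by simp
    then obtain z where z: "z \<in> generate B (?k ` T)" "g z = g y"
      using g.generate_img[OF subk] by auto
    have zc: "z \<in> carrier B" using z(1) f.H.generate_incl[OF subk] by auto
    have "y \<otimes>\<^bsub>B\<^esub> inv\<^bsub>B\<^esub> z \<in> kernel B C g"
      using y zc z by (auto simp: kernel_def)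
    then obtain x where x: "x \<in> carrier A" "y \<otimes>\<^bsub>B\<^esub> inv\<^bsub>B\<^esub> z = f x" using ker by auto
    then have "f x \<in> generate B (f ` S)"
      using f.generate_img[OF S(3)] S(4) by blast
    then have 1: "f x \<in> generate B ?G" using f.H.mono_generate[of "f ` S" ?G] by auto
    have 2: "z \<in> generate B ?G" using z f.H.mono_generate[of "?k ` T" ?G] by auto
    have "y = f x \<otimes>\<^bsub>B\<^esub> z" using x(2)[symmetric] y zc by (simp add: f.H.m_assoc)
    then show ?thesis using generate.eng[OF 1 2] by simp
  qed
  then have "generate B ?G = carrier B" using f.H.generate_incl[OF sub] by auto
  moreover have "card ?G \<le> a + c"
    using card_Un_le[of "f ` S" "?k ` T"] card_image_le[of S f] card_image_le[of T ?k] S T by linarith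
  ultimately show ?thesis
    unfolding generated_by_at_most_def using S T sub by (intro exI[of _ ?G]) auto
qed

lemma generated_by_at_most_sum:
  assumes A: "group A" "generated_by_at_most a A" and C: "group C" "generated_by_at_most c C"
    and B: "group B"
    and iso: "(\<lambda>(x, y). i x \<otimes>\<^bsub>B\<^esub> j y) \<in> iso (A \<times>\<times> C) B"
    and i: "i \<in> hom A B" and j: "j \<in> hom C B"
  shows "generated_by_at_most (a + c) B"
proof -
  interpret i: group_hom A B i using A B i by (simp add: group_hom_def group_hom_axioms_def)
  interpret j: group_hom C B j using C B j by (simp add: group_hom_def group_hom_axioms_def)
  obtain S where S: "finite S" "card S \<le> a" "S \<subseteq> carrier A" "generate A S = carrier A"
    using A unfolding generated_by_at_most_def by auto
  obtain T where T: "finite T" "card T \<le> c" "T \<subseteq> carrier C" "generate C T = carrier C"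
    using C unfolding generated_by_at_most_def by auto
  let ?G = "i ` S \<union> j ` T"
  have sub: "?G \<subseteq> carrier B" using T S by auto
  have "y \<in> generate B ?G" if y: "y \<in> carrier B" for y
  proof -
    have "y \<in> (\<lambda>(x, y). i x \<otimes>\<^bsub>B\<^esub> j y) ` (carrier A \<times> carrier C)"
      using iso y by (simp add: iso_def bij_betw_def)
    then obtain u v where uv: "u \<in> carrier A" "v \<in> carrier C" "y = i u \<otimes>\<^bsub>B\<^esub> j v" by auto
    have "i u \<in> generate B (i ` S)" using i.generate_img[OF S(3)] S(4) uv by blast
    then have 1: "i u \<in> generate B ?G" using i.H.mono_generate[of "i ` S" ?G] by auto
    have "j v \<in> generate B (j ` T)" using j.generate_img[OF T(3)] T(4) uv by blast
    then have 2: "j v \<in> generate B ?G" using i.H.mono_generate[of "j ` T" ?G] by auto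
    show ?thesis using generate.eng[OF 1 2] uv by simp
  qed
  then have "generate B ?G = carrier B" using i.H.generate_incl[OF sub] by auto
  moreover have "card ?G \<le> a + c"
    using card_Un_le[of "i ` S" "j ` T"] card_image_le[of S i] card_image_le[of T j] S T by linarith
  ultimately show ?thesis
    unfolding generated_by_at_most_def using S T sub by (intro exI[of _ ?G]) auto
qed

section \<open>Homology of products with starlike, punctured and finite subsets of the plane\<close>

lemma homotopic_prod_starlike:
  fixes K :: "complex set"
  assumes p: "p \<in> K" and star: "\<And>z. z \<in> K \<Longrightarrow> closed_segment p z \<subseteq> K"
  shows "homotopic_with (\<lambda>h. True) (prod_topology X (top_of_set K)) (prod_topology X (top_of_set K))
           ((\<lambda>x. (x, p)) \<circ> fst) id"
proof -
  let ?P = "prod_topology X (top_of_set K)"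
  let ?I = "top_of_set {0..1::real}"
  let ?h = "\<lambda>w::real \<times> 'a \<times> complex. (1 - fst w) *\<^sub>R p + fst w *\<^sub>R snd (snd w)"
  have sn: "continuous_map (prod_topology ?I ?P) (top_of_set K) (\<lambda>w. snd (snd w))"
    by (metis (no_types, lifting) continuous_map_compose continuous_map_snd comp_def continuous_map_eq)
  then have c1: "continuous_map (prod_topology ?I ?P) euclidean (\<lambda>w. snd (snd w))"
    using continuous_map_into_fulltopology by blast
  have c0: "continuous_map (prod_topology ?I ?P) euclidean (\<lambda>w. fst w)"
    using continuous_map_into_fulltopology continuous_map_fst by blast
  have "continuous_map (prod_topology euclidean euclidean) euclidean
          (\<lambda>v::real \<times> complex. (1 - fst v) *\<^sub>R p + fst v *\<^sub>R snd v)"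
    by (auto intro!: continuous_intros)
  from continuous_map_compose[OF continuous_map_pairedI[OF c0 c1] this]
  have cont: "continuous_map (prod_topology ?I ?P) euclidean ?h"
    by (simp add: comp_def)
  have mem: "?h w \<in> K" if "w \<in> topspace (prod_topology ?I ?P)" for w
  proof -
    have "?h w \<in> closed_segment p (snd (snd w))"
      using that by (auto simp: closed_segment_def)
    then show ?thesis using star[of "snd (snd w)"] that by auto
  qed
  have K: "continuous_map (prod_topology ?I ?P) (top_of_set K) ?h"
    using cont mem by (auto simp: continuous_map_in_subtopology)
  have F: "continuous_map (prod_topology ?I ?P) X (\<lambda>w. fst (snd w))"
    by (metis (no_types, lifting) continuous_map_compose continuous_map_snd continuous_map_fst comp_def continuous_map_eq)
  show ?thesis
    unfolding homotopic_with_def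
    by (rule exI[of _ "\<lambda>w. (fst (snd w), ?h w)"])
       (use K F in \<open>auto intro: continuous_map_pairedI\<close>)
qed

lemma
  fixes K :: "complex set"
  assumes p: "p \<in> K" and star: "\<And>z. z \<in> K \<Longrightarrow> closed_segment p z \<subseteq> K"
  shows iso_hom_induced_fst_starlike:
      "hom_induced k (prod_topology X (top_of_set K)) {} X {} fst
        \<in> iso (homology_group k (prod_topology X (top_of_set K))) (homology_group k X)"
    and iso_hom_induced_section_starlike:
      "hom_induced k X {} (prod_topology X (top_of_set K)) {} (\<lambda>x. (x, p))
        \<in> iso (homology_group k X) (homology_group k (prod_topology X (top_of_set K)))"
proof -
  have c: "continuous_map X (prod_topology X (top_of_set K)) (\<lambda>x. (x, p))"
    using p by (intro continuous_map_pairedI) auto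
  have h: "homotopic_with (\<lambda>h. True) X X (fst \<circ> (\<lambda>x. (x, p))) id"
    by (simp add: comp_def id_def)
  note H = homotopic_prod_starlike[OF assms]
  show "hom_induced k (prod_topology X (top_of_set K)) {} X {} fst
        \<in> iso (homology_group k (prod_topology X (top_of_set K))) (homology_group k X)"
    by (rule homotopy_equivalence_homology_group_isomorphism[OF continuous_map_fst c H h])
  show "hom_induced k X {} (prod_topology X (top_of_set K)) {} (\<lambda>x. (x, p))
        \<in> iso (homology_group k X) (homology_group k (prod_topology X (top_of_set K)))"
    by (rule homotopy_equivalence_homology_group_isomorphism[OF c continuous_map_fst h H])
qed

lemma hom_inv_mult:
  assumes "comm_group C" "group A" "f \<in> hom A C" "g \<in> hom A C"
  shows "(\<lambda>x. f x \<otimes>\<^bsub>C\<^esub> inv\<^bsub>C\<^esub> g x) \<in> hom A C"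
proof -
  interpret C: comm_group C by fact
  interpret f: group_hom A C f using assms by (simp add: group_hom_def group_hom_axioms_def comm_group.axioms)
  interpret g: group_hom A C g using assms by (simp add: group_hom_def group_hom_axioms_def comm_group.axioms)
  show ?thesis
    by (rule homI) (auto simp: C.inv_mult C.m_ac)
qed

lemma subtopology_prod_top_of_set:
  "subtopology (prod_topology X (top_of_set A)) (topspace X \<times> B) = prod_topology X (top_of_set (A \<inter> B))"
  by (simp add: subtopology_Times subtopology_subtopology)

text \<open>In the exact sequence of the pair the boundary map is injective, since the cut half
  plane already maps onto the homology of the half plane. With \<open>H\<close> the homology of
  \<open>X\<close> in degree \<open>k - 1\<close>, its image is the kernel of the addition
  \<open>H \<times> H \<rightarrow> H\<close>, one factor for each quadrant. This kernel is the
  antidiagonal, a copy of \<open>H\<close>.\<close>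

lemma generated_homology_cut_halfplane:
  fixes X :: "'a topology"
  assumes gen: "generated_by_at_most b (homology_group (k - 1) X)"
  shows "generated_by_at_most b (relative_homology_group k (prod_topology X (top_of_set {z::complex. Re z < 0}))
           (topspace X \<times> {z. Re z < 0 \<and> Im z \<noteq> 0}))"
proof -
  define L where "L = {z::complex. Re z < 0}"
  define A where "A = {z::complex. Re z < 0 \<and> Im z \<noteq> 0}"
  define Ap where "Ap = {z::complex. Re z < 0 \<and> Im z > 0}"
  define An where "An = {z::complex. Re z < 0 \<and> Im z < 0}"
  define p where "p = Complex (-1) 1"
  define n where "n = Complex (-1) (-1)"
  let ?P = "\<lambda>K. prod_topology X (top_of_set K)"
  let ?H = "\<lambda>q K. homology_group q (?P K)"
  let ?F = "\<lambda>q K. hom_induced q (?P K) {} X {} fst"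
  let ?s = "\<lambda>q K z. hom_induced q X {} (?P K) {} (\<lambda>x. (x, z))"
  let ?R = "relative_homology_group k (?P L) (topspace X \<times> A)"
  let ?j = "\<lambda>q. hom_induced q (?P A) {} (?P L) {} id"
  have subA: "subtopology (?P L) (topspace X \<times> A) = ?P A"
    unfolding subtopology_prod_top_of_set by (rule arg_cong[of _ _ "\<lambda>S. ?P S"]) (auto simp: A_def L_def)
  have subp: "subtopology (?P A) (topspace X \<times> Ap) = ?P Ap"
    unfolding subtopology_prod_top_of_set by (rule arg_cong[of _ _ "\<lambda>S. ?P S"]) (auto simp: A_def Ap_def)
  have subn: "subtopology (?P A) (topspace X \<times> An) = ?P An"
    unfolding subtopology_prod_top_of_set by (rule arg_cong[of _ _ "\<lambda>S. ?P S"]) (auto simp: A_def An_def)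
  have inL: "p \<in> L" and inA: "p \<in> A" "n \<in> A" and inp: "p \<in> Ap" and inn: "n \<in> An"
    by (auto simp: p_def n_def L_def A_def Ap_def An_def)
  have star: "closed_segment z w \<subseteq> K" if "convex K" "z \<in> K" "w \<in> K" for z w and K :: "complex set"
    using that convex_contains_segment by blast
  have Apn: "Ap = {z. Re z < 0} \<inter> {z. Im z > 0}" "An = {z. Re z < 0} \<inter> {z. Im z < 0}"
    by (auto simp: Ap_def An_def)
  then have cvx: "convex L" "convex Ap" "convex An"
    by (auto simp: L_def intro!: convex_Int convex_halfspace_Re_lt convex_halfspace_Im_lt convex_halfspace_Im_gt)
  have isoL: "?F q L \<in> iso (?H q L) (homology_group q X)" for q
    by (rule iso_hom_induced_fst_starlike[OF inL]) (use cvx inL star in auto)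
  have isop: "?s q Ap p \<in> iso (homology_group q X) (?H q Ap)" for q
    by (rule iso_hom_induced_section_starlike[OF inp]) (use cvx inp star in auto)
  have ison: "?s q An n \<in> iso (homology_group q X) (?H q An)" for q
    by (rule iso_hom_induced_section_starlike[OF inn]) (use cvx inn star in auto)
  have csec: "continuous_map X (?P K) (\<lambda>x. (x, z))" if "z \<in> K" for K z
    using that by (intro continuous_map_pairedI) auto
  have cid: "continuous_map (?P K) (?P K') id" if "K \<subseteq> K'" for K K'
  proof -
    have "continuous_map (top_of_set K) (top_of_set K') id"
      using that by (auto simp: continuous_map_in_subtopology)
    from continuous_map_compose[OF continuous_map_snd this]
    have "continuous_map (?P K) (top_of_set K') snd" by simp
    then have "continuous_map (?P K) (?P K') (\<lambda>x. (fst x, snd x))"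
      by (intro continuous_map_pairedI continuous_map_fst)
    then show ?thesis by (simp add: id_def)
  qed
  have comp_s: "hom_induced q (?P K) {} (?P K') {} id (?s q K z a) = ?s q K' z a"
    if "z \<in> K" "K \<subseteq> K'" for q K K' z a
    by (simp add: hom_induced_compose'[OF csec[OF that(1)] _ cid[OF that(2)]] comp_def)
  have F_s: "?F q K (?s q K z a) = a" if "z \<in> K" "a \<in> carrier (homology_group q X)" for q K z a
    using that by (simp add: hom_induced_compose'[OF csec[OF that(1)] _ continuous_map_fst] comp_def
        hom_induced_id_gen)
  have j_s: "?F q L (?j q (?s q A z a)) = a" if "z \<in> A" "a \<in> carrier (homology_group q X)" for q z a
  proof -
    have "A \<subseteq> L" by (auto simp: A_def L_def)
    then show ?thesis using that by (simp only: comp_s F_s) (auto intro!: F_s)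
  qed
  have homs: "?s q A z \<in> hom (homology_group q X) (?H q A)" for q z
    by (simp add: hom_induced_hom)
  have homj: "?j q \<in> hom (?H q A) (?H q L)" for q
    by (simp add: hom_induced_hom)
  have homF: "?F q L \<in> hom (?H q L) (homology_group q X)" for q
    by (simp add: hom_induced_hom)
  have injF: "inj_on (?F q L) (carrier (?H q L))" for q
    using isoL by (auto simp: iso_def bij_betw_def)
  \<comment> \<open>the inclusion of the cut half plane is onto in homology, as each half already is\<close>
  have onto: "?j q ` carrier (?H q A) = carrier (?H q L)" for q
  proof
    show "?j q ` carrier (?H q A) \<subseteq> carrier (?H q L)" by (auto simp: hom_induced_carrier)
    show "carrier (?H q L) \<subseteq> ?j q ` carrier (?H q A)"
    proof
      fix y assume y: "y \<in> carrier (?H q L)"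
      let ?a = "?F q L y"
      have a: "?a \<in> carrier (homology_group q X)" by (simp add: hom_induced_carrier)
      have "?F q L (?j q (?s q A p ?a)) = ?F q L y" using j_s[OF inA(1) a] .
      then have "?j q (?s q A p ?a) = y"
        using injF[of q] y by (auto simp: inj_on_def hom_induced_carrier)
      then show "y \<in> ?j q ` carrier (?H q A)" by (intro rev_image_eqI[of "?s q A p ?a"]) (simp_all add: hom_induced_carrier)
    qed
  qed
  let ?bd = "hom_boundary k (?P L) (topspace X \<times> A)"
  let ?i = "hom_induced k (?P L) {} (?P L) (topspace X \<times> A) id"
  have ex1: "?i ` carrier (?H k L) = kernel ?R (?H (k - 1) A) ?bd"
    using homology_exactness_axiom_1[of k "?P L" "topspace X \<times> A"] by (simp add: subA)
  have ex2: "?bd ` carrier ?R = kernel (?H (k - 1) A) (?H (k - 1) L) (?j (k - 1))"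
    using homology_exactness_axiom_2[of k "?P L" "topspace X \<times> A"] by (simp add: subA)
  have ex3: "?j k ` carrier (?H k A) = kernel (?H k L) ?R ?i"
    using homology_exactness_axiom_3[of k "?P L" "topspace X \<times> A"] by (simp add: subA)
  have "?i y = \<one>\<^bsub>?R\<^esub>" if "y \<in> carrier (?H k L)" for y
    using ex3 onto[of k] that by (auto simp: kernel_def)
  then have triv: "kernel ?R (?H (k - 1) A) ?bd \<subseteq> {\<one>\<^bsub>?R\<^esub>}" using ex1 by auto
  have hbd: "?bd \<in> hom ?R (?H (k - 1) A)"
    using hom_boundary_hom[of k "?P L" "topspace X \<times> A"] by (simp add: subA)
  interpret bd: group_hom ?R "?H (k - 1) A" ?bd
    using hbd by (simp add: group_hom_def group_hom_axioms_def)
  have inj: "inj_on ?bd (carrier ?R)"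
    using triv bd.inj_iff_trivial_ker by (auto simp: kernel_def)
  \<comment> \<open>The antidiagonal, as the difference of the sections at a point \<open>p\<close>
    above and a point \<open>n\<close> below the cut.\<close>
  define f where "f = (\<lambda>a. ?s (k - 1) A p a \<otimes>\<^bsub>?H (k - 1) A\<^esub> inv\<^bsub>?H (k - 1) A\<^esub> ?s (k - 1) A n a)"
  have homf: "f \<in> hom (homology_group (k - 1) X) (?H (k - 1) A)"
    unfolding f_def by (intro hom_inv_mult homs) auto
  interpret j: group_hom "?H (k - 1) A" "?H (k - 1) L" "?j (k - 1)"
    using homj by (simp add: group_hom_def group_hom_axioms_def)
  interpret F: group_hom "?H (k - 1) L" "homology_group (k - 1) X" "?F (k - 1) L"
    using homF by (simp add: group_hom_def group_hom_axioms_def)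
  interpret X: comm_group "homology_group (k - 1) X" by simp
  interpret sn: group_hom "homology_group (k - 1) X" "?H (k - 1) A" "?s (k - 1) A n"
    using homs by (simp add: group_hom_def group_hom_axioms_def)
  have im: "f ` carrier (homology_group (k - 1) X) = ?bd ` carrier ?R"
    unfolding ex2
  proof
    show "f ` carrier (homology_group (k - 1) X) \<subseteq> kernel (?H (k - 1) A) (?H (k - 1) L) (?j (k - 1))"
    proof
      fix y assume "y \<in> f ` carrier (homology_group (k - 1) X)"
      then obtain a where a: "a \<in> carrier (homology_group (k - 1) X)" "y = f a" by auto
      have c: "?s (k - 1) A z a \<in> carrier (?H (k - 1) A)" for z by (simp add: hom_induced_carrier)
      have "?F (k - 1) L (?j (k - 1) y) = \<one>\<^bsub>homology_group (k - 1) X\<^esub>"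
        unfolding a(2) f_def
        using c j_s[OF inA(1) a(1)] j_s[OF inA(2) a(1)] a(1) by simp
      moreover have yc: "y \<in> carrier (?H (k - 1) A)" using a homf by (auto simp: hom_def)
      ultimately have "?F (k - 1) L (?j (k - 1) y) = ?F (k - 1) L \<one>\<^bsub>?H (k - 1) L\<^esub>" by simp
      then have "?j (k - 1) y = \<one>\<^bsub>?H (k - 1) L\<^esub>"
        using injF[of "k - 1"] yc by (meson j.H.one_closed inj_onD j.hom_closed)
      then show "y \<in> kernel (?H (k - 1) A) (?H (k - 1) L) (?j (k - 1))"
        using yc by (simp add: kernel_def)
    qed
    show "kernel (?H (k - 1) A) (?H (k - 1) L) (?j (k - 1)) \<subseteq> f ` carrier (homology_group (k - 1) X)"
    proof
      fix y assume "y \<in> kernel (?H (k - 1) A) (?H (k - 1) L) (?j (k - 1))"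
      then have y: "y \<in> carrier (?H (k - 1) A)" "?j (k - 1) y = \<one>\<^bsub>?H (k - 1) L\<^esub>"
        by (auto simp: kernel_def)
      have o: "openin (?P A) (topspace X \<times> Ap)" "openin (?P A) (topspace X \<times> An)"
      proof -
        have "open Ap" "open An"
          unfolding Apn by (auto intro!: open_Int open_halfspace_Re_lt open_halfspace_Im_lt open_halfspace_Im_gt)
        moreover have "Ap \<subseteq> A" "An \<subseteq> A" by (auto simp: A_def Ap_def An_def)
        ultimately have "openin (top_of_set A) Ap" "openin (top_of_set A) An"
          by (auto simp: openin_open_eq open_subset)
        then show "openin (?P A) (topspace X \<times> Ap)" "openin (?P A) (topspace X \<times> An)"
          by (auto simp: openin_prod_Times_iff)
      qed
      have "(\<lambda>(a,b). hom_induced (k - 1) (?P Ap) {} (?P A) {} id a \<otimes>\<^bsub>?H (k - 1) A\<^esub>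
                 hom_induced (k - 1) (?P An) {} (?P A) {} id b)
         \<in> iso (?H (k - 1) Ap \<times>\<times> ?H (k - 1) An) (?H (k - 1) A)"
      proof -
        have "disjnt (topspace X \<times> Ap) (topspace X \<times> An)"
          by (auto simp: disjnt_def Ap_def An_def)
        moreover have "topspace X \<times> Ap \<union> topspace X \<times> An = topspace (?P A)"
          by (auto simp: A_def Ap_def An_def)
        ultimately show ?thesis
          using homology_additivity_explicit[OF o, of "k - 1"] unfolding subp subn by blast
      qed
      then have "y \<in> (\<lambda>(a,b). hom_induced (k - 1) (?P Ap) {} (?P A) {} id a \<otimes>\<^bsub>?H (k - 1) A\<^esub>
                 hom_induced (k - 1) (?P An) {} (?P A) {} id b) ` (carrier (?H (k - 1) Ap) \<times> carrier (?H (k - 1) An))"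
        using y(1) by (simp add: iso_def bij_betw_def)
      then obtain u v where uv: "u \<in> carrier (?H (k - 1) Ap)" "v \<in> carrier (?H (k - 1) An)"
        "y = hom_induced (k - 1) (?P Ap) {} (?P A) {} id u \<otimes>\<^bsub>?H (k - 1) A\<^esub>
             hom_induced (k - 1) (?P An) {} (?P A) {} id v" by auto
      have "u \<in> ?s (k - 1) Ap p ` carrier (homology_group (k - 1) X)"
        using isop[of "k - 1"] uv(1) by (simp add: iso_def bij_betw_def)
      then obtain a where a: "a \<in> carrier (homology_group (k - 1) X)" "u = ?s (k - 1) Ap p a" by auto
      have "v \<in> ?s (k - 1) An n ` carrier (homology_group (k - 1) X)"
        using ison[of "k - 1"] uv(2) by (simp add: iso_def bij_betw_def)
      then obtain c where c: "c \<in> carrier (homology_group (k - 1) X)" "v = ?s (k - 1) An n c" by auto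
      have "Ap \<subseteq> A" "An \<subseteq> A" by (auto simp: A_def Ap_def An_def)
      then have y': "y = ?s (k - 1) A p a \<otimes>\<^bsub>?H (k - 1) A\<^esub> ?s (k - 1) A n c"
        using uv(3) unfolding a(2) c(2) by (simp only: comp_s inp inn)
      have cc: "?s (k - 1) A z a \<in> carrier (?H (k - 1) A)" for z a by (simp add: hom_induced_carrier)
      have "?F (k - 1) L (?j (k - 1) y) = \<one>\<^bsub>homology_group (k - 1) X\<^esub>" using y by simp
      \<comment> \<open>After projection to \<open>X\<close> both sections become the identity, so
        an element that dies in the half plane has opposite parts in the two quadrants.\<close>
      then have "a \<otimes>\<^bsub>homology_group (k - 1) X\<^esub> c = \<one>\<^bsub>homology_group (k - 1) X\<^esub>"
        unfolding y' using cc j_s[OF inA(1) a(1)] j_s[OF inA(2) c(1)] by simp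
      then have "c = inv\<^bsub>homology_group (k - 1) X\<^esub> a"
        using a c by (metis F.H.inv_equality X.m_comm)
      then have "y = f a" unfolding y' f_def using a by simp
      then show "y \<in> f ` carrier (homology_group (k - 1) X)" using a by auto
    qed
  qed
  have "generated_by_at_most b ?R"
    by (rule generated_by_at_most_transfer[OF _ gen _ _ homf hbd inj im]) auto
  then show ?thesis by (simp add: L_def A_def)
qed

text \<open>The plane cut along the nonpositive real axis is starlike about 1, so its product with
  \<open>X\<close> has the homology of \<open>X\<close>, and the projection to \<open>X\<close>
  shows that its inclusion is injective in homology. The exact sequence of the pair therefore breaks
  into short ones. Their quotients are relative groups, which excision moves to the half plane
  around the cut.\<close>

lemma generated_homology_prod_punctured_plane:
  fixes X :: "'a topology"
  assumes gen: "generated_by_at_most b (homology_group k X)"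
    and gen': "generated_by_at_most b' (homology_group (k - 1) X)"
  shows "generated_by_at_most (b + b') (homology_group k (prod_topology X (top_of_set (- {0::complex}))))"
proof -
  define C where "C = - {0::complex}"
  define A where "A = {z::complex. \<not> (Re z \<le> 0 \<and> Im z = 0)}"
  \<comment> \<open>The closed right half plane without the origin: closed in the punctured plane
    and inside the open set \<open>A\<close>, so it can be excised. What remains is the pair of
    \<open>generated_homology_cut_halfplane\<close>.\<close>
  define U where "U = {z::complex. z \<noteq> 0 \<and> 0 \<le> Re z}"
  let ?P = "\<lambda>K. prod_topology X (top_of_set K)"
  let ?H = "\<lambda>q K. homology_group q (?P K)"
  let ?F = "\<lambda>q K. hom_induced q (?P K) {} X {} fst"
  let ?R = "relative_homology_group k (?P C) (topspace X \<times> A)"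
  let ?j = "\<lambda>q. hom_induced q (?P A) {} (?P C) {} id"
  have AC: "A \<subseteq> C" by (auto simp: A_def C_def)
  have subA: "subtopology (?P C) (topspace X \<times> A) = ?P A"
    unfolding subtopology_prod_top_of_set by (rule arg_cong[of _ _ "\<lambda>S. ?P S"]) (use AC in auto)
  have isoA: "?F q A \<in> iso (?H q A) (homology_group q X)" for q
  proof (rule iso_hom_induced_fst_starlike[of 1])
    show "1 \<in> A" by (simp add: A_def)
    show "closed_segment 1 z \<subseteq> A" if "z \<in> A" for z
    proof
      fix w assume "w \<in> closed_segment 1 z"
      then obtain u where u: "0 \<le> u" "u \<le> 1" "w = (1 - u) *\<^sub>R 1 + u *\<^sub>R z"
        by (auto simp: closed_segment_def)
      show "w \<in> A"
      proof (rule ccontr)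
        assume "w \<notin> A"
        then have w: "Re w \<le> 0" "Im w = 0" by (auto simp: A_def)
        have re: "Re w = (1 - u) + u * Re z" "Im w = u * Im z" using u by auto
        have "u \<noteq> 0" using w re by auto
        then have "Im z = 0" using w re by simp
        then have "Re z > 0" using that by (simp add: A_def)
        then have "(1 - u) + u * Re z > 0"
          using u \<open>u \<noteq> 0\<close> by (smt (verit) mult_pos_pos)
        then show False using w re by simp
      qed
    qed
  qed
  have cid: "continuous_map (?P A) (?P C) id"
    using subA by (metis continuous_map_from_subtopology continuous_map_id)
  have inj_j: "inj_on (?j q) (carrier (?H q A))" for q
  proof (rule inj_on_imageI2[of "?F q C"])
    have "?F q C \<circ> ?j q = ?F q A"
      by (subst hom_induced_compose_empty[OF cid continuous_map_fst, symmetric]) simp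
    then show "inj_on (?F q C \<circ> ?j q) (carrier (?H q A))"
      using isoA[of q] by (simp add: iso_def bij_betw_def)
  qed
  let ?bd = "hom_boundary k (?P C) (topspace X \<times> A)"
  let ?i = "hom_induced k (?P C) {} (?P C) (topspace X \<times> A) id"
  have ex1: "?i ` carrier (?H k C) = kernel ?R (?H (k - 1) A) ?bd"
    using homology_exactness_axiom_1[of k "?P C" "topspace X \<times> A"] by (simp add: subA)
  have ex2: "?bd ` carrier ?R = kernel (?H (k - 1) A) (?H (k - 1) C) (?j (k - 1))"
    using homology_exactness_axiom_2[of k "?P C" "topspace X \<times> A"] by (simp add: subA)
  have ex3: "?j k ` carrier (?H k A) = kernel (?H k C) ?R ?i"
    using homology_exactness_axiom_3[of k "?P C" "topspace X \<times> A"] by (simp add: subA)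
  interpret j: group_hom "?H (k - 1) A" "?H (k - 1) C" "?j (k - 1)"
    by (simp add: group_hom_def group_hom_axioms_def hom_induced_hom)
  have "kernel (?H (k - 1) A) (?H (k - 1) C) (?j (k - 1)) = {\<one>\<^bsub>?H (k - 1) A\<^esub>}"
    using inj_j[of "k - 1"] j.inj_iff_trivial_ker by blast
  then have "kernel ?R (?H (k - 1) A) ?bd = carrier ?R"
    using ex2 by (auto simp: kernel_def)
  then have onto: "?i ` carrier (?H k C) = carrier ?R" using ex1 by simp
  have genA: "generated_by_at_most b (?H k A)"
  proof (rule generated_by_at_most_iso[OF _ gen])
    show "homology_group k X \<cong> ?H k A"
      using isoA[of k] group.iso_sym[of "?H k A" "homology_group k X"] by (auto simp: is_iso_def)
  qed auto
  have genR: "generated_by_at_most b' ?R"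
  proof (rule generated_by_at_most_iso)
    let ?L = "{z::complex. Re z < 0}" and ?LA = "{z::complex. Re z < 0 \<and> Im z \<noteq> 0}"
    let ?R' = "relative_homology_group k (?P ?L) (topspace X \<times> ?LA)"
    show "generated_by_at_most b' ?R'"
      by (rule generated_homology_cut_halfplane[OF gen'])
    have cl: "closedin (?P C) (topspace X \<times> U)"
    proof -
      have "U = C \<inter> {z. 0 \<le> Re z}" by (auto simp: U_def C_def)
      then have "closedin (top_of_set C) U"
        by (simp add: closedin_closed_Int closed_halfspace_Re_ge)
      then show ?thesis by (simp add: closedin_prod_Times_iff)
    qed
    have op: "openin (?P C) (topspace X \<times> A)"
    proof -
      have "A = - \<real>\<^sub>\<le>\<^sub>0" by (auto simp: A_def complex_nonpos_Reals_iff)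
      then have "open A" by (simp add: open_Compl)
      then have "openin (top_of_set C) A" using AC by (simp add: openin_open_eq open_subset)
      then show ?thesis by (simp add: openin_prod_Times_iff)
    qed
    have UA: "topspace X \<times> U \<subseteq> topspace X \<times> A"
      by (auto simp: U_def A_def complex_eq_iff)
    have "(?P C) closure_of (topspace X \<times> U) \<subseteq> (?P C) interior_of (topspace X \<times> A)"
      using UA by (simp add: closure_of_closedin[OF cl] interior_of_openin[OF op])
    moreover have "topspace X \<times> A \<subseteq> topspace X \<times> C" using AC by auto
    ultimately have "hom_induced k (subtopology (?P C) (topspace X \<times> C - topspace X \<times> U))
          (topspace X \<times> A - topspace X \<times> U) (subtopology (?P C) (topspace X \<times> C)) (topspace X \<times> A) id
        \<in> iso (relative_homology_group k (subtopology (?P C) (topspace X \<times> C - topspace X \<times> U))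
                 (topspace X \<times> A - topspace X \<times> U))
              (relative_homology_group k (subtopology (?P C) (topspace X \<times> C)) (topspace X \<times> A))"
      by (rule homology_excision_axiom)
    moreover have "topspace X \<times> C - topspace X \<times> U = topspace X \<times> ?L"
      by (auto simp: C_def U_def)
    moreover have "topspace X \<times> A - topspace X \<times> U = topspace X \<times> ?LA"
      by (auto simp: A_def U_def)
    moreover have "subtopology (?P C) (topspace X \<times> ?L) = ?P ?L"
      unfolding subtopology_prod_top_of_set by (rule arg_cong[of _ _ "\<lambda>S. ?P S"]) (auto simp: C_def)
    moreover have "subtopology (?P C) (topspace X \<times> C) = ?P C"
      unfolding subtopology_prod_top_of_set by simp
    ultimately show "?R' \<cong> ?R" by (auto simp: is_iso_def)
  qed auto
  have "generated_by_at_most (b + b') (?H k C)"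
    by (rule generated_by_at_most_extension[OF _ genA _ genR _ _ _ onto, of "?j k"])
       (auto simp: hom_induced_hom ex3)
  then show ?thesis by (simp add: C_def)
qed

lemma generated_homology_prod_finite:
  fixes X :: "'a topology" and F :: "complex set"
  assumes gen: "generated_by_at_most b (homology_group k X)" and "finite F"
  shows "generated_by_at_most (card F * b) (homology_group k (prod_topology X (top_of_set F)))"
  using \<open>finite F\<close>
proof (induction F)
  case empty
  then show ?case
    by (intro generated_by_at_most_trivial trivial_homology_group_empty) auto
next
  case (insert a F)
  let ?P = "\<lambda>K. prod_topology X (top_of_set K)"
  have sub: "subtopology (?P (insert a F)) (topspace X \<times> {a}) = ?P {a}"
    "subtopology (?P (insert a F)) (topspace X \<times> F) = ?P F"
    unfolding subtopology_prod_top_of_set by (auto intro!: arg_cong[of _ _ "\<lambda>S. ?P S"])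
  have dis: "openin (top_of_set (insert a F)) S" if "S \<subseteq> insert a F" for S
  proof -
    have "finite (insert a F - S)" using insert by auto
    then have "open (- (insert a F - S))" by (intro open_Compl finite_imp_closed)
    moreover have "S = insert a F \<inter> - (insert a F - S)" using that by auto
    ultimately show ?thesis by (metis openin_open)
  qed
  have o: "openin (?P (insert a F)) (topspace X \<times> {a})" "openin (?P (insert a F)) (topspace X \<times> F)"
    using dis by (auto simp: openin_prod_Times_iff)
  have iso: "(\<lambda>(x,y). hom_induced k (?P {a}) {} (?P (insert a F)) {} id x \<otimes>\<^bsub>homology_group k (?P (insert a F))\<^esub>
             hom_induced k (?P F) {} (?P (insert a F)) {} id y)
         \<in> iso (homology_group k (?P {a}) \<times>\<times> homology_group k (?P F)) (homology_group k (?P (insert a F)))"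
  proof -
    have "disjnt (topspace X \<times> {a}) (topspace X \<times> F)"
      using insert by (auto simp: disjnt_def)
    moreover have "topspace X \<times> {a} \<union> topspace X \<times> F = topspace (?P (insert a F))" by auto
    ultimately show ?thesis
      using homology_additivity_explicit[OF o, of k] unfolding sub by blast
  qed
  have "hom_induced k (?P {a}) {} X {} fst \<in> iso (homology_group k (?P {a})) (homology_group k X)"
    by (rule iso_hom_induced_fst_starlike[of a]) auto
  then have "homology_group k (?P {a}) \<cong> homology_group k X"
    unfolding is_iso_def by blast
  then have "homology_group k X \<cong> homology_group k (?P {a})"
    by (rule group.iso_sym[OF group_relative_homology_group])
  then have ga: "generated_by_at_most b (homology_group k (?P {a}))"
    by (rule generated_by_at_most_iso[OF group_relative_homology_group gen group_relative_homology_group])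
  have "generated_by_at_most (b + card F * b) (homology_group k (?P (insert a F)))"
    by (rule generated_by_at_most_sum[where i="hom_induced k (?P {a}) {} (?P (insert a F)) {} id"
            and j="hom_induced k (?P F) {} (?P (insert a F)) {} id",
          OF group_relative_homology_group ga group_relative_homology_group insert.IH
             group_relative_homology_group iso])
       (auto simp: hom_induced_hom)

  then show ?case using insert by simp
qed

lemma homeomorphic_product_topology_Suc:
  "product_topology Y {..<Suc n} homeomorphic_space prod_topology (product_topology Y {..<n}) (Y n)"
proof -
  let ?f = "\<lambda>x. (restrict x {..<n}, x n)"
  let ?g = "\<lambda>w. \<lambda>i\<in>{..<Suc n}. if i = n then snd w else fst w i"
  let ?P = "product_topology Y {..<Suc n}" and ?Q = "prod_topology (product_topology Y {..<n}) (Y n)"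
  have f: "continuous_map ?P ?Q ?f"
    by (intro continuous_map_pairedI)
       (auto simp: continuous_map_componentwise intro: continuous_map_product_projection)
  have "continuous_map ?Q (Y i) (\<lambda>w. fst w i)" if "i < n" for i
    using continuous_map_compose[OF continuous_map_fst continuous_map_product_projection, of i "{..<n}"] that
    by (simp add: comp_def)
  then have g: "continuous_map ?Q ?P ?g"
    by (auto simp: continuous_map_componentwise continuous_map_snd less_Suc_eq)
  have "homeomorphic_maps ?P ?Q ?f ?g"
    unfolding homeomorphic_maps_def using f g
    by (auto simp: PiE_iff extensional_def fun_eq_iff less_Suc_eq)
  then show ?thesis unfolding homeomorphic_space_def by blast
qed

lemma generated_homology_group_point:
  assumes "topspace X = {a}"
  shows "generated_by_at_most (if k = 0 then 1 else 0) (homology_group k X)"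
proof (cases "k = 0")
  case False
  then show ?thesis
    using homology_dimension_axiom[OF assms False] by (simp add: generated_by_at_most_trivial)
next
  case True
  interpret I: group integer_group by simp
  have "x = 1 [^]\<^bsub>integer_group\<^esub> x" for x :: int by simp
  then have "x \<in> generate integer_group {1}" for x
    unfolding I.generate_pow[of 1, simplified] by blast
  then have "generate integer_group {1} = carrier integer_group" by auto
  then have "generated_by_at_most 1 integer_group"
    unfolding generated_by_at_most_def by (intro exI[of _ "{1}"]) auto
  moreover have "integer_group \<cong> homology_group 0 X"
    by (rule group.iso_sym[OF group_relative_homology_group homology_coefficients[OF assms]])
  ultimately have "generated_by_at_most 1 (homology_group 0 X)"
    by (intro generated_by_at_most_iso[OF group_integer_group _ group_relative_homology_group])
  then show ?thesis using True by simp
qed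

text \<open>A punctured plane as last factor adds the bounds in degrees \<open>k\<close> and
  \<open>k - 1\<close>, which is Pascal's rule; a finite last factor multiplies the bound by its
  number of points.\<close>

lemma generated_homology_group_product:
  fixes K :: "nat \<Rightarrow> complex set"
  assumes "r \<le> n" "\<And>i. i < r \<Longrightarrow> finite (K i)" "\<And>i. \<lbrakk>r \<le> i; i < n\<rbrakk> \<Longrightarrow> K i = - {0}"
  shows "generated_by_at_most ((\<Prod>i<r. card (K i)) * ((n - r) choose k))
           (homology_group (int k) (product_topology (\<lambda>i. top_of_set (K i)) {..<n}))"
  using assms
proof (induction n arbitrary: r k)
  case 0
  have "topspace (product_topology (\<lambda>i. top_of_set (K i)) {..<0::nat}) = {\<lambda>x. undefined}" by simp
  from generated_homology_group_point[OF this, of "int k"] 0 show ?case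
    by (cases k) (auto split: if_splits)
next
  case (Suc n)
  let ?X = "product_topology (\<lambda>i. top_of_set (K i)) {..<n}"
  let ?Y = "product_topology (\<lambda>i. top_of_set (K i)) {..<Suc n}"
  have iso: "homology_group (int k) (prod_topology ?X (top_of_set (K n))) \<cong> homology_group (int k) ?Y"
    by (rule homeomorphic_space_imp_isomorphic_homology_groups)
       (rule homeomorphic_space_sym[THEN iffD1, OF homeomorphic_product_topology_Suc])
  note transfer = generated_by_at_most_iso[OF group_relative_homology_group _ group_relative_homology_group iso]
  show ?case
  proof (cases "r \<le> n")
    case True
    have g: "generated_by_at_most ((\<Prod>i<r. card (K i)) * ((n - r) choose k)) (homology_group (int k) ?X)" for k
      by (rule Suc.IH) (use True Suc.prems in auto)
    have K: "K n = - {0}" using Suc True by auto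
    have "\<exists>b'. b' + ((n - r) choose k) = (Suc n - r) choose k \<and>
       generated_by_at_most ((\<Prod>i<r. card (K i)) * b') (homology_group (int k - 1) ?X)"
    proof (cases k)
      case 0
      \<comment> \<open>In degree \<open>-1\<close> homology is trivial, so \<open>b' = 0\<close>
        serves.\<close>
      then show ?thesis by (intro exI[of _ 0]) (auto intro: generated_by_at_most_trivial)
    next
      case (Suc l)
      then show ?thesis using g[of l] True
        by (intro exI[of _ "(n - r) choose l"]) (auto simp: Suc_diff_le)
    qed
    then obtain b' where b': "b' + ((n - r) choose k) = (Suc n - r) choose k"
       "generated_by_at_most ((\<Prod>i<r. card (K i)) * b') (homology_group (int k - 1) ?X)" by blast
    show ?thesis
      using transfer[OF generated_homology_prod_punctured_plane[OF g b'(2), folded K]]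
      by (simp add: b'(1)[symmetric] algebra_simps)
  next
    case False
    then have r: "r = Suc n" using Suc by auto
    have g: "generated_by_at_most ((\<Prod>i<n. card (K i)) * ((n - n) choose k)) (homology_group (int k) ?X)"
      by (rule Suc.IH) (use r Suc.prems in auto)
    have "finite (K n)" using Suc r by auto
    from transfer[OF generated_homology_prod_finite[OF g this]] show ?thesis
      by (simp add: r algebra_simps)
  qed
qed

section \<open>Logarithms along simplices\<close>

abbreviation vertex :: "nat \<Rightarrow> nat \<Rightarrow> real"
  where "vertex j \<equiv> (\<lambda>i. if i = j then 1 else 0)"

text \<open>Normalized so that logarithms are unique up to integers and one turn around the circle
  changes them by 1.\<close>

abbreviation E2 :: "complex \<Rightarrow> complex"
  where "E2 z \<equiv> exp (2 * of_real pi * \<i> * z)"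

definition unit_valued :: "nat \<Rightarrow> ((nat \<Rightarrow> real) \<Rightarrow> complex) \<Rightarrow> bool"
  where "unit_valued p f \<longleftrightarrow> continuous_on (standard_simplex p) f \<and> (\<forall>x\<in>standard_simplex p. f x \<noteq> 0)"

definition log_lift :: "nat \<Rightarrow> ((nat \<Rightarrow> real) \<Rightarrow> complex) \<Rightarrow> ((nat \<Rightarrow> real) \<Rightarrow> complex) \<Rightarrow> bool"
  where "log_lift p f L \<longleftrightarrow> continuous_on (standard_simplex p) L \<and> (\<forall>x\<in>standard_simplex p. E2 (L x) = f x)"

text \<open>Two lifts differ by a constant (\<open>log_lift_unique\<close>), so the difference
  between two vertices does not depend on the lift chosen.\<close>

definition dlog :: "nat \<Rightarrow> ((nat \<Rightarrow> real) \<Rightarrow> complex) \<Rightarrow> nat \<Rightarrow> complex"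
  where "dlog p f j = (SOME L. log_lift p f L) (vertex j) - (SOME L. log_lift p f L) (vertex 0)"

lemma compact_standard_simplex: "compact (standard_simplex p)"
  using compactin_standard_simplex[of p] by (simp add: euclidean_product_topology)

lemma connected_standard_simplex: "connected (standard_simplex p)"
  using connectedin_standard_simplex[of p] by (simp add: euclidean_product_topology)

text \<open>The radial homotopy to a vertex is uniformly continuous, so \<open>f\<close> is a finite product of
  factors in the disc of radius \<open>1\<close> about \<open>1\<close>, each having a principal logarithm.\<close>

lemma log_lift_exists:
  assumes "unit_valued p f" shows "\<exists>L. log_lift p f L"
proof -
  let ?K = "standard_simplex p"
  define h where "h = (\<lambda>w::real \<times> (nat \<Rightarrow> real). f (\<lambda>i. (1 - fst w) * vertex 0 i + fst w * snd w i))"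
  have f: "continuous_on ?K f" "\<And>x. x \<in> ?K \<Longrightarrow> f x \<noteq> 0" using assms by (auto simp: unit_valued_def)
  have in_K: "(\<lambda>i. (1 - t) * vertex 0 i + t * x i) \<in> ?K" if "x \<in> ?K" "t \<in> {0..1}" for t x
    using convex_standard_simplex[of "vertex 0" p x t] that by simp
  have h0: "h w \<noteq> 0" if "w \<in> {0..1} \<times> ?K" for w
    unfolding h_def by (rule f(2)[OF in_K]) (use that in auto)
  have cont: "continuous_on ({0..1::real} \<times> ?K) h"
    unfolding h_def
  proof (rule continuous_on_compose2[OF f(1)])
    have "continuous_on ({0..1::real} \<times> ?K) (\<lambda>w. snd w i)" for i
      by (rule continuous_on_product_then_coordinatewise[OF continuous_on_snd[OF continuous_on_id]])
    then show "continuous_on ({0..1::real} \<times> ?K) (\<lambda>w i. (1 - fst w) * vertex 0 i + fst w * snd w i)"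
      by (intro continuous_on_coordinatewise_then_product continuous_intros)
    show "(\<lambda>w i. (1 - fst w) * vertex 0 i + fst w * snd w i) ` ({0..1::real} \<times> ?K) \<subseteq> ?K"
    proof (rule image_subsetI)
      fix w assume "w \<in> {0..1::real} \<times> ?K"
      then show "(\<lambda>i. (1 - fst w) * vertex 0 i + fst w * snd w i) \<in> ?K" by (intro in_K) auto
    qed
  qed
  have cpt: "compact ({0..1::real} \<times> ?K)" by (intro compact_Times compact_standard_simplex) simp
  have ne: "({0..1::real} \<times> ?K) \<noteq> {}" using nonempty_standard_simplex by auto
  obtain w0 where w0: "w0 \<in> {0..1} \<times> ?K" and "\<forall>w\<in>{0..1} \<times> ?K. norm (h w0) \<le> norm (h w)"
    using continuous_attains_inf[OF cpt ne continuous_on_norm[OF cont]] by (elim bexE)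
  then have w0min: "norm (h w0) \<le> norm (h w)" if "w \<in> {0..1} \<times> ?K" for w using that by blast
  \<comment> \<open>Variations of \<open>h\<close> below its minimum modulus \<open>m\<close> keep
    quotients of neighbouring values within distance 1 of 1, away from the branch cut of
    \<open>Ln\<close>.\<close>
  define m where "m = norm (h w0)"
  have m: "m > 0" using h0[OF w0] by (simp add: m_def)
  have uc: "uniformly_continuous_on ({0..1::real} \<times> ?K) h" by (rule compact_uniformly_continuous[OF cont cpt])
  obtain \<delta> where \<delta>: "\<delta> > 0"
    "\<And>w w'. \<lbrakk>w \<in> {0..1} \<times> ?K; w' \<in> {0..1} \<times> ?K; dist w' w < \<delta>\<rbrakk> \<Longrightarrow> dist (h w') (h w) < m"
    using uc[unfolded uniformly_continuous_on_def, THEN spec, of m] m by auto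
  obtain N' where N': "inverse (real (Suc N')) < \<delta>" using reals_Archimedean[OF \<delta>(1)] by blast
  define N where "N = Suc N'"
  have N: "N > 0" "1 / real N < \<delta>" using N' by (simp_all add: N_def inverse_eq_divide)
  \<comment> \<open>Quotients of consecutive stages of the homotopy; their product over
    \<open>j\<close> telescopes to \<open>f x / f (vertex 0)\<close>.\<close>
  define q where "q = (\<lambda>j x. h (real (Suc j) / real N, x) / h (real j / real N, x))"
  have tI: "real j / real N \<in> {0..1}" if "j \<le> N" for j using that N by simp
  have qclose: "norm (q j x - 1) < 1" if "j < N" "x \<in> ?K" for j x
  proof -
    have w: "(real (Suc j) / real N, x) \<in> {0..1} \<times> ?K" "(real j / real N, x) \<in> {0..1} \<times> ?K"
      using tI[of j] tI[of "Suc j"] that by auto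
    have "dist (real (Suc j) / real N, x) (real j / real N, x) = \<bar>real (Suc j) / real N - real j / real N\<bar>"
      by (simp add: dist_Pair_Pair dist_real_def)
    also have "\<dots> = 1 / real N" using N by (simp add: field_simps)
    finally have "dist (h (real (Suc j) / real N, x)) (h (real j / real N, x)) < m"
      using \<delta>(2)[OF w(2,1)] N by simp
    also have "m \<le> norm (h (real j / real N, x))" using w0min[OF w(2)] by (simp add: m_def)
    finally have *: "norm (h (real (Suc j) / real N, x) - h (real j / real N, x)) < norm (h (real j / real N, x))"
      by (simp add: dist_norm)
    have "q j x - 1 = (h (real (Suc j) / real N, x) - h (real j / real N, x)) / h (real j / real N, x)"
      using h0[OF w(2)] by (simp add: q_def field_simps)
    then show ?thesis using * h0[OF w(2)] by (simp add: norm_divide divide_less_eq)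
  qed
  have qnn: "q j x \<notin> \<real>\<^sub>\<le>\<^sub>0" if "j < N" "x \<in> ?K" for j x
  proof
    assume "q j x \<in> \<real>\<^sub>\<le>\<^sub>0"
    then have "Re (q j x) \<le> 0" by (simp add: complex_nonpos_Reals_iff)
    then have "1 \<le> \<bar>Re (q j x - 1)\<bar>" by simp
    then show False using qclose[OF that] abs_Re_le_cmod[of "q j x - 1"] by linarith
  qed
  have qcont: "continuous_on ?K (q j)" if "j < N" for j
  proof -
    have "continuous_on ?K (\<lambda>x. h (t, x))" if "t \<in> {0..1}" for t
      by (rule continuous_on_compose2[OF cont]) (use that in \<open>auto intro!: continuous_intros\<close>)
    then show ?thesis
      unfolding q_def using tI[of j] tI[of "Suc j"] that h0
      by (intro continuous_on_divide) auto
  qed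
  define L where "L = (\<lambda>x. (Ln (f (vertex 0)) + (\<Sum>j<N. Ln (q j x))) / (2 * of_real pi * \<i>))"
  have "continuous_on ?K L"
    unfolding L_def using qcont qnn by (intro continuous_intros continuous_on_Ln') auto
  moreover have "E2 (L x) = f x" if x: "x \<in> ?K" for x
  proof -
    have "E2 (L x) = exp (Ln (f (vertex 0)) + (\<Sum>j<N. Ln (q j x)))" by (simp add: L_def)
    also have "\<dots> = f (vertex 0) * (\<Prod>j<N. q j x)"
    proof -
      have "exp (Ln (q j x)) = q j x" if "j < N" for j using qnn[OF that x] by (intro exp_Ln) auto
      moreover have "exp (Ln (f (vertex 0))) = f (vertex 0)" by (intro exp_Ln f(2)) simp
      ultimately show ?thesis by (simp add: exp_add exp_sum)
    qed
    also have "(\<Prod>j<n. q j x) = h (real n / real N, x) / h (0, x)" if "n \<le> N" for n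
      using that
    proof (induction n)
      case 0
      then show ?case using h0[of "(0, x)"] x by simp
    next
      case (Suc n)
      then show ?case using h0[of "(real n / real N, x)"] tI[of n] x by (simp add: q_def)
    qed
    from this[of N] have "(\<Prod>j<N. q j x) = h (1, x) / h (0, x)" using N by simp
    also have "h (1, x) = f x" by (simp add: h_def)
    also have "h (0, x) = f (vertex 0)" by (simp add: h_def)
    finally show ?thesis using f(2)[of "vertex 0"] by simp
  qed
  ultimately show ?thesis unfolding log_lift_def by blast
qed

text \<open>The difference of two lifts is continuous with integer values on a connected simplex,
  hence constant.\<close>

lemma log_lift_unique:
  assumes "log_lift p f L" "log_lift p f L'" "x \<in> standard_simplex p" "y \<in> standard_simplex p"
  shows "L x - L y = L' x - L' y"
proof -
  let ?K = "standard_simplex p" and ?g = "\<lambda>x. L x - L' x"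
  have cont: "continuous_on ?K ?g" using assms by (auto simp: log_lift_def intro: continuous_intros)
  have int: "\<exists>n::int. ?g z = of_int n" if "z \<in> ?K" for z
  proof -
    have "E2 (L z) = E2 (L' z)" using assms that by (simp add: log_lift_def)
    then obtain n :: int where "2 * of_real pi * \<i> * L z = 2 * of_real pi * \<i> * L' z + of_int (2 * n) * pi * \<i>"
      unfolding exp_eq by blast
    then have "2 * of_real pi * \<i> * (L z - L' z) = 2 * of_real pi * \<i> * of_int n" by (simp add: algebra_simps)
    then have "L z - L' z = of_int n" by (simp del: mult_cancel_left)
    then show ?thesis by blast
  qed
  have "?g constant_on ?K"
  proof (rule continuous_discrete_range_constant[OF connected_standard_simplex cont])
    fix z assume z: "z \<in> ?K"
    show "\<exists>e>0. \<forall>y. y \<in> ?K \<and> ?g y \<noteq> ?g z \<longrightarrow> e \<le> norm (?g y - ?g z)"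
    proof (intro exI[of _ 1] conjI allI impI)
      fix y assume y: "y \<in> ?K \<and> ?g y \<noteq> ?g z"
      obtain a b :: int where ab: "?g y = of_int a" "?g z = of_int b" using int y z by metis
      then have "a \<noteq> b" using y by auto
      then have "1 \<le> \<bar>real_of_int (a - b)\<bar>" by linarith
      also have "\<dots> = norm (?g y - ?g z)" unfolding ab of_int_diff[symmetric] norm_of_int ..
      finally show "1 \<le> norm (?g y - ?g z)" .
    qed simp
  qed
  then have "?g x = ?g y" using assms(3,4) unfolding constant_on_def by metis
  then show ?thesis by (simp add: algebra_simps)
qed

lemma dlog_eqI:
  assumes "log_lift p f L" "j \<le> p" shows "dlog p f j = L (vertex j) - L (vertex 0)"
  unfolding dlog_def
  by (rule log_lift_unique[OF someI[of "log_lift p f", OF assms(1)] assms(1)]) (use assms in auto)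

lemma dlog_0 [simp]: "dlog p f 0 = 0"
  by (simp add: dlog_def)

lemma dlog_mult:
  assumes "unit_valued p f" "unit_valued p g" "j \<le> p"
  shows "dlog p (\<lambda>x. f x * g x) j = dlog p f j + dlog p g j"
proof -
  obtain L L' where L: "log_lift p f L" "log_lift p g L'" using assms log_lift_exists by metis
  then have "log_lift p (\<lambda>x. f x * g x) (\<lambda>x. L x + L' x)"
    by (auto simp: log_lift_def ring_distribs exp_add intro: continuous_intros)
  from dlog_eqI[OF this assms(3)] show ?thesis using dlog_eqI[OF L(1) assms(3)] dlog_eqI[OF L(2) assms(3)] by simp
qed

lemma dlog_const: "c \<noteq> 0 \<Longrightarrow> j \<le> p \<Longrightarrow> dlog p (\<lambda>x. c) j = 0"
  using dlog_eqI[of p "\<lambda>x. c" "\<lambda>x. Ln c / (2 * of_real pi * \<i>)" j] by (simp add: log_lift_def)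

lemma dlog_cong: "(\<And>x. x \<in> standard_simplex p \<Longrightarrow> f x = g x) \<Longrightarrow> dlog p f j = dlog p g j"
proof -
  assume "\<And>x. x \<in> standard_simplex p \<Longrightarrow> f x = g x"
  then have "log_lift p f = log_lift p g" by (auto simp: log_lift_def fun_eq_iff)
  then show ?thesis by (simp add: dlog_def)
qed

text \<open>The coface map on vertex numbers: the increasing map that omits
  \<open>i\<close>.\<close>

definition skip :: "nat \<Rightarrow> nat \<Rightarrow> nat"
  where "skip i j = (if j < i then j else Suc j)"

lemma simplical_face_vertex: "simplical_face i (vertex j) = vertex (skip i j)"
  by (auto simp: simplical_face_def skip_def fun_eq_iff)

lemma continuous_on_simplical_face: "continuous_on S (simplical_face i :: (nat \<Rightarrow> real) \<Rightarrow> nat \<Rightarrow> real)"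
proof (rule continuous_on_coordinatewise_then_product)
  fix l
  have "continuous_on S (\<lambda>x::nat \<Rightarrow> real. x m)" for m
    by (rule continuous_on_product_then_coordinatewise[OF continuous_on_id])
  then show "continuous_on S (\<lambda>x::nat \<Rightarrow> real. simplical_face i x l)"
    by (cases "l < i"; cases "l = i") (simp_all add: simplical_face_def)
qed

text \<open>Differences on a face start at its own first vertex, which is \<open>skip i 0\<close> in
  the large simplex and differs from \<open>0\<close> exactly when \<open>i = 0\<close>; hence the
  subtracted term.\<close>

lemma dlog_face:
  assumes f: "unit_valued (Suc p) f" and "i \<le> Suc p" "j \<le> p"
  shows "dlog p (\<lambda>x. f (simplical_face i x)) j = dlog (Suc p) f (skip i j) - dlog (Suc p) f (skip i 0)"
proof -
  obtain L where L: "log_lift (Suc p) f L" using f log_lift_exists by metis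
  have mem: "simplical_face i x \<in> standard_simplex (Suc p)" if "x \<in> standard_simplex p" for x :: "nat \<Rightarrow> real"
    using simplical_face_in_standard_simplex[of "Suc p" i x] assms(2) that by simp
  have "log_lift p (\<lambda>x. f (simplical_face i x)) (\<lambda>x. L (simplical_face i x))"
    unfolding log_lift_def
  proof
    show "continuous_on (standard_simplex p) (\<lambda>x. L (simplical_face i x))"
      by (rule continuous_on_compose2[OF _ continuous_on_simplical_face])
         (use L mem in \<open>auto simp: log_lift_def\<close>)
    show "\<forall>x\<in>standard_simplex p. E2 (L (simplical_face i x)) = f (simplical_face i x)"
      using L mem by (auto simp: log_lift_def)
  qed
  from dlog_eqI[OF this assms(3)] show ?thesis
    using dlog_eqI[OF L, of "skip i j"] dlog_eqI[OF L, of "skip i 0"] assms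
    by (simp add: simplical_face_vertex skip_def)
qed

subsection \<open>Volumes of straightened simplices\<close>

text \<open>The column \<open>j\<close> of the matrix consists of \<open>1\<close> and of the coordinates of vertex \<open>j\<close>; the row of
  ones makes the volume translation invariant and turns faces into deleted columns.\<close>

definition volume :: "nat \<Rightarrow> ('x \<Rightarrow> nat \<Rightarrow> complex) \<Rightarrow> 'x list \<Rightarrow> complex"
  where "volume k a xs = dt (Suc k) (\<lambda>i j. if i = 0 then 1 else a (xs ! (i - 1)) j)"

text \<open>Subtracting a multiple of the row of ones from each other row is multiplication by a
  unipotent triangular matrix.\<close>

lemma volume_translate: "volume k (\<lambda>x j. a x j - c x) xs = volume k a xs"
proof -
  let ?T = "\<lambda>i l. if i = l then 1 else if l = 0 then - c (xs ! (i - 1)) else 0"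
  let ?A = "\<lambda>i j. if i = 0 then 1 else a (xs ! (i - 1)) j"
  have T: "dt (Suc k) ?T = 1"
  proof -
    have "dt (Suc k) (\<lambda>i l. ?T l i) = (\<Prod>i<Suc k. ?T i i)" by (rule dt_upper_triangular) auto
    then show ?thesis using dt_transpose[of "Suc k" ?T] by simp
  qed
  have "(\<Sum>l<Suc k. ?T i l * ?A l j) = (if i = 0 then 1 else a (xs ! (i - 1)) j - c (xs ! (i - 1)))"
    if "i < Suc k" for i j
  proof (cases "i = 0")
    case True
    then have "(\<Sum>l<Suc k. ?T i l * ?A l j) = (\<Sum>l<Suc k. if l = 0 then 1 else 0)"
      by (intro sum.cong) auto
    then show ?thesis using True by simp
  next
    case False
    then have "(\<Sum>l<Suc k. ?T i l * ?A l j) = (\<Sum>l<Suc k. (if l = i then a (xs ! (i - 1)) j else 0) + (if l = 0 then - c (xs ! (i - 1)) else 0))"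
      by (intro sum.cong) auto
    also have "\<dots> = a (xs ! (i - 1)) j - c (xs ! (i - 1))"
      unfolding sum.distrib using that by (simp add: sum.delta)
    finally show ?thesis using False by simp
  qed
  then have "dt (Suc k) ?T * dt (Suc k) ?A = volume k (\<lambda>x j. a x j - c x) xs"
    unfolding dt_mult volume_def by (intro dt_cong) simp
  then show ?thesis using T by (simp add: volume_def)
qed

text \<open>A second row of ones makes the determinant vanish. Its expansion along one of these rows
  is the alternating sum over the faces, each of which \<open>volume_translate\<close> rebases at
  its first vertex.\<close>

lemma volume_cocycle:
  "(\<Sum>i\<le>Suc k. (-1) ^ i * volume k (\<lambda>x j. a x (skip i j) - a x (skip i 0)) xs) = 0"
proof -
  let ?F = "\<lambda>i j. if i \<le> Suc 0 then 1 else a (xs ! (i - 2)) j"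
  have "0 = dt (Suc (Suc k)) ?F"
    by (rule dt_equal_rows[of 0 _ 1, symmetric]) auto
  also have "\<dots> = (\<Sum>j\<le>Suc k. (-1) ^ j * dt (Suc k) (\<lambda>i c. ?F (Suc i) (skip j c)))"
    unfolding dt_laplace_row[OF le0] by (simp add: skip_def)
  also have "\<dots> = (\<Sum>j\<le>Suc k. (-1) ^ j * volume k (\<lambda>x c. a x (skip j c)) xs)"
    unfolding volume_def by (intro sum.cong refl arg_cong2[of _ _ _ _ "(*)"] dt_cong) (auto simp: numeral_2_eq_2)
  also have "\<dots> = (\<Sum>j\<le>Suc k. (-1) ^ j * volume k (\<lambda>x c. a x (skip j c) - a x (skip j 0)) xs)"
    by (intro sum.cong refl) (simp add: volume_translate)
  finally show ?thesis by simp
qed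

lemma volume_cong:
  "length xs = k \<Longrightarrow> (\<And>x j. x \<in> set xs \<Longrightarrow> j \<le> k \<Longrightarrow> a x j = b x j) \<Longrightarrow> volume k a xs = volume k b xs"
  unfolding volume_def by (intro dt_cong) auto

lemma volume_map: "length xs = k \<Longrightarrow> volume k a (map f xs) = volume k (\<lambda>x. a (f x)) xs"
  unfolding volume_def by (intro dt_cong) auto

lemma alternating_volume:
  assumes a: "\<And>x y j. \<lbrakk>x \<in> carrier A; y \<in> carrier A; j \<le> k\<rbrakk> \<Longrightarrow> a (x \<otimes>\<^bsub>A\<^esub> y) j = a x j + a y j"
  shows "alternating k A (volume k a)"
  unfolding alternating_def
proof (intro conjI ballI allI impI)
  fix xs i x y assume xs: "xs \<in> tuples k A" "i < k" "x \<in> carrier A" "y \<in> carrier A"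
  let ?f = "\<lambda>l j. if l = 0 then 1 else a (xs ! (l - 1)) j"
  have *: "volume k a (xs[i := z]) = dt (Suc k) (\<lambda>l j. if l = Suc i then a z j else ?f l j)" for z
    unfolding volume_def using xs by (intro dt_cong) (auto simp: tuples_def nth_list_update)
  have "volume k a (xs[i := x \<otimes>\<^bsub>A\<^esub> y]) = dt (Suc k) (\<lambda>l j. if l = Suc i then a x j + a y j else ?f l j)"
    unfolding * using a[OF xs(3,4)] by (intro dt_cong) auto
  then show "volume k a (xs[i := x \<otimes>\<^bsub>A\<^esub> y]) = volume k a (xs[i := x]) + volume k a (xs[i := y])"
    unfolding * using dt_row_add[of "Suc i" "Suc k" "a x" "a y" ?f] xs(2) by simp
next
  fix xs i j assume "xs \<in> tuples k A" "j < k" "i < j" "xs ! i = xs ! j"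
  then show "volume k a xs = 0"
    unfolding volume_def by (intro dt_equal_rows[of "Suc i" _ "Suc j"]) auto
qed

section \<open>Fundamental cycles of coordinate tori\<close>

text \<open>The cube is cut into the simplices with vertices
  \<open>0, e\<^sub>{q\<^sup>-\<^sup>1(1)}, e\<^sub>{q\<^sup>-\<^sup>1(1)} + e\<^sub>{q\<^sup>-\<^sup>1(2)}, \<dots>\<close>; coordinate \<open>m\<close> is \<open>x\<^sub>{q(m)} + \<dots> + x\<^sub>k\<close>
  in barycentric coordinates.\<close>

definition torus_simplex :: "nat \<Rightarrow> ((nat \<Rightarrow> complex) \<Rightarrow> 'p) \<Rightarrow> (nat \<Rightarrow> nat) \<Rightarrow> (nat \<Rightarrow> real) \<Rightarrow> 'p"
  where "torus_simplex k \<Phi> q = restrict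
    (\<lambda>x. \<Phi> (\<lambda>m. if m \<in> {1..k} then E2 (of_real (\<Sum>l=q m..k. x l)) else 1)) (standard_simplex k)"

definition torus_cycle :: "nat \<Rightarrow> ((nat \<Rightarrow> complex) \<Rightarrow> 'p) \<Rightarrow> 'p chain"
  where "torus_cycle k \<Phi> =
    (\<Sum>q\<in>{q. q permutes {1..k}}. frag_cmul (sign q) (frag_of (torus_simplex k \<Phi> q)))"

text \<open>The cyclic shift that matches the face opposite vertex \<open>0\<close> with the face
  opposite vertex \<open>k\<close> once opposite sides of the cube are glued.\<close>

definition cyc :: "nat \<Rightarrow> nat \<Rightarrow> nat"
  where "cyc k j = (if j = 1 then k else if 2 \<le> j \<and> j \<le> k then j - 1 else j)"

lemma cyc_permutes_sign: "k \<ge> 1 \<Longrightarrow> cyc k permutes {1..k} \<and> sign (cyc k) = (-1) ^ (k - 1)"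
proof (induction k rule: dec_induct)
  case base
  have "cyc 1 = id" by (auto simp: cyc_def fun_eq_iff)
  then show ?case using permutes_id[of "{1..1}"] sign_id by (metis diff_self_eq_0 power_0)
next
  case (step k)
  let ?t = "Transposition.transpose k (Suc k)"
  have eq: "cyc (Suc k) = ?t \<circ> cyc k"
    using step.hyps by (auto simp: cyc_def fun_eq_iff Transposition.transpose_def)
  have p: "cyc k permutes {1..Suc k}"
    using step.IH permutes_subset[of "cyc k" "{1..k}" "{1..Suc k}"] by auto
  have t: "?t permutes {1..Suc k}" using step.hyps by (intro permutes_swap_id) auto
  have "sign (?t \<circ> cyc k) = sign ?t * sign (cyc k)"
    by (intro sign_compose permutes_imp_permutation[OF _ t] permutes_imp_permutation[OF _ p]) auto
  also have "\<dots> = (-1) ^ (Suc k - 1)"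
    using step by (cases k) (auto simp: sign_swap_id)
  finally show ?case unfolding eq by (intro conjI permutes_compose[OF p t])
qed

text \<open>On face \<open>i\<close> the barycentric coordinate \<open>i\<close> is zero, so the
  tails starting at \<open>i\<close> and at \<open>i + 1\<close> agree and exchanging these two
  values of \<open>q\<close> changes nothing.\<close>

lemma singular_face_torus_inner:
  assumes "1 \<le> i" "i < k"
  shows "singular_face k i (torus_simplex k \<Phi> (Transposition.transpose i (Suc i) \<circ> q)) =
         singular_face k i (torus_simplex k \<Phi> q)"
  unfolding singular_face_def
proof (rule restrict_ext)
  fix y assume y: "y \<in> standard_simplex (k - Suc 0)"
  let ?x = "simplical_face i y"
  have x: "?x \<in> standard_simplex k" using simplical_face_in_standard_simplex[of k i y] assms y by simp
  have xi: "?x i = 0" by (simp add: simplical_face_def)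
  have s: "(\<Sum>l=i..k. ?x l) = (\<Sum>l=Suc i..k. ?x l)"
    using assms xi by (subst sum.atLeast_Suc_atMost) auto
  have "(\<Sum>l=(Transposition.transpose i (Suc i) \<circ> q) m..k. ?x l) = (\<Sum>l=q m..k. ?x l)" for m
    using s by (cases "q m = i"; cases "q m = Suc i") (auto simp: Transposition.transpose_def)
  then have e: "(\<lambda>m. if m \<in> {1..k} then E2 (of_real (\<Sum>l=(Transposition.transpose i (Suc i) \<circ> q) m..k. ?x l)) else 1) =
      (\<lambda>m. if m \<in> {1..k} then E2 (of_real (\<Sum>l=q m..k. ?x l)) else 1)" by metis
  show "(torus_simplex k \<Phi> (Transposition.transpose i (Suc i) \<circ> q) \<circ> simplical_face i) y =
      (torus_simplex k \<Phi> q \<circ> simplical_face i) y"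
    using e unfolding comp_apply torus_simplex_def restrict_apply'[OF x] by (rule arg_cong[of _ _ \<Phi>])
qed

text \<open>On face \<open>0\<close> the coordinate with \<open>q m = 1\<close> has tail 1; on face
  \<open>k\<close> the matching one has tail 0. \<open>E2\<close> sends both to the same point. All
  other tails shift by one.\<close>

lemma singular_face_torus_ends:
  assumes k: "1 \<le> k" and q: "q permutes {1..k}"
  shows "singular_face k 0 (torus_simplex k \<Phi> q) = singular_face k k (torus_simplex k \<Phi> (cyc k \<circ> q))"
  unfolding singular_face_def
proof (rule restrict_ext)
  fix y assume y: "y \<in> standard_simplex (k - Suc 0)"
  let ?x = "simplical_face 0 y" and ?x' = "simplical_face k y"
  have x: "?x \<in> standard_simplex k" "?x' \<in> standard_simplex k"
    using simplical_face_in_standard_simplex[of k _ y] k y by simp_all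
  have "E2 (of_real (\<Sum>l=a..k. ?x l)) = E2 (of_real (\<Sum>l=cyc k a..k. ?x' l))" if a: "a \<in> {1..k}" for a
  proof -
    have "(\<Sum>l=a..k. ?x l) = (\<Sum>l=Suc (a - 1)..Suc (k - 1). y (l - 1))"
      using a by (intro sum.cong) (auto simp: simplical_face_def)
    also have "\<dots> = (\<Sum>l=a - 1..k - 1. y l)"
      by (subst sum.shift_bounds_cl_Suc_ivl) simp
    finally have 1: "(\<Sum>l=a..k. ?x l) = (\<Sum>l=a - 1..k - 1. y l)" .
    have 2: "(\<Sum>l=c..k. ?x' l) = (\<Sum>l\<in>{c..<k}. y l)" if "c \<le> k" for c
    proof -
      have "(\<Sum>l=c..k. ?x' l) = (\<Sum>l\<in>{c..<k}. ?x' l)"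
        using that by (intro sum.mono_neutral_right) (auto simp: simplical_face_def)
      then show ?thesis by (simp add: simplical_face_def)
    qed
    show ?thesis
    proof (cases "a = 1")
      case True
      have "(\<Sum>l=0..k - 1. y l) = 1" using y by (simp add: standard_simplex_def atMost_atLeast0)
      then show ?thesis using True 1 2[of k] exp_two_pi_i by (simp add: cyc_def mult_ac)
    next
      case False
      then have "cyc k a = a - 1" "{a - 1..<k} = {a - 1..k - 1}" using a by (auto simp: cyc_def)
      moreover have "a - 1 \<le> k" using a by auto
      ultimately show ?thesis unfolding 1 using 2[of "a - 1"] by simp
    qed
  qed
  moreover have "q m \<in> {1..k}" if "m \<in> {1..k}" for m using permutes_in_image[OF q, of m] that by simp
  ultimately have "(\<lambda>m. if m \<in> {1..k} then E2 (of_real (\<Sum>l=q m..k. ?x l)) else 1) =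
     (\<lambda>m. if m \<in> {1..k} then E2 (of_real (\<Sum>l=(cyc k \<circ> q) m..k. ?x' l)) else 1)"
    by (auto simp: fun_eq_iff)
  then show "(torus_simplex k \<Phi> q \<circ> simplical_face 0) y = (torus_simplex k \<Phi> (cyc k \<circ> q) \<circ> simplical_face k) y"
    unfolding comp_apply torus_simplex_def restrict_apply'[OF x(1)] restrict_apply'[OF x(2)]
    by (rule arg_cong[of _ _ \<Phi>])
qed

lemma frag_eq_minus_self: "(u :: 'a \<Rightarrow>\<^sub>0 int) = - u \<Longrightarrow> u = 0"
proof (rule poly_mapping_eqI)
  fix x assume "u = - u"
  then have "Poly_Mapping.lookup u x = - Poly_Mapping.lookup u x" by (metis lookup_uminus)
  then show "Poly_Mapping.lookup u x = Poly_Mapping.lookup 0 x" by simp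
qed

text \<open>Inner faces cancel in pairs under adjacent transpositions. For the two outer faces the
  sign \<open>(-1) ^ (k - 1)\<close> of \<open>cyc k\<close> is opposite to the sign
  \<open>(-1) ^ k\<close> of the last face.\<close>

lemma chain_boundary_torus_cycle: "chain_boundary k (torus_cycle k \<Phi>) = 0"
proof (cases "k = 0")
  case True
  then show ?thesis by (simp add: chain_boundary_def)
next
  case False
  then have k: "1 \<le> k" by simp
  let ?P = "{q. q permutes {1..k}}"
  let ?F = "\<lambda>i q. frag_of (singular_face k i (torus_simplex k \<Phi> q))"
  define S where "S i = (\<Sum>q\<in>?P. frag_cmul (sign q) (?F i q))" for i
  have sgn: "sign (t \<circ> q) = sign t * sign q" if "t permutes {1..k}" "q permutes {1..k}" for t q :: "nat \<Rightarrow> nat"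
    using that by (intro sign_compose permutes_imp_permutation[of "{1..k}"]) auto
  have "chain_boundary k (torus_cycle k \<Phi>) =
      (\<Sum>q\<in>?P. \<Sum>i\<le>k. frag_cmul ((-1) ^ i) (frag_cmul (sign q) (?F i q)))"
    unfolding torus_cycle_def chain_boundary_sum
    using False by (intro sum.cong refl) (simp add: chain_boundary_cmul chain_boundary_of frag_cmul_sum mult.commute)
  also have "\<dots> = (\<Sum>i\<le>k. frag_cmul ((-1) ^ i) (S i))"
    unfolding S_def frag_cmul_sum by (subst sum.swap) (simp add: comp_def)
  also have "\<dots> = (\<Sum>i\<in>{0, k}. frag_cmul ((-1) ^ i) (S i))"
  proof (rule sum.mono_neutral_right)
    show "\<forall>i\<in>{..k} - {0, k}. frag_cmul ((-1) ^ i) (S i) = 0"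
    proof
      fix i assume "i \<in> {..k} - {0, k}"
      then have i: "1 \<le> i" "i < k" by auto
      let ?t = "Transposition.transpose i (Suc i)"
      have t: "?t permutes {1..k}" using i by (intro permutes_swap_id) auto
      have "S i = (\<Sum>q\<in>?P. frag_cmul (sign (?t \<circ> q)) (?F i (?t \<circ> q)))"
        unfolding S_def by (rule setum_permutations_compose_left[OF t])
      also have "\<dots> = (\<Sum>q\<in>?P. - frag_cmul (sign q) (?F i q))"
        using sgn[OF t] by (intro sum.cong refl) (simp add: singular_face_torus_inner[OF i] sign_swap_id)
      also have "\<dots> = - S i" unfolding S_def by (rule sum_negf)
      finally have "S i = 0" by (rule frag_eq_minus_self)
      then show "frag_cmul ((-1) ^ i) (S i) = 0" by simp
    qed
  qed auto
  also have "\<dots> = S 0 + frag_cmul ((-1) ^ k) (S k)" using False by simp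
  also have "S 0 = frag_cmul ((-1) ^ (k - 1)) (S k)"
  proof -
    have c: "cyc k permutes {1..k}" "sign (cyc k) = (-1) ^ (k - 1)" using cyc_permutes_sign[OF k] by auto
    have "S k = (\<Sum>q\<in>?P. frag_cmul (sign (cyc k \<circ> q)) (?F k (cyc k \<circ> q)))"
      unfolding S_def by (rule setum_permutations_compose_left[OF c(1)])
    also have "\<dots> = (\<Sum>q\<in>?P. frag_cmul ((-1) ^ (k - 1)) (frag_cmul (sign q) (?F 0 q)))"
      using sgn[OF c(1)] c(2) by (intro sum.cong refl) (simp add: singular_face_torus_ends[OF k])
    also have "\<dots> = frag_cmul ((-1) ^ (k - 1)) (S 0)" by (simp add: S_def frag_cmul_sum comp_def)
    finally show ?thesis by (simp add: power_add[symmetric] flip: mult_2)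
  qed
  also have "frag_cmul ((-1) ^ (k - 1)) (S k) + frag_cmul ((-1) ^ k) (S k) = 0"
    using k by (cases k) (simp_all add: frag_cmul_distrib[symmetric])
  finally show ?thesis .
qed

lemma singular_cycle_torus_cycle:
  assumes "\<And>q. q permutes {1..k} \<Longrightarrow> singular_simplex k X (torus_simplex k \<Phi> q)"
  shows "singular_relcycle k X {} (torus_cycle k \<Phi>)"
proof -
  have "singular_chain k X (torus_cycle k \<Phi>)"
    unfolding torus_cycle_def
    by (intro singular_chain_sum singular_chain_cmul) (simp add: singular_chain_of assms)
  then show ?thesis unfolding singular_cycle using chain_boundary_torus_cycle by blast
qed

lemma frag_lin_torus_cycle:
  "frag_lin h (torus_cycle k \<Phi>) = (\<Sum>q\<in>{q. q permutes {1..k}}. of_int (sign q) * h (torus_simplex k \<Phi> q))"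
  by (simp add: torus_cycle_def frag_lin_sum frag_lin_cmul)

text \<open>Here a lift is known: the sum itself, which is 0 at vertex \<open>0\<close> because
  \<open>1 \<le> c\<close>, and at vertex \<open>j\<close> is 1 precisely if the sum includes the
  index \<open>j\<close>.\<close>

lemma dlog_partial_sum:
  assumes "1 \<le> c" "j \<le> k"
  shows "dlog k (\<lambda>y. E2 (of_real (\<Sum>l=c..k. y l))) j = (if c \<le> j then 1 else 0)"
proof -
  have "continuous_on S (\<lambda>x::nat \<Rightarrow> real. x m)" for m S
    by (rule continuous_on_product_then_coordinatewise[OF continuous_on_id])
  then have "log_lift k (\<lambda>y. E2 (of_real (\<Sum>l=c..k. y l))) (\<lambda>y. of_real (\<Sum>l=c..k. y l))"
    unfolding log_lift_def by (auto intro!: continuous_on_of_real continuous_on_sum)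
  from dlog_eqI[OF this assms(2)] show ?thesis using assms by (auto simp: sum.delta)
qed

text \<open>Since \<open>q\<close> fixes \<open>0\<close>, the row of ones is the case
  \<open>i = 0\<close> of the general pattern, and undoing \<open>q\<close> leaves the upper
  triangular matrix of ones.\<close>

lemma dt_permuted_triangle:
  assumes "q permutes {1..k}"
  shows "dt (Suc k) (\<lambda>i j. if i = 0 then 1 else if q i \<le> j then 1 else 0) = (of_int (sign q) :: complex)"
proof -
  have q: "q permutes {..<Suc k}" by (rule permutes_subset[OF assms]) auto
  have q0: "q 0 = 0" using assms permutes_not_in[OF assms, of 0] by simp
  have "dt (Suc k) (\<lambda>i j. if i = 0 then 1 else if q i \<le> j then 1 else 0 :: complex) =
      dt (Suc k) (\<lambda>i j. if q i \<le> j then 1 else 0)"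
    using q0 by (intro dt_cong) auto
  also have "\<dots> = of_int (sign q) * dt (Suc k) (\<lambda>i j. if i \<le> j then 1 else 0)"
    by (rule dt_permute_rows[OF q])
  also have "dt (Suc k) (\<lambda>i j. if i \<le> j then 1 else 0 :: complex) = 1"
    by (subst dt_upper_triangular) auto
  finally show ?thesis by simp
qed

section \<open>Cohomology as the dual of homology\<close>

text \<open>Injectivity makes the determinant nonzero, and the adjugate supplies the
  solution.\<close>

lemma injective_linear_system_solvable:
  fixes A :: "nat \<Rightarrow> nat \<Rightarrow> complex"
  assumes inj: "\<And>v. (\<And>i. i < n \<Longrightarrow> (\<Sum>j<n. A i j * v j) = 0) \<Longrightarrow> (\<forall>j<n. v j = 0)"
  shows "\<exists>v. \<forall>i<n. (\<Sum>j<n. A i j * v j) = x i"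
proof -
  let ?A = "mat n n (\<lambda>(i, j). A i j)"
  have mv: "(?A *\<^sub>v w) $ i = (\<Sum>j<n. A i j * w $ j)" if "w \<in> carrier_vec n" "i < n" for w i
    using that by (simp add: scalar_prod_def atLeast0LessThan)
  have "det ?A \<noteq> 0"
  proof
    assume "det ?A = 0"
    then obtain w where w: "w \<in> carrier_vec n" "w \<noteq> 0\<^sub>v n" "?A *\<^sub>v w = 0\<^sub>v n"
      using det_0_iff_vec_prod_zero_field[of ?A n] by auto
    have "(\<Sum>j<n. A i j * w $ j) = 0" if "i < n" for i
      using mv[OF w(1) that] w(3) that by simp
    then have "\<forall>j<n. w $ j = 0" using inj[of "\<lambda>j. w $ j"] by blast
    then have "w = 0\<^sub>v n" using w(1) by (intro eq_vecI) auto
    then show False using w(2) by blast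
  qed
  define w where "w = (1 / det ?A) \<cdot>\<^sub>v (adj_mat ?A *\<^sub>v vec n x)"
  have adj: "adj_mat ?A \<in> carrier_mat n n" "?A * adj_mat ?A = det ?A \<cdot>\<^sub>m 1\<^sub>m n"
    using adj_mat[of ?A n] by auto
  have w: "w \<in> carrier_vec n" using adj(1) by (auto simp: w_def)
  have "?A *\<^sub>v w = (1 / det ?A) \<cdot>\<^sub>v (?A *\<^sub>v (adj_mat ?A *\<^sub>v vec n x))"
    unfolding w_def using adj(1) by (intro mult_mat_vec) auto
  also have "?A *\<^sub>v (adj_mat ?A *\<^sub>v vec n x) = (det ?A \<cdot>\<^sub>m 1\<^sub>m n) *\<^sub>v vec n x"
    using assoc_mult_mat_vec[of ?A n n "adj_mat ?A" n "vec n x"] adj by simp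
  also have "\<dots> = det ?A \<cdot>\<^sub>v vec n x" by (auto intro!: eq_vecI)
  finally have "?A *\<^sub>v w = vec n x" using \<open>det ?A \<noteq> 0\<close> by (auto intro!: eq_vecI)
  then have "(\<Sum>j<n. A i j * w $ j) = x i" if "i < n" for i using mv[OF w that] that by simp
  then show ?thesis by blast
qed

section \<open>Cochains, cocycles and coboundaries as functions on singular simplices\<close>

context
  fixes k :: nat and X :: "'p topology"
begin

text \<open>Every cochain has this form (\<open>cochain_eq_coch\<close>), so cochain groups are
  calculated with functions on simplices. Changing \<open>h\<close> off the singular simplices of
  \<open>X\<close> does not change the cochain (\<open>coch_cong\<close>).\<close>

definition coch :: "(((nat \<Rightarrow> real) \<Rightarrow> 'p) \<Rightarrow> complex) \<Rightarrow> 'p cochain"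
  where "coch h = restrict (frag_lin h) (singular_chain_set k X)"

lemma coch_in: "coch h \<in> cochain_set k X"
  by (auto simp: coch_def cochain_set_def hom_def complex_add_group_def frag_lin_add
      intro: singular_chain_add)

lemma coch_cong: "(\<And>\<sigma>. singular_simplex k X \<sigma> \<Longrightarrow> h \<sigma> = h' \<sigma>) \<Longrightarrow> coch h = coch h'"
  unfolding coch_def by (rule restrict_ext) (auto simp: frag_lin_def singular_chain_def intro!: sum.cong)

lemma cochain_eq_coch:
  assumes c: "c \<in> cochain_set k X" shows "c = coch (\<lambda>\<sigma>. c (frag_of \<sigma>))"
proof
  fix u
  have add: "c (u + v) = c u + c v" if "singular_chain k X u" "singular_chain k X v" for u v
    using c that by (simp add: cochain_set_def hom_def complex_add_group_def)
  have "c 0 = 0" using add[of 0 0] by simp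
  then have minus: "c (- v) = - c v" if "singular_chain k X v" for v
    using add[of v "- v"] that by (simp add: singular_chain_minus add_eq_0_iff)
  have diff: "c (u - v) = c u - c v" if "singular_chain k X u" "singular_chain k X v" for u v
    using add[of u "- v"] minus[of v] that by (simp add: singular_chain_minus)
  show "c u = coch (\<lambda>\<sigma>. c (frag_of \<sigma>)) u"
  proof (cases "singular_chain k X u")
    case True
    then have "Poly_Mapping.keys u \<subseteq> singular_simplex_set k X" by (simp add: singular_chain_def)
    then have "c u = frag_lin (\<lambda>\<sigma>. c (frag_of \<sigma>)) u"
      by (rule free_Abelian_group_induct)
         (auto simp: \<open>c 0 = 0\<close> diff frag_lin_diff singular_chain_def)
    then show ?thesis using True by (simp add: coch_def)
  next
    case False
    then show ?thesis using c by (simp add: coch_def cochain_set_def extensional_def)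
  qed
qed

lemma cochain_set_eq: "cochain_set k X = range coch"
  using coch_in cochain_eq_coch by blast

lemma coch_mult: "coch h \<otimes>\<^bsub>cochain_group k X\<^esub> coch h' = coch (\<lambda>\<sigma>. h \<sigma> + h' \<sigma>)"
  unfolding cochain_group_def
  by (auto simp: coch_def fun_eq_iff frag_lin_def sum.distrib ring_distribs)

lemma coch_one: "\<one>\<^bsub>cochain_group k X\<^esub> = coch (\<lambda>\<sigma>. 0)"
  unfolding cochain_group_def by (auto simp: coch_def fun_eq_iff frag_lin_def)

lemma coch_scale: "cochain_scale k X a (coch h) = coch (\<lambda>\<sigma>. a * h \<sigma>)"
  by (auto simp: cochain_scale_def coch_def fun_eq_iff frag_lin_def sum_distrib_left mult_ac)

lemma carrier_cochain_group: "carrier (cochain_group k X) = range coch"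
  by (simp add: cochain_group_def cochain_set_eq)

lemma comm_group_cochain_group: "comm_group (cochain_group k X)"
proof (rule comm_groupI)
  fix x y assume "x \<in> carrier (cochain_group k X)" "y \<in> carrier (cochain_group k X)"
  then obtain h h' where hh: "x = coch h" "y = coch h'" by (auto simp: carrier_cochain_group)
  show "x \<otimes>\<^bsub>cochain_group k X\<^esub> y \<in> carrier (cochain_group k X)"
    by (simp add: hh coch_mult carrier_cochain_group)
  show "x \<otimes>\<^bsub>cochain_group k X\<^esub> y = y \<otimes>\<^bsub>cochain_group k X\<^esub> x"
    by (simp add: hh coch_mult add.commute)
  show "\<one>\<^bsub>cochain_group k X\<^esub> \<otimes>\<^bsub>cochain_group k X\<^esub> x = x"
    by (simp add: hh coch_mult coch_one)
  have "coch (\<lambda>\<sigma>. - h \<sigma>) \<otimes>\<^bsub>cochain_group k X\<^esub> x = \<one>\<^bsub>cochain_group k X\<^esub>"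
    by (simp add: hh coch_mult coch_one)
  then show "\<exists>y\<in>carrier (cochain_group k X). y \<otimes>\<^bsub>cochain_group k X\<^esub> x = \<one>\<^bsub>cochain_group k X\<^esub>"
    by (auto simp: carrier_cochain_group)
  fix z assume "z \<in> carrier (cochain_group k X)"
  then obtain h'' where h'': "z = coch h''" by (auto simp: carrier_cochain_group)
  show "x \<otimes>\<^bsub>cochain_group k X\<^esub> y \<otimes>\<^bsub>cochain_group k X\<^esub> z = x \<otimes>\<^bsub>cochain_group k X\<^esub> (y \<otimes>\<^bsub>cochain_group k X\<^esub> z)"
    by (simp add: hh h'' coch_mult add.assoc)
qed (auto simp: carrier_cochain_group coch_one)

lemma coch_inv: "inv\<^bsub>cochain_group k X\<^esub> coch h = coch (\<lambda>\<sigma>. - h \<sigma>)"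
proof -
  interpret comm_group "cochain_group k X" by (rule comm_group_cochain_group)
  show ?thesis by (rule inv_equality) (auto simp: coch_mult coch_one carrier_cochain_group)
qed

definition cocycle_fun :: "(((nat \<Rightarrow> real) \<Rightarrow> 'p) \<Rightarrow> complex) \<Rightarrow> bool"
  where "cocycle_fun h \<longleftrightarrow> (\<forall>u. singular_chain (Suc k) X u \<longrightarrow> frag_lin h (chain_boundary (Suc k) u) = 0)"

lemma cocycle_funI:
  assumes "\<And>\<tau>. singular_simplex (Suc k) X \<tau> \<Longrightarrow> (\<Sum>i\<le>Suc k. (-1) ^ i * h (singular_face (Suc k) i \<tau>)) = 0"
  shows "cocycle_fun h"
  unfolding cocycle_fun_def
proof (intro allI impI)
  fix u assume "singular_chain (Suc k) X u"
  then have "Poly_Mapping.keys u \<subseteq> singular_simplex_set (Suc k) X" by (simp add: singular_chain_def)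
  then show "frag_lin h (chain_boundary (Suc k) u) = 0"
    by (rule free_Abelian_group_induct)
       (auto simp: chain_boundary_diff frag_lin_diff chain_boundary_of frag_lin_sum frag_lin_cmul assms
         simp del: sum.atMost_Suc)
qed

lemma cocycle_set_eq: "cocycle_set k X = coch ` Collect cocycle_fun"
proof -
  have "coboundary (Suc k) X (coch h) = \<one>\<^bsub>cochain_group (Suc k) X\<^esub> \<longleftrightarrow> cocycle_fun h" for h
    unfolding coboundary_def cochain_group_def cocycle_fun_def
    by (auto simp: fun_eq_iff compose_def coch_def singular_chain_boundary_alt)
  then show ?thesis unfolding cocycle_set_def cochain_set_eq by auto
qed

lemma subgroup_cocycle_set: "subgroup (cocycle_set k X) (cochain_group k X)"
proof -
  interpret comm_group "cochain_group k X" by (rule comm_group_cochain_group)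
  have add: "cocycle_fun (\<lambda>\<sigma>. h \<sigma> + h' \<sigma>)" if "cocycle_fun h" "cocycle_fun h'" for h h'
    using that by (simp add: cocycle_fun_def frag_lin_def sum.distrib ring_distribs)
  have minus: "cocycle_fun (\<lambda>\<sigma>. - h \<sigma>)" if "cocycle_fun h" for h
    using that by (simp add: cocycle_fun_def frag_lin_def sum_negf)
  have zero: "cocycle_fun (\<lambda>\<sigma>. 0)" by (simp add: cocycle_fun_def frag_lin_def)
  show ?thesis
    by unfold_locales
       (auto simp: cocycle_set_eq carrier_cochain_group coch_mult coch_one coch_inv intro!: add minus zero imageI)
qed

lemma carrier_cocycle_group: "carrier (cocycle_group k X) = coch ` Collect cocycle_fun"
  unfolding cocycle_group_def
  using subgroup.carrier_subgroup_generated_subgroup[OF subgroup_cocycle_set] cocycle_set_eq by simp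

lemma comm_group_cocycle_group: "comm_group (cocycle_group k X)"
  unfolding cocycle_group_def
  by (rule group.abelian_subgroup_generated[OF comm_group.axioms(2)[OF comm_group_cochain_group] comm_group_cochain_group])

lemma cocycle_group_simps:
  "coch h \<otimes>\<^bsub>cocycle_group k X\<^esub> coch h' = coch (\<lambda>\<sigma>. h \<sigma> + h' \<sigma>)"
  "\<one>\<^bsub>cocycle_group k X\<^esub> = coch (\<lambda>\<sigma>. 0)"
  by (simp_all add: cocycle_group_def coch_mult coch_one)

lemma cocycle_group_inv:
  assumes "cocycle_fun h" shows "inv\<^bsub>cocycle_group k X\<^esub> coch h = coch (\<lambda>\<sigma>. - h \<sigma>)"
proof -
  interpret comm_group "cocycle_group k X" by (rule comm_group_cocycle_group)
  have "cocycle_fun (\<lambda>\<sigma>. - h \<sigma>)" using assms by (simp add: cocycle_fun_def frag_lin_def sum_negf)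
  then show ?thesis using assms
    by (intro inv_equality) (auto simp: cocycle_group_simps carrier_cocycle_group)
qed

lemma cocycle_fun_scale: "cocycle_fun h \<Longrightarrow> cocycle_fun (\<lambda>\<sigma>. a * h \<sigma>)"
  by (simp add: cocycle_fun_def frag_lin_def mult.left_commute[of _ a] sum_distrib_left[symmetric])

lemma cocycle_fun_sum:
  assumes "\<And>b. b \<in> I \<Longrightarrow> cocycle_fun (w b)" shows "cocycle_fun (\<lambda>\<sigma>. \<Sum>b\<in>I. c b * w b \<sigma>)"
proof -
  have "frag_lin (\<lambda>\<sigma>. \<Sum>b\<in>I. c b * w b \<sigma>) u = (\<Sum>b\<in>I. c b * frag_lin (w b) u)" for u
    unfolding frag_lin_def sum_distrib_left by (subst sum.swap) (simp add: mult_ac)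
  then show ?thesis using assms by (simp add: cocycle_fun_def)
qed

lemma scalar_module_cocycle_group: "scalar_module (cocycle_group k X) (cochain_scale k X)"
proof -
  interpret comm_group "cocycle_group k X" by (rule comm_group_cocycle_group)
  show ?thesis
    by unfold_locales
       (auto simp: carrier_cocycle_group coch_scale cocycle_group_simps cocycle_fun_scale
         ring_distribs mult_ac)
qed

lemma lc_cocycle_group:
  assumes "\<And>b. b \<in> I \<Longrightarrow> cocycle_fun (w b)"
  shows "scalar_module.lc (cocycle_group k X) (cochain_scale k X) c (\<lambda>b. coch (w b)) I =
    coch (\<lambda>\<sigma>. \<Sum>b\<in>I. c b * w b \<sigma>)"
proof -
  interpret scalar_module "cocycle_group k X" "cochain_scale k X" by (rule scalar_module_cocycle_group)
  show ?thesis
    using assms unfolding lc_def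
    by (induction I rule: infinite_finite_induct)
       (simp_all add: cocycle_group_simps coch_scale carrier_cocycle_group cocycle_fun_scale Pi_iff)
qed

text \<open>The vanishing of Ext into the complex numbers in concrete form: a cochain that vanishes
  on cycles factors through the boundary map, and the resulting functional on boundaries extends to
  all chains.\<close>

lemma coboundary_set_eq:
  "coboundary_set k X = coch ` {h. \<forall>u. singular_relcycle k X {} u \<longrightarrow> frag_lin h u = 0}"
proof (intro equalityI subsetI)
  fix x assume "x \<in> coboundary_set k X"
  then obtain c where c: "c \<in> cochain_set (k - 1) X" "x = coboundary k X c"
    unfolding coboundary_set_def by blast
  have add: "c (u + v) = c u + c v" if "singular_chain (k - 1) X u" "singular_chain (k - 1) X v" for u v
    using c(1) that by (simp add: cochain_set_def hom_def complex_add_group_def)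
  have c0: "c 0 = 0" using add[of 0 0] by simp
  have "x \<in> cochain_set k X"
    unfolding c(2) coboundary_def cochain_set_def
    using singular_chain_boundary[of k X] add
    by (auto simp: hom_def complex_add_group_def compose_def chain_boundary_add singular_chain_add)
  then have x: "x = coch (\<lambda>\<sigma>. x (frag_of \<sigma>))" by (rule cochain_eq_coch)
  have "frag_lin (\<lambda>\<sigma>. x (frag_of \<sigma>)) u = 0" if u: "singular_relcycle k X {} u" for u
  proof -
    have uc: "singular_chain k X u" "chain_boundary k u = 0" using u by (auto simp: singular_cycle)
    have "frag_lin (\<lambda>\<sigma>. x (frag_of \<sigma>)) u = x u" using fun_cong[OF x, of u] uc by (simp add: coch_def)
    also have "\<dots> = c (chain_boundary k u)" unfolding c(2) coboundary_def using uc by (simp add: compose_def)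
    finally show ?thesis using uc c0 by simp
  qed
  then show "x \<in> coch ` {h. \<forall>u. singular_relcycle k X {} u \<longrightarrow> frag_lin h u = 0}"
    by (subst x) (rule imageI, simp)
next
  fix x assume "x \<in> coch ` {h. \<forall>u. singular_relcycle k X {} u \<longrightarrow> frag_lin h u = 0}"
  then obtain h where h: "x = coch h" and z: "\<And>u. singular_relcycle k X {} u \<Longrightarrow> frag_lin h u = 0" by blast
  let ?B = "chain_boundary k ` singular_chain_set k X"
  \<comment> \<open>Well defined on boundaries because two preimages differ by a cycle, where
    \<open>h\<close> vanishes.\<close>
  define f where "f = (\<lambda>v. frag_lin h (SOME u. singular_chain k X u \<and> chain_boundary k u = v))"
  have f: "f (chain_boundary k u) = frag_lin h u" if u: "singular_chain k X u" for u
  proof -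
    let ?u = "SOME u'. singular_chain k X u' \<and> chain_boundary k u' = chain_boundary k u"
    have u': "singular_chain k X ?u \<and> chain_boundary k ?u = chain_boundary k u"
      by (rule someI[of _ u]) (use u in simp)
    then have "singular_relcycle k X {} (?u - u)"
      using u by (simp add: singular_cycle singular_chain_diff chain_boundary_diff)
    from z[OF this] show ?thesis by (simp add: f_def frag_lin_diff)
  qed
  obtain F where F: "\<And>u v. F (u + v) = F u + F v" "\<And>u. u \<in> ?B \<Longrightarrow> F u = f u"
  proof (rule additive_extension[of ?B f])
    show "0 \<in> ?B" by (rule image_eqI[of _ _ 0]) auto
    fix u v assume "u \<in> ?B" "v \<in> ?B"
    then obtain u' v' where uv: "u = chain_boundary k u'" "v = chain_boundary k v'"
      "singular_chain k X u'" "singular_chain k X v'" by blast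
    have d: "u - v = chain_boundary k (u' - v')" "singular_chain k X (u' - v')"
      using uv by (auto simp: chain_boundary_diff singular_chain_diff)
    show "u - v \<in> ?B" unfolding d(1) using d(2) by blast
    have "f (u - v) = frag_lin h (u' - v')" unfolding d(1) by (rule f[OF d(2)])
    moreover have "f u = frag_lin h u'" "f v = frag_lin h v'" unfolding uv(1,2) by (rule f, rule uv)+
    ultimately show "f (u - v) = f u - f v" by (simp only: frag_lin_diff)
  qed blast
  let ?c = "restrict F (singular_chain_set (k - 1) X)"
  have "?c \<in> cochain_set (k - 1) X"
    by (auto simp: cochain_set_def hom_def complex_add_group_def F(1) singular_chain_add)
  moreover have "x = coboundary k X ?c"
    unfolding h coboundary_def compose_def coch_def carrier_chain_group
  proof (rule restrict_ext)
    fix u assume "u \<in> singular_chain_set k X"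
    then have u: "singular_chain k X u" by simp
    then show "frag_lin h u = ?c (chain_boundary k u)"
      using singular_chain_boundary[OF u] F(2)[of "chain_boundary k u"] f[OF u] by auto
  qed
  ultimately show "x \<in> coboundary_set k X" unfolding coboundary_set_def by blast
qed

lemma coboundary_coch_iff:
  "coch h \<in> coboundary_set k X \<longleftrightarrow> (\<forall>u. singular_relcycle k X {} u \<longrightarrow> frag_lin h u = 0)"
proof -
  have "frag_lin h u = frag_lin h' u" if "coch h = coch h'" "singular_relcycle k X {} u" for h h' u
    using fun_cong[OF that(1), of u] that(2) by (simp add: coch_def singular_cycle)
  note eq = this
  show ?thesis
  proof
    assume "coch h \<in> coboundary_set k X"
    then obtain h' where h': "coch h = coch h'" "\<forall>u. singular_relcycle k X {} u \<longrightarrow> frag_lin h' u = 0"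
      unfolding coboundary_set_eq by (elim imageE CollectE)
    show "\<forall>u. singular_relcycle k X {} u \<longrightarrow> frag_lin h u = 0"
      using eq[OF h'(1)] h'(2) by simp
  next
    assume "\<forall>u. singular_relcycle k X {} u \<longrightarrow> frag_lin h u = 0"
    then show "coch h \<in> coboundary_set k X" unfolding coboundary_set_eq by (intro imageI CollectI)
  qed
qed

lemma cocycle_fun_of_vanishing:
  assumes "\<And>u. singular_relcycle k X {} u \<Longrightarrow> frag_lin h u = 0" shows "cocycle_fun h"
  unfolding cocycle_fun_def
proof (intro allI impI)
  fix u assume "singular_chain (Suc k) X u"
  then have "singular_relcycle k X {} (chain_boundary (Suc k) u)"
    by (simp add: singular_cycle singular_chain_boundary_alt chain_boundary_boundary_alt)
  then show "frag_lin h (chain_boundary (Suc k) u) = 0" by (rule assms)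
qed

lemma subgroup_coboundary_set: "subgroup (coboundary_set k X) (cocycle_group k X)"
proof -
  interpret comm_group "cocycle_group k X" by (rule comm_group_cocycle_group)
  let ?V = "\<lambda>h. \<forall>u. singular_relcycle k X {} u \<longrightarrow> frag_lin h u = 0"
  have add: "?V (\<lambda>\<sigma>. h \<sigma> + h' \<sigma>)" if "?V h" "?V h'" for h h'
    using that by (simp add: frag_lin_def sum.distrib ring_distribs)
  have minus: "?V (\<lambda>\<sigma>. - h \<sigma>)" if "?V h" for h
    using that by (simp add: frag_lin_def sum_negf)
  have zero: "?V (\<lambda>\<sigma>. 0)" by (simp add: frag_lin_def)
  show ?thesis
  proof
    show "coboundary_set k X \<subseteq> carrier (cocycle_group k X)"
      unfolding coboundary_set_eq carrier_cocycle_group using cocycle_fun_of_vanishing by blast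
    show "\<one>\<^bsub>cocycle_group k X\<^esub> \<in> coboundary_set k X"
      unfolding cocycle_group_simps coboundary_coch_iff by (rule zero)
    fix x assume "x \<in> coboundary_set k X"
    then obtain h where h: "x = coch h" "?V h" unfolding coboundary_set_eq by blast
    show "inv\<^bsub>cocycle_group k X\<^esub> x \<in> coboundary_set k X"
      using cocycle_group_inv[of h] cocycle_fun_of_vanishing[of h] minus[OF h(2)] h coboundary_coch_iff by simp
    fix y assume "y \<in> coboundary_set k X"
    then obtain h' where h': "y = coch h'" "?V h'" unfolding coboundary_set_eq by blast
    show "x \<otimes>\<^bsub>cocycle_group k X\<^esub> y \<in> coboundary_set k X"
      unfolding h(1) h'(1) cocycle_group_simps coboundary_coch_iff by (rule add[OF h(2) h'(2)])
  qed
qed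

lemma coboundary_set_scale: "cochain_scale k X a ` coboundary_set k X \<subseteq> coboundary_set k X"
proof clarify
  fix x assume "x \<in> coboundary_set k X"
  then obtain h where h: "x = coch h" "\<forall>u. singular_relcycle k X {} u \<longrightarrow> frag_lin h u = 0"
    unfolding coboundary_set_eq by blast
  then show "cochain_scale k X a x \<in> coboundary_set k X"
    by (simp add: coch_scale coboundary_coch_iff frag_lin_def mult.left_commute[of _ a] sum_distrib_left[symmetric])
qed

lemma scalar_module_cohomology: "scalar_module (cohomology_group k X) (cohomology_scale k X)"
  using scalar_module_Mod[OF scalar_module_cocycle_group subgroup_coboundary_set coboundary_set_scale]
  unfolding cohomology_group_def cohomology_scale_def[abs_def] .

text \<open>A cocycle is constant on each homology class, and the classes on which it vanishes are
  closed under the group operations; so it can be tested on one representative of each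
  generator.\<close>

lemma cocycle_fun_vanishes:
  assumes h: "cocycle_fun h" and G: "G \<subseteq> carrier (homology_group (int k) X)"
    and gen: "generate (homology_group (int k) X) G = carrier (homology_group (int k) X)"
    and y: "\<And>C. C \<in> G \<Longrightarrow> \<exists>v\<in>C. frag_lin h v = 0"
    and u: "singular_relcycle k X {} u"
  shows "frag_lin h u = 0"
proof -
  have bd: "frag_lin h v = 0" if "singular_relboundary k X {} v" for v
    using h that by (auto simp: singular_boundary cocycle_fun_def)
  have cls: "\<forall>v\<in>C. frag_lin h v = 0" if C: "C \<in> carrier (homology_group (int k) X)" "\<exists>v\<in>C. frag_lin h v = 0" for C
  proof -
    obtain v0 where "C = homologous_rel_set k X {} v0" using C(1) by (auto simp: carrier_relative_homology_group)
    moreover obtain v where "v \<in> C" "frag_lin h v = 0" using C(2) by blast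
    ultimately have *: "homologous_rel k X {} v w" "frag_lin h v = 0" if "w \<in> C" for w
      using that by (auto dest: homologous_rel_sym[THEN iffD1] intro: homologous_rel_trans)
    show ?thesis
    proof
      fix w assume "w \<in> C"
      from bd[OF *(1)[OF this, unfolded homologous_rel_def]] *(2)[OF this]
      show "frag_lin h w = 0" by (simp add: frag_lin_diff)
    qed
  qed
  have "\<forall>v\<in>C. frag_lin h v = 0" if "C \<in> generate (homology_group (int k) X) G" for C
    using that
  proof (induction rule: generate.induct)
    case one
    then show ?case using bd by simp
  next
    case (incl C)
    then show ?case using cls[of C] y G by blast
  next
    case (inv C)
    then have "C \<in> carrier (homology_group (int k) X)" "\<forall>v\<in>C. frag_lin h v = 0" using cls[of C] y G by blast+
    then show ?case by (auto simp: inv_relative_homology_group frag_lin_minus)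
  next
    case (eng C C')
    then show ?case by (auto simp: mult_relative_homology_group frag_lin_add)
  qed
  moreover have "homologous_rel_set k X {} u \<in> carrier (homology_group (int k) X)"
    using u by (simp add: carrier_relative_homology_group)
  moreover have "u \<in> homologous_rel_set k X {} u" by simp
  ultimately show ?thesis unfolding gen by blast
qed

text \<open>Independence comes from the pairing with the \<open>z b\<close>. For spanning, a
  combination of the \<open>w b\<close> that vanishes on the generators of homology vanishes on all
  cycles, in particular on the \<open>z b\<close>, so its coefficients are zero. There are at most
  \<open>card I\<close> generators, so this is an injective square system, hence solvable: every
  cocycle agrees on the generators with a combination of the \<open>w b\<close>, and the difference
  is a coboundary.\<close>

lemma cohomology_basis:
  assumes I: "finite I" and w: "\<And>b. b \<in> I \<Longrightarrow> cocycle_fun (w b)"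
    and z: "\<And>b. b \<in> I \<Longrightarrow> singular_relcycle k X {} (z b)"
    and pair: "\<And>b b'. b \<in> I \<Longrightarrow> b' \<in> I \<Longrightarrow> frag_lin (w b) (z b') = (if b = b' then \<kappa> else 0)"
    and \<kappa>: "\<kappa> \<noteq> 0"
    and gen: "generated_by_at_most (card I) (homology_group (int k) X)"
  shows "scalar_module.basis_on (cohomology_group k X) (cohomology_scale k X) I
    (\<lambda>b. coboundary_set k X #>\<^bsub>cocycle_group k X\<^esub> coch (w b))"
proof -
  let ?H = "homology_group (int k) X"
  have lin: "frag_lin (\<lambda>\<sigma>. \<Sum>b\<in>I. c b * w b \<sigma>) u = (\<Sum>b\<in>I. c b * frag_lin (w b) u)" for c u
    unfolding frag_lin_def sum_distrib_left by (subst sum.swap) (simp add: mult_ac)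
  have indep: "c b = 0" if c: "\<And>u. singular_relcycle k X {} u \<Longrightarrow> frag_lin (\<lambda>\<sigma>. \<Sum>b\<in>I. c b * w b \<sigma>) u = 0"
    and b: "b \<in> I" for c b
  proof -
    have "0 = (\<Sum>b'\<in>I. c b' * frag_lin (w b') (z b))" using c[OF z[OF b]] unfolding lin by simp
    also have "\<dots> = (\<Sum>b'\<in>I. if b' = b then c b' * \<kappa> else 0)" using b by (intro sum.cong) (auto simp: pair)
    also have "\<dots> = c b * \<kappa>" using I b by (simp add: sum.delta)
    finally show ?thesis using \<kappa> by simp
  qed
  obtain G where G: "finite G" "card G \<le> card I" "G \<subseteq> carrier ?H" "generate ?H G = carrier ?H"
    using gen unfolding generated_by_at_most_def by blast
  obtain g where g: "G = g ` {..<card G}" "inj_on g {..<card G}"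
    using G(1) bij_betw_from_nat_into_finite[OF G(1)] by (metis bij_betw_def)
  obtain e where e: "bij_betw e {..<card I} I" using bij_betw_from_nat_into_finite[OF I] by blast
  have "\<exists>v. v \<in> C" if C: "C \<in> G" for C
  proof -
    obtain u where "C = homologous_rel_set k X {} u"
      using G(3) C unfolding carrier_relative_homology_group by blast
    then have "u \<in> C" by simp
    then show ?thesis by blast
  qed
  then have rep: "(SOME v. v \<in> C) \<in> C" if "C \<in> G" for C by (rule someI_ex[OF _]) (rule that)
  \<comment> \<open>There may be fewer generators than elements of \<open>I\<close>; padding with
    the zero chain makes the system square.\<close>
  define y where "y i = (if i < card G then SOME v. v \<in> g i else 0)" for i
  have "\<exists>c. \<forall>i<card I. (\<Sum>j<card I. frag_lin (w (e j)) (y i) * c j) = x i" for x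
  proof (rule injective_linear_system_solvable)
    fix c :: "nat \<Rightarrow> complex"
    assume c: "\<And>i. i < card I \<Longrightarrow> (\<Sum>j<card I. frag_lin (w (e j)) (y i) * c j) = 0"
    let ?c = "\<lambda>b. c (inv_into {..<card I} e b)"
    have re: "(\<Sum>b\<in>I. ?c b * frag_lin (w b) u) = (\<Sum>j<card I. frag_lin (w (e j)) u * c j)" for u
      using sum.reindex_bij_betw[OF e, of "\<lambda>b. ?c b * frag_lin (w b) u"] e
      by (simp add: bij_betw_def mult.commute)
    have ex: "\<exists>v\<in>C. frag_lin (\<lambda>\<sigma>. \<Sum>b\<in>I. ?c b * w b \<sigma>) v = 0" if C: "C \<in> G" for C
    proof -
      obtain i where i: "i < card G" "C = g i" using subsetD[OF equalityD1[OF g(1)] C] by (elim imageE) simp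
      have "frag_lin (\<lambda>\<sigma>. \<Sum>b\<in>I. ?c b * w b \<sigma>) (y i) = 0"
        unfolding lin re using c[of i] i G(2) by simp
      then show ?thesis using rep[OF C] i by (auto simp: y_def)
    qed
    have cf: "cocycle_fun (\<lambda>\<sigma>. \<Sum>b\<in>I. ?c b * w b \<sigma>)" by (rule cocycle_fun_sum[OF w])
    have v: "frag_lin (\<lambda>\<sigma>. \<Sum>b\<in>I. ?c b * w b \<sigma>) u = 0" if "singular_relcycle k X {} u" for u
      by (rule cocycle_fun_vanishes[OF cf G(3,4) ex that])
    show "\<forall>j<card I. c j = 0"
    proof (intro allI impI)
      fix j assume j: "j < card I"
      then have "e j \<in> I" "inv_into {..<card I} e (e j) = j" using e by (auto simp: bij_betw_def)
      then show "c j = 0" using indep[of ?c "e j", OF v] by simp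
    qed
  qed
  note solve = this
  have spanning: "\<exists>c. \<forall>u. singular_relcycle k X {} u \<longrightarrow> frag_lin (\<lambda>\<sigma>. h \<sigma> - (\<Sum>b\<in>I. c b * w b \<sigma>)) u = 0"
    if h: "cocycle_fun h" for h
  proof -
    obtain c where c: "\<And>i. i < card I \<Longrightarrow> (\<Sum>j<card I. frag_lin (w (e j)) (y i) * c j) = frag_lin h (y i)"
      using solve[of "\<lambda>i. frag_lin h (y i)"] by blast
    let ?c = "\<lambda>b. c (inv_into {..<card I} e b)"
    let ?d = "\<lambda>\<sigma>. h \<sigma> - (\<Sum>b\<in>I. ?c b * w b \<sigma>)"
    have re: "(\<Sum>b\<in>I. ?c b * frag_lin (w b) u) = (\<Sum>j<card I. frag_lin (w (e j)) u * c j)" for u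
      using sum.reindex_bij_betw[OF e, of "\<lambda>b. ?c b * frag_lin (w b) u"] e
      by (simp add: bij_betw_def mult.commute)
    have dl: "frag_lin ?d u = frag_lin h u - (\<Sum>b\<in>I. ?c b * frag_lin (w b) u)" for u
      unfolding lin[symmetric] by (simp add: frag_lin_def sum_subtractf[symmetric] algebra_simps)
    have dc: "cocycle_fun ?d"
      using h cocycle_fun_sum[of I w ?c] w unfolding cocycle_fun_def dl lin by simp
    have ex: "\<exists>v\<in>C. frag_lin ?d v = 0" if C: "C \<in> G" for C
    proof -
      obtain i where i: "i < card G" "C = g i" using subsetD[OF equalityD1[OF g(1)] C] by (elim imageE) simp
      have "frag_lin ?d (y i) = 0" unfolding dl re using c[of i] i G(2) by simp
      then show ?thesis using rep[OF C] i by (auto simp: y_def)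
    qed
    have "frag_lin ?d u = 0" if "singular_relcycle k X {} u" for u
      by (rule cocycle_fun_vanishes[OF dc G(3,4) ex that])
    then show ?thesis by (intro exI[of _ ?c] allI impI)
  qed
  note sm = scalar_module_cohomology[unfolded cohomology_group_def]
  show ?thesis
    unfolding cohomology_group_def
  proof (rule basis_on_Mod[OF scalar_module_cocycle_group subgroup_coboundary_set sm _ _ I])
    show "cohomology_scale k X c (coboundary_set k X #>\<^bsub>cocycle_group k X\<^esub> x) =
        coboundary_set k X #>\<^bsub>cocycle_group k X\<^esub> cochain_scale k X c x"
      if "x \<in> carrier (cocycle_group k X)" for c x
      unfolding cohomology_scale_def
      by (rule coset_map_coset[OF comm_group_cocycle_group subgroup_coboundary_set
            scalar_module.sc_hom[OF scalar_module_cocycle_group] coboundary_set_scale that])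
    show "(\<lambda>b. coch (w b)) \<in> I \<rightarrow> carrier (cocycle_group k X)"
      using w by (auto simp: carrier_cocycle_group)
  next
    fix x assume "x \<in> carrier (cocycle_group k X)"
    then obtain h where h: "x = coch h" "cocycle_fun h" by (auto simp: carrier_cocycle_group)
    obtain c where c: "\<forall>u. singular_relcycle k X {} u \<longrightarrow> frag_lin (\<lambda>\<sigma>. h \<sigma> - (\<Sum>b\<in>I. c b * w b \<sigma>)) u = 0"
      using spanning[OF h(2)] by blast
    have "x \<otimes>\<^bsub>cocycle_group k X\<^esub> inv\<^bsub>cocycle_group k X\<^esub> scalar_module.lc (cocycle_group k X) (cochain_scale k X) c (\<lambda>b. coch (w b)) I
       = coch (\<lambda>\<sigma>. h \<sigma> - (\<Sum>b\<in>I. c b * w b \<sigma>))"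
      unfolding h(1) using w by (simp add: lc_cocycle_group cocycle_group_inv cocycle_fun_sum cocycle_group_simps)
    moreover have "coch (\<lambda>\<sigma>. h \<sigma> - (\<Sum>b\<in>I. c b * w b \<sigma>)) \<in> coboundary_set k X"
      unfolding coboundary_coch_iff by (rule c)
    ultimately have "x \<otimes>\<^bsub>cocycle_group k X\<^esub> inv\<^bsub>cocycle_group k X\<^esub> scalar_module.lc (cocycle_group k X) (cochain_scale k X) c (\<lambda>b. coch (w b)) I \<in> coboundary_set k X"
      by (simp only:)
    then show "\<exists>c. x \<otimes>\<^bsub>cocycle_group k X\<^esub> inv\<^bsub>cocycle_group k X\<^esub> scalar_module.lc (cocycle_group k X) (cochain_scale k X) c (\<lambda>b. coch (w b)) I \<in> coboundary_set k X"
      by (rule exI[of _ c])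
  next
    fix c b
    assume "scalar_module.lc (cocycle_group k X) (cochain_scale k X) c (\<lambda>b. coch (w b)) I \<in> coboundary_set k X" "b \<in> I"
    then show "c b = 0" using indep[of c b] w by (simp add: lc_cocycle_group coboundary_coch_iff)
  qed
qed

lemma cochain_pullback_coch:
  assumes "continuous_map X X \<rho>"
  shows "cochain_pullback k X \<rho> (coch h) = coch (\<lambda>\<sigma>. h (simplex_map k \<rho> \<sigma>))"
  unfolding cochain_pullback_def compose_def coch_def carrier_chain_group
proof (rule restrict_ext)
  fix u assume "u \<in> singular_chain_set k X"
  then have "singular_chain k X (chain_map k \<rho> u)" using assms by (simp add: singular_chain_chain_map)
  then show "restrict (frag_lin h) (singular_chain_set k X) (chain_map k \<rho> u) = frag_lin (\<lambda>\<sigma>. h (simplex_map k \<rho> \<sigma>)) u"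
    by (simp add: chain_map_def frag_lin_extend)
qed

lemma frag_lin_chain_map: "frag_lin (\<lambda>\<sigma>. h (simplex_map k \<rho> \<sigma>)) u = frag_lin h (chain_map k \<rho> u)"
  by (simp add: chain_map_def frag_lin_extend)

text \<open>The matrix \<open>a\<close> describes the pullback on every single simplex and not only
  up to coboundaries, so it descends directly to the classes of the basis.\<close>

theorem cohomology_trace:
  assumes \<rho>: "continuous_map X X \<rho>"
    and I: "finite I" and w: "\<And>b. b \<in> I \<Longrightarrow> cocycle_fun (w b)"
    and z: "\<And>b. b \<in> I \<Longrightarrow> singular_relcycle k X {} (z b)"
    and pair: "\<And>b b'. b \<in> I \<Longrightarrow> b' \<in> I \<Longrightarrow> frag_lin (w b) (z b') = (if b = b' then \<kappa> else 0)"
    and \<kappa>: "\<kappa> \<noteq> 0"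
    and gen: "generated_by_at_most (card I) (homology_group (int k) X)"
    and a: "\<And>b \<sigma>. b \<in> I \<Longrightarrow> singular_simplex k X \<sigma> \<Longrightarrow> w b (simplex_map k \<rho> \<sigma>) = (\<Sum>b'\<in>I. a b' b * w b' \<sigma>)"
  shows "module_trace (cohomology_group k X) (cohomology_scale k X) (cohomology_pullback k X \<rho>) = (\<Sum>b\<in>I. a b b)"
proof -
  let ?G = "cocycle_group k X" and ?B = "coboundary_set k X"
  interpret C: scalar_module ?G "cochain_scale k X" by (rule scalar_module_cocycle_group)
  interpret H: scalar_module "cohomology_group k X" "cohomology_scale k X" by (rule scalar_module_cohomology)
  let ?p = "cochain_pullback k X \<rho>"
  have cyc: "singular_relcycle k X {} (chain_map k \<rho> u)" if "singular_relcycle k X {} u" for u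
    using that \<rho> chain_boundary_chain_map[of k X u \<rho>] by (auto simp: singular_cycle singular_chain_chain_map)
  have coc: "cocycle_fun (\<lambda>\<sigma>. h (simplex_map k \<rho> \<sigma>))" if "cocycle_fun h" for h
    unfolding cocycle_fun_def frag_lin_chain_map
  proof (intro allI impI)
    fix u assume u: "singular_chain (Suc k) X u"
    then have "chain_map k \<rho> (chain_boundary (Suc k) u) = chain_boundary (Suc k) (chain_map (Suc k) \<rho> u)"
      using chain_boundary_chain_map[of "Suc k" X u \<rho>] by simp
    then show "frag_lin h (chain_map k \<rho> (chain_boundary (Suc k) u)) = 0"
      using that u singular_chain_chain_map[OF u \<rho>] by (simp add: cocycle_fun_def)
  qed
  have hom: "?p \<in> hom ?G ?G"
    by (rule homI) (auto simp: carrier_cocycle_group cochain_pullback_coch[OF \<rho>] coc cocycle_group_simps)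
  have B: "?p ` ?B \<subseteq> ?B"
  proof clarify
    fix x assume "x \<in> ?B"
    then obtain h where h: "x = coch h" "\<forall>u. singular_relcycle k X {} u \<longrightarrow> frag_lin h u = 0"
      unfolding coboundary_set_eq by blast
    then show "?p x \<in> ?B" using cyc by (simp add: cochain_pullback_coch[OF \<rho>] coboundary_coch_iff frag_lin_chain_map)
  qed
  note cm = coset_map_coset[OF comm_group_cocycle_group subgroup_coboundary_set]
  have pc: "cohomology_pullback k X \<rho> (?B #>\<^bsub>?G\<^esub> x) = ?B #>\<^bsub>?G\<^esub> ?p x" if "x \<in> carrier ?G" for x
    unfolding cohomology_pullback_def by (rule cm[OF hom B that])
  have scc: "cohomology_scale k X c (?B #>\<^bsub>?G\<^esub> x) = ?B #>\<^bsub>?G\<^esub> cochain_scale k X c x" if "x \<in> carrier ?G" for c x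
    unfolding cohomology_scale_def by (rule cm[OF C.sc_hom coboundary_set_scale that])
  have hom': "cohomology_pullback k X \<rho> \<in> hom (cohomology_group k X) (cohomology_group k X)"
    unfolding cohomology_pullback_def cohomology_group_def
    by (rule coset_map_hom[OF comm_group_cocycle_group subgroup_coboundary_set hom B])
  have linear: "H.linear (cohomology_pullback k X \<rho>)"
    unfolding H.linear_def
  proof (intro conjI hom' allI ballI)
    fix c x assume "x \<in> carrier (cohomology_group k X)"
    then obtain y where y: "y \<in> carrier ?G" "x = ?B #>\<^bsub>?G\<^esub> y"
      using comm_group_Mod(3)[OF comm_group_cocycle_group subgroup_coboundary_set] unfolding cohomology_group_def by auto
    then obtain h where h: "y = coch h" by (auto simp: carrier_cocycle_group)
    have "?p (cochain_scale k X c y) = cochain_scale k X c (?p y)"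
      unfolding h by (simp add: coch_scale cochain_pullback_coch[OF \<rho>])
    then show "cohomology_pullback k X \<rho> (cohomology_scale k X c x) = cohomology_scale k X c (cohomology_pullback k X \<rho> x)"
      unfolding y(2) using pc scc y(1) hom_in_carrier[OF hom y(1)] C.sc_closed[OF y(1)] by simp
  qed
  have wc: "(\<lambda>b. coch (w b)) \<in> I \<rightarrow> carrier ?G" using w by (auto simp: carrier_cocycle_group)
  show ?thesis
  proof (rule H.module_trace_eqI[where a = a, OF cohomology_basis[OF I w z pair \<kappa> gen] linear])
    fix b assume b: "b \<in> I"
    have "cohomology_pullback k X \<rho> (?B #>\<^bsub>?G\<^esub> coch (w b)) = ?B #>\<^bsub>?G\<^esub> ?p (coch (w b))"
      using b wc by (intro pc) auto
    also have "?p (coch (w b)) = coch (\<lambda>\<sigma>. \<Sum>b'\<in>I. a b' b * w b' \<sigma>)"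
      unfolding cochain_pullback_coch[OF \<rho>] by (rule coch_cong) (rule a[OF b])
    also have "\<dots> = C.lc (\<lambda>b'. a b' b) (\<lambda>b. coch (w b)) I" using w by (simp add: lc_cocycle_group)
    also have "?B #>\<^bsub>?G\<^esub> C.lc (\<lambda>b'. a b' b) (\<lambda>b. coch (w b)) I =
        H.lc (\<lambda>b'. a b' b) (\<lambda>b. ?B #>\<^bsub>?G\<^esub> coch (w b)) I"
      using lc_Mod[OF C.scalar_module_axioms subgroup_coboundary_set
          H.scalar_module_axioms[unfolded cohomology_group_def] scc wc]
      unfolding cohomology_group_def by simp
    finally show "cohomology_pullback k X \<rho> (?B #>\<^bsub>?G\<^esub> coch (w b)) =
        H.lc (\<lambda>b'. a b' b) (\<lambda>b. ?B #>\<^bsub>?G\<^esub> coch (w b)) I" .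
  qed
qed

end

section \<open>Bases adapted to a subgroup\<close>

lemma exterior_basisI:
  assumes "comm_group A" "scalar_module.basis_on A (\<lambda>(n::int) x. x [^]\<^bsub>A\<^esub> n) {..<s} b"
  shows "exterior_basis A s b"
proof -
  interpret comm_group A by (rule assms(1))
  show ?thesis by unfold_locales (rule assms(2))
qed

lemma int_lc_hom:
  assumes G: "comm_group G" and H: "comm_group H" and h: "h \<in> hom G H" and b: "b \<in> I \<rightarrow> carrier G"
  shows "h (scalar_module.lc G (\<lambda>(n::int) x. x [^]\<^bsub>G\<^esub> n) c b I) =
    scalar_module.lc H (\<lambda>(n::int) x. x [^]\<^bsub>H\<^esub> n) c (\<lambda>i. h (b i)) I"
proof -
  interpret G: scalar_module G "\<lambda>(n::int) x. x [^]\<^bsub>G\<^esub> n" by (rule scalar_module_int[OF G])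
  interpret H: scalar_module H "\<lambda>(n::int) x. x [^]\<^bsub>H\<^esub> n" by (rule scalar_module_int[OF H])
  have hb: "h (b i) \<in> carrier H" if "i \<in> I" for i using hom_in_carrier[OF h] b that by auto
  have "h (finprod G (\<lambda>i. b i [^]\<^bsub>G\<^esub> c i) I) = finprod H (\<lambda>i. h (b i [^]\<^bsub>G\<^esub> c i)) I"
    by (rule hom_finprod[OF G H h]) (use b in auto)
  also have "\<dots> = finprod H (\<lambda>i. h (b i) [^]\<^bsub>H\<^esub> c i) I"
    using b hb by (intro H.finprod_cong') (auto simp: hom_int_pow[OF h _ G.is_group H.is_group] Pi_iff)
  finally show ?thesis unfolding G.lc_def H.lc_def .
qed

lemma basis_on_iso_int:
  assumes G: "comm_group G" and H: "comm_group H" and h: "h \<in> iso G H"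
    and B: "scalar_module.basis_on G (\<lambda>(n::int) x. x [^]\<^bsub>G\<^esub> n) I b"
  shows "scalar_module.basis_on H (\<lambda>(n::int) x. x [^]\<^bsub>H\<^esub> n) I (\<lambda>i. h (b i))"
proof -
  interpret G: scalar_module G "\<lambda>(n::int) x. x [^]\<^bsub>G\<^esub> n" by (rule scalar_module_int[OF G])
  interpret H: scalar_module H "\<lambda>(n::int) x. x [^]\<^bsub>H\<^esub> n" by (rule scalar_module_int[OF H])
  have hom: "h \<in> hom G H" and inj: "inj_on h (carrier G)" and img: "h ` carrier G = carrier H"
    using h by (auto simp: iso_def bij_betw_def)
  have b: "finite I" "b \<in> I \<rightarrow> carrier G" using B by (auto simp: G.basis_on_def)
  note lc = int_lc_hom[OF G H hom b(2)]
  show ?thesis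
    unfolding H.basis_on_def
  proof (intro conjI ballI allI impI)
    show "finite I" by (rule b(1))
    show "(\<lambda>i. h (b i)) \<in> I \<rightarrow> carrier H" using b(2) hom_in_carrier[OF hom] by auto
    fix y assume "y \<in> carrier H"
    then obtain x where x: "x \<in> carrier G" "y = h x" using img by auto
    obtain c where "x = G.lc c b I" using G.basis_on_expand[OF B x(1)] by blast
    then show "\<exists>c. y = H.lc c (\<lambda>i. h (b i)) I" using x(2) lc by auto
  next
    fix c i assume c: "H.lc c (\<lambda>i. h (b i)) I = \<one>\<^bsub>H\<^esub>" and i: "i \<in> I"
    have "h (G.lc c b I) = h \<one>\<^bsub>G\<^esub>" unfolding lc c using hom_one[OF hom G.is_group H.is_group] by simp
    then have "G.lc c b I = \<one>\<^bsub>G\<^esub>" using b(2) by (intro inj_onD[OF inj]) auto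
    then show "c i = 0" using B i unfolding G.basis_on_def by blast
  qed
qed

lemma sum_frag_of_lookup:
  assumes "finite I"
  shows "Poly_Mapping.lookup (\<Sum>i\<in>I. frag_cmul (c i) (frag_of i)) j = (if j \<in> I then c j else 0)"
proof -
  have "Poly_Mapping.lookup (\<Sum>i\<in>I. frag_cmul (c i) (frag_of i)) j = (\<Sum>i\<in>I. if i = j then c i else 0)"
    unfolding lookup_sum by (intro sum.cong refl) simp
  then show ?thesis using assms by (simp add: sum.delta)
qed

lemma sum_frag_of_expand:
  assumes "finite I" "Poly_Mapping.keys u \<subseteq> I"
  shows "u = (\<Sum>i\<in>I. frag_cmul (Poly_Mapping.lookup u i) (frag_of i))"
  by (rule poly_mapping_eqI) (use assms in \<open>auto simp: sum_frag_of_lookup in_keys_iff\<close>)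

lemma basis_on_free_Abelian_group:
  assumes I: "finite I"
  shows "scalar_module.basis_on (free_Abelian_group I) (\<lambda>(n::int) x. x [^]\<^bsub>free_Abelian_group I\<^esub> n) I frag_of"
proof -
  interpret F: scalar_module "free_Abelian_group I" "\<lambda>(n::int) x. x [^]\<^bsub>free_Abelian_group I\<^esub> n"
    by (rule scalar_module_int[OF abelian_free_Abelian_group])
  have lc: "F.lc c frag_of I = (\<Sum>i\<in>I. frag_cmul (c i) (frag_of i))" for c
    by (rule lc_free_Abelian_group) simp
  show ?thesis
    unfolding F.basis_on_def lc
  proof (intro conjI ballI allI impI)
    fix u assume "u \<in> carrier (free_Abelian_group I)"
    then show "\<exists>c. u = (\<Sum>i\<in>I. frag_cmul (c i) (frag_of i))"
      using sum_frag_of_expand[OF I] by (intro exI[of _ "Poly_Mapping.lookup u"]) simp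
  next
    fix c i assume "(\<Sum>i\<in>I. frag_cmul (c i) (frag_of i)) = \<one>\<^bsub>free_Abelian_group I\<^esub>" "i \<in> I"
    then show "c i = 0" using sum_frag_of_lookup[OF I, of c i] by simp
  qed (use I in auto)
qed

text \<open>Applied to the diagonal entries of the normal form, with \<open>P\<close> singling out
  the nonzero ones, so that these occupy the first \<open>r\<close> places.\<close>

lemma sorting_permutation: "\<exists>p r. p permutes {..<n::nat} \<and> r \<le> n \<and> (\<forall>i<n. P (p i) \<longleftrightarrow> i < r)"
proof -
  define xs where "xs = filter P [0..<n] @ filter (\<lambda>i. \<not> P i) [0..<n]"
  define r where "r = length (filter P [0..<n])"
  define p where "p i = (if i < n then xs ! i else i)" for i
  have xs: "distinct xs" "set xs = {..<n}" by (auto simp: xs_def)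
  have len: "length xs = n" using distinct_card[OF xs(1)] xs(2) by simp
  have "bij_betw ((!) xs) {..<n} {..<n}" by (rule bij_betw_nth) (use xs len in auto)
  then have "bij_betw p {..<n} {..<n}" by (subst bij_betw_cong[of _ _ "(!) xs"]) (auto simp: p_def)
  then have "p permutes {..<n}" by (rule bij_imp_permutes) (simp add: p_def)
  moreover have "r \<le> n" using len by (simp add: r_def xs_def)
  moreover have "P (p i) \<longleftrightarrow> i < r" if i: "i < n" for i
  proof (cases "i < r")
    case True
    then have "p i \<in> set (filter P [0..<n])" using i nth_mem[of i "filter P [0..<n]"] by (simp add: p_def xs_def r_def nth_append)
    then show ?thesis using True by simp
  next
    case False
    then have "p i = filter (\<lambda>i. \<not> P i) [0..<n] ! (i - r)" using i by (simp add: p_def xs_def r_def nth_append)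
    moreover have "i - r < length (filter (\<lambda>i. \<not> P i) [0..<n])" using i len False by (simp add: xs_def r_def)
    ultimately have "p i \<in> set (filter (\<lambda>i. \<not> P i) [0..<n])" using nth_mem by metis
    then show ?thesis using False by simp
  qed
  ultimately show ?thesis by blast
qed

text \<open>The coordinates of \<open>exterior_basis\<close> are what is wanted here, hence the
  degree \<open>0\<close>. The first \<open>r\<close> basis elements span the saturation of
  \<open>N\<close>; entries \<open>d i = 1\<close> are allowed and contribute one-point factors to
  the torus.\<close>

locale adapted_basis = exterior_basis M 0 n e
  for M :: "('a, 'm) monoid_scheme" (structure) and n :: nat and e :: "nat \<Rightarrow> 'a" +
  fixes N :: "'a set" and r :: nat and d :: "nat \<Rightarrow> nat"
  assumes r_le: "r \<le> n" and d_pos: "\<And>i. i < r \<Longrightarrow> 0 < d i"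
    and N_eq: "N = {x \<in> carrier M. (\<forall>i<r. int (d i) dvd coord x i) \<and> (\<forall>i. r \<le> i \<longrightarrow> i < n \<longrightarrow> coord x i = 0)}"

theorem adapted_basis_exists:
  assumes M: "comm_group M" and isoM: "M \<cong> free_Abelian_group {..<n}" and N: "subgroup N M"
  shows "\<exists>e r d. adapted_basis M n e N r d"
proof -
  interpret M: comm_group M by (rule M)
  let ?F = "free_Abelian_group {..<n}"
  have F: "comm_group ?F" by (rule abelian_free_Abelian_group)
  obtain h where h: "h \<in> iso ?F M" using M.iso_sym[OF isoM] unfolding is_iso_def by blast
  then have hh: "h \<in> hom ?F M" and hb: "bij_betw h (carrier ?F) (carrier M)" by (auto simp: iso_def)
  have hc: "h u \<in> carrier M" if "u \<in> carrier ?F" for u using hom_in_carrier[OF hh that] .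
  have hd: "h (u - v) = h u \<otimes>\<^bsub>M\<^esub> inv\<^bsub>M\<^esub> h v" if u: "u \<in> carrier ?F" and v: "v \<in> carrier ?F" for u v
  proof -
    have uv: "u - v \<in> carrier ?F" using u v keys_diff[of u v] by auto
    have "h u = h (u - v) \<otimes>\<^bsub>M\<^esub> h v" using hom_mult[OF hh uv v] by simp
    then show ?thesis using M.inv_solve_right[OF hc[OF uv] hc[OF u] hc[OF v]] by blast
  qed
  \<comment> \<open>\<open>P\<close> and \<open>lookup\<close> identify the vectors in
    \<open>Zn n\<close> with the free abelian group; through \<open>h\<close> the subgroup
    \<open>N\<close> becomes the sublattice \<open>L\<close>.\<close>
  define P :: "(nat \<Rightarrow> int) \<Rightarrow> nat \<Rightarrow>\<^sub>0 int" where "P = Abs_poly_mapping"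
  have lP: "Poly_Mapping.lookup (P x) = x" if "x \<in> Zn n" for x
  proof -
    have "{i. x i \<noteq> 0} \<subseteq> {..<n}" using that by (auto simp: Zn_def not_less[symmetric])
    then have "finite {i. x i \<noteq> 0}" using finite_subset by blast
    then show ?thesis unfolding P_def by simp
  qed
  have Pl: "P (Poly_Mapping.lookup u) = u" for u unfolding P_def by simp
  have Pc: "P x \<in> carrier ?F" if x: "x \<in> Zn n" for x
    using x by (auto simp: in_keys_iff lP[OF x] Zn_def not_less[symmetric])
  have lZ: "Poly_Mapping.lookup u \<in> Zn n" if "u \<in> carrier ?F" for u
    using that by (auto simp: Zn_def in_keys_iff subset_iff)
  have Zd: "(\<lambda>i. x i - y i) \<in> Zn n" if "x \<in> Zn n" "y \<in> Zn n" for x y using that by (simp add: Zn_def)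
  have Pd: "P (\<lambda>i. x i - y i) = P x - P y" if "x \<in> Zn n" "y \<in> Zn n" for x y
    by (rule poly_mapping_eqI) (simp add: lP[OF Zd[OF that]] lP[OF that(1)] lP[OF that(2)] lookup_minus)
  define L where "L = {x \<in> Zn n. h (P x) \<in> N}"
  have L: "sublattice n L"
    unfolding sublattice_def
  proof (intro conjI ballI)
    show "L \<subseteq> Zn n" by (auto simp: L_def)
    have z: "(\<lambda>i. 0) \<in> Zn n" by (simp add: Zn_def)
    have "P (\<lambda>i. 0) = 0" using Pd[OF z z] by simp
    then have "h (P (\<lambda>i. 0)) = \<one>\<^bsub>M\<^esub>" using hom_one[OF hh] M.is_group by simp
    then show "(\<lambda>i. 0) \<in> L" using z subgroup.one_closed[OF N] by (simp add: L_def)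
    fix x y assume xy: "x \<in> L" "y \<in> L"
    then have Z: "x \<in> Zn n" "y \<in> Zn n" by (auto simp: L_def)
    have "h (P (\<lambda>i. x i - y i)) = h (P x) \<otimes>\<^bsub>M\<^esub> inv\<^bsub>M\<^esub> h (P y)"
      unfolding Pd[OF Z] by (rule hd[OF Pc[OF Z(1)] Pc[OF Z(2)]])
    also have "\<dots> \<in> N" using xy by (intro subgroup.m_closed[OF N] subgroup.m_inv_closed[OF N]) (auto simp: L_def)
    finally show "(\<lambda>i. x i - y i) \<in> L" using Zd[OF Z] by (simp add: L_def)
  qed
  obtain T0 D0 where T0: "lattice_aut n T0" "T0 ` L = {x \<in> Zn n. \<forall>i<n. (D0 i :: int) dvd x i}"
    using sublattice_diagonal[OF L] by blast
  obtain p r where p: "p permutes {..<n}" "r \<le> n" "\<forall>i<n. D0 (p i) \<noteq> 0 \<longleftrightarrow> i < r"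
    using sorting_permutation[of n "\<lambda>i. D0 i \<noteq> 0"] by blast
  define pi where "pi = inv_into UNIV p"
  have pi: "pi permutes {..<n}" unfolding pi_def by (rule permutes_inv[OF p(1)])
  have p_lt: "p i < n \<longleftrightarrow> i < n" "pi i < n \<longleftrightarrow> i < n" for i
    using permutes_in_image[OF p(1), of i] permutes_in_image[OF pi, of i] by simp_all
  have pinv: "p (pi i) = i" "pi (p i) = i" for i using permutes_inverses[OF p(1)] by (simp_all add: pi_def)
  have pZ: "x \<circ> p \<in> Zn n" "x \<circ> pi \<in> Zn n" if "x \<in> Zn n" for x
    using that p_lt by (auto simp: Zn_def not_less[symmetric])
  have pa: "lattice_aut n (\<lambda>x. x \<circ> p)"
    by (rule lattice_autI[where U = "\<lambda>x. x \<circ> pi"]) (auto simp: pZ[unfolded comp_def] pinv comp_def)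
  define T where "T = (\<lambda>x. x \<circ> p) \<circ> T0"
  have T: "lattice_aut n T" unfolding T_def by (rule lattice_aut_compose[OF T0(1) pa])
  have TL: "T ` L = {x \<in> Zn n. \<forall>i<n. D0 (p i) dvd x i}"
  proof -
    have "T ` L = (\<lambda>x. x \<circ> p) ` {x \<in> Zn n. \<forall>i<n. D0 i dvd x i}"
      unfolding T_def image_comp[symmetric] T0(2) ..
    also have "\<dots> = {x \<in> Zn n. \<forall>i<n. D0 (p i) dvd x i}"
    proof (intro equalityI subsetI)
      fix x assume "x \<in> {x \<in> Zn n. \<forall>i<n. D0 (p i) dvd x i}"
      then have x: "x \<in> Zn n" "\<And>i. i < n \<Longrightarrow> D0 (p i) dvd x i" by auto
      have "D0 i dvd (x \<circ> pi) i" if "i < n" for i using x(2)[of "pi i"] that by (simp add: p_lt pinv)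
      then have "x \<circ> pi \<in> {x \<in> Zn n. \<forall>i<n. D0 i dvd x i}" using pZ(2)[OF x(1)] by simp
      moreover have "x = (x \<circ> pi) \<circ> p" by (simp add: fun_eq_iff pinv)
      ultimately show "x \<in> (\<lambda>x. x \<circ> p) ` {x \<in> Zn n. \<forall>i<n. D0 i dvd x i}" by (rule image_eqI[where f = "\<lambda>x. x \<circ> p", rotated])
    qed (auto simp: pZ p_lt)
    finally show ?thesis .
  qed
  have Tb: "bij_betw T (Zn n) (Zn n)" and Td: "\<And>x y. x \<in> Zn n \<Longrightarrow> y \<in> Zn n \<Longrightarrow> T (\<lambda>i. x i - y i) = (\<lambda>i. T x i - T y i)"
    using T by (auto simp: lattice_aut_def)
  define U where "U = inv_into (Zn n) T"
  have Ub: "bij_betw U (Zn n) (Zn n)" unfolding U_def by (rule bij_betw_inv_into[OF Tb])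
  have UZ: "U x \<in> Zn n" if "x \<in> Zn n" for x by (rule bspec[OF bij_betwE[OF Ub] that])
  have TU: "T (U x) = x" if "x \<in> Zn n" for x unfolding U_def by (rule bij_betw_inv_into_right[OF Tb that])
  have UT: "U (T x) = x" if "x \<in> Zn n" for x unfolding U_def by (rule bij_betw_inv_into_left[OF Tb that])
  have Ud: "U (\<lambda>i. x i - y i) = (\<lambda>i. U x i - U y i)" if "x \<in> Zn n" "y \<in> Zn n" for x y
    using UT[OF Zd[OF UZ[OF that(1)] UZ[OF that(2)]]] unfolding Td[OF UZ[OF that(1)] UZ[OF that(2)]] TU[OF that(1)] TU[OF that(2)] .
  have UL: "U x \<in> L \<longleftrightarrow> (\<forall>i<n. D0 (p i) dvd x i)" if x: "x \<in> Zn n" for x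
  proof -
    have "U x \<in> L \<longleftrightarrow> x \<in> T ` L"
    proof
      assume "U x \<in> L" then show "x \<in> T ` L" using TU[OF x] by (metis imageI)
    next
      assume "x \<in> T ` L"
      then obtain y where "y \<in> L" "x = T y" by blast
      then show "U x \<in> L" using UT[of y] by (simp add: L_def)
    qed
    then show ?thesis unfolding TL using x by simp
  qed
  \<comment> \<open>The isomorphism of the new basis: coordinates are taken back by the inverse
    \<open>U\<close> of the diagonalizing automorphism, so that \<open>N\<close> is diagonal in the
    coordinates of \<open>H\<close>.\<close>
  define H where "H u = h (P (U (Poly_Mapping.lookup u)))" for u
  have Hb: "bij_betw H (carrier ?F) (carrier M)"
  proof -
    have "bij_betw Poly_Mapping.lookup (carrier ?F) (Zn n)"
      by (rule bij_betw_byWitness[where f' = P]) (auto simp: Pl lP lZ Pc simp del: carrier_free_Abelian_group_iff)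
    moreover have "bij_betw P (Zn n) (carrier ?F)"
      by (rule bij_betw_byWitness[where f' = Poly_Mapping.lookup]) (auto simp: Pl lP lZ Pc simp del: carrier_free_Abelian_group_iff)
    ultimately have "bij_betw (h \<circ> (P \<circ> (U \<circ> Poly_Mapping.lookup))) (carrier ?F) (carrier M)"
      using Ub hb by (intro bij_betw_trans)
    then show ?thesis by (simp add: H_def[abs_def] comp_def)
  qed
  have Hd: "H (u - v) = H u \<otimes>\<^bsub>M\<^esub> inv\<^bsub>M\<^esub> H v" if u: "u \<in> carrier ?F" and v: "v \<in> carrier ?F" for u v
  proof -
    have "Poly_Mapping.lookup (u - v) = (\<lambda>i. Poly_Mapping.lookup u i - Poly_Mapping.lookup v i)"
      by (simp add: fun_eq_iff lookup_minus)
    then show ?thesis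
      unfolding H_def by (simp only: Ud[OF lZ[OF u] lZ[OF v]] Pd[OF UZ[OF lZ[OF u]] UZ[OF lZ[OF v]]]
          hd[OF Pc[OF UZ[OF lZ[OF u]]] Pc[OF UZ[OF lZ[OF v]]]])
  qed
  have Hc: "H u \<in> carrier M" if "u \<in> carrier ?F" for u by (rule bspec[OF bij_betwE[OF Hb] that])
  have "H \<in> hom ?F M"
  proof (rule homI)
    fix u v assume u: "u \<in> carrier ?F" and v: "v \<in> carrier ?F"
    have uv: "u + v \<in> carrier ?F" using u v keys_add[of u v] by auto
    have "H u = H (u + v) \<otimes>\<^bsub>M\<^esub> inv\<^bsub>M\<^esub> H v" using Hd[OF uv v] by simp
    then show "H (u \<otimes>\<^bsub>?F\<^esub> v) = H u \<otimes>\<^bsub>M\<^esub> H v"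
      using M.inv_solve_right[OF Hc[OF u] Hc[OF uv] Hc[OF v]] by simp
  qed (rule Hc)
  then have Hh: "H \<in> hom ?F M" and Hi: "H \<in> iso ?F M" using Hb by (auto simp: iso_def)
  define e where "e i = H (frag_of i)" for i
  have eb: "scalar_module.basis_on M (\<lambda>(n::int) x. x [^]\<^bsub>M\<^esub> n) {..<n} e"
    unfolding e_def by (rule basis_on_iso_int[OF F M Hi basis_on_free_Abelian_group]) simp
  interpret E: exterior_basis M 0 n e by (rule exterior_basisI[OF M eb])
  have coord: "E.coord (H u) i = Poly_Mapping.lookup u i" if u: "u \<in> carrier ?F" and i: "i < n" for u i
  proof (rule E.coord_eqI[OF _ i])
    have f: "frag_of \<in> {..<n} \<rightarrow> carrier ?F" by auto
    have "u = scalar_module.lc ?F (\<lambda>(n::int) x. x [^]\<^bsub>?F\<^esub> n) (Poly_Mapping.lookup u) frag_of {..<n}"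
      using sum_frag_of_expand[of "{..<n}" u] u lc_free_Abelian_group[of "{..<n}" frag_of "{..<n}" "Poly_Mapping.lookup u"] by simp
    then show "H u = E.Z.lc (Poly_Mapping.lookup u) e {..<n}"
      using int_lc_hom[OF F M Hh f, of "Poly_Mapping.lookup u"] by (simp add: e_def[abs_def])
  qed
  define d where "d i = nat \<bar>D0 (p i)\<bar>" for i
  have "x \<in> N \<longleftrightarrow> (\<forall>i<r. int (d i) dvd E.coord x i) \<and> (\<forall>i. r \<le> i \<longrightarrow> i < n \<longrightarrow> E.coord x i = 0)"
    if x: "x \<in> carrier M" for x
  proof -
    obtain u where u: "u \<in> carrier ?F" "x = H u" using x bij_betw_imp_surj_on[OF Hb] by (metis imageE)
    have "x \<in> N \<longleftrightarrow> U (Poly_Mapping.lookup u) \<in> L"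
      using UZ[OF lZ[OF u(1)]] by (simp add: u(2) H_def L_def)
    also have "\<dots> \<longleftrightarrow> (\<forall>i<n. D0 (p i) dvd E.coord x i)"
      unfolding UL[OF lZ[OF u(1)]] u(2) using coord[OF u(1)] by simp
    also have "\<dots> \<longleftrightarrow> (\<forall>i<r. int (d i) dvd E.coord x i) \<and> (\<forall>i. r \<le> i \<longrightarrow> i < n \<longrightarrow> E.coord x i = 0)"
    proof -
      have "D0 (p i) dvd E.coord x i \<longleftrightarrow> (if i < r then int (d i) dvd E.coord x i else E.coord x i = 0)" if "i < n" for i
        using p(3) that by (auto simp: d_def)
      then show ?thesis using p(2) by (auto simp: not_less)
    qed
    finally show ?thesis .
  qed
  then have "N = {x \<in> carrier M. (\<forall>i<r. int (d i) dvd E.coord x i) \<and> (\<forall>i. r \<le> i \<longrightarrow> i < n \<longrightarrow> E.coord x i = 0)}"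
    using subgroup.subset[OF N] by (intro equalityI subsetI CollectI conjI) auto
  moreover have "0 < d i" if i: "i < r" for i
  proof -
    have "D0 (p i) \<noteq> 0" using p(3)[rule_format, of i] i p(2) by simp
    then show ?thesis unfolding d_def zero_less_nat_eq zero_less_abs_iff .
  qed
  ultimately have "adapted_basis M n e N r d" using p(2) by unfold_locales
  then show ?thesis by (intro exI)
qed

section \<open>Endomorphisms in coordinates\<close>

context exterior_basis
begin

lemma coord_one: "i < s \<Longrightarrow> coord \<one> i = 0"
  using coord_mult[of \<one> \<one> i] by simp

lemma coord_inv: "x \<in> carrier A \<Longrightarrow> i < s \<Longrightarrow> coord (inv x) i = - coord x i"
  using coord_mult[of x "inv x" i] coord_one[of i] by simp

lemma coord_int_pow:
  assumes x: "x \<in> carrier A" and i: "i < s" shows "coord (x [^] (m::int)) i = m * coord x i"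
proof (rule coord_eqI[OF _ i])
  have "x [^] m = (Z.lc (coord x) b {..<s}) [^] m" using coord[OF x] by simp
  then show "x [^] m = Z.lc (\<lambda>i. m * coord x i) b {..<s}" unfolding Z.sc_lc[OF b_Pi] .
qed

lemma coord_ext:
  assumes "x \<in> carrier A" "y \<in> carrier A" "\<And>i. i < s \<Longrightarrow> coord x i = coord y i" shows "x = y"
proof -
  have "x = Z.lc (coord x) b {..<s}" by (rule coord[OF assms(1)])
  also have "\<dots> = Z.lc (coord y) b {..<s}" by (rule Z.lc_cong) (use assms(3) in auto)
  finally show ?thesis using coord[OF assms(2)] by simp
qed

lemma coord_lc:
  assumes "finite I" "w \<in> I \<rightarrow> carrier A" "i < s"
  shows "coord (Z.lc c w I) i = (\<Sum>j\<in>I. c j * coord (w j) i)"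
  using assms unfolding Z.lc_def
  by (induction I rule: finite_induct) (simp_all add: coord_one coord_mult coord_int_pow Pi_iff)

lemma coord_hom:
  assumes f: "f \<in> hom A A" and x: "x \<in> carrier A" and i: "i < s"
  shows "coord (f x) i = (\<Sum>j<s. coord (f (b j)) i * coord x j)"
proof -
  have "f x = f (Z.lc (coord x) b {..<s})" using coord[OF x] by simp
  also have "\<dots> = Z.lc (coord x) (\<lambda>j. f (b j)) {..<s}"
    by (rule int_lc_hom[OF comm_group_axioms comm_group_axioms f b_Pi])
  finally show ?thesis
    using coord_lc[of "{..<s}" "\<lambda>j. f (b j)" i "coord x"] hom_in_carrier[OF f] i by (simp add: mult.commute)
qed

lemma int_trace_coord:
  assumes f: "f \<in> hom A A" shows "int_trace A f = (\<Sum>i<s. coord (f (b i)) i)"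
  unfolding int_trace_def
proof (rule Z.module_trace_eqI[where a = "\<lambda>i j. coord (f (b j)) i", OF basis linear_int_hom[OF comm_group_axioms f]])
  fix j assume "j \<in> {..<s}"
  then show "f (b j) = Z.lc (coord (f (b j))) b {..<s}" using hom_in_carrier[OF f] by (intro coord) auto
qed

lemma funpow_hom: "f \<in> hom A A \<Longrightarrow> (f ^^ j) \<in> hom A A"
  by (induction j) (auto simp: hom_def Pi_iff)

lemma coord_funpow:
  assumes f: "f \<in> hom A A"
  shows "u < s \<Longrightarrow> v < s \<Longrightarrow> coord ((f ^^ j) (b v)) u = mat_power s (\<lambda>i j. coord (f (b j)) i) j u v"
proof (induction j arbitrary: u v)
  case 0
  then show ?case by (simp add: coord_b)
next
  case (Suc j)
  have "coord ((f ^^ Suc j) (b v)) u = coord ((f ^^ j) (f (b v))) u" by (simp add: funpow_swap1)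
  also have "\<dots> = (\<Sum>l<s. coord ((f ^^ j) (b l)) u * coord (f (b v)) l)"
    using Suc.prems by (intro coord_hom funpow_hom[OF f] hom_in_carrier[OF f]) auto
  finally show ?case using Suc by simp
qed

lemma int_trace_exterior_power_minors:
  assumes f: "f \<in> hom A A"
  shows "int_trace (exterior_power k A) (exterior_power_map k A f) = minor_sum s (\<lambda>i j. coord (f (b j)) i) k"
proof -
  have "minor I (map f (map b I)) = dt k (\<lambda>i j. coord (f (b (I ! j))) (I ! i))" if "I \<in> bases" for I
  proof -
    have "minor I (map f (map b I)) = dt k (\<lambda>i j. coord (f (b (I ! i))) (I ! j))"
      unfolding minor_def using that by (intro dt_cong) (simp add: increasing_lists_def)
    then show ?thesis using dt_transpose[of k "\<lambda>i j. coord (f (b (I ! j))) (I ! i)"] by simp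
  qed
  then show ?thesis unfolding int_trace_exterior_power[OF f] minor_sum_def by (intro sum.cong refl)
qed

end

section \<open>Torsion and free part of the quotient by \<open>N\<close> in an adapted basis\<close>

context adapted_basis
begin

text \<open>The preimage in \<open>M\<close> of the torsion of \<open>M Mod N\<close>
  (\<open>mem_torsion\<close>), that is, the elements with a positive multiple in \<open>N\<close>
  (\<open>saturation_iff\<close>).\<close>

definition saturation :: "'a set"
  where "saturation = {x \<in> carrier M. \<forall>i. r \<le> i \<longrightarrow> i < n \<longrightarrow> coord x i = 0}"

lemma N_subset: "N \<subseteq> saturation" "saturation \<subseteq> carrier M"
  by (auto simp: N_eq saturation_def)

lemma subgroup_N: "subgroup N M"
proof
  fix x y assume "x \<in> N" "y \<in> N"
  then show "x \<otimes> y \<in> N" using r_le by (auto simp: N_eq coord_mult)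
next
  fix x assume "x \<in> N"
  then show "inv x \<in> N" using r_le by (auto simp: N_eq coord_inv)
qed (use r_le in \<open>auto simp: N_eq coord_one\<close>)

lemma subgroup_saturation: "subgroup saturation M"
  by unfold_locales (auto simp: saturation_def coord_one coord_mult coord_inv)

lemma power_mem_N:
  assumes "x \<in> saturation" shows "x [^] int (\<Prod>i<r. d i) \<in> N"
proof -
  have x: "x \<in> carrier M" using assms by (simp add: saturation_def)
  have "d i dvd (\<Prod>i<r. d i)" if "i < r" for i using that by (intro dvd_prodI) auto
  then have "int (d i) dvd int (\<Prod>i<r. d i) * coord x i" if "i < r" for i
    using that by (intro dvd_mult2) (simp only: int_dvd_int_iff)
  then show ?thesis using assms r_le by (simp add: N_eq saturation_def coord_int_pow[OF x] del: of_nat_prod)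
qed

lemma prod_d_pos: "0 < (\<Prod>i<r. d i)" by (rule prod_pos) (use d_pos in simp)

lemma saturation_iff:
  assumes x: "x \<in> carrier M" shows "x \<in> saturation \<longleftrightarrow> (\<exists>k::nat. 0 < k \<and> x [^] int k \<in> N)"
proof
  assume "x \<in> saturation"
  from power_mem_N[OF this] show "\<exists>k::nat. 0 < k \<and> x [^] int k \<in> N"
    using prod_d_pos by (intro exI[of _ "\<Prod>i<r. d i"] conjI)
next
  assume "\<exists>k::nat. 0 < k \<and> x [^] int k \<in> N"
  then obtain k :: nat where k: "0 < k" "x [^] int k \<in> N" by (elim exE conjE)
  have "coord x i = 0" if "r \<le> i" "i < n" for i
  proof -
    have "coord (x [^] int k) i = 0" using k(2) that by (simp add: N_eq)
    then show ?thesis using k(1) that by (simp only: coord_int_pow[OF x] mult_eq_0_iff) simp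
  qed
  then show "x \<in> saturation" using x by (simp add: saturation_def)
qed

abbreviation "Q \<equiv> M Mod N"
abbreviation "QF \<equiv> Q Mod torsion Q"

lemmas N_Mod = comm_group_Mod[OF comm_group_axioms subgroup_N]

lemma mem_torsion: "x \<in> carrier M \<Longrightarrow> N #> x \<in> torsion Q \<longleftrightarrow> x \<in> saturation"
proof -
  assume x: "x \<in> carrier M"
  have "(N #> x) [^]\<^bsub>Q\<^esub> k = \<one>\<^bsub>Q\<^esub> \<longleftrightarrow> x [^] int k \<in> N" for k :: nat
    using int_pow_coset[OF comm_group_axioms subgroup_N x, of "int k"]
      coset_eq_self_iff[OF comm_group_axioms subgroup_N, of "x [^] int k"] x by (simp add: int_pow_int)
  moreover have "N #> x \<in> carrier Q" unfolding N_Mod(3)[symmetric] using x by (rule imageI)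
  ultimately show ?thesis unfolding torsion_def saturation_iff[OF x] by simp
qed

lemma torsion_eq: "torsion Q = (\<lambda>x. N #> x) ` saturation"
proof (intro equalityI subsetI)
  fix X assume X: "X \<in> torsion Q"
  then have "X \<in> (\<lambda>x. N #> x) ` carrier M" unfolding N_Mod(3) by (simp add: torsion_def)
  then obtain x where x: "x \<in> carrier M" "X = N #> x" by (elim imageE) simp
  show "X \<in> (\<lambda>x. N #> x) ` saturation" unfolding x(2)
    by (rule imageI) (use X mem_torsion[OF x(1)] x(2) in simp)
next
  fix X assume "X \<in> (\<lambda>x. N #> x) ` saturation"
  then obtain x where x: "x \<in> saturation" "X = N #> x" by (elim imageE) simp
  then show "X \<in> torsion Q" using mem_torsion[of x] N_subset(2) by auto
qed

lemma subgroup_torsion: "subgroup (torsion Q) Q"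
proof -
  interpret Q: comm_group Q by (rule N_Mod(1))
  interpret h: group_hom M Q "\<lambda>x. N #> x" by unfold_locales (rule N_Mod(2))
  show ?thesis unfolding torsion_eq by (rule h.subgroup_img_is_subgroup[OF subgroup_saturation])
qed

lemmas QF_Mod = comm_group_Mod[OF N_Mod(1) subgroup_torsion]

definition proj :: "'a \<Rightarrow> 'a set set"
  where "proj x = torsion Q #>\<^bsub>Q\<^esub> (N #> x)"

lemma proj_hom: "proj \<in> hom M QF"
proof (rule homI)
  fix x y assume xy: "x \<in> carrier M" "y \<in> carrier M"
  note c = hom_in_carrier[OF N_Mod(2)]
  show "proj x \<in> carrier QF" unfolding proj_def by (rule hom_in_carrier[OF QF_Mod(2) c[OF xy(1)]])
  show "proj (x \<otimes> y) = proj x \<otimes>\<^bsub>QF\<^esub> proj y"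
    unfolding proj_def hom_mult[OF N_Mod(2) xy] by (rule hom_mult[OF QF_Mod(2) c[OF xy(1)] c[OF xy(2)]])
qed

lemma proj_image: "proj ` carrier M = carrier QF"
  unfolding QF_Mod(3)[symmetric] N_Mod(3)[symmetric] image_image proj_def[abs_def] ..

lemma proj_eq_iff:
  assumes x: "x \<in> carrier M" and y: "y \<in> carrier M"
  shows "proj x = proj y \<longleftrightarrow> x \<otimes> inv y \<in> saturation"
proof -
  interpret Q: comm_group Q by (rule N_Mod(1))
  interpret h: group_hom M Q "\<lambda>x. N #> x" by unfold_locales (rule N_Mod(2))
  have "proj x = proj y \<longleftrightarrow> (N #> x) \<otimes>\<^bsub>Q\<^esub> inv\<^bsub>Q\<^esub> (N #> y) \<in> torsion Q"
    unfolding proj_def using x y by (intro coset_eq_iff[OF N_Mod(1) subgroup_torsion]) auto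
  also have "(N #> x) \<otimes>\<^bsub>Q\<^esub> inv\<^bsub>Q\<^esub> (N #> y) = N #> (x \<otimes> inv y)"
    using x y h.hom_mult[of x "inv y"] h.hom_inv[of y] by simp
  finally show ?thesis unfolding mem_torsion[OF m_closed[OF x inv_closed[OF y]]] .
qed

definition free_basis :: "nat \<Rightarrow> 'a set set"
  where "free_basis i = proj (e (r + i))"

lemma lc_free_basis:
  "scalar_module.lc QF (\<lambda>(k::int) x. x [^]\<^bsub>QF\<^esub> k) c free_basis {..<n - r} = proj (Z.lc c (\<lambda>i. e (r + i)) {..<n - r})"
proof -
  have "(\<lambda>i. e (r + i)) \<in> {..<n - r} \<rightarrow> carrier M" by auto
  from int_lc_hom[OF comm_group_axioms QF_Mod(1) proj_hom this] show ?thesis by (simp add: free_basis_def[abs_def])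
qed

lemma coord_lc_free:
  assumes "r \<le> i" "i < n" shows "coord (Z.lc c (\<lambda>i. e (r + i)) {..<n - r}) i = c (i - r)"
proof -
  have "coord (Z.lc c (\<lambda>i. e (r + i)) {..<n - r}) i = (\<Sum>j<n - r. c j * coord (e (r + j)) i)"
    using assms by (intro coord_lc) auto
  also have "\<dots> = (\<Sum>j<n - r. if j = i - r then c j else 0)"
    using assms by (intro sum.cong refl) (auto simp: coord_b)
  finally show ?thesis using assms by (simp add: sum.delta)
qed

lemma proj_expand:
  assumes x: "x \<in> carrier M"
  shows "proj x = scalar_module.lc QF (\<lambda>(k::int) x. x [^]\<^bsub>QF\<^esub> k) (\<lambda>i. coord x (r + i)) free_basis {..<n - r}"
proof -
  let ?y = "Z.lc (\<lambda>i. coord x (r + i)) (\<lambda>i. e (r + i)) {..<n - r}"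
  have y: "?y \<in> carrier M" by (rule Z.lc_closed) auto
  have "coord (x \<otimes> inv ?y) i = 0" if "r \<le> i" "i < n" for i
    using that x y coord_lc_free[OF that] by (simp add: coord_mult coord_inv)
  then have "x \<otimes> inv ?y \<in> saturation" using x y by (simp add: saturation_def)
  then show ?thesis unfolding lc_free_basis proj_eq_iff[OF x y] .
qed

lemma exterior_basis_QF: "exterior_basis QF (n - r) free_basis"
proof -
  interpret F: scalar_module QF "\<lambda>(k::int) x. x [^]\<^bsub>QF\<^esub> k" by (rule scalar_module_int[OF QF_Mod(1)])
  show ?thesis
  proof (rule exterior_basisI[OF QF_Mod(1)], unfold F.basis_on_def, intro conjI ballI allI impI)
    show "free_basis \<in> {..<n - r} \<rightarrow> carrier QF"
      using hom_in_carrier[OF proj_hom] by (auto simp: free_basis_def)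
    fix X assume "X \<in> carrier QF"
    then obtain x where x: "x \<in> carrier M" "X = proj x" unfolding proj_image[symmetric] by (elim imageE) simp
    show "\<exists>c. X = F.lc c free_basis {..<n - r}" unfolding x(2) using proj_expand[OF x(1)] by (rule exI[of _ "\<lambda>i. coord x (r + i)"])
  next
    fix c i assume c: "F.lc c free_basis {..<n - r} = \<one>\<^bsub>QF\<^esub>" and i: "i \<in> {..<n - r}"
    let ?y = "Z.lc c (\<lambda>i. e (r + i)) {..<n - r}"
    have y: "?y \<in> carrier M" by (rule Z.lc_closed) auto
    have "proj ?y = proj \<one>" using c hom_one[OF proj_hom is_group F.is_group] unfolding lc_free_basis by simp
    then have "?y \<in> saturation" using proj_eq_iff[OF y] y by simp
    then show "c i = 0" using coord_lc_free[of "r + i" c] i by (simp add: saturation_def)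
  qed simp
qed

lemma coord_proj: "x \<in> carrier M \<Longrightarrow> i < n - r \<Longrightarrow> exterior_basis.coord QF (n - r) free_basis (proj x) i = coord x (r + i)"
  by (rule exterior_basis.coord_eqI[OF exterior_basis_QF proj_expand])

end

text \<open>Stated for any endomorphism that maps \<open>N\<close> into itself, so that it covers
  the action of \<open>g\<close> and of its powers.\<close>

locale adapted_endomorphism = adapted_basis +
  fixes f :: "'a \<Rightarrow> 'a"
  assumes f_hom: "f \<in> hom M M" and f_N: "f ` N \<subseteq> N"
begin

abbreviation entry :: "nat \<Rightarrow> nat \<Rightarrow> int"
  where "entry i j \<equiv> coord (f (e j)) i"

abbreviation "act_Q \<equiv> coset_map M N f"
abbreviation "act_QF \<equiv> coset_map Q (torsion Q) act_Q"

lemma f_closed: "x \<in> carrier M \<Longrightarrow> f x \<in> carrier M"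
  by (rule hom_in_carrier[OF f_hom])

lemma f_saturation: "x \<in> saturation \<Longrightarrow> f x \<in> saturation"
proof -
  assume x: "x \<in> saturation"
  then have xc: "x \<in> carrier M" using N_subset by blast
  obtain k :: nat where k: "0 < k" "x [^] int k \<in> N" using x unfolding saturation_iff[OF xc] by (elim exE conjE)
  have "f (x [^] int k) \<in> N" using k(2) f_N by blast
  then have "f x [^] int k \<in> N" using hom_int_pow[OF f_hom xc is_group is_group] by simp
  then show "f x \<in> saturation" using k(1) unfolding saturation_iff[OF f_closed[OF xc]] by (intro exI[of _ k] conjI)
qed

text \<open>Since \<open>f\<close> preserves the saturation, its matrix is block triangular: images
  of the first \<open>r\<close> basis elements have no free coordinates.\<close>

lemma entry_eq_0: "j < r \<Longrightarrow> r \<le> i \<Longrightarrow> i < n \<Longrightarrow> entry i j = 0"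
proof -
  assume ij: "j < r" "r \<le> i" "i < n"
  have "e j \<in> saturation" using ij by (auto simp: saturation_def coord_b)
  then show "entry i j = 0" using f_saturation ij by (auto simp: saturation_def)
qed

lemma scaled_basis_in_N: "j < r \<Longrightarrow> e j [^] int (d j) \<in> N"
  using r_le by (auto simp: N_eq coord_int_pow coord_b)

text \<open>Expresses that \<open>f\<close> maps \<open>d j\<close> times \<open>e j\<close> into
  \<open>N\<close>; this is the compatibility required by \<open>card_fixed_dual\<close>.\<close>

lemma entry_dvd: "i < r \<Longrightarrow> j < r \<Longrightarrow> int (d i) dvd entry i j * int (d j)"
proof -
  assume ij: "i < r" "j < r"
  have "f (e j [^] int (d j)) \<in> N" using scaled_basis_in_N[OF ij(2)] f_N by blast
  then have "f (e j) [^] int (d j) \<in> N" using hom_int_pow[OF f_hom _ is_group is_group, of "e j"] ij r_le by simp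
  then have "int (d i) dvd coord (f (e j) [^] int (d j)) i" using ij(1) by (simp add: N_eq)
  then show ?thesis using ij r_le f_closed by (simp add: coord_int_pow mult.commute)
qed

lemma act_Q_coset: "x \<in> carrier M \<Longrightarrow> act_Q (N #> x) = N #> f x"
  by (rule coset_map_coset[OF comm_group_axioms subgroup_N f_hom f_N])

lemma act_Q_hom: "act_Q \<in> hom Q Q"
  by (rule coset_map_hom[OF comm_group_axioms subgroup_N f_hom f_N])

lemma act_Q_torsion: "act_Q ` torsion Q \<subseteq> torsion Q"
proof (rule image_subsetI)
  fix X assume "X \<in> torsion Q"
  then obtain x where x: "x \<in> saturation" "X = N #> x" unfolding torsion_eq by (elim imageE) simp
  then have "act_Q X = N #> f x" using act_Q_coset[of x] N_subset by auto
  then show "act_Q X \<in> torsion Q" unfolding torsion_eq using f_saturation[OF x(1)] by simp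
qed

lemma act_QF_hom: "act_QF \<in> hom QF QF"
  by (rule coset_map_hom[OF N_Mod(1) subgroup_torsion act_Q_hom act_Q_torsion])

lemma act_QF_proj: "x \<in> carrier M \<Longrightarrow> act_QF (proj x) = proj (f x)"
proof -
  assume x: "x \<in> carrier M"
  have "N #> x \<in> carrier Q" unfolding N_Mod(3)[symmetric] using x by (rule imageI)
  from coset_map_coset[OF N_Mod(1) subgroup_torsion act_Q_hom act_Q_torsion this]
  show ?thesis unfolding proj_def act_Q_coset[OF x] .
qed

lemma coord_act_QF:
  "i < n - r \<Longrightarrow> j < n - r \<Longrightarrow>
   exterior_basis.coord QF (n - r) free_basis (act_QF (free_basis j)) i = entry (r + i) (r + j)"
  unfolding free_basis_def by (simp add: act_QF_proj coord_proj[unfolded free_basis_def[abs_def]] f_closed)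

lemma int_trace_QF: "int_trace QF act_QF = (\<Sum>i<n - r. entry (r + i) (r + i))"
  using exterior_basis.int_trace_coord[OF exterior_basis_QF act_QF_hom] by (simp add: coord_act_QF)

lemma int_trace_M: "int_trace M f = (\<Sum>i<n. entry i i)"
  by (rule int_trace_coord[OF f_hom])

text \<open>In the basis of \<open>N\<close> formed by \<open>d j\<close> times \<open>e j\<close>
  the matrix is conjugated by the diagonal matrix of the \<open>d i\<close>, which leaves its
  diagonal unchanged.\<close>

lemma int_trace_N: "int_trace (subgroup_generated M N) f = (\<Sum>i<r. entry i i)"
proof -
  let ?N = "subgroup_generated M N"
  have cN: "carrier ?N = N" by (rule subgroup.carrier_subgroup_generated_subgroup[OF subgroup_N])
  have comm: "comm_group ?N" by (rule abelian_subgroup_generated[OF comm_group_axioms])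
  interpret S: scalar_module ?N "\<lambda>(k::int) x. x [^]\<^bsub>?N\<^esub> k" by (rule scalar_module_int[OF comm])
  let ?b = "\<lambda>i. e i [^] int (d i)"
  have b: "?b \<in> {..<r} \<rightarrow> carrier ?N" unfolding cN using scaled_basis_in_N by auto
  have bM: "?b \<in> {..<r} \<rightarrow> carrier M" using r_le by auto
  have "(\<lambda>x. x) \<in> hom ?N M" using N_subset by (auto simp: hom_def cN)
  from int_lc_hom[OF comm comm_group_axioms this b]
  have lc: "S.lc c ?b {..<r} = Z.lc c ?b {..<r}" for c by simp
  have co: "coord (Z.lc c ?b {..<r}) i = (if i < r then c i * int (d i) else 0)" if "i < n" for c i
  proof -
    have "coord (Z.lc c ?b {..<r}) i = (\<Sum>j<r. c j * coord (?b j) i)"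
      using bM that by (intro coord_lc) auto
    also have "\<dots> = (\<Sum>j<r. if j = i then c j * int (d j) else 0)"
      using that r_le by (intro sum.cong refl) (auto simp: coord_int_pow coord_b)
    finally show ?thesis by (simp add: sum.delta)
  qed
  \<comment> \<open>The division is exact, because the coordinates of elements of \<open>N\<close>
    are multiples of the \<open>d i\<close>.\<close>
  have expand: "x = S.lc (\<lambda>i. coord x i div int (d i)) ?b {..<r}" if x: "x \<in> N" for x
    unfolding lc
  proof (rule coord_ext)
    show "x \<in> carrier M" using x N_subset by blast
    show "Z.lc (\<lambda>i. coord x i div int (d i)) ?b {..<r} \<in> carrier M" by (rule Z.lc_closed[OF bM])
    fix i assume i: "i < n"
    show "coord x i = coord (Z.lc (\<lambda>i. coord x i div int (d i)) ?b {..<r}) i"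
      unfolding co[OF i] using x i by (auto simp: N_eq)
  qed
  have basisN: "S.basis_on {..<r} ?b"
    unfolding S.basis_on_def
  proof (intro conjI ballI allI impI)
    show "?b \<in> {..<r} \<rightarrow> carrier ?N" by (rule b)
    fix x assume "x \<in> carrier ?N"
    then show "\<exists>c. x = S.lc c ?b {..<r}" unfolding cN by (intro exI) (rule expand)
  next
    fix c i assume c: "S.lc c ?b {..<r} = \<one>\<^bsub>?N\<^esub>" and i: "i \<in> {..<r}"
    have "coord (Z.lc c ?b {..<r}) i = coord \<one> i" using c unfolding lc by simp
    then show "c i = 0" using co[of i c] coord_one[of i] i r_le d_pos[of i] by simp
  qed simp
  have f: "f \<in> hom ?N ?N"
    using f_N N_subset hom_mult[OF f_hom] by (auto simp: hom_def cN subset_iff)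
  have "int_trace ?N f = (\<Sum>i<r. coord (f (?b i)) i div int (d i))"
    unfolding int_trace_def
  proof (rule S.module_trace_eqI[where a = "\<lambda>i j. coord (f (?b j)) i div int (d i)", OF basisN linear_int_hom[OF comm f]])
    fix j assume "j \<in> {..<r}"
    then show "f (?b j) = S.lc (\<lambda>i. coord (f (?b j)) i div int (d i)) ?b {..<r}"
      using b cN f_N by (intro expand) auto
  qed
  also have "\<dots> = (\<Sum>i<r. entry i i)"
  proof (intro sum.cong refl)
    fix i assume "i \<in> {..<r}"
    then have i: "i < r" "i < n" using r_le by auto
    have "coord (f (?b i)) i = int (d i) * entry i i"
      using i f_closed by (simp add: hom_int_pow[OF f_hom _ is_group is_group] coord_int_pow)
    then show "coord (f (?b i)) i div int (d i) = entry i i" using d_pos[OF i(1)] by simp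
  qed
  finally show ?thesis .
qed

lemma int_trace_QF_diff: "int_trace QF act_QF = int_trace M f - int_trace (subgroup_generated M N) f"
proof -
  have "(\<Sum>i<n. entry i i) = (\<Sum>i<r. entry i i) + (\<Sum>i<n - r. entry (r + i) (r + i))"
    using r_le sum.atLeastLessThan_concat[of 0 r n "\<lambda>i. entry i i"] sum.shift_bounds_nat_ivl[of "\<lambda>i. entry i i" 0 r "n - r"]
    by (simp add: atLeast0LessThan add.commute)
  then show ?thesis unfolding int_trace_QF int_trace_M int_trace_N by simp
qed

lemma int_trace_exterior_QF:
  "int_trace (exterior_power k QF) (exterior_power_map k QF act_QF) =
   minor_sum (n - r) (\<lambda>i j. entry (r + i) (r + j)) k"
proof -
  have "minor_sum (n - r) (\<lambda>i j. exterior_basis.coord QF (n - r) free_basis (act_QF (free_basis j)) i) k =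
      minor_sum (n - r) (\<lambda>i j. entry (r + i) (r + j)) k"
    unfolding minor_sum_def
    by (intro sum.cong refl dt_cong coord_act_QF) (auto simp: increasing_lists_def subset_iff)
  then show ?thesis unfolding exterior_basis.int_trace_exterior_power_minors[OF exterior_basis_QF act_QF_hom] .
qed

text \<open>Meant for \<open>h\<close> the action of a power of \<open>g\<close>, which is known to
  agree with the iterate of \<open>f\<close> on the carrier. On the free part, iterates become
  matrix powers.\<close>

lemma int_trace_iterate:
  assumes h: "adapted_endomorphism M n e N r d h" and hf: "\<And>x. x \<in> carrier M \<Longrightarrow> h x = (f ^^ j) x"
  shows "int_trace QF (coset_map Q (torsion Q) (coset_map M N h)) =
    (\<Sum>u<n - r. mat_power (n - r) (\<lambda>i j. entry (r + i) (r + j)) j u u)"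
proof -
  interpret h: adapted_endomorphism M n e N r d h by (rule h)
  have fc: "(f ^^ l) x \<in> carrier M" if "x \<in> carrier M" for l x
    using that by (induction l) (auto simp: f_closed)
  have it: "proj ((f ^^ l) x) = (act_QF ^^ l) (proj x)" if x: "x \<in> carrier M" for l x
    by (induction l) (simp_all add: act_QF_proj[OF fc[OF x], symmetric])
  have mp: "mat_power (n - r) (\<lambda>i j. exterior_basis.coord QF (n - r) free_basis (act_QF (free_basis j)) i) j u v =
      mat_power (n - r) (\<lambda>i j. entry (r + i) (r + j)) j u v" if "u < n - r" "v < n - r" for u v
    using that by (induction j arbitrary: v) (auto intro!: sum.cong simp: coord_act_QF)
  have "h.entry (r + u) (r + u) = mat_power (n - r) (\<lambda>i j. entry (r + i) (r + j)) j u u" if u: "u < n - r" for u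
  proof -
    have ec: "e (r + u) \<in> carrier M" using u by simp
    have "h.entry (r + u) (r + u) = exterior_basis.coord QF (n - r) free_basis (proj ((f ^^ j) (e (r + u)))) u"
      using coord_proj[OF fc[OF ec] u] hf[OF ec] by simp
    also have "\<dots> = exterior_basis.coord QF (n - r) free_basis ((act_QF ^^ j) (free_basis u)) u"
      unfolding it[OF ec] free_basis_def ..
    also have "\<dots> = mat_power (n - r) (\<lambda>i j. exterior_basis.coord QF (n - r) free_basis (act_QF (free_basis j)) i) j u u"
      by (rule exterior_basis.coord_funpow[OF exterior_basis_QF act_QF_hom u u])
    finally show ?thesis using mp[OF u u] by simp
  qed
  then show ?thesis unfolding h.int_trace_QF by (intro sum.cong refl) simp
qed

end

section \<open>The character torus of a quotient\<close>

lemma comm_group_complex_mult: "comm_group complex_mult_group"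
proof (rule comm_groupI)
  fix x assume "x \<in> carrier complex_mult_group"
  then show "\<exists>y\<in>carrier complex_mult_group. y \<otimes>\<^bsub>complex_mult_group\<^esub> x = \<one>\<^bsub>complex_mult_group\<^esub>"
    by (intro bexI[of _ "inverse x"]) (auto simp: complex_mult_group_def)
qed (auto simp: complex_mult_group_def)

lemma carrier_complex_mult: "carrier complex_mult_group = - {0}"
  by (auto simp: complex_mult_group_def)

lemma mult_complex_mult: "x \<otimes>\<^bsub>complex_mult_group\<^esub> y = x * y" "\<one>\<^bsub>complex_mult_group\<^esub> = 1"
  by (simp_all add: complex_mult_group_def)

lemma int_pow_complex_mult:
  assumes "z \<noteq> 0" shows "z [^]\<^bsub>complex_mult_group\<^esub> (k::int) = z powi k"
proof -
  interpret comm_group complex_mult_group by (rule comm_group_complex_mult)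
  have nat: "z [^]\<^bsub>complex_mult_group\<^esub> (m::nat) = z ^ m" for m
    by (induction m) (simp_all add: mult_complex_mult)
  have inv: "inv\<^bsub>complex_mult_group\<^esub> w = inverse w" if "w \<noteq> 0" for w
    using that by (intro inv_equality) (auto simp: mult_complex_mult carrier_complex_mult)
  show ?thesis using assms by (simp add: int_pow_def2 nat inv power_int_def power_inverse)
qed

lemma finprod_complex_mult:
  assumes "finite I" "\<And>i. i \<in> I \<Longrightarrow> g i \<noteq> 0" shows "finprod complex_mult_group g I = prod g I"
proof -
  interpret comm_group complex_mult_group by (rule comm_group_complex_mult)
  show ?thesis using assms
    by (induction I rule: finite_induct) (simp_all add: mult_complex_mult carrier_complex_mult Pi_iff)
qed

lemma topspace_toric_intersection:
  "topspace (toric_intersection M S) = {\<psi> \<in> extensional (carrier M). \<psi> \<in> hom M complex_mult_group \<and> (\<forall>m\<in>S. \<psi> m = 1)}"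
  by (auto simp: toric_intersection_def character_space_def PiE_UNIV_domain extensional_def PiE_def)

text \<open>The kernel of a character is a subgroup, so a character that is 1 on \<open>S\<close> is
  1 on the subgroup generated by \<open>S\<close>.\<close>

lemma (in comm_group) toric_intersection_generate:
  assumes S: "S \<subseteq> carrier G" shows "toric_intersection G S = toric_intersection G (generate G S)"
proof -
  have "\<psi> m = 1" if \<psi>: "\<psi> \<in> hom G complex_mult_group" and one: "\<forall>m\<in>S. \<psi> m = 1" and m: "m \<in> generate G S" for \<psi> m
  proof -
    interpret h: group_hom G complex_mult_group \<psi>
      by (intro group_hom.intro group_hom_axioms.intro is_group comm_group.axioms(2)[OF comm_group_complex_mult] \<psi>)
    have "S \<subseteq> kernel G complex_mult_group \<psi>" using S one by (auto simp: kernel_def mult_complex_mult)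
    then have "generate G S \<subseteq> kernel G complex_mult_group \<psi>" by (rule generate_subgroup_incl[OF _ h.subgroup_kernel])
    then show ?thesis using m by (auto simp: kernel_def mult_complex_mult)
  qed
  then have eq: "topspace (character_space G) \<inter> {\<psi>. \<forall>m\<in>S. \<psi> m = 1} = topspace (character_space G) \<inter> {\<psi>. \<forall>m\<in>generate G S. \<psi> m = 1}"
    using generate.incl[of _ S G] unfolding character_space_def by auto
  have "subtopology (character_space G) {\<psi>. \<forall>m\<in>S. \<psi> m = 1} =
      subtopology (character_space G) (topspace (character_space G) \<inter> {\<psi>. \<forall>m\<in>S. \<psi> m = 1})"
    by (rule subtopology_restrict[symmetric])
  also have "\<dots> = subtopology (character_space G) {\<psi>. \<forall>m\<in>generate G S. \<psi> m = 1}"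
    unfolding eq by (rule subtopology_restrict)
  finally show ?thesis unfolding toric_intersection_def .
qed

lemma root_of_unity_separation:
  assumes "d > 0" "\<And>z::complex. z ^ d = 1 \<Longrightarrow> z powi y = 1" shows "int d dvd y"
proof -
  have "(\<Sum>z\<in>{z::complex. z ^ d = 1}. z powi y) = of_nat (card {z::complex. z ^ d = 1})" using assms(2) by simp
  then have "(\<Sum>z\<in>{z::complex. z ^ d = 1}. z powi y) \<noteq> 0" using assms(1) by (simp add: card_roots_unity_eq)
  then show ?thesis unfolding sum_roots_of_unity_power[OF assms(1)] by (simp split: if_splits)
qed

lemma two_powi_eq_1: assumes "(2::complex) powi k = 1" shows "k = 0"
proof -
  have "(2::real) powi k = norm ((2::complex) powi k)" by (simp add: norm_power_int)
  then have "2 powr (of_int k) = (1::real)" using assms by (simp add: powr_real_of_int')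
  then show ?thesis by (simp add: powr_eq_one_iff_gen)
qed

lemma continuous_map_prod_powi:
  assumes "\<And>i. i \<in> I \<Longrightarrow> continuous_map X euclidean (g i)" and "\<And>i x. i \<in> I \<Longrightarrow> x \<in> topspace X \<Longrightarrow> g i x \<noteq> (0::complex)"
  shows "continuous_map X euclidean (\<lambda>x. \<Prod>i\<in>I. g i x powi c i)"
  unfolding continuous_map_atin limitin_canonical_iff
proof
  fix x assume x: "x \<in> topspace X"
  have "(g i \<longlongrightarrow> g i x) (atin X x)" if "i \<in> I" for i
    using assms(1)[OF that] x unfolding continuous_map_atin limitin_canonical_iff by blast
  then show "((\<lambda>x. \<Prod>i\<in>I. g i x powi c i) \<longlongrightarrow> (\<Prod>i\<in>I. g i x powi c i)) (atin X x)"
    using assms(2) x by (intro tendsto_prod tendsto_power_int) auto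
qed

context adapted_basis
begin

abbreviation "torus \<equiv> toric_intersection M N"

lemma character_expand:
  assumes \<psi>: "\<psi> \<in> hom M complex_mult_group" and x: "x \<in> carrier M"
  shows "\<psi> x = (\<Prod>i<n. \<psi> (e i) powi coord x i)"
proof -
  interpret C: scalar_module complex_mult_group "\<lambda>(k::int) x. x [^]\<^bsub>complex_mult_group\<^esub> k"
    by (rule scalar_module_int[OF comm_group_complex_mult])
  have nz: "\<psi> (e i) \<noteq> 0" if "i < n" for i using hom_in_carrier[OF \<psi>, of "e i"] that by (simp add: carrier_complex_mult)
  have "\<psi> x = \<psi> (Z.lc (coord x) e {..<n})" using coord[OF x] by simp
  also have "\<dots> = C.lc (coord x) (\<lambda>i. \<psi> (e i)) {..<n}"
    by (rule int_lc_hom[OF comm_group_axioms comm_group_complex_mult \<psi> b_Pi])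
  also have "\<dots> = finprod complex_mult_group (\<lambda>i. \<psi> (e i) powi coord x i) {..<n}"
    unfolding C.lc_def using nz by (intro C.finprod_cong') (auto simp: int_pow_complex_mult carrier_complex_mult)
  also have "\<dots> = (\<Prod>i<n. \<psi> (e i) powi coord x i)" using nz by (intro finprod_complex_mult) auto
  finally show ?thesis .
qed

definition char :: "(nat \<Rightarrow> complex) \<Rightarrow> 'a \<Rightarrow> complex"
  where "char z = (\<lambda>x\<in>carrier M. \<Prod>i<n. z i powi coord x i)"

lemma char_basis: "j < n \<Longrightarrow> char z (e j) = z j"
proof -
  assume j: "j < n"
  have "char z (e j) = (\<Prod>i<n. z i powi (if i = j then 1 else 0))"
    unfolding char_def using j by (simp add: coord_b)
  also have "\<dots> = (\<Prod>i<n. if i = j then z i else 1)" by (intro prod.cong refl) simp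
  finally show "char z (e j) = z j" using j by (simp add: prod.delta)
qed

lemma char_in_torus:
  assumes z: "\<And>i. i < n \<Longrightarrow> z i \<noteq> 0" and zd: "\<And>i. i < r \<Longrightarrow> z i ^ d i = 1"
  shows "char z \<in> topspace torus"
proof -
  have "char z \<in> hom M complex_mult_group"
    using z by (intro homI) (auto simp: char_def carrier_complex_mult mult_complex_mult coord_mult power_int_add prod.distrib[symmetric] intro!: prod.cong)
  moreover have "char z m = 1" if m: "m \<in> N" for m
  proof -
    have "z i powi coord m i = 1" if i: "i < n" for i
    proof (cases "i < r")
      case True
      then have "int (d i) dvd coord m i" using m by (simp add: N_eq)
      then obtain q where "coord m i = int (d i) * q" by (elim dvdE)
      then show ?thesis by (simp add: power_int_mult zd[OF True])
    next
      case False
      then show ?thesis using m i by (simp add: N_eq)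
    qed
    then show ?thesis using m N_subset by (auto simp: char_def intro!: prod.neutral)
  qed
  moreover have "char z \<in> extensional (carrier M)" by (simp add: char_def)
  ultimately show ?thesis unfolding topspace_toric_intersection by simp
qed

text \<open>\<open>N\<close> is the common kernel of the characters in the torus. Characters with a
  single nontrivial value on the basis test one coordinate at a time.\<close>

lemma torus_separates:
  assumes x: "x \<in> carrier M" and one: "\<And>\<psi>. \<psi> \<in> topspace torus \<Longrightarrow> \<psi> x = 1"
  shows "x \<in> N"
proof -
  have zi: "w powi coord x i = 1" if i: "i < n" and w: "w \<noteq> 0" "i < r \<Longrightarrow> w ^ d i = 1" for w :: complex and i
  proof -
    let ?z = "\<lambda>j. if j = i then w else 1"
    have "char ?z \<in> topspace torus" using w by (intro char_in_torus) auto
    from one[OF this] have "(\<Prod>j<n. ?z j powi coord x j) = 1" using x by (simp add: char_def)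
    moreover have "(\<Prod>j<n. ?z j powi coord x j) = (\<Prod>j<n. if j = i then w powi coord x j else 1)"
      by (intro prod.cong) auto
    ultimately show ?thesis using i by (simp add: prod.delta)
  qed
  have "int (d i) dvd coord x i" if i: "i < r" for i
  proof (rule root_of_unity_separation[OF d_pos[OF i]])
    fix w :: complex assume w: "w ^ d i = 1"
    then have "w \<noteq> 0" using d_pos[OF i] by (auto simp: zero_power)
    then show "w powi coord x i = 1" using zi[of i w] w i r_le by simp
  qed
  \<comment> \<open>The test value 2 has infinite order in the multiplicative group.\<close>
  moreover have "coord x i = 0" if "r \<le> i" "i < n" for i
    using zi[of i 2] that by (intro two_powi_eq_1) simp
  ultimately show ?thesis using x by (simp add: N_eq)
qed

text \<open>From left to right, \<open>torus_separates\<close> turns statements about characters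
  into membership in \<open>N\<close>: stability of the torus gives one inclusion, surjectivity of
  the pullback the other. From right to left, the inverse of \<open>f\<close> also preserves
  \<open>N\<close>, so pulling back along it provides preimages.\<close>

lemma stabilizes_torus_iff:
  assumes f: "f \<in> hom M M" and bij: "bij_betw f (carrier M) (carrier M)"
  shows "(\<lambda>\<psi>. compose (carrier M) \<psi> f) ` topspace torus = topspace torus \<longleftrightarrow> f ` N = N"
    (is "?\<rho> ` ?T = ?T \<longleftrightarrow> _")
proof
  assume eq: "?\<rho> ` ?T = ?T"
  have fN: "f m \<in> N" if m: "m \<in> N" for m
  proof (rule torus_separates)
    have mc: "m \<in> carrier M" using m N_subset by auto
    show "f m \<in> carrier M" using hom_in_carrier[OF f mc] .
    fix \<psi> assume "\<psi> \<in> ?T"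
    then have "?\<rho> \<psi> \<in> ?\<rho> ` ?T" by (rule imageI)
    then have "?\<rho> \<psi> \<in> ?T" unfolding eq .
    then have "?\<rho> \<psi> m = 1" using m by (simp add: topspace_toric_intersection)
    then show "\<psi> (f m) = 1" using mc by (simp add: compose_def)
  qed
  show "f ` N = N"
  proof (intro equalityI subsetI)
    fix x assume x: "x \<in> N"
    then have "x \<in> f ` carrier M" using bij_betw_imp_surj_on[OF bij] N_subset by auto
    then obtain y where y: "y \<in> carrier M" "x = f y" by (elim imageE) simp
    have "y \<in> N"
    proof (rule torus_separates[OF y(1)])
      fix \<psi> assume "\<psi> \<in> ?T"
      then have "\<psi> \<in> ?\<rho> ` ?T" using eq by simp
      then obtain \<psi>' where \<psi>': "\<psi>' \<in> ?T" "\<psi> = ?\<rho> \<psi>'" by (elim imageE) simp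
      then show "\<psi> y = 1" using x y by (simp add: compose_def topspace_toric_intersection)
    qed
    then show "x \<in> f ` N" using y by simp
  qed (use fN in auto)
next
  assume eq: "f ` N = N"
  have comp: "compose (carrier M) \<psi> h \<in> ?T" if \<psi>: "\<psi> \<in> ?T" and h: "h \<in> hom M M" "h ` N \<subseteq> N" for \<psi> h
  proof -
    have p: "\<psi> \<in> hom M complex_mult_group" "\<And>m. m \<in> N \<Longrightarrow> \<psi> m = 1" using \<psi> by (auto simp: topspace_toric_intersection)
    have "compose (carrier M) \<psi> h \<in> hom M complex_mult_group" by (rule hom_compose[OF h(1) p(1)])
    moreover have "compose (carrier M) \<psi> h m = 1" if "m \<in> N" for m
    proof -
      have "m \<in> carrier M" "h m \<in> N" using that h(2) N_subset by auto
      then show ?thesis using p(2) by (simp add: compose_def)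
    qed
    ultimately show ?thesis unfolding topspace_toric_intersection by (simp add: compose_def)
  qed
  define g where "g = inv_into (carrier M) f"
  have iso: "f \<in> iso M M" using f bij by (simp add: iso_def)
  have g: "g \<in> hom M M" using iso_set_sym[OF iso] by (simp add: g_def iso_def)
  have gf: "g (f x) = x" if "x \<in> carrier M" for x unfolding g_def by (rule bij_betw_inv_into_left[OF bij that])
  have "g ` N \<subseteq> N"
  proof (rule image_subsetI)
    fix x assume "x \<in> N"
    then have "x \<in> f ` N" using eq by simp
    then obtain y where "y \<in> N" "x = f y" by (elim imageE) simp
    then show "g x \<in> N" using gf[of y] N_subset by auto
  qed
  show "?\<rho> ` ?T = ?T"
  proof (intro equalityI subsetI)
    fix \<psi> assume \<psi>: "\<psi> \<in> ?T"
    have pull: "?\<rho> (compose (carrier M) \<psi> g) = \<psi>"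
    proof (rule extensionalityI[of _ "carrier M"])
      show "\<psi> \<in> extensional (carrier M)" using \<psi> by (simp add: topspace_toric_intersection)
      fix x assume "x \<in> carrier M"
      then show "?\<rho> (compose (carrier M) \<psi> g) x = \<psi> x" using hom_in_carrier[OF f] gf by (simp add: compose_def)
    qed (simp add: compose_def)
    show "\<psi> \<in> ?\<rho> ` ?T" using imageI[OF comp[OF \<psi> g \<open>g ` N \<subseteq> N\<close>], of ?\<rho>] unfolding pull .
  next
    fix \<psi> assume "\<psi> \<in> ?\<rho> ` ?T"
    then show "\<psi> \<in> ?T" using comp[OF _ f] eq by (elim imageE) simp
  qed
qed

lemma continuous_map_eval: "x \<in> carrier M \<Longrightarrow> continuous_map torus euclidean (\<lambda>\<psi>. \<psi> x)"
  unfolding toric_intersection_def character_space_def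
  by (intro continuous_map_from_subtopology continuous_map_product_projection)

lemma torus_eq: "torus = subtopology (product_topology (\<lambda>_. euclidean) (carrier M)) (hom M complex_mult_group \<inter> {\<psi>. \<forall>m\<in>N. \<psi> m = 1})"
  unfolding toric_intersection_def character_space_def subtopology_subtopology ..

lemma continuous_map_torusI:
  assumes h: "\<And>x. x \<in> topspace X \<Longrightarrow> h x \<in> topspace torus"
    and c: "\<And>m. m \<in> carrier M \<Longrightarrow> continuous_map X euclidean (\<lambda>x. h x m)"
  shows "continuous_map X torus h"
  unfolding torus_eq continuous_map_in_subtopology continuous_map_componentwise
  using h c by (auto simp: topspace_toric_intersection)

lemma continuous_map_char:
  assumes c: "\<And>i. i < n \<Longrightarrow> continuous_map X euclidean (\<lambda>x. z x i)"
    and z: "\<And>x i. x \<in> topspace X \<Longrightarrow> i < n \<Longrightarrow> z x i \<noteq> 0"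
    and zd: "\<And>x i. x \<in> topspace X \<Longrightarrow> i < r \<Longrightarrow> z x i ^ d i = 1"
  shows "continuous_map X torus (\<lambda>x. char (z x))"
proof (rule continuous_map_torusI)
  show "char (z x) \<in> topspace torus" if "x \<in> topspace X" for x
    by (rule char_in_torus) (use z zd that in auto)
  fix m assume m: "m \<in> carrier M"
  have "continuous_map X euclidean (\<lambda>x. \<Prod>i<n. z x i powi coord m i)"
    by (rule continuous_map_prod_powi) (use c z in auto)
  then show "continuous_map X euclidean (\<lambda>x. char (z x) m)" using m by (simp add: char_def)
qed

abbreviation factor :: "nat \<Rightarrow> complex set"
  where "factor i \<equiv> (if i < r then {z. z ^ d i = 1} else - {0})"

lemma torus_value_in_factor:
  assumes \<psi>: "\<psi> \<in> topspace torus" and i: "i < n" shows "\<psi> (e i) \<in> factor i" "\<psi> (e i) \<noteq> 0"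
proof -
  have p: "\<psi> \<in> hom M complex_mult_group" "\<And>m. m \<in> N \<Longrightarrow> \<psi> m = 1" using \<psi> by (auto simp: topspace_toric_intersection)
  show nz: "\<psi> (e i) \<noteq> 0" using hom_in_carrier[OF p(1), of "e i"] i by (simp add: carrier_complex_mult)
  have "\<psi> (e i) ^ d i = 1" if ir: "i < r"
  proof -
    have "e i [^] int (d i) \<in> N" using ir r_le by (auto simp: N_eq coord_int_pow coord_b)
    then have "1 = \<psi> (e i [^] int (d i))" using p(2) by simp
    also have "\<dots> = \<psi> (e i) powi int (d i)"
      unfolding hom_int_pow[OF p(1) b_carrier[OF i] is_group comm_group.axioms(2)[OF comm_group_complex_mult]]
      by (rule int_pow_complex_mult[OF nz])
    finally show ?thesis by simp
  qed
  then show "\<psi> (e i) \<in> factor i" using nz by simp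
qed

lemma torus_homeomorphic:
  "torus homeomorphic_space product_topology (\<lambda>i. top_of_set (factor i)) {..<n}"
proof -
  let ?Y = "product_topology (\<lambda>i. top_of_set (factor i)) {..<n}"
  have Y: "z i \<noteq> 0" "i < r \<Longrightarrow> z i ^ d i = 1" if "z \<in> topspace ?Y" "i < n" for z i
  proof -
    have "z i \<in> factor i" using that by (auto simp: PiE_iff)
    then show "z i \<noteq> 0" "i < r \<Longrightarrow> z i ^ d i = 1" using d_pos[of i] by (auto simp: zero_power split: if_splits)
  qed
  have "homeomorphic_maps torus ?Y (\<lambda>\<psi>. \<lambda>i\<in>{..<n}. \<psi> (e i)) char"
    unfolding homeomorphic_maps_def
  proof (intro conjI ballI)
    show "continuous_map torus ?Y (\<lambda>\<psi>. \<lambda>i\<in>{..<n}. \<psi> (e i))"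
      unfolding continuous_map_componentwise
    proof (intro conjI ballI)
      fix i assume i: "i \<in> {..<n}"
      have "continuous_map torus (top_of_set (factor i)) (\<lambda>\<psi>. \<psi> (e i))"
        unfolding continuous_map_in_subtopology
        using i continuous_map_eval[of "e i"] torus_value_in_factor(1)[of _ i] by auto
      then show "continuous_map torus (top_of_set (factor i)) (\<lambda>\<psi>. (\<lambda>i\<in>{..<n}. \<psi> (e i)) i)" using i by simp
    qed auto
    have "continuous_map ?Y torus (\<lambda>z. char z)"
    proof (rule continuous_map_char)
      fix i assume i: "i < n"
      have "continuous_map ?Y (top_of_set (factor i)) (\<lambda>z. z i)" using i by (intro continuous_map_product_projection) simp
      then show "continuous_map ?Y euclidean (\<lambda>z. z i)" by (rule continuous_map_into_fulltopology)
    qed (use Y r_le in auto)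
    then show "continuous_map ?Y torus char" .
    fix \<psi> assume \<psi>: "\<psi> \<in> topspace torus"
    have p: "\<psi> \<in> hom M complex_mult_group" "\<psi> \<in> extensional (carrier M)" using \<psi> by (auto simp: topspace_toric_intersection)
    show "char (\<lambda>i\<in>{..<n}. \<psi> (e i)) = \<psi>"
    proof (rule extensionalityI[of _ "carrier M"])
      fix x assume x: "x \<in> carrier M"
      show "char (\<lambda>i\<in>{..<n}. \<psi> (e i)) x = \<psi> x" unfolding character_expand[OF p(1) x] char_def using x by simp
    qed (use p in \<open>auto simp: char_def\<close>)
  next
    fix z assume z: "z \<in> topspace ?Y"
    then have "z \<in> extensional {..<n}" by (simp add: PiE_iff)
    then show "(\<lambda>i\<in>{..<n}. char z (e i)) = z"
      by (intro extensionalityI[of _ "{..<n}"]) (auto simp: char_basis)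
  qed
  then show ?thesis by (auto simp: homeomorphic_space_def)
qed

lemma generated_homology_group_torus:
  "generated_by_at_most ((\<Prod>i<r. d i) * ((n - r) choose k)) (homology_group (int k) torus)"
proof -
  let ?Y = "product_topology (\<lambda>i. top_of_set (factor i)) {..<n}"
  have "generated_by_at_most ((\<Prod>i<r. card (factor i)) * ((n - r) choose k)) (homology_group (int k) ?Y)"
    by (rule generated_homology_group_product[OF r_le]) (auto simp: finite_roots_of_unity d_pos)
  moreover have "(\<Prod>i<r. card (factor i)) = (\<Prod>i<r. d i)"
    by (intro prod.cong refl) (simp add: card_roots_unity_eq d_pos)
  ultimately have "generated_by_at_most ((\<Prod>i<r. d i) * ((n - r) choose k)) (homology_group (int k) ?Y)" by simp
  moreover have "homology_group (int k) ?Y \<cong> homology_group (int k) torus"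
    by (rule homeomorphic_space_imp_isomorphic_homology_groups[OF torus_homeomorphic[unfolded homeomorphic_space_sym[of torus]]])
  ultimately show ?thesis by (rule generated_by_at_most_iso[OF group_relative_homology_group _ group_relative_homology_group])
qed

end

section \<open>Cochains and cycles on the character torus\<close>

lemma (in exterior_basis) additive_expand:
  fixes h :: "'a \<Rightarrow> complex"
  assumes h: "\<And>x y. x \<in> carrier A \<Longrightarrow> y \<in> carrier A \<Longrightarrow> h (x \<otimes> y) = h x + h y" and x: "x \<in> carrier A"
  shows "h x = (\<Sum>i<s. of_int (coord x i) * h (b i))"
proof -
  have one: "h \<one> = 0" using h[of \<one> \<one>] by simp
  have inv: "h (inv x) = - h x" if "x \<in> carrier A" for x
    using h[of x "inv x"] that one by (simp add: add_eq_0_iff2)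
  have nat: "h (x [^] (m::nat)) = of_nat m * h x" if "x \<in> carrier A" for x m
    using that by (induction m) (simp_all add: one h ring_distribs)
  have pow: "h (x [^] (m::int)) = of_int m * h x" if "x \<in> carrier A" for x m
  proof -
    have "h (x [^] m) = (if m < 0 then - (of_nat (nat (- m)) * h x) else of_nat (nat m) * h x)"
      unfolding int_pow_def2 using inv[OF nat_pow_closed[OF that]] nat[OF that] by (simp only: split: if_split) simp
    then show ?thesis by (simp add: of_nat_nat)
  qed
  have "h (Z.lc c b I) = (\<Sum>i\<in>I. of_int (c i) * h (b i))" if "finite I" "I \<subseteq> {..<s}" for c I
    using that unfolding Z.lc_def
    by (induction I rule: finite_induct) (simp_all add: one h pow Pi_iff subset_iff)
  from this[of "{..<s}" "coord x"] show ?thesis using coord[OF x] by simp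
qed

lemma continuous_on_simplex_iff:
  "continuous_map (subtopology (powertop_real UNIV) S) euclidean g \<longleftrightarrow> continuous_on S g"
  by (simp add: euclidean_product_topology)

context adapted_basis
begin

definition vals :: "nat \<Rightarrow> ((nat \<Rightarrow> real) \<Rightarrow> 'a \<Rightarrow> complex) \<Rightarrow> 'a \<Rightarrow> nat \<Rightarrow> complex"
  where "vals p \<sigma> x j = dlog p (\<lambda>q. \<sigma> q x) j"

text \<open>Differences of logarithms kill torsion (\<open>vals_torsion\<close>), so they descend to
  the free part; the formula in coordinates gives the descended map as a function on
  \<open>QF\<close> without a choice of representatives.\<close>

definition free_vals :: "nat \<Rightarrow> ((nat \<Rightarrow> real) \<Rightarrow> 'a \<Rightarrow> complex) \<Rightarrow> 'a set set \<Rightarrow> nat \<Rightarrow> complex"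
  where "free_vals p \<sigma> X j =
    (\<Sum>i<n - r. of_int (exterior_basis.coord QF (n - r) free_basis X i) * vals p \<sigma> (e (r + i)) j)"

text \<open>Read off at the first vertex, but constant along a simplex by
  \<open>value_constant\<close>: the values on the torsion coordinates name the connected component
  that contains the simplex.\<close>

definition component :: "((nat \<Rightarrow> real) \<Rightarrow> 'a \<Rightarrow> complex) \<Rightarrow> nat \<Rightarrow> complex"
  where "component \<sigma> = (\<lambda>i\<in>{..<r}. \<sigma> (vertex 0) (e i))"

definition torus_index :: "nat \<Rightarrow> ((nat \<Rightarrow> complex) \<times> nat list) set"
  where "torus_index k = dual_group r d \<times> increasing_lists (n - r) k"

definition torus_cochain :: "nat \<Rightarrow> (nat \<Rightarrow> complex) \<times> nat list \<Rightarrow> ((nat \<Rightarrow> real) \<Rightarrow> 'a \<Rightarrow> complex) \<Rightarrow> complex"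
  where "torus_cochain k b \<sigma> =
    (if component \<sigma> = fst b then volume k (free_vals k \<sigma>) (map free_basis (snd b)) else 0)"

lemma finite_torus_index: "finite (torus_index k)"
  unfolding torus_index_def by (intro finite_cartesian_product finite_dual_group d_pos finite_increasing_lists)

lemma card_torus_index: "card (torus_index k) = (\<Prod>i<r. d i) * ((n - r) choose k)"
  unfolding torus_index_def card_cartesian_product card_increasing_lists
  by (simp add: card_dual_group d_pos)

lemma free_vals_basis: "i < n - r \<Longrightarrow> free_vals p \<sigma> (free_basis i) j = vals p \<sigma> (e (r + i)) j"
proof -
  assume i: "i < n - r"
  have "free_vals p \<sigma> (free_basis i) j = (\<Sum>l<n - r. if l = i then vals p \<sigma> (e (r + l)) j else 0)"
    unfolding free_vals_def using i exterior_basis.coord_b[OF exterior_basis_QF] by (intro sum.cong) auto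
  then show ?thesis using i by (simp add: sum.delta)
qed

section \<open>Logarithms and components along a singular simplex of the torus\<close>

context
  fixes p :: nat and \<sigma> :: "(nat \<Rightarrow> real) \<Rightarrow> 'a \<Rightarrow> complex"
  assumes \<sigma>: "singular_simplex p torus \<sigma>"
begin

lemma simplex_value: "q \<in> standard_simplex p \<Longrightarrow> \<sigma> q \<in> topspace torus"
  using \<sigma> by (auto simp: singular_simplex_def continuous_map_def)

lemma simplex_value_hom: "q \<in> standard_simplex p \<Longrightarrow> \<sigma> q \<in> hom M complex_mult_group"
  using simplex_value by (simp add: topspace_toric_intersection)

lemma continuous_on_simplex_value: "x \<in> carrier M \<Longrightarrow> continuous_on (standard_simplex p) (\<lambda>q. \<sigma> q x)"
proof -
  assume x: "x \<in> carrier M"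
  have "continuous_map (subtopology (powertop_real UNIV) (standard_simplex p)) torus \<sigma>"
    using \<sigma> by (simp add: singular_simplex_def)
  from continuous_map_compose[OF this continuous_map_eval[OF x]]
  have "continuous_map (subtopology (powertop_real UNIV) (standard_simplex p)) euclidean (\<lambda>q. \<sigma> q x)"
    by (simp add: comp_def)
  then show ?thesis unfolding continuous_on_simplex_iff .
qed

lemma unit_valued_simplex: "x \<in> carrier M \<Longrightarrow> unit_valued p (\<lambda>q. \<sigma> q x)"
  unfolding unit_valued_def
  using continuous_on_simplex_value hom_in_carrier[OF simplex_value_hom] by (auto simp: carrier_complex_mult)

lemma vals_mult:
  assumes "x \<in> carrier M" "y \<in> carrier M" "j \<le> p" shows "vals p \<sigma> (x \<otimes> y) j = vals p \<sigma> x j + vals p \<sigma> y j"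
proof -
  have "vals p \<sigma> (x \<otimes> y) j = dlog p (\<lambda>q. \<sigma> q x * \<sigma> q y) j"
    unfolding vals_def
    by (rule dlog_cong) (use hom_mult[OF simplex_value_hom] assms in \<open>simp add: mult_complex_mult\<close>)
  then show ?thesis unfolding vals_def using assms by (simp add: dlog_mult unit_valued_simplex)
qed

lemma vals_expand: "x \<in> carrier M \<Longrightarrow> j \<le> p \<Longrightarrow> vals p \<sigma> x j = (\<Sum>i<n. of_int (coord x i) * vals p \<sigma> (e i) j)"
  by (rule additive_expand[of "\<lambda>x. vals p \<sigma> x j"]) (auto simp: vals_mult)

text \<open>On \<open>d i\<close> times \<open>e i\<close>, an element of \<open>N\<close>, the
  simplex is constantly 1. So \<open>d i\<close> times the difference vanishes, and the complex
  numbers are torsion free.\<close>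

lemma vals_torsion:
  assumes i: "i < r" and j: "j \<le> p" shows "vals p \<sigma> (e i) j = 0"
proof -
  have ei: "e i [^] int (d i) \<in> N" "e i [^] int (d i) \<in> carrier M" "i < n"
    using i r_le by (auto simp: N_eq coord_int_pow coord_b)
  have "vals p \<sigma> (e i [^] int (d i)) j = dlog p (\<lambda>q. 1) j"
    unfolding vals_def by (rule dlog_cong) (use simplex_value ei in \<open>simp add: topspace_toric_intersection\<close>)
  then have "vals p \<sigma> (e i [^] int (d i)) j = 0" using j by (simp add: dlog_const)
  moreover have "vals p \<sigma> (e i [^] int (d i)) j = (\<Sum>l<n. if l = i then of_nat (d i) * vals p \<sigma> (e l) j else 0)"
    unfolding vals_expand[OF ei(2) j] using ei(3) by (intro sum.cong) (auto simp: coord_int_pow coord_b)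
  ultimately have "of_nat (d i) * vals p \<sigma> (e i) j = 0" using ei(3) by (simp add: sum.delta)
  then show ?thesis using d_pos[OF i] by simp
qed

lemma vals_expand_free:
  assumes x: "x \<in> carrier M" and j: "j \<le> p"
  shows "vals p \<sigma> x j = (\<Sum>i<n - r. of_int (coord x (r + i)) * vals p \<sigma> (e (r + i)) j)"
proof -
  have "vals p \<sigma> x j = (\<Sum>i\<in>{..<n} - {..<r}. of_int (coord x i) * vals p \<sigma> (e i) j)"
    unfolding vals_expand[OF x j] using vals_torsion j by (intro sum.mono_neutral_right) auto
  also have "\<dots> = (\<Sum>i<n - r. of_int (coord x (r + i)) * vals p \<sigma> (e (r + i)) j)"
    by (rule sum.reindex_bij_witness[of _ "\<lambda>i. r + i" "\<lambda>i. i - r"]) auto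
  finally show ?thesis .
qed

lemma component_in: "component \<sigma> \<in> dual_group r d"
  unfolding component_def dual_group_def restrict_PiE_iff
proof
  fix i assume "i \<in> {..<r}"
  then show "\<sigma> (vertex 0) (e i) \<in> {z. z ^ d i = 1}"
    using torus_value_in_factor(1)[OF simplex_value[of "vertex 0"], of i] r_le by simp
qed

text \<open>A continuous function with finitely many values on a connected simplex is
  constant.\<close>

lemma value_constant:
  assumes i: "i < r" and q: "q \<in> standard_simplex p" "q' \<in> standard_simplex p"
  shows "\<sigma> q (e i) = \<sigma> q' (e i)"
proof -
  have i_n: "i < n" using i r_le by simp
  have "(\<lambda>q. \<sigma> q (e i)) ` standard_simplex p \<subseteq> {z. z ^ d i = 1}"
    using torus_value_in_factor(1)[OF simplex_value i_n] i by auto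
  then have "finite ((\<lambda>q. \<sigma> q (e i)) ` standard_simplex p)"
    using finite_roots_of_unity[OF d_pos[OF i]] by (rule finite_subset)
  then have "(\<lambda>q. \<sigma> q (e i)) constant_on standard_simplex p"
    by (intro continuous_finite_range_constant connected_standard_simplex continuous_on_simplex_value) (simp add: i_n)
  then show ?thesis using q unfolding constant_on_def by metis
qed

end

lemma component_face:
  assumes \<tau>: "singular_simplex (Suc k) torus \<tau>" and i: "i \<le> Suc k"
  shows "component (singular_face (Suc k) i \<tau>) = component \<tau>"
proof -
  have "singular_face (Suc k) i \<tau> (vertex 0) = \<tau> (vertex (skip i 0))"
    by (simp add: singular_face_def simplical_face_vertex)
  moreover have "\<tau> (vertex (skip i 0)) (e l) = \<tau> (vertex 0) (e l)" if "l < r" for l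
    by (rule value_constant[OF \<tau> that]) (simp_all add: skip_def)
  ultimately show ?thesis by (auto simp: component_def)
qed

lemma vals_face:
  assumes \<tau>: "singular_simplex (Suc k) torus \<tau>" and i: "i \<le> Suc k" and j: "j \<le> k" and x: "x \<in> carrier M"
  shows "vals k (singular_face (Suc k) i \<tau>) x j = vals (Suc k) \<tau> x (skip i j) - vals (Suc k) \<tau> x (skip i 0)"
proof -
  have "vals k (singular_face (Suc k) i \<tau>) x j = dlog k (\<lambda>q. \<tau> (simplical_face i q) x) j"
    unfolding vals_def by (rule dlog_cong) (simp add: singular_face_def)
  also have "\<dots> = vals (Suc k) \<tau> x (skip i j) - vals (Suc k) \<tau> x (skip i 0)"
    unfolding vals_def by (rule dlog_face[OF unit_valued_simplex[OF \<tau> x] i j])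
  finally show ?thesis .
qed

text \<open>All faces lie in the component of the simplex, so either every term vanishes or
  \<open>volume_cocycle\<close> applies.\<close>

lemma torus_cochain_cocycle:
  assumes b: "b \<in> torus_index k" shows "cocycle_fun k torus (torus_cochain k b)"
proof (rule cocycle_funI)
  fix \<tau> assume \<tau>: "singular_simplex (Suc k) torus \<tau>"
  let ?xs = "map free_basis (snd b)" and ?a = "free_vals (Suc k) \<tau>"
  have len: "length ?xs = k" using b by (auto simp: torus_index_def increasing_lists_def)
  have fv: "free_vals k (singular_face (Suc k) i \<tau>) X j = ?a X (skip i j) - ?a X (skip i 0)"
    if "i \<le> Suc k" "j \<le> k" for i X j
    unfolding free_vals_def sum_subtractf[symmetric]
    by (intro sum.cong refl) (simp add: vals_face[OF \<tau> that] right_diff_distrib)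
  have "torus_cochain k b (singular_face (Suc k) i \<tau>) =
      (if component \<tau> = fst b then volume k (\<lambda>X j. ?a X (skip i j) - ?a X (skip i 0)) ?xs else 0)"
    if i: "i \<le> Suc k" for i
    unfolding torus_cochain_def component_face[OF \<tau> i] using volume_cong[OF len fv[OF i]] by simp
  then have "(\<Sum>i\<le>Suc k. (-1) ^ i * torus_cochain k b (singular_face (Suc k) i \<tau>)) =
      (\<Sum>i\<le>Suc k. (-1) ^ i * (if component \<tau> = fst b then volume k (\<lambda>X j. ?a X (skip i j) - ?a X (skip i 0)) ?xs else 0))"
    by (intro sum.cong refl) (simp only: atMost_iff)
  also have "\<dots> = 0"
  proof (cases "component \<tau> = fst b")
    case True
    show ?thesis unfolding if_P[OF True] by (rule volume_cocycle)
  qed simp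
  finally show "(\<Sum>i\<le>Suc k. (-1) ^ i * torus_cochain k b (singular_face (Suc k) i \<tau>)) = 0" .
qed

text \<open>The product inverts the list \<open>J\<close>: for distinct entries at most one factor
  is a \<open>u m\<close>, and free coordinates outside \<open>J\<close> receive the empty value 1.
  The shift by one reflects that torus coordinates are numbered from 1 and list positions from
  0.\<close>

definition torus_point :: "(nat \<Rightarrow> complex) \<Rightarrow> nat list \<Rightarrow> (nat \<Rightarrow> complex) \<Rightarrow> nat \<Rightarrow> complex"
  where "torus_point c J u i =
    (if i < r then c i else \<Prod>m\<in>{1..length J}. if r + J ! (m - 1) = i then u m else 1)"

definition subtorus_cycle :: "nat \<Rightarrow> (nat \<Rightarrow> complex) \<times> nat list \<Rightarrow> ('a \<Rightarrow> complex) chain"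
  where "subtorus_cycle k b = torus_cycle k (\<lambda>u. char (torus_point (fst b) (snd b) u))"

context
  fixes k :: nat and c :: "nat \<Rightarrow> complex" and J :: "nat list" and q :: "nat \<Rightarrow> nat"
  assumes c: "c \<in> dual_group r d" and J: "J \<in> increasing_lists (n - r) k" and q: "q permutes {1..k}"
begin

abbreviation (input) "angle x \<equiv> (\<lambda>m. if m \<in> {1..k} then E2 (of_real (\<Sum>l=q m..k. x l)) else 1)"
abbreviation (input) "\<tau> \<equiv> torus_simplex k (\<lambda>u. char (torus_point c J u)) q"

lemma c_root: "i < r \<Longrightarrow> c i ^ d i = 1" "i < r \<Longrightarrow> c i \<noteq> 0"
proof -
  show *: "c i ^ d i = 1" if "i < r" using c that by (auto simp: dual_group_def)
  show "c i \<noteq> 0" if "i < r" using *[OF that] d_pos[OF that] by (auto simp: zero_power)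
qed

lemma J_list: "length J = k" "distinct J" "m < k \<Longrightarrow> J ! m < n - r"
proof -
  show len: "length J = k" and "distinct J" using J by (auto simp: increasing_lists_def strict_sorted_iff)
  show "J ! m < n - r" if "m < k"
    using J nth_mem[of m J] that len by (auto simp: increasing_lists_def subset_iff)
qed

lemma torus_point_nonzero: "torus_point c J (angle x) i \<noteq> 0"
  unfolding torus_point_def using c_root by (auto simp: prod_zero_iff)

lemma singular_simplex_torus_simplex: "singular_simplex k torus \<tau>"
  unfolding singular_simplex_def
proof
  let ?S = "subtopology (powertop_real UNIV) (standard_simplex k)"
  have "continuous_map ?S torus (\<lambda>x. char (torus_point c J (angle x)))"
  proof (rule continuous_map_char)
    fix i
    have coor: "continuous_on S (\<lambda>x::nat \<Rightarrow> real. x m)" for m S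
      by (rule continuous_on_product_then_coordinatewise[OF continuous_on_id])
    have ang: "continuous_on (standard_simplex k) (\<lambda>x. E2 (of_real (\<Sum>l=a..k. x l)))" for a
      by (intro continuous_intros coor)
    have "continuous_on (standard_simplex k) (\<lambda>x. if r + J ! (m - 1) = i then angle x m else 1)" for m
      by (cases "r + J ! (m - 1) = i"; cases "m \<in> {1..k}") (simp_all only: if_True if_False simp_thms ang continuous_on_const)
    then have "continuous_on (standard_simplex k) (\<lambda>x. torus_point c J (angle x) i)"
      unfolding torus_point_def by (cases "i < r") (simp_all add: continuous_on_prod del: atLeastAtMost_iff)
    then show "continuous_map ?S euclidean (\<lambda>x. torus_point c J (angle x) i)"
      unfolding continuous_on_simplex_iff .
  next
    fix x i show "torus_point c J (angle x) i \<noteq> 0" by (rule torus_point_nonzero)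
  next
    fix x i assume "i < r" then show "torus_point c J (angle x) i ^ d i = 1"
      using c_root(1) by (simp add: torus_point_def)
  qed
  then show "continuous_map ?S torus \<tau>"
    by (rule continuous_map_eq) (simp add: torus_simplex_def)
  show "\<tau> \<in> extensional (standard_simplex k)" by (simp add: torus_simplex_def)
qed

lemma torus_simplex_value:
  "x \<in> standard_simplex k \<Longrightarrow> i < n \<Longrightarrow> \<tau> x (e i) = torus_point c J (angle x) i"
  unfolding torus_simplex_def by (simp only: restrict_apply' char_basis)

lemma component_torus_simplex: "component \<tau> = c"
proof (rule extensionalityI[of _ "{..<r}"])
  show "c \<in> extensional {..<r}" using c by (simp add: dual_group_def PiE_iff)
  fix i assume i: "i \<in> {..<r}"
  have v: "vertex 0 \<in> standard_simplex k" by simp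
  show "component \<tau> i = c i"
    using i r_le torus_simplex_value[OF v, of i] by (simp add: component_def torus_point_def)
qed (simp add: component_def)

text \<open>The free coordinate at position \<open>m\<close> of \<open>J\<close> is the exponential
  of the tail starting at \<open>q (Suc m)\<close>, so its logarithm rises by 1 from vertex
  \<open>0\<close> to vertex \<open>j\<close> exactly when that tail contains \<open>j\<close>. Free
  coordinates outside \<open>J\<close> are constant.\<close>

lemma vals_torus_simplex:
  assumes l: "l < n - r" and j: "j \<le> k"
  shows "m < k \<Longrightarrow> l = J ! m \<Longrightarrow> vals k \<tau> (e (r + l)) j = (if q (Suc m) \<le> j then 1 else 0)"
    and "l \<notin> set J \<Longrightarrow> vals k \<tau> (e (r + l)) j = 0"
proof -
  have v: "vals k \<tau> (e (r + l)) j = dlog k (\<lambda>x. \<Prod>m'\<in>{1..k}. if J ! (m' - 1) = l then angle x m' else 1) j"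
    unfolding vals_def
  proof (rule dlog_cong)
    fix x assume x: "x \<in> standard_simplex k"
    have rl: "r + l < n" "\<not> r + l < r" using l by auto
    show "\<tau> x (e (r + l)) = (\<Prod>m'\<in>{1..k}. if J ! (m' - 1) = l then angle x m' else 1)"
      unfolding torus_simplex_value[OF x rl(1)] torus_point_def if_not_P[OF rl(2)] J_list(1) add_left_cancel ..
  qed
  show "vals k \<tau> (e (r + l)) j = (if q (Suc m) \<le> j then 1 else 0)" if m: "m < k" "l = J ! m" for m
  proof -
    have eq: "J ! (m' - 1) = l \<longleftrightarrow> m' = Suc m" if "m' \<in> {1..k}" for m'
    proof -
      have "m' - 1 < length J" using that J_list(1) by auto
      then have "J ! (m' - 1) = l \<longleftrightarrow> m' - 1 = m"
        unfolding m(2) using m(1) J_list(1) by (intro nth_eq_iff_index_eq[OF J_list(2)]) auto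
      then show ?thesis using that by auto
    qed
    have "(\<Prod>m'\<in>{1..k}. if J ! (m' - 1) = l then u m' else 1) = u (Suc m)" for u :: "nat \<Rightarrow> complex"
    proof -
      have "(\<Prod>m'\<in>{1..k}. if J ! (m' - 1) = l then u m' else 1) = (\<Prod>m'\<in>{1..k}. if m' = Suc m then u m' else 1)"
        by (intro prod.cong refl if_cong eq)
      then show ?thesis using m(1) by (simp add: prod.delta)
    qed
    then have "vals k \<tau> (e (r + l)) j = dlog k (\<lambda>x. angle x (Suc m)) j" unfolding v by (simp only:)
    also have "\<dots> = dlog k (\<lambda>x. E2 (of_real (\<Sum>l=q (Suc m)..k. x l))) j"
      using m(1) by (intro dlog_cong) simp
    also have "\<dots> = (if q (Suc m) \<le> j then 1 else 0)"
    proof (rule dlog_partial_sum[OF _ j])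
      show "1 \<le> q (Suc m)" using permutes_in_image[OF q, of "Suc m"] m(1) by simp
    qed
    finally show ?thesis .
  qed
  show "vals k \<tau> (e (r + l)) j = 0" if "l \<notin> set J"
  proof -
    have "J ! (m' - 1) \<noteq> l" if "m' \<in> {1..k}" for m'
    proof -
      have "m' - 1 < length J" using that J_list(1) by auto
      then show ?thesis using nth_mem \<open>l \<notin> set J\<close> by metis
    qed
    then have "(\<Prod>m'\<in>{1..k}. if J ! (m' - 1) = l then u m' else 1) = 1" for u :: "nat \<Rightarrow> complex"
      by (intro prod.neutral) simp
    then have "vals k \<tau> (e (r + l)) j = dlog k (\<lambda>x. 1) j" unfolding v by (simp only:)
    then show ?thesis using j by (simp add: dlog_const)
  qed
qed

text \<open>For \<open>I = J\<close> this is the matrix of \<open>dt_permuted_triangle\<close>;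
  otherwise some index of \<open>I\<close> lies outside \<open>J\<close> and gives a zero
  row.\<close>

lemma volume_torus_simplex:
  assumes I: "I \<in> increasing_lists (n - r) k"
  shows "volume k (free_vals k \<tau>) (map free_basis I) = (if I = J then of_int (sign q) else 0)"
proof -
  have I': "length I = k" "distinct I" "\<And>m. m < k \<Longrightarrow> I ! m < n - r"
  proof -
    show len: "length I = k" and "distinct I" using I by (auto simp: increasing_lists_def strict_sorted_iff)
    show "I ! m < n - r" if "m < k" for m
      using I nth_mem[of m I] that len by (auto simp: increasing_lists_def subset_iff)
  qed
  have vol: "volume k (free_vals k \<tau>) (map free_basis I) =
      dt (Suc k) (\<lambda>i j. if i = 0 then 1 else vals k \<tau> (e (r + I ! (i - 1))) j)"
    unfolding volume_def
  proof (rule dt_cong)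
    fix i j assume ij: "i < Suc k" "j < Suc k"
    show "(if i = 0 then 1 else free_vals k \<tau> (map free_basis I ! (i - 1)) j) =
        (if i = 0 then 1 else vals k \<tau> (e (r + I ! (i - 1))) j)"
    proof (cases "i = 0")
      case False
      then have "i - 1 < k" using ij by simp
      then show ?thesis using False I' by (simp add: free_vals_basis)
    qed simp
  qed
  show ?thesis
  proof (cases "I = J")
    case True
    have "volume k (free_vals k \<tau>) (map free_basis I) = dt (Suc k) (\<lambda>i j. if i = 0 then 1 else if q i \<le> j then 1 else 0)"
      unfolding vol
    proof (rule dt_cong)
      fix i j assume ij: "i < Suc k" "j < Suc k"
      show "(if i = 0 then 1 else vals k \<tau> (e (r + I ! (i - 1))) j) = (if i = 0 then 1 else if q i \<le> j then 1 else 0)"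
      proof (cases "i = 0")
        case False
        then have "i - 1 < k" "Suc (i - 1) = i" using ij by auto
        then show ?thesis using False ij True vals_torus_simplex(1)[of "J ! (i - 1)" j "i - 1"] J_list(3)[of "i - 1"] by simp
      qed simp
    qed
    then show ?thesis using True dt_permuted_triangle[OF q] by simp
  next
    case False
    have "set I \<noteq> set J"
      using inj_onD[OF bij_betw_imp_inj_on[OF bij_betw_increasing_lists] _ I J] False by auto
    moreover have "card (set I) = card (set J)"
      using I' J_list by (simp add: distinct_card)
    ultimately have "\<not> set I \<subseteq> set J" using card_subset_eq[of "set J" "set I"] by auto
    then obtain x where x: "x \<in> set I" "x \<notin> set J" by auto
    then obtain m where "m < length I" "I ! m = x" unfolding in_set_conv_nth by auto
    then have m: "m < k" "I ! m \<notin> set J" using x I'(1) by auto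
    have "dt (Suc k) (\<lambda>i j. if i = 0 then 1 else vals k \<tau> (e (r + I ! (i - 1))) j) = 0"
      using m I'(3) vals_torus_simplex(2) by (intro dt_row_zero[of "Suc m"]) auto
    then show ?thesis unfolding vol using False by simp
  qed
qed

end

lemma subtorus_cycle: "b \<in> torus_index k \<Longrightarrow> singular_relcycle k torus {} (subtorus_cycle k b)"
  unfolding subtorus_cycle_def
  by (rule singular_cycle_torus_cycle, rule singular_simplex_torus_simplex) (auto simp: torus_index_def)

text \<open>On the matching cycle each of the \<open>k!\<close> simplices contributes the square of
  its sign.\<close>

lemma cochain_cycle_pairing:
  assumes b: "b \<in> torus_index k" and b': "b' \<in> torus_index k"
  shows "frag_lin (torus_cochain k b) (subtorus_cycle k b') = (if b = b' then fact k else 0)"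
proof -
  let ?t = "\<lambda>q. torus_simplex k (\<lambda>u. char (torus_point (fst b') (snd b') u)) q"
  have ind: "fst b' \<in> dual_group r d" "snd b' \<in> increasing_lists (n - r) k" "snd b \<in> increasing_lists (n - r) k"
    using b b' by (auto simp: torus_index_def)
  have v: "torus_cochain k b (?t q) = (if b = b' then of_int (sign q) else 0)" if q: "q permutes {1..k}" for q
    unfolding torus_cochain_def component_torus_simplex[OF ind(1,2) q] volume_torus_simplex[OF ind(1,2) q ind(3)]
    by (auto simp: prod_eq_iff)
  have "frag_lin (torus_cochain k b) (subtorus_cycle k b') =
      (\<Sum>q\<in>{q. q permutes {1..k}}. of_int (sign q) * (if b = b' then of_int (sign q) else 0))"
    unfolding subtorus_cycle_def frag_lin_torus_cycle by (intro sum.cong refl) (simp add: v)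
  also have "\<dots> = (\<Sum>q\<in>{q. q permutes {1..k}}. if b = b' then 1 else 0)"
    by (intro sum.cong refl) (simp flip: of_int_mult)
  also have "\<dots> = (if b = b' then fact k else 0)" using card_permutations[of "{1..k}" k] by simp
  finally show ?thesis .
qed

end

section \<open>The trace on the cohomology of the torus\<close>

lemma minor_sum_eq_0: "s < k \<Longrightarrow> minor_sum s A k = 0"
proof -
  assume "s < k"
  then have "card (increasing_lists s k) = 0" by (simp add: card_increasing_lists)
  then have "increasing_lists s k = {}" by simp
  then show ?thesis by (simp add: minor_sum_def)
qed

context adapted_endomorphism
begin

abbreviation pull :: "('a \<Rightarrow> complex) \<Rightarrow> 'a \<Rightarrow> complex"
  where "pull \<equiv> (\<lambda>\<psi>. compose (carrier M) \<psi> f)"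

lemma continuous_map_pull: "continuous_map torus torus pull"
proof (rule continuous_map_torusI)
  fix \<psi> assume \<psi>: "\<psi> \<in> topspace torus"
  then have p: "\<psi> \<in> hom M complex_mult_group" "\<And>m. m \<in> N \<Longrightarrow> \<psi> m = 1" by (auto simp: topspace_toric_intersection)
  have "pull \<psi> \<in> hom M complex_mult_group" by (rule hom_compose[OF f_hom p(1)])
  moreover have "pull \<psi> m = 1" if "m \<in> N" for m
  proof -
    have "m \<in> carrier M" "f m \<in> N" using that f_N N_subset by auto
    then show ?thesis using p(2) by (simp add: compose_def)
  qed
  ultimately show "pull \<psi> \<in> topspace torus" unfolding topspace_toric_intersection by (simp add: compose_def)
next
  fix m assume m: "m \<in> carrier M"
  show "continuous_map torus euclidean (\<lambda>\<psi>. pull \<psi> m)"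
    using continuous_map_eval[OF f_closed[OF m]] m by (simp add: compose_def)
qed

lemma vals_pull: "x \<in> carrier M \<Longrightarrow> vals k (simplex_map k pull \<sigma>) x j = vals k \<sigma> (f x) j"
  unfolding vals_def by (rule dlog_cong) (simp add: simplex_map_def compose_def)

text \<open>Evaluating the pulled back simplex at \<open>x\<close> means evaluating the original one
  at \<open>f x\<close>; modulo torsion this trades the action on the torus for the action on
  \<open>QF\<close>.\<close>

lemma free_vals_pull:
  assumes \<sigma>: "singular_simplex k torus \<sigma>" and i: "i < n - r" and j: "j \<le> k"
  shows "free_vals k (simplex_map k pull \<sigma>) (free_basis i) j = free_vals k \<sigma> (act_QF (free_basis i)) j"
proof -
  have ec: "e (r + i) \<in> carrier M" using i by simp
  have "free_vals k (simplex_map k pull \<sigma>) (free_basis i) j = vals k \<sigma> (f (e (r + i))) j"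
    using i by (simp add: free_vals_basis vals_pull)
  also have "\<dots> = (\<Sum>l<n - r. of_int (entry (r + l) (r + i)) * vals k \<sigma> (e (r + l)) j)"
    by (rule vals_expand_free[OF \<sigma> f_closed[OF ec] j])
  also have "\<dots> = free_vals k \<sigma> (act_QF (free_basis i)) j"
    unfolding free_vals_def using i by (intro sum.cong refl) (simp add: coord_act_QF)
  finally show ?thesis .
qed

text \<open>Block triangularity removes the factors with \<open>l \<ge> r\<close> from the expansion
  of a character at \<open>f (e i)\<close>, which leaves the dual of the torsion block.\<close>

lemma component_pull:
  assumes \<sigma>: "singular_simplex k torus \<sigma>"
  shows "component (simplex_map k pull \<sigma>) = dual_map r entry (component \<sigma>)"
proof -
  have v: "vertex 0 \<in> standard_simplex k" by simp
  have "\<sigma> (vertex 0) (f (e i)) = (\<Prod>l<r. component \<sigma> l powi entry l i)" if i: "i < r" for i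
  proof -
    have fe: "f (e i) \<in> carrier M" using i r_le f_closed by simp
    have "\<sigma> (vertex 0) (f (e i)) = (\<Prod>l<n. \<sigma> (vertex 0) (e l) powi entry l i)"
      by (rule character_expand[OF simplex_value_hom[OF \<sigma> v] fe])
    also have "\<dots> = (\<Prod>l<r. \<sigma> (vertex 0) (e l) powi entry l i)"
      using r_le i entry_eq_0 by (intro prod.mono_neutral_right) auto
    finally show ?thesis by (simp add: component_def)
  qed
  then show ?thesis
    unfolding component_def[of "simplex_map k pull \<sigma>"] dual_map_def
    using r_le by (intro restrict_ext) (simp add: simplex_map_def compose_def)
qed

lemma cohomology_trace_torus:
  "module_trace (cohomology_group k torus) (cohomology_scale k torus) (cohomology_pullback k torus pull) =
   of_nat (card {c \<in> dual_group r d. dual_map r entry c = c}) *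
   of_int (int_trace (exterior_power k QF) (exterior_power_map k QF act_QF))"
proof -
  interpret X: exterior_basis QF k "n - r" free_basis by (rule exterior_basis_QF)
  let ?D = "dual_group r d" and ?L = "increasing_lists (n - r) k"
  define \<mu> where "\<mu> J I = X.minor J (map act_QF (map free_basis I))" for J I
  \<comment> \<open>The tensor product of the incidence matrix of the map on components with the
    matrix of the exterior power. The cochain of \<open>b\<close> pulls back to a cochain supported
    on the components that are sent to \<open>fst b\<close>.\<close>
  define a where "a b' b = (if dual_map r entry (fst b') = fst b then of_int (\<mu> (snd b') (snd b)) else (0::complex))"
    for b' b :: "(nat \<Rightarrow> complex) \<times> nat list"
  have D: "finite ?D" by (rule finite_dual_group[OF d_pos])
  \<comment> \<open>Volumes are alternating on the free part, so they annihilate the exterior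
    relations and expand in minors as wedge products do.\<close>
  have expand: "volume k (free_vals k \<sigma>) (map act_QF (map free_basis I)) =
      (\<Sum>J\<in>?L. of_int (\<mu> J I) * volume k (free_vals k \<sigma>) (map free_basis J))" if I: "I \<in> ?L" for I \<sigma>
  proof -
    have "free_vals k \<sigma> (x \<otimes>\<^bsub>QF\<^esub> y) j = free_vals k \<sigma> x j + free_vals k \<sigma> y j"
      if "x \<in> carrier QF" "y \<in> carrier QF" for x y j
      unfolding free_vals_def sum.distrib[symmetric] using X.coord_mult[OF that]
      by (intro sum.cong refl) (simp only: lessThan_iff of_int_add ring_distribs)
    then have alt: "alternating k QF (volume k (free_vals k \<sigma>))" by (rule alternating_volume)
    have "map act_QF (map free_basis I) \<in> tuples k QF"
      by (rule X.map_tuples[OF act_QF_hom X.map_b_bases[OF I]])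
    from X.alternating_vanishes_R[OF alt X.tuple_expansion[OF this]]
    show ?thesis unfolding frag_lin_diff frag_lin_sum frag_lin_cmul frag_lin_of \<mu>_def by (rule eq_iff_diff_eq_0[THEN iffD2])
  qed
  have pullback: "torus_cochain k b (simplex_map k pull \<sigma>) = (\<Sum>b'\<in>torus_index k. a b' b * torus_cochain k b' \<sigma>)"
    if b: "b \<in> torus_index k" and \<sigma>: "singular_simplex k torus \<sigma>" for b \<sigma>
  proof -
    have I: "snd b \<in> ?L" using b by (auto simp: torus_index_def)
    then have len: "length (snd b) = k" and mem: "\<And>i. i \<in> set (snd b) \<Longrightarrow> i < n - r"
      by (auto simp: increasing_lists_def)
    let ?V = "\<lambda>J. volume k (free_vals k \<sigma>) (map free_basis J)"
    let ?s = "if dual_map r entry (component \<sigma>) = fst b then \<Sum>J\<in>?L. of_int (\<mu> J (snd b)) * ?V J else 0"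
    have "volume k (free_vals k (simplex_map k pull \<sigma>)) (map free_basis (snd b)) =
        volume k (\<lambda>i. free_vals k (simplex_map k pull \<sigma>) (free_basis i)) (snd b)"
      by (rule volume_map[OF len])
    also have "\<dots> = volume k (\<lambda>i. free_vals k \<sigma> (act_QF (free_basis i))) (snd b)"
      by (rule volume_cong[OF len free_vals_pull[OF \<sigma> mem]])
    also have "\<dots> = volume k (free_vals k \<sigma>) (map act_QF (map free_basis (snd b)))"
      using len by (simp only: volume_map length_map)
    finally have "torus_cochain k b (simplex_map k pull \<sigma>) = ?s"
      unfolding torus_cochain_def component_pull[OF \<sigma>] expand[OF I] by (simp only:)
    also have "?s = (\<Sum>c\<in>?D. if c = component \<sigma> then (if dual_map r entry c = fst b then \<Sum>J\<in>?L. of_int (\<mu> J (snd b)) * ?V J else 0) else 0)"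
      using D component_in[OF \<sigma>] by (simp add: sum.delta)
    also have "\<dots> = (\<Sum>c\<in>?D. \<Sum>J\<in>?L. a (c, J) b * torus_cochain k (c, J) \<sigma>)"
      by (intro sum.cong refl) (auto simp: a_def torus_cochain_def)
    also have "\<dots> = (\<Sum>b'\<in>torus_index k. a b' b * torus_cochain k b' \<sigma>)"
      unfolding torus_index_def sum.cartesian_product by (intro sum.cong) auto
    finally show ?thesis .
  qed
  have gen: "generated_by_at_most (card (torus_index k)) (homology_group (int k) torus)"
    unfolding card_torus_index by (rule generated_homology_group_torus)
  have "module_trace (cohomology_group k torus) (cohomology_scale k torus) (cohomology_pullback k torus pull) =
      (\<Sum>b\<in>torus_index k. a b b)"
  proof (rule cohomology_trace[where w = "torus_cochain k" and z = "subtorus_cycle k" and a = a and \<kappa> = "fact k"])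
    show "(fact k :: complex) \<noteq> 0" by (rule fact_nonzero)
  qed (fact continuous_map_pull finite_torus_index torus_cochain_cocycle subtorus_cycle
      cochain_cycle_pairing gen pullback)+
  also have "\<dots> = (\<Sum>c\<in>?D. \<Sum>I\<in>?L. (if dual_map r entry c = c then 1 else 0) * of_int (\<mu> I I))"
    unfolding torus_index_def sum.cartesian_product by (intro sum.cong) (auto simp: a_def)
  also have "\<dots> = (\<Sum>c\<in>?D. if dual_map r entry c = c then 1 else 0) * (\<Sum>I\<in>?L. of_int (\<mu> I I))"
    by (simp only: sum_product)
  also have "(\<Sum>c\<in>?D. if dual_map r entry c = c then 1 else (0::complex)) = of_nat (card {c \<in> ?D. dual_map r entry c = c})"
    using D by (simp add: sum.If_cases Int_def)
  also have "(\<Sum>I\<in>?L. of_int (\<mu> I I)) = (of_int (int_trace (exterior_power k QF) (exterior_power_map k QF act_QF)) :: complex)"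
    unfolding X.int_trace_exterior_power[OF act_QF_hom] \<mu>_def by simp
  finally show ?thesis .
qed

text \<open>The residues in \<open>?box\<close> represent the torsion elements uniquely. In these
  coordinates \<open>act_Q\<close> is given by the matrix \<open>entry\<close>, and
  \<open>card_fixed_dual\<close> passes to the characters.\<close>

lemma card_fixed_torsion:
  "card {X \<in> torsion Q. act_Q X = X} = card {c \<in> dual_group r d. dual_map r entry c = c}"
proof -
  let ?box = "\<Pi>\<^sub>E i\<in>{..<r}. {0..<int (d i)}"
  let ?P = "\<lambda>x. \<forall>i<r. int (d i) dvd (\<Sum>j<r. entry i j * x j) - x i"
  define y where "y x = Z.lc x e {..<r}" for x :: "nat \<Rightarrow> int"
  have er: "e \<in> {..<r} \<rightarrow> carrier M" using r_le by auto
  have yc: "y x \<in> carrier M" for x unfolding y_def by (rule Z.lc_closed[OF er])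
  have cy: "coord (y x) i = (if i < r then x i else 0)" if i: "i < n" for x i
  proof -
    have "coord (y x) i = (\<Sum>j<r. x j * coord (e j) i)" unfolding y_def by (rule coord_lc[OF _ er i]) simp
    also have "\<dots> = (\<Sum>j<r. if j = i then x j else 0)"
      using i r_le by (intro sum.cong refl) (auto simp: coord_b)
    finally show ?thesis by (simp add: sum.delta)
  qed
  have ys: "y x \<in> saturation" for x using yc cy by (simp add: saturation_def)
  have N_iff: "N #> x = N #> z \<longleftrightarrow> (\<forall>i<r. int (d i) dvd coord x i - coord z i)"
    if xz: "x \<in> saturation" "z \<in> saturation" for x z
  proof -
    have c: "x \<in> carrier M" "z \<in> carrier M" using xz N_subset by auto
    have "coord (x \<otimes> inv z) i = coord x i - coord z i" if "i < n" for i
      using c that by (simp add: coord_mult coord_inv)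
    then have "x \<otimes> inv z \<in> N \<longleftrightarrow> (\<forall>i<r. int (d i) dvd coord x i - coord z i)"
      unfolding N_eq using c xz r_le by (auto simp: saturation_def)
    then show ?thesis unfolding coset_eq_iff[OF comm_group_axioms subgroup_N c] .
  qed
  have fixed: "act_Q (N #> y x) = N #> y x \<longleftrightarrow> ?P x" for x
  proof -
    have "coord (f (y x)) i = (\<Sum>j<r. entry i j * x j)" if i: "i < r" for i
    proof -
      have "coord (f (y x)) i = (\<Sum>j<n. entry i j * coord (y x) j)"
        using i r_le by (intro coord_hom[OF f_hom yc]) simp
      also have "\<dots> = (\<Sum>j<r. entry i j * x j)"
        using r_le by (intro sum.mono_neutral_cong_right) (auto simp: cy)
      finally show ?thesis .
    qed
    then show ?thesis
      unfolding act_Q_coset[OF yc] N_iff[OF f_saturation[OF ys] ys] using r_le by (simp add: cy)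
  qed
  have "bij_betw (\<lambda>x. N #> y x) {x \<in> ?box. ?P x} {X \<in> torsion Q. act_Q X = X}"
    unfolding bij_betw_def
  proof
    show "inj_on (\<lambda>x. N #> y x) {x \<in> ?box. ?P x}"
    proof (rule inj_onI)
      fix x x' assume x: "x \<in> {x \<in> ?box. ?P x}" "x' \<in> {x \<in> ?box. ?P x}" and eq: "N #> y x = N #> y x'"
      have "x i = x' i" if i: "i < r" for i
      proof -
        have "int (d i) dvd x i - x' i" using eq i r_le unfolding N_iff[OF ys ys] by (simp add: cy)
        then have "x i mod int (d i) = x' i mod int (d i)" by (simp add: mod_eq_dvd_iff)
        moreover have "x i \<in> {0..<int (d i)}" "x' i \<in> {0..<int (d i)}" using x i by (auto simp: PiE_iff)
        ultimately show ?thesis by (simp add: mod_pos_pos_trivial)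
      qed
      then show "x = x'" using x by (intro PiE_ext[of x "{..<r}" "\<lambda>i. {0..<int (d i)}" x']) auto
    qed
    show "(\<lambda>x. N #> y x) ` {x \<in> ?box. ?P x} = {X \<in> torsion Q. act_Q X = X}"
    proof (intro equalityI subsetI)
      fix X assume "X \<in> (\<lambda>x. N #> y x) ` {x \<in> ?box. ?P x}"
      then obtain x where x: "X = N #> y x" "x \<in> {x \<in> ?box. ?P x}" by (elim imageE)
      have "N #> y x \<in> torsion Q" unfolding torsion_eq by (rule imageI[OF ys])
      then show "X \<in> {X \<in> torsion Q. act_Q X = X}" unfolding x(1) using fixed[of x] x(2) by blast
    next
      fix X assume X: "X \<in> {X \<in> torsion Q. act_Q X = X}"
      then have "X \<in> (\<lambda>x. N #> x) ` saturation" unfolding torsion_eq by simp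
      then obtain z where z: "z \<in> saturation" "X = N #> z" by (elim imageE) simp
      define x where "x = (\<lambda>i\<in>{..<r}. coord z i mod int (d i))"
      have box: "x \<in> ?box" unfolding x_def using d_pos by (intro restrict_PiE_iff[THEN iffD2]) simp
      have "int (d i) dvd coord (y x) i - coord z i" if "i < r" for i
        using that r_le by (simp add: cy x_def mod_eq_dvd_iff[symmetric])
      then have eq: "N #> y x = X" unfolding z(2) N_iff[OF ys z(1)] by simp
      then have "?P x" unfolding fixed[symmetric] using X by simp
      then show "X \<in> (\<lambda>x. N #> y x) ` {x \<in> ?box. ?P x}" using box eq by (intro image_eqI[of _ _ x]) auto
    qed
  qed
  then have "card {x \<in> ?box. ?P x} = card {X \<in> torsion Q. act_Q X = X}" by (rule bij_betw_same_card)
  then show ?thesis using card_fixed_dual[of r d entry] d_pos entry_dvd by simp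
qed

theorem cohomology_trace_quotient:
  "module_trace (cohomology_group k torus) (cohomology_scale k torus) (cohomology_pullback k torus pull) =
   of_nat (card {X \<in> torsion Q. act_Q X = X}) *
   of_int (int_trace (exterior_power k QF) (exterior_power_map k QF act_QF))"
  unfolding card_fixed_torsion by (rule cohomology_trace_torus)

end

theorem mainTheorem3:
  fixes M :: "('a, 'm) monoid_scheme"
    and \<Gamma> :: "('g, 'k) monoid_scheme"
    and \<phi> :: "'g \<Rightarrow> 'a \<Rightarrow> 'a"
    and R S N :: "'a set" and n :: nat and g :: 'g
    and Z :: "('a \<Rightarrow> complex) topology"
    and \<rho> :: "('a \<Rightarrow> complex) \<Rightarrow> 'a \<Rightarrow> complex"
    and Q :: "'a set monoid" and QF :: "'a set set monoid" and QT :: "'a set set"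
    and actQ :: "'g \<Rightarrow> 'a set \<Rightarrow> 'a set" and actQF :: "'g \<Rightarrow> 'a set set \<Rightarrow> 'a set set"
    and m :: nat
  assumes "comm_group M" and "M \<cong> free_Abelian_group {..<n}"
    and "finite R" and "R \<subseteq> carrier M - {\<one>\<^bsub>M\<^esub>}"
    and "group \<Gamma>" and "finite (carrier \<Gamma>)"
    and "group_action \<Gamma> (carrier M) \<phi>" and "\<forall>h\<in>carrier \<Gamma>. \<phi> h \<in> hom M M"
    and "\<forall>h\<in>carrier \<Gamma>. \<phi> h ` R \<subseteq> R"
    and "S \<subseteq> R"
    and "g \<in> carrier \<Gamma>"
  defines "N \<equiv> generate M S"
    and "Z \<equiv> toric_intersection M S"
    and "\<rho> \<equiv> (\<lambda>\<psi>. compose (carrier M) \<psi> (\<phi> g))"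
    and "Q \<equiv> M Mod N"
    and "QT \<equiv> torsion Q"
    and "QF \<equiv> Q Mod QT"
    and "actQ \<equiv> (\<lambda>h. coset_map M N (\<phi> h))"
    and "actQF \<equiv> (\<lambda>h. coset_map Q QT (actQ h))"
    and "m \<equiv> card {x \<in> QT. actQ g x = x}"
  shows "(\<rho> ` topspace Z = topspace Z \<longleftrightarrow> \<phi> g ` N = N) \<and>
    (\<rho> ` topspace Z = topspace Z \<longrightarrow>
       equivariant_poincare Z \<rho> =
         fps_const (of_nat m) *
         (\<Sum>i=0..n. fps_const (of_int (int_trace (exterior_power i QF)
                                          (exterior_power_map i QF (actQF g)))) * fps_X ^ i)
       \<and> int_trace QF (actQF g) =
           int_trace M (\<phi> g) - int_trace (subgroup_generated M N) (\<phi> g)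
       \<and> (\<forall>k\<ge>1. int k * int_trace (exterior_power k QF) (exterior_power_map k QF (actQF g)) =
            (\<Sum>j=1..k. (- 1) ^ (j - 1) *
               int_trace (exterior_power (k - j) QF) (exterior_power_map (k - j) QF (actQF g)) *
               int_trace QF (actQF (g [^]\<^bsub>\<Gamma>\<^esub> j)))))"
proof -
  interpret M: comm_group M by fact
  interpret act: group_action \<Gamma> "carrier M" \<phi> by fact
  have SM: "S \<subseteq> carrier M" using \<open>S \<subseteq> R\<close> \<open>R \<subseteq> carrier M - {\<one>\<^bsub>M\<^esub>}\<close> by blast
  have N: "subgroup N M" unfolding N_def by (rule M.generate_is_subgroup[OF SM])
  obtain e r d where "adapted_basis M n e N r d"
    using adapted_basis_exists[OF \<open>comm_group M\<close> \<open>M \<cong> free_Abelian_group {..<n}\<close> N] by (elim exE)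
  then interpret B: adapted_basis M n e N r d .
  have Z: "Z = B.torus" unfolding Z_def N_def by (rule M.toric_intersection_generate[OF SM])
  have hom: "\<phi> h \<in> hom M M" if "h \<in> carrier \<Gamma>" for h
    by (rule bspec[OF \<open>\<forall>h\<in>carrier \<Gamma>. \<phi> h \<in> hom M M\<close> that])
  have bij: "bij_betw (\<phi> g) (carrier M) (carrier M)"
    using act.bij_prop0[OF \<open>g \<in> carrier \<Gamma>\<close>] by (simp add: Bij_def)
  have pow_closed: "g [^]\<^bsub>\<Gamma>\<^esub> j \<in> carrier \<Gamma>" for j :: nat
    by (rule monoid.nat_pow_closed[OF group.is_monoid[OF \<open>group \<Gamma>\<close>] \<open>g \<in> carrier \<Gamma>\<close>])
  \<comment> \<open>The Newton identities are stated with the action of powers of \<open>g\<close>,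
    whereas the calculation with matrices uses iterates of the action of \<open>g\<close>.\<close>
  have pow: "x \<in> carrier M \<Longrightarrow> \<phi> (g [^]\<^bsub>\<Gamma>\<^esub> (j::nat)) x = (\<phi> g ^^ j) x" for j x
  proof (induction j arbitrary: x)
    case 0
    then show ?case using fun_cong[OF act.id_eq_one, of x] by simp
  next
    case (Suc j)
    have "\<phi> (g [^]\<^bsub>\<Gamma>\<^esub> Suc j) x = \<phi> (g [^]\<^bsub>\<Gamma>\<^esub> j) (\<phi> g x)"
      using act.composition_rule[OF Suc.prems pow_closed[of j] \<open>g \<in> carrier \<Gamma>\<close>] by simp
    also have "\<dots> = (\<phi> g ^^ j) (\<phi> g x)" by (rule Suc.IH[OF hom_in_carrier[OF hom[OF \<open>g \<in> carrier \<Gamma>\<close>] Suc.prems]])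
    finally show ?case by (simp add: funpow_swap1)
  qed
  have part1: "\<rho> ` topspace Z = topspace Z \<longleftrightarrow> \<phi> g ` N = N"
    unfolding \<rho>_def Z by (rule B.stabilizes_torus_iff[OF hom[OF \<open>g \<in> carrier \<Gamma>\<close>] bij])
  show ?thesis
  proof (rule conjI[OF part1], rule impI)
    assume "\<rho> ` topspace Z = topspace Z"
    then have gN: "\<phi> g ` N = N" using part1 by simp
    have adapted: "adapted_endomorphism M n e N r d (\<phi> h)" if "h \<in> carrier \<Gamma>" "\<phi> h ` N \<subseteq> N" for h
      by (intro adapted_endomorphism.intro B.adapted_basis_axioms adapted_endomorphism_axioms.intro hom that)
    interpret E: adapted_endomorphism M n e N r d "\<phi> g" by (rule adapted) (use \<open>g \<in> carrier \<Gamma>\<close> gN in auto)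
    have pow_N: "\<phi> (g [^]\<^bsub>\<Gamma>\<^esub> j) ` N \<subseteq> N" for j :: nat
    proof (rule image_subsetI)
      fix x assume x: "x \<in> N"
      have "(\<phi> g ^^ j) x \<in> N" using x gN by (induction j) auto
      moreover have "x \<in> carrier M" using x B.N_subset by auto
      ultimately show "\<phi> (g [^]\<^bsub>\<Gamma>\<^esub> j) x \<in> N" using pow by simp
    qed
    have eqs: "Q = B.Q" "QT = torsion B.Q" "QF = B.QF" "actQ g = E.act_Q" "actQF g = E.act_QF"
      by (simp_all only: Q_def QT_def QF_def actQ_def actQF_def)
    have iter: "int_trace QF (actQF (g [^]\<^bsub>\<Gamma>\<^esub> j)) =
        (\<Sum>u<n - r. mat_power (n - r) (\<lambda>i j. E.entry (r + i) (r + j)) j u u)" for j :: nat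
      using E.int_trace_iterate[OF adapted[OF pow_closed pow_N] pow]
      by (simp only: Q_def QT_def QF_def actQ_def actQF_def)
    let ?t = "\<lambda>k. int_trace (exterior_power k QF) (exterior_power_map k QF (actQF g))"
    have t: "?t k = minor_sum (n - r) (\<lambda>i j. E.entry (r + i) (r + j)) k" for k
      unfolding eqs by (rule E.int_trace_exterior_QF)
    have poincare: "equivariant_poincare Z \<rho> = fps_const (of_nat m) * (\<Sum>i=0..n. fps_const (of_int (?t i)) * fps_X ^ i)"
    proof (rule fps_ext)
      fix k
      have "fps_nth (equivariant_poincare Z \<rho>) k = of_nat m * of_int (?t k)"
        unfolding equivariant_poincare_def fps_nth_Abs_fps Z \<rho>_def m_def eqs by (rule E.cohomology_trace_quotient)
      \<comment> \<open>For \<open>k > n\<close> the left side is zero, as the free part has rank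
        \<open>n - r\<close>; so ending the sum at \<open>n\<close> loses nothing.\<close>
      also have "of_int (?t k) = (\<Sum>i=0..n. if i = k then of_int (?t i) else (0::complex))"
        using minor_sum_eq_0[of "n - r" k] t[of k] by (simp add: sum.delta)
      also have "\<dots> = fps_nth (\<Sum>i=0..n. fps_const (of_int (?t i)) * fps_X ^ i) k"
        unfolding fps_sum_nth by (intro sum.cong refl) simp
      finally show "fps_nth (equivariant_poincare Z \<rho>) k =
          fps_nth (fps_const (of_nat m) * (\<Sum>i=0..n. fps_const (of_int (?t i)) * fps_X ^ i)) k" by simp
    qed
    show "equivariant_poincare Z \<rho> = fps_const (of_nat m) * (\<Sum>i=0..n. fps_const (of_int (?t i)) * fps_X ^ i) \<and>
      int_trace QF (actQF g) = int_trace M (\<phi> g) - int_trace (subgroup_generated M N) (\<phi> g) \<and>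
      (\<forall>k\<ge>1. int k * ?t k = (\<Sum>j=1..k. (- 1) ^ (j - 1) * ?t (k - j) * int_trace QF (actQF (g [^]\<^bsub>\<Gamma>\<^esub> j))))"
    proof (intro conjI poincare allI impI)
      show "int_trace QF (actQF g) = int_trace M (\<phi> g) - int_trace (subgroup_generated M N) (\<phi> g)"
        unfolding eqs by (rule E.int_trace_QF_diff)
      fix k :: nat assume "1 \<le> k"
      then show "int k * ?t k = (\<Sum>j=1..k. (- 1) ^ (j - 1) * ?t (k - j) * int_trace QF (actQF (g [^]\<^bsub>\<Gamma>\<^esub> j)))"
        unfolding t iter by (rule newton_minor_sum)
    qed
  qed
qed

end
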